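(* Let $\Omega\subset\mathbb R^N$, $N\ge 1$, be a smooth bounded domain, and let $m:[0,\infty)\to\mathbb R$ and $f:\mathbb R\to\mathbb R$ be continuous functions. Let $K\geq 1$ be an integer and suppose: (m) there exist numbers $0=t_0<t_1<t_2<\dots<t_K$ such that $m(t_k)=0$ and $m>0$ in $(t_{k-1},t_k)$ for all $k\in\{1,\dots,K\}$; (f) there exists $s_*>0$ such that $f(t)>0$ for $t\in(0,s_* )$ and $f(s_* )=0$; (A) for all $k\in\{1,\dots,K\}$, $$\alpha_k<\frac12\int_{t_{k-1}}^{t_k}m(s)\,ds<F(s_* )\,|\Omega|.$$ Then the problem $$-m(\|u\|^2)\Delta u=f(u)\ \text{ in }\Omega,\qquad u=0\ \text{ on }\partial\Omega,$$ possesses at least $K$ nontrivial positive (weak) solutions $u_1,\dots,u_K\in H_0^1(\Omega)$. Furthermore, these solutions are ordered in the $H_0^1(\Omega)$-norm, i.e. $$0<\|u_1\|^2<t_1<\|u_2\|^2<t_2<\dots<t_{K-1}<\|u_K\|^2<t_K.$$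
   Context: $\|u\|:=|\nabla u|_2$ (the $L^2(\Omega)$-norm of $\nabla u$) is the norm of $H_0^1(\Omega)$, and $|\Omega|$ is the Lebesgue measure of $\Omega$. $F(t)=\int_0^t f(s)\,ds$. The truncation $f_*$ is defined by $f_*(t)=f(0)$ if $t<0$, $f_*(t)=f(t)$ if $0\le t<s_*$, $f_*(t)=0$ if $t\ge s_*$, and $F_*(t)=\int_0^t f_*(s)\,ds$. For $k\in\{1,\dots,K\}$, $$\alpha_k:=\max_{u\in H_0^1(\Omega),\ \|u\|\le t_k^{1/2}}\int_\Omega F_*(u)\,dx.$$ A weak solution is a $u\in H_0^1(\Omega)$ with $m(\|u\|^2)\int_\Omega\nabla u\cdot\nabla v\,dx=\int_\Omega f(u)v\,dx$ for all $v\in H_0^1(\Omega)$. *)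

theory Defs
  imports "HOL-Analysis.Analysis"
begin

section \<open>Smooth functions and smooth bounded domains\<close>

text \<open>The ambient space is an arbitrary Euclidean space of (positive) dimension \<open>N = DIM('a)\<close>.\<close>

primrec Ck :: "nat \<Rightarrow> ('a::euclidean_space \<Rightarrow> real) \<Rightarrow> bool" where
  "Ck 0 f \<longleftrightarrow> continuous_on UNIV f"
| "Ck (Suc k) f \<longleftrightarrow> f differentiable_on UNIV \<and>
     (\<forall>b\<in>Basis. Ck k (\<lambda>x. frechet_derivative f (at x) b))"

definition smooth :: "('a::euclidean_space \<Rightarrow> real) \<Rightarrow> bool" where
  "smooth f \<longleftrightarrow> (\<forall>k. Ck k f)"

text \<open>Near each boundary point, the domain lies strictly above the graph of a smooth function over
  the hyperplane orthogonal to some unit vector \<open>e\<close>. That function is written as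
  a smooth \<open>\<gamma>\<close> on the whole space, of which only the values on the hyperplane
  matter.\<close>

definition smooth_boundary :: "'a::euclidean_space set \<Rightarrow> bool" where
  "smooth_boundary \<Omega> \<longleftrightarrow>
     (\<forall>x\<in>frontier \<Omega>. \<exists>r>0. \<exists>e \<gamma>. norm e = 1 \<and> smooth \<gamma> \<and>
        \<Omega> \<inter> ball x r = {y \<in> ball x r. \<gamma> (y - (y \<bullet> e) *\<^sub>R e) < y \<bullet> e})"

definition smooth_bounded_domain :: "'a::euclidean_space set \<Rightarrow> bool" where
  "smooth_bounded_domain \<Omega> \<longleftrightarrow>
     open \<Omega> \<and> connected \<Omega> \<and> \<Omega> \<noteq> {} \<and> bounded \<Omega> \<and> smooth_boundary \<Omega>"


section \<open>The Sobolev space $H_0^1(\Omega)$\<close>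

text \<open>Elements of the function spaces are represented by functions on the whole space,
  of which only the values on \<open>\<Omega>\<close>, up to Lebesgue null sets, are relevant.\<close>

definition L2_fun :: "'a::euclidean_space set \<Rightarrow> ('a \<Rightarrow> 'b::euclidean_space) \<Rightarrow> bool" where
  "L2_fun \<Omega> u \<longleftrightarrow> u \<in> borel_measurable (lebesgue_on \<Omega>) \<and>
     integrable (lebesgue_on \<Omega>) (\<lambda>x. (norm (u x))\<^sup>2)"

definition L2_norm :: "'a::euclidean_space set \<Rightarrow> ('a \<Rightarrow> 'b::euclidean_space) \<Rightarrow> real" where
  "L2_norm \<Omega> u = sqrt (LINT x|lebesgue_on \<Omega>. (norm (u x))\<^sup>2)"

definition test_fun :: "'a::euclidean_space set \<Rightarrow> ('a \<Rightarrow> real) \<Rightarrow> bool" where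
  "test_fun \<Omega> \<phi> \<longleftrightarrow> smooth \<phi> \<and>
     compact (closure {x. \<phi> x \<noteq> 0}) \<and> closure {x. \<phi> x \<noteq> 0} \<subseteq> \<Omega>"

definition grad :: "('a::euclidean_space \<Rightarrow> real) \<Rightarrow> 'a \<Rightarrow> 'a" where
  "grad \<phi> x = (\<Sum>b\<in>Basis. frechet_derivative \<phi> (at x) b *\<^sub>R b)"

definition has_weak_grad :: "'a::euclidean_space set \<Rightarrow> ('a \<Rightarrow> real) \<Rightarrow> ('a \<Rightarrow> 'a) \<Rightarrow> bool" where
  "has_weak_grad \<Omega> u g \<longleftrightarrow> (\<forall>\<phi>. test_fun \<Omega> \<phi> \<longrightarrow>
     (LINT x|lebesgue_on \<Omega>. u x *\<^sub>R grad \<phi> x) = - (LINT x|lebesgue_on \<Omega>. \<phi> x *\<^sub>R g x))"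

definition H1 :: "'a::euclidean_space set \<Rightarrow> ('a \<Rightarrow> real) set" where
  "H1 \<Omega> = {u. L2_fun \<Omega> u \<and> (\<exists>g. L2_fun \<Omega> g \<and> has_weak_grad \<Omega> u g)}"

text \<open>The weak gradient of an \<open>H1\<close> function is unique up to null sets of
  \<open>\<Omega>\<close>; \<open>wgrad\<close> chooses a representative, and is only used inside integrals
  over \<open>\<Omega>\<close>.\<close>

definition wgrad :: "'a::euclidean_space set \<Rightarrow> ('a \<Rightarrow> real) \<Rightarrow> 'a \<Rightarrow> 'a" where
  "wgrad \<Omega> u = (SOME g. L2_fun \<Omega> g \<and> has_weak_grad \<Omega> u g)"

definition H1_norm :: "'a::euclidean_space set \<Rightarrow> ('a \<Rightarrow> real) \<Rightarrow> real" where
  "H1_norm \<Omega> u = sqrt ((L2_norm \<Omega> u)\<^sup>2 + (L2_norm \<Omega> (wgrad \<Omega> u))\<^sup>2)"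

text \<open>The closure of the test functions in \<open>H1\<close>.\<close>

definition H10 :: "'a::euclidean_space set \<Rightarrow> ('a \<Rightarrow> real) set" where
  "H10 \<Omega> = {u \<in> H1 \<Omega>. \<exists>\<phi> :: nat \<Rightarrow> 'a \<Rightarrow> real.
     (\<forall>n. test_fun \<Omega> (\<phi> n)) \<and> (\<lambda>n. H1_norm \<Omega> (\<lambda>x. u x - \<phi> n x)) \<longlonglongrightarrow> 0}"

definition H10_norm :: "'a::euclidean_space set \<Rightarrow> ('a \<Rightarrow> real) \<Rightarrow> real" where
  "H10_norm \<Omega> u = L2_norm \<Omega> (wgrad \<Omega> u)"


section \<open>The nonlocal problem\<close>

text \<open>The interval integral is oriented, so this is the primitive vanishing at 0 for negative
  arguments as well.\<close>

definition primitive :: "(real \<Rightarrow> real) \<Rightarrow> real \<Rightarrow> real" where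
  "primitive f t = (LBINT s=ereal 0..ereal t. f s)"

definition truncation :: "(real \<Rightarrow> real) \<Rightarrow> real \<Rightarrow> real \<Rightarrow> real" where
  "truncation f s\<^sub>0 t = (if t < 0 then f 0 else if t < s\<^sub>0 then f t else 0)"

text \<open>\<open>alpha \<Omega> f s\<^sub>0 T\<close> is the maximum of \<open>\<integral> F\<^sub>* (u)\<close> over the closed
  ball of radius \<open>sqrt T\<close> in \<open>H10 \<Omega>\<close>; \<open>Greatest\<close> is the greatest
  element of the (infinite) set of values.\<close>

definition alpha :: "'a::euclidean_space set \<Rightarrow> (real \<Rightarrow> real) \<Rightarrow> real \<Rightarrow> real \<Rightarrow> real" where
  "alpha \<Omega> f s\<^sub>0 T = (GREATEST y. y \<in>
     (\<lambda>u. LINT x|lebesgue_on \<Omega>. primitive (truncation f s\<^sub>0) (u x)) `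
       {u \<in> H10 \<Omega>. H10_norm \<Omega> u \<le> sqrt T})"

text \<open>Integrability of \<open>f(u) v\<close> is demanded explicitly, since the Bochner integral of a
  non-integrable function is 0 by convention. The integrand on the left is always integrable for
  \<open>u\<close> and \<open>v\<close> in \<open>H1 \<Omega>\<close>.\<close>

definition weak_solution ::
    "'a::euclidean_space set \<Rightarrow> (real \<Rightarrow> real) \<Rightarrow> (real \<Rightarrow> real) \<Rightarrow> ('a \<Rightarrow> real) \<Rightarrow> bool" where
  "weak_solution \<Omega> m f u \<longleftrightarrow> u \<in> H10 \<Omega> \<and> (\<forall>v\<in>H10 \<Omega>.
     integrable (lebesgue_on \<Omega>) (\<lambda>x. f (u x) * v x) \<and>
     m ((H10_norm \<Omega> u)\<^sup>2) * (LINT x|lebesgue_on \<Omega>. wgrad \<Omega> u x \<bullet> wgrad \<Omega> v x)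
       = (LINT x|lebesgue_on \<Omega>. f (u x) * v x))"

definition nontrivial_on :: "'a::euclidean_space set \<Rightarrow> ('a \<Rightarrow> real) \<Rightarrow> bool" where
  "nontrivial_on \<Omega> u \<longleftrightarrow> \<not> (AE x in lebesgue_on \<Omega>. u x = 0)"

definition positive_on :: "'a::euclidean_space set \<Rightarrow> ('a \<Rightarrow> real) \<Rightarrow> bool" where
  "positive_on \<Omega> u \<longleftrightarrow> (AE x in lebesgue_on \<Omega>. u x > 0)"

end

(* Truncate f outside [0, s*] and realise H_0^1 as the closed graph of the weak gradient over test
   functions inside L^2 x L^2; a gradient y then determines its potential compactly (Rellich), and
   the problem becomes m(|y|^2) y = G y with G the compact gradient of Phi(u) = int F_*(u).

   Put J(y) = M(|y|^2)/2 - Phi(y), where M is a primitive of m cut off to vanish below t_{k-1}.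
   On the ball |y|^2 <= t_k, assumption (A) makes J positive at the boundary.  If k >= 2 or f(0) > 0, J takes
   smaller values inside, and its minimiser lies in the shell t_{k-1} < |y|^2 < t_k.  If k = 1
   and f(0) = 0, every minimum could be the trivial one; J then has a mountain pass, with m continued by
   -(r - t_1) beyond t_1 so that J tends to -infinity and critical points stay inside the ball.

   Testing with smooth flat functions of u gives 0 <= u <= s*.  A solution is superharmonic, and a
   logarithmic gradient estimate shows that the indicator of {u > 0} has vanishing weak gradient,
   so that u > 0 almost everywhere by connectedness. *)
theory Submission
  imports Defs "HOL-Library.Diagonal_Subsequence" "HOL-Real_Asymp.Real_Asymp"
begin

section \<open>Hilbert spaces\<close>

text \<open>The coefficient \<open>m\<close> degenerates at the ends of the intervals, so a bounded
  sequence of almost critical points need not converge strongly: y_n is recovered from m(|y_n|^2)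
  y_n only if the limit of |y_n|^2 is not a zero of m. Existence is therefore a matter of levels:
  the strict inequality at the radius given by t_k keeps the minimum and the minimax level away from
  the values that J takes in the degenerate limit. The unknown is an arbitrary square integrable
  vector field y, not only a gradient; it is paired with the potential of its projection onto
  gradients. The Hilbert space is thus a whole type, and critical points with positive coefficient
  turn out to be gradients by themselves, since G takes values in gradients. The truncated f is only
  continuous, so J has just a continuous gradient; yet its first order expansion is uniform on
  balls, and this allows a single cut-off gradient step in the role of a deformation flow. Bounds
  and strict positivity are read off the weak form by suitable smooth test functions of u.\<close>

lemma power2_norm_diff_scaleR:
  fixes a b :: "'h::real_inner"
  shows "(norm (a - s *\<^sub>R b))\<^sup>2 = (norm a)\<^sup>2 - 2 * s * inner a b + s\<^sup>2 * (norm b)\<^sup>2"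
  unfolding power2_norm_eq_inner
  by (simp add: inner_simps inner_commute power2_eq_square[of s] algebra_simps)

text \<open>The midpoint of \<open>v m\<close> and \<open>v n\<close> lies in \<open>V\<close>, so
  the parallelogram law bounds the distance between the two by the excess of their squared distances
  to \<open>x\<close> over \<open>d\<close>.\<close>

lemma minimizing_sequence_Cauchy:
  fixes x :: "'h::real_inner" and v :: "nat \<Rightarrow> 'h"
  assumes V: "subspace V" and vV: "\<And>n. v n \<in> V"
    and low: "\<And>w. w \<in> V \<Longrightarrow> d \<le> (norm (x - w))\<^sup>2"
    and up: "\<And>n. (norm (x - v n))\<^sup>2 < d + inverse (real (Suc n))"
  shows "Cauchy v"
proof (rule CauchyI)
  fix e :: real assume e: "e > 0"
  obtain N where N: "inverse (real (Suc N)) < e\<^sup>2 / 4"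
    using reals_Archimedean[of "e\<^sup>2/4"] e by auto
  have "norm (v m - v n) < e" if mn: "m \<ge> N" "n \<ge> N" for m n
  proof -
    have inv: "inverse (real (Suc k)) \<le> inverse (real (Suc N))" if "k \<ge> N" for k
      using that by (simp add: field_simps)
    define w where "w = (1/2) *\<^sub>R (v m + v n)"
    have "w \<in> V" unfolding w_def by (intro subspace_mul subspace_add V vV)
    then have dw: "d \<le> (norm (x - w))\<^sup>2" by (rule low)
    have "(norm (v m - v n))\<^sup>2 = 2 * (norm (x - v n))\<^sup>2 + 2 * (norm (x - v m))\<^sup>2 - 4 * (norm (x - w))\<^sup>2"
      unfolding w_def power2_norm_eq_inner
      by (simp add: inner_simps inner_commute) (simp add: field_simps inner_commute)
    also have "\<dots> < 4 * inverse (real (Suc N))"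
      using up[of m] up[of n] dw inv[OF mn(1)] inv[OF mn(2)] by linarith
    also have "\<dots> < e\<^sup>2" using N by simp
    finally show ?thesis using e by (simp add: power2_less_imp_less)
  qed
  then show "\<exists>M. \<forall>m\<ge>M. \<forall>n\<ge>M. norm (v m - v n) < e" by blast
qed

text \<open>By completeness the distance from \<open>x\<close> to \<open>V\<close> is attained, and
  moving the minimiser along a vector of \<open>V\<close> cannot shorten the distance; this forces
  orthogonality.\<close>

lemma orthogonal_projection_exists:
  fixes x :: "'h::{real_inner,complete_space}"
  assumes V: "subspace V" and cV: "closed V"
  shows "\<exists>p\<in>V. \<forall>v\<in>V. inner (x - p) v = 0"
proof -
  define S where "S = (\<lambda>w. (norm (x - w))\<^sup>2) ` V"
  define d where "d = Inf S"
  have ne: "S \<noteq> {}" using subspace_0[OF V] by (auto simp: S_def)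
  have bb: "bdd_below S" by (rule bdd_belowI[of _ 0]) (auto simp: S_def)
  have low: "d \<le> (norm (x - w))\<^sup>2" if "w \<in> V" for w
    unfolding d_def using that bb by (intro cInf_lower) (auto simp: S_def)
  have "\<exists>w\<in>V. (norm (x - w))\<^sup>2 < d + inverse (real (Suc n))" for n
  proof -
    have "Inf S < d + inverse (real (Suc n))" by (simp add: d_def)
    from cInf_lessD[OF ne this] show ?thesis by (auto simp: S_def)
  qed
  then obtain v where v: "\<And>n. v n \<in> V" "\<And>n. (norm (x - v n))\<^sup>2 < d + inverse (real (Suc n))"
    by metis
  have "Cauchy v" by (rule minimizing_sequence_Cauchy[OF V v(1) low v(2)])
  then obtain p where p: "v \<longlonglongrightarrow> p" using Cauchy_convergent convergent_def by blast
  have pV: "p \<in> V" using closed_sequentially[OF cV] v(1) p by blast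
  have "(\<lambda>n. (norm (x - v n))\<^sup>2) \<longlonglongrightarrow> (norm (x - p))\<^sup>2" by (intro tendsto_intros p)
  moreover have "(\<lambda>n. d + inverse (real (Suc n))) \<longlonglongrightarrow> d"
    using tendsto_add[OF tendsto_const LIMSEQ_inverse_real_of_nat, of d] by simp
  ultimately have pd: "(norm (x - p))\<^sup>2 \<le> d"
    using LIMSEQ_le[of "\<lambda>n. (norm (x - v n))\<^sup>2"] less_imp_le[OF v(2)] by blast
  have "inner (x - p) w = 0" if w: "w \<in> V" for w
  proof (cases "w = 0")
    case False
    \<comment> \<open>This \<open>s\<close> minimises the quadratic polynomial
      \<open>(norm (x - (p + s *\<^sub>R w)))\<^sup>2\<close>, so the gain over \<open>p\<close> is
      as large as possible.\<close>
    define s where "s = inner (x - p) w / (norm w)\<^sup>2"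
    have nw: "(norm w)\<^sup>2 > 0" using False by simp
    have "d \<le> (norm (x - (p + s *\<^sub>R w)))\<^sup>2"
      by (intro low subspace_add subspace_mul V pV w)
    also have "\<dots> = (norm (x - p))\<^sup>2 - 2 * s * inner (x - p) w + s\<^sup>2 * (norm w)\<^sup>2"
      using power2_norm_diff_scaleR[of "x - p" s w] by (simp add: algebra_simps)
    also have "\<dots> = (norm (x - p))\<^sup>2 - (inner (x - p) w)\<^sup>2 / (norm w)\<^sup>2"
      using nw by (simp add: s_def power2_eq_square divide_simps)
    finally have "(inner (x - p) w)\<^sup>2 / (norm w)\<^sup>2 \<le> 0" using pd by linarith
    then show ?thesis using nw by (simp add: divide_le_0_iff)
  qed auto
  then show ?thesis using pV by blast
qed

section \<open>Riesz representation, weak sequential compactness and adjoints\<close>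

lemma riesz_representation:
  fixes f :: "'h::{real_inner,complete_space} \<Rightarrow> real"
  assumes f: "bounded_linear f"
  shows "\<exists>k. \<forall>x. f x = inner k x"
proof (cases "\<forall>x. f x = 0")
  case True
  then show ?thesis by (intro exI[of _ 0]) simp
next
  case False
  then obtain z where z: "f z \<noteq> 0" by blast
  interpret f: bounded_linear f by (rule f)
  define V where "V = {x. f x = 0}"
  have V: "subspace V" unfolding subspace_def V_def by (auto simp: f.add f.scaleR f.zero)
  have "continuous_on UNIV f" using f.continuous_on[OF continuous_on_id] by simp
  then have "closed V" unfolding V_def by (intro closed_Collect_eq) auto
  from orthogonal_projection_exists[OF V this, of z]
  obtain p where p: "p \<in> V" "\<And>v. v \<in> V \<Longrightarrow> inner (z - p) v = 0" by blast
  \<comment> \<open>A normal vector of the kernel. Every \<open>x\<close> differs from a multiple of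
    \<open>w\<close> by an element of the kernel, so \<open>f\<close> is the pairing with a multiple
    of \<open>w\<close>.\<close>
  define w where "w = z - p"
  have fw: "f w \<noteq> 0" using z p(1) by (simp add: w_def V_def f.diff)
  then have nw: "(norm w)\<^sup>2 > 0" using f.zero by force
  have "f x = inner ((f w / (norm w)\<^sup>2) *\<^sub>R w) x" for x
  proof -
    have "x - (f x / f w) *\<^sub>R w \<in> V" using fw by (simp add: V_def f.diff f.scaleR)
    from p(2)[OF this] have "inner w x = (f x / f w) * (norm w)\<^sup>2"
      by (simp add: w_def[symmetric] inner_simps power2_norm_eq_inner)
    then show ?thesis using fw nw by (simp add: field_simps)
  qed
  then show ?thesis by blast
qed

text \<open>A diagonal extraction makes the inner products with the members of the sequence itself
  converge. The vectors against which the subsequence converges form a closed subspace, and on its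
  orthogonal complement all inner products vanish; so every vector is covered even in a nonseparable
  space.\<close>

lemma bounded_weakly_convergent_subsequence:
  fixes y :: "nat \<Rightarrow> 'h::{real_inner,complete_space}"
  assumes bd: "\<And>n. norm (y n) \<le> C"
  shows "\<exists>r z. strict_mono r \<and> (\<forall>x. (\<lambda>n. inner (y (r n)) x) \<longlonglongrightarrow> inner z x)"
proof -
  have C0: "C \<ge> 0" using bd[of 0] norm_ge_zero[of "y 0"] by linarith
  have ib: "\<bar>inner (y n) x\<bar> \<le> C * norm x" for n x
    using Cauchy_Schwarz_ineq2[of "y n" x] mult_right_mono[OF bd[of n] norm_ge_zero[of x]] by linarith
  interpret subseqs "\<lambda>m s. convergent (\<lambda>n. inner (y (s n)) (y m))"
  proof
    fix n and s :: "nat \<Rightarrow> nat"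
    have "bounded (range (\<lambda>k. inner (y (s k)) (y n)))"
      unfolding bounded_iff using ib by (auto intro!: exI[of _ "C * norm (y n)"])
    from bounded_imp_convergent_subsequence[OF this]
    show "\<exists>r'. strict_mono r' \<and> convergent (\<lambda>k. inner (y ((s \<circ> r') k)) (y n))"
      by (auto simp: convergent_def o_def)
  qed
  define r where "r = diagseq"
  have r: "strict_mono r" unfolding r_def by (rule subseq_diagseq)
  define X where "X = {x. convergent (\<lambda>n. inner (y (r n)) x)}"
  \<comment> \<open>The diagonal sequence is controlled by the extraction for \<open>y m\<close>
    only from the index \<open>Suc m\<close> on; the initial segment is dropped at the end.\<close>
  have yX: "y m \<in> X" for m
  proof -
    have "convergent (\<lambda>n. inner (y ((diagseq \<circ> ((+) (Suc m))) n)) (y m))"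
    proof (rule diagseq_holds)
      fix r s :: "nat \<Rightarrow> nat" and n assume "strict_mono r" "convergent (\<lambda>k. inner (y (s k)) (y n))"
      from convergent_subseq_convergent[OF this(2,1)]
      show "convergent (\<lambda>k. inner (y ((s \<circ> r) k)) (y n))" by (simp add: o_def)
    qed
    then have "convergent (\<lambda>n. inner (y (r (n + Suc m))) (y m))" by (simp add: r_def o_def add.commute)
    then show ?thesis unfolding X_def mem_Collect_eq
      by (subst (asm) convergent_ignore_initial_segment[where f = "\<lambda>n. inner (y (r n)) (y m)"])
  qed
  have sX: "subspace X" unfolding subspace_def X_def
    by (auto simp: inner_simps intro!: convergent_add convergent_mult convergent_const)
  have cX: "closed X"
  proof (rule closed_sequential_limits[THEN iffD2], intro allI impI, elim conjE)
    fix s l assume s: "\<forall>n. s n \<in> X" "s \<longlonglongrightarrow> l"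
    have "Cauchy (\<lambda>n. inner (y (r n)) l)"
    proof (rule CauchyI)
      fix e :: real assume e: "e > 0"
      have "e / (3 * (C + 1)) > 0" using e C0 by simp
      then obtain k where k: "norm (s k - l) < e / (3 * (C + 1))"
        using s(2) LIMSEQ_D by blast
      have "Cauchy (\<lambda>n. inner (y (r n)) (s k))" using s(1) by (auto simp: X_def convergent_Cauchy)
      then obtain M where M: "\<And>m n. m \<ge> M \<Longrightarrow> n \<ge> M \<Longrightarrow>
          norm (inner (y (r m)) (s k) - inner (y (r n)) (s k)) < e/3"
        using CauchyD[of "\<lambda>n. inner (y (r n)) (s k)" "e/3"] e by auto
      \<comment> \<open>The common bound \<open>C\<close> makes the error of replacing
        \<open>l\<close> by \<open>s k\<close> uniform in \<open>n\<close>.\<close>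
      have small: "\<bar>inner (y n) (s k - l)\<bar> \<le> e/3" for n
      proof -
        have "\<bar>inner (y n) (s k - l)\<bar> \<le> C * norm (s k - l)" by (rule ib)
        also have "\<dots> \<le> (C + 1) * (e / (3 * (C + 1)))"
          using k C0 by (intro mult_mono) auto
        also have "\<dots> = e/3" using C0 by (simp add: field_simps)
        finally show ?thesis .
      qed
      have "norm (inner (y (r m)) l - inner (y (r n)) l) < e" if "m \<ge> M" "n \<ge> M" for m n
        using M[OF that] small[of "r m"] small[of "r n"] unfolding inner_diff_right real_norm_def by linarith
      then show "\<exists>M. \<forall>m\<ge>M. \<forall>n\<ge>M. norm (inner (y (r m)) l - inner (y (r n)) l) < e" by blast
    qed
    then show "l \<in> X" by (simp add: X_def Cauchy_convergent)
  qed
  have allX: "x \<in> X" for x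
  proof -
    obtain p where p: "p \<in> X" "\<And>v. v \<in> X \<Longrightarrow> inner (x - p) v = 0"
      using orthogonal_projection_exists[OF sX cX, of x] by blast
    have "inner (y (r n)) (x - p) = 0" for n by (subst inner_commute) (rule p(2)[OF yX])
    then have "x - p \<in> X" by (simp add: X_def convergent_const)
    from subspace_add[OF sX this p(1)] show ?thesis by simp
  qed
  define L where "L = (\<lambda>x. lim (\<lambda>n. inner (y (r n)) x))"
  have L: "(\<lambda>n. inner (y (r n)) x) \<longlonglongrightarrow> L x" for x
    using allX[of x] by (simp add: X_def L_def convergent_LIMSEQ_iff)
  have "bounded_linear L"
  proof (rule bounded_linear_intro[where K = C])
    show "L (x + x') = L x + L x'" for x x'
      using tendsto_add[OF L[of x] L[of x']] L[of "x + x'"]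
      by (simp add: inner_simps LIMSEQ_unique)
    show "L (a *\<^sub>R x) = a *\<^sub>R L x" for a x
      using tendsto_mult_left[OF L[of x], of a] L[of "a *\<^sub>R x"]
      by (simp add: inner_simps LIMSEQ_unique)
    show "norm (L x) \<le> norm x * C" for x
      using tendsto_norm[OF L[of x]] ib
      by (intro LIMSEQ_le_const2[of "\<lambda>n. norm (inner (y (r n)) x)"]) (auto simp: mult.commute)
  qed
  from riesz_representation[OF this] obtain z where "\<And>x. L x = inner z x" by blast
  then show ?thesis using r L by auto
qed

text \<open>The limit \<open>\<rho>\<close> of the norms is recorded next to the weak limit
  \<open>z\<close>, because the energy depends on the norm, which is not weakly continuous. All that
  relates the two is weak lower semicontinuity, \<open>norm z \<le> \<rho>\<close>.\<close>

lemma bounded_weak_limit: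
  fixes y :: "nat \<Rightarrow> 'h::{real_inner,complete_space}"
  assumes bd: "\<And>n. norm (y n) \<le> C"
  shows "\<exists>r z \<rho>. strict_mono r \<and> (\<forall>x. (\<lambda>n. inner (y (r n)) x) \<longlonglongrightarrow> inner z x) \<and>
    (\<lambda>n. norm (y (r n))) \<longlonglongrightarrow> \<rho> \<and> norm z \<le> \<rho>"
proof -
  have "bounded (range (\<lambda>n. norm (y n)))"
    unfolding bounded_iff using bd by (auto intro!: exI[of _ C])
  from bounded_imp_convergent_subsequence[OF this]
  obtain s \<rho> where s: "strict_mono s" "(\<lambda>n. norm (y (s n))) \<longlonglongrightarrow> \<rho>" by (auto simp: o_def)
  from bounded_weakly_convergent_subsequence[of "y \<circ> s" C] bd
  obtain r z where r: "strict_mono r" "\<And>x. (\<lambda>n. inner (y (s (r n))) x) \<longlonglongrightarrow> inner z x" by auto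
  have \<rho>: "(\<lambda>n. norm (y (s (r n)))) \<longlonglongrightarrow> \<rho>"
    using LIMSEQ_subseq_LIMSEQ[OF s(2) r(1)] by (simp add: o_def)
  have \<rho>0: "\<rho> \<ge> 0" by (rule LIMSEQ_le_const[OF \<rho>]) auto
  \<comment> \<open>Cauchy-Schwarz for the pairing of the sequence with \<open>z\<close> itself, in
    the limit.\<close>
  have "norm z * norm z \<le> \<rho> * norm z"
  proof (rule LIMSEQ_le)
    show "(\<lambda>n. inner (y (s (r n))) z) \<longlonglongrightarrow> norm z * norm z"
      using r(2)[of z] by (simp add: power2_norm_eq_inner flip: power2_eq_square)
    show "(\<lambda>n. norm (y (s (r n))) * norm z) \<longlonglongrightarrow> \<rho> * norm z" by (intro tendsto_intros \<rho>)
    show "\<exists>N. \<forall>n\<ge>N. inner (y (s (r n))) z \<le> norm (y (s (r n))) * norm z"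
      using Cauchy_Schwarz_ineq2 abs_le_D1 by blast
  qed
  then have "norm z \<le> \<rho>" using \<rho>0 by (cases "norm z = 0") (auto simp: mult_le_cancel_right)
  then show ?thesis using r \<rho> strict_mono_o[OF s(1) r(1)]
    by (intro exI[of _ "s \<circ> r"] exI[of _ z] exI[of _ \<rho>]) (simp add: o_def)
qed

text \<open>Riesz representation of \<open>x \<mapsto> inner w (S x)\<close>; testing with
  \<open>x = S' w\<close> shows that \<open>S'\<close> inherits the bound of
  \<open>S\<close>.\<close>

lemma adjoint_exists:
  fixes S :: "'h::{real_inner,complete_space} \<Rightarrow> 'g::real_inner"
  assumes S: "bounded_linear S"
  obtains S' where "bounded_linear S'" "\<And>w x. inner (S' w) x = inner w (S x)"
proof -
  have "\<exists>k. \<forall>x. inner w (S x) = inner k x" for w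
    by (rule riesz_representation) (rule bounded_linear_compose[OF bounded_linear_inner_right S])
  then obtain S' where S': "\<And>w x. inner (S' w) x = inner w (S x)" by metis
  obtain B where B: "\<And>x. norm (S x) \<le> norm x * B" and B0: "B > 0"
    using bounded_linear.pos_bounded[OF S] by blast
  have "bounded_linear S'"
  proof (rule bounded_linear_intro[where K = B])
    show "S' (a + b) = S' a + S' b" for a b
      by (rule vector_eq_rdot[THEN iffD1, rule_format]) (simp add: inner_simps S')
    show "S' (c *\<^sub>R a) = c *\<^sub>R S' a" for c a
      by (rule vector_eq_rdot[THEN iffD1, rule_format]) (simp add: inner_simps S')
    show "norm (S' w) \<le> norm w * B" for w
    proof -
      have "norm (S' w) * norm (S' w) = inner w (S (S' w))"
        by (simp add: S'[symmetric] power2_norm_eq_inner flip: power2_eq_square)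
      also have "\<dots> \<le> norm w * norm (S (S' w))" using Cauchy_Schwarz_ineq2 abs_le_D1 by blast
      also have "\<dots> \<le> norm w * (norm (S' w) * B)" by (intro mult_left_mono B) auto
      finally have "norm (S' w) * norm (S' w) \<le> (norm w * B) * norm (S' w)" by (simp add: ac_simps)
      then show ?thesis using B0 by (cases "norm (S' w) = 0") (auto simp: mult_le_cancel_right)
    qed
  qed
  then show thesis using that S' by blast
qed

section \<open>Two critical point theorems\<close>

text \<open>An abstract version of the energy \<open>u \<mapsto> M (\<parallel>u\<parallel>\<^sup>2) / 2 - \<integral> F (u)\<close>:
  \<open>\<Phi>\<close> stands for the integral and \<open>G\<close> for its gradient, both of which turn
  weakly convergent sequences into strongly convergent ones.\<close>

locale nonlocal_energy =
  fixes \<Phi> :: "'h::{real_inner,complete_space} \<Rightarrow> real" and G :: "'h \<Rightarrow> 'h"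
    and \<mu> M :: "real \<Rightarrow> real"
  assumes unif: "\<And>\<epsilon>. \<epsilon> > 0 \<Longrightarrow> \<exists>\<eta>>0. \<forall>y h. norm h \<le> \<eta> \<longrightarrow>
      \<bar>\<Phi> (y + h) - \<Phi> y - inner (G y) h\<bar> \<le> \<epsilon> * norm h"
    and G_bdd: "\<exists>B. \<forall>y. norm (G y) \<le> B"
    and G_weak: "\<And>y z C. (\<And>n. norm (y n) \<le> C) \<Longrightarrow> (\<And>x. (\<lambda>n. inner (y n) x) \<longlonglongrightarrow> inner z x) \<Longrightarrow> (\<lambda>n. G (y n)) \<longlonglongrightarrow> G z"
    and \<Phi>_weak: "\<And>y z C. (\<And>n. norm (y n) \<le> C) \<Longrightarrow> (\<And>x. (\<lambda>n. inner (y n) x) \<longlonglongrightarrow> inner z x) \<Longrightarrow> (\<lambda>n. \<Phi> (y n)) \<longlonglongrightarrow> \<Phi> z"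
    and \<Phi>_0: "\<Phi> 0 = 0"
    and \<mu>_cont: "continuous_on UNIV \<mu>"
    and M_deriv: "\<And>r. (M has_real_derivative \<mu> r) (at r)"
    and M_0: "M 0 = 0"
begin

definition J :: "'h \<Rightarrow> real" where
  "J y = M ((norm y)\<^sup>2) / 2 - \<Phi> y"

definition dJ :: "'h \<Rightarrow> 'h" where
  "dJ y = \<mu> ((norm y)\<^sup>2) *\<^sub>R y - G y"

lemma J_0: "J 0 = 0"
  by (simp add: J_def M_0 \<Phi>_0)

lemma M_tendsto: "a \<longlonglongrightarrow> l \<Longrightarrow> (\<lambda>n. M (a n)) \<longlonglongrightarrow> M l"
  using isCont_tendsto_compose[OF DERIV_isCont[OF M_deriv]] .

lemma \<mu>_tendsto: "a \<longlonglongrightarrow> l \<Longrightarrow> (\<lambda>n. \<mu> (a n)) \<longlonglongrightarrow> \<mu> l"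
  using isCont_tendsto_compose[of l \<mu>] \<mu>_cont continuous_on_eq_continuous_at by blast

text \<open>Strongly convergent sequences are bounded and weakly convergent, so the weak-to-strong
  axioms contain the continuity of \<open>G\<close> and \<open>\<Phi>\<close>.\<close>

lemma G_\<Phi>_tendsto:
  assumes "y \<longlonglongrightarrow> z"
  shows G_tendsto: "(\<lambda>n. G (y n)) \<longlonglongrightarrow> G z" and \<Phi>_tendsto: "(\<lambda>n. \<Phi> (y n)) \<longlonglongrightarrow> \<Phi> z"
proof -
  obtain C where C: "\<And>n. norm (y n) \<le> C"
    using convergent_imp_bounded[OF assms] unfolding bounded_iff by blast
  have w: "\<And>x. (\<lambda>n. inner (y n) x) \<longlonglongrightarrow> inner z x" by (intro tendsto_intros assms)
  show "(\<lambda>n. G (y n)) \<longlonglongrightarrow> G z" "(\<lambda>n. \<Phi> (y n)) \<longlonglongrightarrow> \<Phi> z"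
    by (rule G_weak[OF C w], rule \<Phi>_weak[OF C w])
qed

lemma J_tendsto: "y \<longlonglongrightarrow> z \<Longrightarrow> (\<lambda>n. J (y n)) \<longlonglongrightarrow> J z"
  unfolding J_def by (intro tendsto_intros M_tendsto \<Phi>_tendsto) auto

lemma continuous_J: "continuous_on UNIV J"
  using J_tendsto by (auto simp: continuous_on_sequentially o_def)

lemma continuous_dJ: "continuous_on UNIV dJ"
proof -
  have "(\<lambda>n. dJ (y n)) \<longlonglongrightarrow> dJ z" if "y \<longlonglongrightarrow> z" for y z
    unfolding dJ_def by (intro tendsto_intros \<mu>_tendsto G_tendsto that)
  then show ?thesis by (auto simp: continuous_on_sequentially o_def)
qed

text \<open>Uniform continuity of \<open>\<mu>\<close> on a compact interval and the mean value
  inequality make the remainder uniform in the base point.\<close>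

lemma M_expansion:
  assumes "\<epsilon> > 0"
  shows "\<exists>\<eta>>0. \<forall>r\<in>{0..R}. \<forall>s\<in>{0..R}. \<bar>s - r\<bar> \<le> \<eta> \<longrightarrow> \<bar>M s - M r - \<mu> r * (s - r)\<bar> \<le> \<epsilon> * \<bar>s - r\<bar>"
proof -
  have "uniformly_continuous_on {0..R} \<mu>"
    using \<mu>_cont by (intro compact_uniformly_continuous) (auto intro: continuous_on_subset)
  then obtain \<eta> where \<eta>: "\<eta> > 0" "\<And>r s. r \<in> {0..R} \<Longrightarrow> s \<in> {0..R} \<Longrightarrow> dist s r < \<eta> \<Longrightarrow> dist (\<mu> s) (\<mu> r) < \<epsilon>"
    unfolding uniformly_continuous_on_def using assms by blast
  have "\<bar>M s - M r - \<mu> r * (s - r)\<bar> \<le> \<epsilon> * \<bar>s - r\<bar>"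
    if r: "r \<in> {0..R}" and s: "s \<in> {0..R}" and sr: "\<bar>s - r\<bar> \<le> \<eta>/2" for r s
  proof -
    have d: "((\<lambda>t. M t - \<mu> r * t) has_field_derivative (\<mu> t - \<mu> r)) (at t within closed_segment r s)" for t
      by (rule has_field_derivative_at_within) (auto intro!: derivative_eq_intros M_deriv)
    have "norm (\<mu> t - \<mu> r) \<le> \<epsilon>" if t: "t \<in> closed_segment r s" for t
    proof -
      have "t \<in> {0..R}" using t r s by (auto simp: closed_segment_eq_real_ivl split: if_splits)
      moreover have "\<bar>t - r\<bar> \<le> \<bar>s - r\<bar>" using t by (auto simp: closed_segment_eq_real_ivl split: if_splits)
      ultimately show ?thesis using \<eta>(2)[OF r, of t] sr \<eta>(1) by (auto simp: dist_real_def)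
    qed
    from field_differentiable_bound[OF convex_closed_segment d this, of s r]
    show ?thesis by (simp add: algebra_simps)
  qed
  then show ?thesis using \<eta>(1) by (intro exI[of _ "\<eta>/2"]) auto
qed

text \<open>Uniformity over a ball is the purpose: one step length then serves every point of a
  bounded region in the deformation below.\<close>

lemma J_expansion:
  assumes e: "\<epsilon> > 0" and R: "R > 0"
  shows "\<exists>\<eta>>0. \<forall>y h. norm y \<le> R \<longrightarrow> norm h \<le> \<eta> \<longrightarrow>
      \<bar>J (y + h) - J y - inner (dJ y) h\<bar> \<le> \<epsilon> * norm h"
proof -
  define R' where "R' = (R + 1)\<^sup>2"
  have "compact (\<mu> ` {0..R'})" 
    using \<mu>_cont by (intro compact_continuous_image) (auto intro: continuous_on_subset)
  then obtain C where C: "C > 0" "\<And>r. r \<in> {0..R'} \<Longrightarrow> \<bar>\<mu> r\<bar> \<le> C"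
    using compact_imp_bounded[of "\<mu> ` {0..R'}"] unfolding bounded_pos by auto
  \<comment> \<open>For steps of length at most 1 from the ball of radius \<open>R\<close>, the
    squared norm changes by at most \<open>(2 * R + 1) * norm h\<close>; \<open>\<delta>\<close>
    compensates this factor.\<close>
  define \<delta> where "\<delta> = \<epsilon> / (2 * R + 1)"
  have \<delta>: "\<delta> > 0" using e R by (simp add: \<delta>_def)
  obtain \<eta>1 where \<eta>1: "\<eta>1 > 0" "\<And>y h. norm h \<le> \<eta>1 \<Longrightarrow>
      \<bar>\<Phi> (y + h) - \<Phi> y - inner (G y) h\<bar> \<le> (\<epsilon>/4) * norm h"
    using unif[of "\<epsilon>/4"] e by auto
  obtain \<eta>2 where \<eta>2: "\<eta>2 > 0" "\<And>r s. r\<in>{0..R'} \<Longrightarrow> s\<in>{0..R'} \<Longrightarrow> \<bar>s - r\<bar> \<le> \<eta>2 \<Longrightarrow>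
      \<bar>M s - M r - \<mu> r * (s - r)\<bar> \<le> \<delta> * \<bar>s - r\<bar>"
    using M_expansion[OF \<delta>, of R'] by blast
  define \<eta> where "\<eta> = min (min 1 \<eta>1) (min (\<eta>2 / (2 * R + 1)) (\<epsilon> / (2 * C)))"
  have "\<eta> > 0" using \<eta>1(1) \<eta>2(1) R e C by (simp add: \<eta>_def)
  moreover have "\<bar>J (y + h) - J y - inner (dJ y) h\<bar> \<le> \<epsilon> * norm h"
    if y: "norm y \<le> R" and h: "norm h \<le> \<eta>" for y h
  proof -
    have hh: "norm h \<le> 1" "norm h \<le> \<eta>1" "norm h \<le> \<eta>2 / (2 * R + 1)" "norm h \<le> \<epsilon> / (2 * C)"
      using h by (auto simp: \<eta>_def)
    define r s where "r = (norm y)\<^sup>2" and "s = (norm (y + h))\<^sup>2"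
    have sr: "s - r = 2 * inner y h + (norm h)\<^sup>2"
      unfolding r_def s_def power2_norm_eq_inner by (simp add: inner_simps inner_commute)
    have nyh: "norm (y + h) \<le> R + 1" using norm_triangle_ineq[of y h] y hh(1) by linarith
    have rs: "r \<in> {0..R'}" "s \<in> {0..R'}"
      unfolding r_def s_def R'_def using nyh y R by (auto intro!: power_mono)
    have "\<bar>s - r\<bar> \<le> 2 * (norm y * norm h) + norm h * norm h"
    proof -
      have "\<bar>2 * inner y h + (norm h)\<^sup>2\<bar> \<le> 2 * \<bar>inner y h\<bar> + norm h * norm h"
        using abs_triangle_ineq[of "2 * inner y h" "(norm h)\<^sup>2"] by (simp add: power2_eq_square abs_mult)
      then show ?thesis unfolding sr using Cauchy_Schwarz_ineq2[of y h] by linarith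
    qed
    also have "\<dots> \<le> 2 * (R * norm h) + 1 * norm h"
      by (intro add_mono mult_left_mono mult_right_mono y hh) auto
    finally have srb: "\<bar>s - r\<bar> \<le> (2 * R + 1) * norm h" by (simp add: algebra_simps)
    also have "\<dots> \<le> \<eta>2" using hh(3) R by (simp add: field_simps)
    finally have "\<bar>M s - M r - \<mu> r * (s - r)\<bar> \<le> \<delta> * \<bar>s - r\<bar>" using \<eta>2(2)[OF rs] by simp
    also have "\<dots> \<le> \<delta> * ((2 * R + 1) * norm h)" using srb \<delta> by (intro mult_left_mono) auto
    also have "\<dots> = \<epsilon> * norm h" using R by (simp add: \<delta>_def)
    finally have 1: "\<bar>M s - M r - \<mu> r * (s - r)\<bar> \<le> \<epsilon> * norm h" .
    have "\<bar>\<mu> r * (norm h)\<^sup>2\<bar> \<le> C * (norm h * norm h)"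
      unfolding abs_mult using C(2)[OF rs(1)] by (intro mult_mono) (auto simp: power2_eq_square)
    also have "\<dots> \<le> C * (\<epsilon> / (2 * C) * norm h)"
      using C hh(4) by (intro mult_left_mono mult_right_mono) auto
    also have "\<dots> = \<epsilon> * norm h / 2" using C by simp
    finally have 2: "\<bar>\<mu> r * (norm h)\<^sup>2\<bar> \<le> \<epsilon> * norm h / 2" .
    have 3: "\<bar>\<Phi> (y + h) - \<Phi> y - inner (G y) h\<bar> \<le> \<epsilon> * norm h / 4" using \<eta>1(2)[OF hh(2), of y] by simp
    \<comment> \<open>An exact splitting into the remainder of \<open>M\<close>, the quadratic part
      of the squared norm and the remainder of \<open>\<Phi>\<close>. They contribute at most 1/2,
      1/4 and 1/4 of the allowed error.\<close>
    have "J (y + h) - J y - inner (dJ y) h = (M s - M r - \<mu> r * (s - r)) / 2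
        + \<mu> r * (norm h)\<^sup>2 / 2 - (\<Phi> (y + h) - \<Phi> y - inner (G y) h)"
      unfolding J_def dJ_def sr r_def[symmetric] s_def[symmetric]
      by (simp add: inner_simps) (simp add: field_simps)
    moreover have "\<bar>a\<bar> \<le> X" if "a = b / 2 + c / 2 - d" "\<bar>b\<bar> \<le> X" "\<bar>c\<bar> \<le> X / 2" "\<bar>d\<bar> \<le> X / 4"
      for a b c d X :: real
      using that by linarith
    ultimately show ?thesis using 1 2 3 by blast
  qed
  ultimately show ?thesis by blast
qed

text \<open>If the gradient did not vanish, a short step against it would lower \<open>J\<close> by
  at least half of the first order term.\<close>

lemma local_minimum_critical:
  assumes "\<eta> > 0" and min: "\<And>z. norm (z - y) \<le> \<eta> \<Longrightarrow> J y \<le> J z"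
  shows "dJ y = 0"
proof (rule ccontr)
  assume nz: "dJ y \<noteq> 0"
  define d where "d = norm (dJ y)"
  have d: "d > 0" using nz by (simp add: d_def)
  obtain \<eta>' where \<eta>': "\<eta>' > 0" "\<And>h. norm h \<le> \<eta>' \<Longrightarrow> \<bar>J (y + h) - J y - inner (dJ y) h\<bar> \<le> (d/2) * norm h"
  proof -
    have "d/2 > 0" "norm y + 1 > 0" "norm y \<le> norm y + 1" using d by (auto intro: add_nonneg_pos)
    with J_expansion[of "d/2" "norm y + 1"] that show ?thesis by blast
  qed
  define h where "h = (- (min \<eta> \<eta>') / d) *\<^sub>R dJ y"
  have nh: "norm h = min \<eta> \<eta>'" using d \<eta>'(1) assms(1) by (simp add: h_def d_def[symmetric])
  have "inner (dJ y) h = - min \<eta> \<eta>' * d"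
    using d by (simp add: h_def power2_norm_eq_inner[symmetric] d_def[symmetric] power2_eq_square)
  then have "J (y + h) - J y \<le> - min \<eta> \<eta>' * d + (d/2) * min \<eta> \<eta>'"
    using abs_le_D1[OF \<eta>'(2)[of h]] nh by simp
  also have "\<dots> < 0" using d \<eta>'(1) assms(1) by (simp add: field_simps min_def)
  finally show False using min[of "y + h"] nh by simp
qed

section \<open>Minimisation on a closed ball\<close>

lemma M_mono:
  assumes "\<And>r. 0 < r \<Longrightarrow> r < T \<Longrightarrow> \<mu> r \<ge> 0" "0 \<le> a" "a \<le> b" "b \<le> T"
  shows "M a \<le> M b"
proof (cases "a = b")
  case False
  have c: "continuous_on {a..b} M"
    by (rule DERIV_continuous_on) (rule has_field_derivative_at_within[OF M_deriv])
  show ?thesis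
  proof (rule DERIV_nonneg_imp_increasing_open[OF \<open>a \<le> b\<close> _ c])
    fix x assume "a < x" "x < b"
    then show "\<exists>y. DERIV M x :> y \<and> y \<ge> 0"
      using assms by (intro exI[of _ "\<mu> x"] conjI M_deriv) auto
  qed
qed simp

lemma M_nonneg:
  assumes "\<And>r. 0 < r \<Longrightarrow> r < T \<Longrightarrow> \<mu> r \<ge> 0" "0 \<le> a" "a \<le> T"
  shows "M a \<ge> 0"
  using M_mono[OF assms(1), of T 0 a] assms M_0 by simp

text \<open>The direct method on the closed ball of squared radius \<open>T\<close>. Lower
  semicontinuity comes from the monotonicity of \<open>M\<close>, the sphere is excluded by the
  bound \<open>\<alpha>\<close>, and \<open>deg\<close> says that a point with
  \<open>G y = 0\<close> is never a minimiser. The equation then forbids a vanishing coefficient,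
  which places the minimiser in the shell. The guard \<open>0 < \<tau>\<close> leaves the value of
  \<open>\<mu>\<close> at 0 free when the shell is a punctured ball.\<close>

theorem minimum_critical_point:
  assumes T: "0 \<le> \<tau>" "\<tau> < T"
    and \<mu>0: "\<And>r. 0 \<le> r \<Longrightarrow> r \<le> \<tau> \<Longrightarrow> 0 < \<tau> \<Longrightarrow> \<mu> r = 0"
    and \<mu>1: "\<And>r. \<tau> < r \<Longrightarrow> r < T \<Longrightarrow> \<mu> r > 0"
    and \<alpha>: "\<alpha> < M T / 2" "\<And>y. (norm y)\<^sup>2 \<le> T \<Longrightarrow> \<Phi> y \<le> \<alpha>"
    and deg: "\<And>y. G y = 0 \<Longrightarrow> (norm y)\<^sup>2 \<le> T \<Longrightarrow> \<exists>z. (norm z)\<^sup>2 \<le> T \<and> J z < J y"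
  shows "\<exists>y. \<tau> < (norm y)\<^sup>2 \<and> (norm y)\<^sup>2 < T \<and> \<mu> ((norm y)\<^sup>2) *\<^sub>R y = G y"
proof -
  have \<mu>_nn: "\<mu> r \<ge> 0" if "0 < r" "r < T" for r
    using \<mu>0[of r] \<mu>1[of r] that T by (cases "r \<le> \<tau>") auto
  have T0: "T > 0" using T by simp
  define B where "B = {y :: 'h. (norm y)\<^sup>2 \<le> T}"
  define c where "c = Inf (J ` B)"
  have "J y \<ge> - \<alpha>" if "y \<in> B" for y
    using M_nonneg[of T "(norm y)\<^sup>2"] \<mu>_nn \<alpha>(2)[of y] that by (auto simp: J_def B_def)
  then have bb: "bdd_below (J ` B)" by (auto intro!: bdd_belowI[of _ "-\<alpha>"])
  have B0: "0 \<in> B" using T0 by (simp add: B_def)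
  have "\<exists>y\<in>B. J y < c + inverse (real (Suc n))" for n
  proof -
    have "Inf (J ` B) < c + inverse (real (Suc n))" by (simp add: c_def)
    from cInf_lessD[OF _ this] B0 show ?thesis by auto
  qed
  then obtain y where y: "\<And>n. y n \<in> B" "\<And>n. J (y n) < c + inverse (real (Suc n))" by metis
  have yb: "norm (y n) \<le> sqrt T" for n using y(1)[of n] by (simp add: B_def real_le_rsqrt)
  obtain r z \<rho> where r: "strict_mono r" and z: "\<And>x. (\<lambda>n. inner (y (r n)) x) \<longlonglongrightarrow> inner z x"
    and \<rho>: "(\<lambda>n. norm (y (r n))) \<longlonglongrightarrow> \<rho>" "norm z \<le> \<rho>"
    using bounded_weak_limit[of y "sqrt T", OF yb] by blast
  have "\<rho> \<le> sqrt T" using yb by (intro LIMSEQ_le_const2[OF \<rho>(1)]) auto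
  then have \<rho>T: "\<rho>\<^sup>2 \<le> T"
    using T0 power_mono[of \<rho> "sqrt T" 2] order_trans[OF norm_ge_zero \<rho>(2)] by simp
  have z\<rho>: "(norm z)\<^sup>2 \<le> \<rho>\<^sup>2" using \<rho>(2) by (simp add: power_mono)
  have zB: "z \<in> B" using z\<rho> \<rho>T by (simp add: B_def)
  have "(\<lambda>n. J (y (r n))) \<longlonglongrightarrow> M (\<rho>\<^sup>2) / 2 - \<Phi> z"
    unfolding J_def by (intro tendsto_intros M_tendsto \<Phi>_weak[OF yb z] \<rho>) auto
  moreover have "(\<lambda>n. c + inverse (real (Suc (r n)))) \<longlonglongrightarrow> c"
    using tendsto_add[OF tendsto_const LIMSEQ_subseq_LIMSEQ[OF LIMSEQ_inverse_real_of_nat r], of c]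
    by (simp add: o_def)
  ultimately have "M (\<rho>\<^sup>2) / 2 - \<Phi> z \<le> c"
    using LIMSEQ_le[of "\<lambda>n. J (y (r n))"] less_imp_le[OF y(2)] by blast
  \<comment> \<open>Passing to the weak limit can only lose norm, and \<open>M\<close> is
    nondecreasing up to \<open>T\<close>.\<close>
  moreover have "M ((norm z)\<^sup>2) \<le> M (\<rho>\<^sup>2)"
    using M_mono[of T "(norm z)\<^sup>2" "\<rho>\<^sup>2"] \<mu>_nn z\<rho> \<rho>T by simp
  ultimately have Jz: "J z \<le> c" by (simp add: J_def)
  have min: "J z \<le> J w" if "w \<in> B" for w
    using Jz cInf_lower[of "J w" "J ` B"] that bb by (auto simp: c_def)
  \<comment> \<open>On the sphere \<open>J\<close> is positive, whereas the minimum is at most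
    \<open>J 0 = 0\<close>.\<close>
  have "(norm z)\<^sup>2 \<noteq> T"
  proof
    assume "(norm z)\<^sup>2 = T"
    then have "J z > 0" using \<alpha>(1) \<alpha>(2)[of z] by (simp add: J_def)
    then show False using min[OF B0] J_0 by simp
  qed
  then have zT: "(norm z)\<^sup>2 < T" using zB by (simp add: B_def)
  have "dJ z = 0"
  proof (rule local_minimum_critical)
    have zs: "norm z < sqrt T" using zT by (simp add: real_less_rsqrt)
    then show "sqrt T - norm z > 0" by simp
    fix w assume "norm (w - z) \<le> sqrt T - norm z"
    then have "norm w \<le> sqrt T" using norm_triangle_ineq[of z "w - z"] by simp
    then have "(norm w)\<^sup>2 \<le> T" using T0 power_mono[of "norm w" "sqrt T" 2] by simp
    then show "J z \<le> J w" by (intro min) (simp add: B_def)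
  qed
  then have crit: "\<mu> ((norm z)\<^sup>2) *\<^sub>R z = G z" by (simp add: dJ_def)
  \<comment> \<open>This rules out a vanishing coefficient and \<open>z = 0\<close> at once: the
    former excludes the inner ball if \<open>\<tau> > 0\<close>, the latter the centre if
    \<open>\<tau> = 0\<close>.\<close>
  have "G z \<noteq> 0" using deg[of z] min zB by (force simp: B_def)
  then have "\<mu> ((norm z)\<^sup>2) \<noteq> 0" "z \<noteq> 0" using crit by auto
  then have "\<tau> < (norm z)\<^sup>2"
    using \<mu>0[of "(norm z)\<^sup>2"] T(1) by (cases "\<tau> = 0") (auto simp: not_less[symmetric])
  then show ?thesis using zT crit by blast
qed

end

section \<open>The mountain pass for a degenerate coefficient\<close>

context nonlocal_energy
begin

text \<open>The sphere of squared radius \<open>T\<close> separates 0 from far points, where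
  \<open>J\<close> is negative. The minimax level \<open>c\<close> lies strictly between 0 and
  \<open>M T / 2\<close>, and these are the only levels at which almost critical sequences can lose
  compactness: if \<open>\<mu> (\<rho>\<^sup>2)\<close> vanishes in the limit, then
  \<open>\<Phi>\<close> vanishes as well and the level is \<open>M (\<rho>\<^sup>2) / 2\<close> with
  \<open>\<rho>\<^sup>2\<close> equal to 0 or \<open>T\<close>.\<close>

lemma mountain_pass_critical_point:
  assumes T: "0 < T"
    and \<mu>1: "\<And>r. 0 < r \<Longrightarrow> r < T \<Longrightarrow> \<mu> r > 0" and \<mu>T: "\<mu> T = 0" and \<mu>2: "\<And>r. T < r \<Longrightarrow> \<mu> r < 0"
    and Mlim: "filterlim M at_bot at_top"
    and \<alpha>: "\<alpha> < M T / 2" "\<And>y. (norm y)\<^sup>2 \<le> T \<Longrightarrow> \<Phi> y \<le> \<alpha>"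
    and \<Phi>_nn: "\<And>y. \<Phi> y \<ge> 0" and G_nn: "\<And>y. inner (G y) y \<ge> 0"
    and deg: "\<And>y. G y = 0 \<Longrightarrow> \<Phi> y = 0"
    and v: "\<And>s. s > 0 \<Longrightarrow> \<Phi> (s *\<^sub>R v) > 0"
  shows "\<exists>y. 0 < (norm y)\<^sup>2 \<and> (norm y)\<^sup>2 < T \<and> \<mu> ((norm y)\<^sup>2) *\<^sub>R y = G y"
proof -
  \<comment> \<open>The height of the barrier: \<open>J\<close> is at least \<open>\<delta>\<close>
    on the sphere of squared radius \<open>T\<close>.\<close>
  define \<delta> where "\<delta> = M T / 2 - \<alpha>"
  have \<delta>: "\<delta> > 0" using \<alpha>(1) by (simp add: \<delta>_def)
  have MT: "M r \<le> M T" if "r \<ge> 0" for r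
  proof (cases "r \<le> T")
    case True
    then show ?thesis using M_mono[of T r T] \<mu>1 that by (force intro: less_imp_le)
  next
    case False
    have c: "continuous_on {T..r} M"
      by (rule DERIV_continuous_on) (rule has_field_derivative_at_within[OF M_deriv])
    have "M T \<ge> M r"
    proof (rule DERIV_nonpos_imp_decreasing_open[OF _ _ c])
      show "T \<le> r" using False by simp
      fix x assume "T < x" "x < r"
      then show "\<exists>y. DERIV M x :> y \<and> y \<le> 0"
        using \<mu>2[of x] by (intro exI[of _ "\<mu> x"] conjI M_deriv) auto
    qed
    then show ?thesis .
  qed
  have "eventually (\<lambda>r. M r < 0) at_top" using Mlim by (simp add: filterlim_at_bot_dense)
  then obtain R1 where R1: "\<And>r. r \<ge> R1 \<Longrightarrow> M r < 0" by (auto simp: eventually_at_top_linorder)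
  define R0 where "R0 = max R1 (T + 1)"
  have R0: "R0 > T" "\<And>r. r \<ge> R0 \<Longrightarrow> M r < 0" using R1 by (auto simp: R0_def)
  define R where "R = sqrt R0"
  have R: "R > 0" using R0(1) T by (simp add: R_def)
  \<comment> \<open>Since \<open>M\<close> tends to minus infinity, nonnegative values of
    \<open>J\<close> occur only in a fixed ball. Almost critical sequences at a positive level are
    thereby bounded.\<close>
  have J_neg: "J y < 0" if "(norm y)\<^sup>2 \<ge> R0" for y
    using R0(2)[OF that] \<Phi>_nn[of y] by (simp add: J_def)
  have bounded: "norm y \<le> R" if "J y \<ge> 0" for y
  proof -
    have "(norm y)\<^sup>2 \<le> R0" using J_neg[of y] that by force
    then show ?thesis unfolding R_def by (rule real_le_rsqrt)
  qed
  have "v \<noteq> 0" using v[of 1] \<Phi>_0 by auto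
  \<comment> \<open>The far endpoint is taken on the ray of \<open>v\<close>, so that
    \<open>\<Phi>\<close> is positive on the segment leading to it; this is what makes
    \<open>c_up\<close> strict.\<close>
  define w where "w = (R / norm v) *\<^sub>R v"
  have nw: "norm w = R" using \<open>v \<noteq> 0\<close> R by (simp add: w_def)
  have Jw: "J w < 0" using J_neg[of w] R0(1) T by (simp add: nw R_def)
  \<comment> \<open>The minimax value is encoded through upper bounds: \<open>\<Gamma> a\<close>
    holds if some path from 0 to \<open>w\<close> stays at or below the level \<open>a\<close>, and
    \<open>c\<close> is the infimum of these levels.\<close>
  define below where "below a \<gamma> \<longleftrightarrow> continuous_on {0..1} \<gamma> \<and> \<gamma> (0::real) = 0 \<and> \<gamma> 1 = w \<and> (\<forall>t\<in>{0..1}. J (\<gamma> t) \<le> a)" for a \<gamma>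
  define \<Gamma> where "\<Gamma> a \<longleftrightarrow> (\<exists>\<gamma>. below a \<gamma>)" for a
  have \<Gamma>_low: "\<delta> \<le> a" if "\<Gamma> a" for a
  proof -
    obtain \<gamma> where "below a \<gamma>" using \<open>\<Gamma> a\<close> unfolding \<Gamma>_def by blast
    then have \<gamma>: "continuous_on {0..1} \<gamma>" "\<gamma> (0::real) = 0" "\<gamma> 1 = w" "\<forall>t\<in>{0..1}. J (\<gamma> t) \<le> a"
      unfolding below_def by auto
    have "norm (\<gamma> 0) \<le> sqrt T" "sqrt T \<le> norm (\<gamma> 1)"
      using T R0(1) by (simp_all add: \<gamma>(2,3) nw R_def)
    from IVT'[OF this zero_le_one continuous_on_norm[OF \<gamma>(1)]]
    obtain t where "0 \<le> t" "t \<le> 1" "norm (\<gamma> t) = sqrt T" by blast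
    then have t: "t \<in> {0..1}" "(norm (\<gamma> t))\<^sup>2 = T" using T by auto
    then show ?thesis using \<alpha>(2)[of "\<gamma> t"] bspec[OF \<gamma>(4) t(1)] by (simp add: J_def \<delta>_def)
  qed
  have bb: "bdd_below {a. \<Gamma> a}" using \<Gamma>_low by (auto intro!: bdd_belowI[of _ \<delta>])
  define c where "c = Inf {a. \<Gamma> a}"
  \<comment> \<open>Only the straight segment is needed. At its highest point either
    \<open>J\<close> is 0, or \<open>\<Phi>\<close> is positive and \<open>J\<close> falls short of
    half the maximum \<open>M T\<close>.\<close>
  have c_up: "c < M T / 2" and \<Gamma>_ne: "{a. \<Gamma> a} \<noteq> {}"
  proof -
    have "continuous_on {0..1} (\<lambda>t::real. J (t *\<^sub>R w))"
      by (rule continuous_on_compose2[OF continuous_J]) (auto intro!: continuous_intros)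
    from continuous_attains_sup[OF _ _ this]
    obtain t where t: "t \<in> {0..1}" "\<And>s. s \<in> {0..1} \<Longrightarrow> J (s *\<^sub>R w) \<le> J (t *\<^sub>R w)" by auto
    have "\<Gamma> (J (t *\<^sub>R w))" unfolding \<Gamma>_def below_def
      by (rule exI[of _ "\<lambda>s. s *\<^sub>R w"]) (use t in \<open>auto intro!: continuous_intros\<close>)
    then show "{a. \<Gamma> a} \<noteq> {}" "c < M T / 2"
    proof -
      have "J (t *\<^sub>R w) < M T / 2"
      proof (cases "t = 0")
        case True
        have "\<Phi> 0 \<le> \<alpha>" by (rule \<alpha>(2)) (use T in simp)
        then show ?thesis using True \<alpha>(1) J_0 \<Phi>_0 by simp
      next
        case False
        then have "\<Phi> (t *\<^sub>R w) > 0" using t v[of "t * (R / norm v)"] R \<open>v \<noteq> 0\<close> by (simp add: w_def)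
        then show ?thesis using MT[of "(norm (t *\<^sub>R w))\<^sup>2"] by (simp add: J_def)
      qed
      moreover have "c \<le> J (t *\<^sub>R w)" unfolding c_def using \<open>\<Gamma> (J (t *\<^sub>R w))\<close> bb by (intro cInf_lower) auto
      ultimately show "c < M T / 2" by simp
    qed auto
  qed
  have c_low: "\<delta> \<le> c" unfolding c_def using \<Gamma>_ne \<Gamma>_low by (intro cInf_greatest) auto
  \<comment> \<open>By contradiction: if the gradient were long throughout a band around the level
    \<open>c\<close>, a step against it would push a nearly optimal path below
    \<open>c\<close>.\<close>
  have palais_smale: "\<exists>y. \<bar>J y - c\<bar> \<le> \<epsilon> \<and> norm (dJ y) \<le> \<epsilon>" if \<epsilon>: "\<epsilon> > 0" "\<epsilon> \<le> \<delta> / 2" for \<epsilon>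
  proof (rule ccontr)
    assume "\<not> ?thesis"
    then have steep: "norm (dJ y) > \<epsilon>" if "\<bar>J y - c\<bar> \<le> \<epsilon>" for y using that by force
    have Rb: "norm y \<le> R" if "\<bar>J y - c\<bar> \<le> \<epsilon>" for y
      using that \<epsilon> \<delta> c_low by (intro bounded) linarith
    obtain B where B: "\<And>y. norm (G y) \<le> B" using G_bdd by blast
    have "compact (\<mu> ` {0..R\<^sup>2})"
      using \<mu>_cont by (intro compact_continuous_image) (auto intro: continuous_on_subset)
    then obtain C where "C > 0" and C: "\<And>r. r \<in> {0..R\<^sup>2} \<Longrightarrow> \<bar>\<mu> r\<bar> \<le> C"
      using compact_imp_bounded[of "\<mu> ` {0..R\<^sup>2}"] unfolding bounded_pos by auto
    have D: "norm (dJ y) \<le> C * R + B" if "norm y \<le> R" for y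
    proof -
      have "\<bar>\<mu> ((norm y)\<^sup>2)\<bar> \<le> C" by (rule C) (use that in \<open>simp add: power_mono\<close>)
      then have "norm (\<mu> ((norm y)\<^sup>2) *\<^sub>R y) \<le> C * R"
        using that R by (simp) (rule mult_mono, auto)
      then show ?thesis unfolding dJ_def using B[of y] norm_triangle_ineq4[of "\<mu> ((norm y)\<^sup>2) *\<^sub>R y" "G y"] by linarith
    qed
    have D0: "C * R + B \<ge> 0" using order_trans[OF norm_ge_zero D[of 0]] R by simp
    have "\<epsilon>/2 > 0" using \<epsilon> by simp
    from J_expansion[OF this R] obtain \<eta> where \<eta>: "\<eta> > 0"
      "\<And>y h. norm y \<le> R \<Longrightarrow> norm h \<le> \<eta> \<Longrightarrow> \<bar>J (y + h) - J y - inner (dJ y) h\<bar> \<le> \<epsilon>/2 * norm h" by blast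
    \<comment> \<open>On the ball of radius \<open>R\<close> the gradient is at most
      \<open>C * R + B\<close> long, so a step with factor \<open>s\<close> stays within the range
      \<open>\<eta>\<close> of the uniform expansion.\<close>
    define s where "s = \<eta> / (C * R + B + 1)"
    have s: "s > 0" "s * (C * R + B) \<le> \<eta>" using \<eta>(1) D0 by (auto simp: s_def field_simps)
    \<comment> \<open>Equal to 1 where \<open>J\<close> is within \<open>\<epsilon> / 2\<close> of
      \<open>c\<close>, equal to 0 outside the band of half-width \<open>\<epsilon>\<close>, and
      linear in between; it switches the step off at the endpoints of paths.\<close>
    define cut where "cut y = max 0 (min 1 (2 - 2 * \<bar>J y - c\<bar> / \<epsilon>))" for y
    have cut01: "0 \<le> cut y" "cut y \<le> 1" for y by (auto simp: cut_def)
    have cut_1: "cut y = 1" if "\<bar>J y - c\<bar> \<le> \<epsilon>/2" for y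
      using that \<epsilon> by (auto simp: cut_def field_simps min_def)
    have cut_0: "cut y = 0" if "\<bar>J y - c\<bar> \<ge> \<epsilon>" for y
      using that \<epsilon> by (auto simp: cut_def field_simps max_def min_def)
    \<comment> \<open>A single gradient step in the role of a flow: continuity is enough to map
      paths to paths, and the expansion gives the decrease.\<close>
    define \<Psi> where "\<Psi> y = y - (s * cut y) *\<^sub>R dJ y" for y
    have cont_\<Psi>: "continuous_on UNIV \<Psi>"
      unfolding \<Psi>_def cut_def using \<epsilon> by (intro continuous_intros continuous_J continuous_dJ) auto
    have decrease: "J (\<Psi> y) \<le> J y - s * cut y * (\<epsilon> * \<epsilon> / 2)" for y
    proof (cases "cut y = 0")
      case False
      then have close: "\<bar>J y - c\<bar> \<le> \<epsilon>" using cut_0[of y] by force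
      define k where "k = s * cut y"
      define d where "d = norm (dJ y)"
      define h where "h = (- k) *\<^sub>R dJ y"
      have k: "0 \<le> k" "k \<le> s" using s cut01[of y] by (auto simp: k_def mult_le_cancel_left2)
      have nh: "norm h = k * d" using k by (simp add: h_def d_def)
      have "k * d \<le> s * (C * R + B)"
        using k D[OF Rb[OF close]] s D0 by (intro mult_mono) (auto simp: d_def)
      then have "norm h \<le> \<eta>" using nh s by simp
      from \<eta>(2)[OF Rb[OF close] this] have "J (y + h) - J y - inner (dJ y) h \<le> \<epsilon>/2 * (k * d)"
        unfolding nh by linarith
      moreover have "inner (dJ y) h = - k * d * d"
        by (simp add: h_def d_def power2_norm_eq_inner[symmetric] power2_eq_square)
      ultimately have "J (y + h) \<le> J y - k * (d * (d - \<epsilon>/2))" by (simp add: algebra_simps)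
      \<comment> \<open>Inside the band \<open>d\<close> exceeds \<open>\<epsilon>\<close>, hence
        \<open>d - \<epsilon>/2\<close> exceeds \<open>\<epsilon>/2\<close>.\<close>
      also have "\<dots> \<le> J y - k * (\<epsilon> * (\<epsilon>/2))"
        using steep[OF close] \<epsilon> k unfolding d_def[symmetric]
        by (intro diff_left_mono mult_left_mono mult_mono) auto
      finally show ?thesis by (simp add: \<Psi>_def h_def k_def)
    qed (simp add: \<Psi>_def)
    \<comment> \<open>A full step lowers \<open>J\<close> by at least \<open>2 * \<rho>\<close>,
      which takes a path below \<open>c + \<rho>\<close> to below \<open>c - \<rho>\<close>; points
      already under \<open>c - \<epsilon>/2\<close> are low enough.\<close>
    define \<rho> where "\<rho> = min (\<epsilon>/2) (s * (\<epsilon> * \<epsilon>) / 4)"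
    have \<rho>: "\<rho> > 0" "\<rho> \<le> \<epsilon>/2" "\<rho> \<le> s * (\<epsilon> * \<epsilon>) / 4" using \<epsilon> s by (auto simp: \<rho>_def)
    have "Inf {a. \<Gamma> a} < c + \<rho>" using \<rho> by (simp add: c_def)
    from cInf_lessD[OF \<Gamma>_ne this] obtain a where a: "\<Gamma> a" "a < c + \<rho>" by auto
    then obtain \<gamma> where "below a \<gamma>" unfolding \<Gamma>_def by blast
    then have \<gamma>: "continuous_on {0..1} \<gamma>" "\<gamma> (0::real) = 0" "\<gamma> 1 = w" "\<forall>t\<in>{0..1}. J (\<gamma> t) \<le> a"
      unfolding below_def by auto
    have "\<Gamma> (c - \<rho>)"
      unfolding \<Gamma>_def below_def
    proof (rule exI[of _ "\<lambda>t. \<Psi> (\<gamma> t)"], intro conjI ballI)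
      show "continuous_on {0..1} (\<lambda>t. \<Psi> (\<gamma> t))"
        by (rule continuous_on_compose2[OF cont_\<Psi> \<gamma>(1)]) auto
      have "cut 0 = 0" by (rule cut_0) (use J_0 c_low \<epsilon> \<delta> in linarith)
      then show "\<Psi> (\<gamma> 0) = 0" by (simp add: \<gamma> \<Psi>_def)
      have "cut w = 0" by (rule cut_0) (use Jw c_low \<epsilon> \<delta> in linarith)
      then show "\<Psi> (\<gamma> 1) = w" by (simp add: \<gamma> \<Psi>_def)
      fix t :: real assume t: "t \<in> {0..1}"
      show "J (\<Psi> (\<gamma> t)) \<le> c - \<rho>"
      proof (cases "J (\<gamma> t) \<ge> c - \<epsilon>/2")
        case True
        have "cut (\<gamma> t) = 1"
          by (rule cut_1) (use True bspec[OF \<gamma>(4) t] a(2) \<rho> in linarith)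
        then show ?thesis using decrease[of "\<gamma> t"] bspec[OF \<gamma>(4) t] a(2) \<rho> by simp
      next
        case False
        have "s * cut (\<gamma> t) * (\<epsilon> * \<epsilon> / 2) \<ge> 0" using s cut01 \<epsilon> by simp
        then show ?thesis using decrease[of "\<gamma> t"] False \<rho> by linarith
      qed
    qed
    then have "c \<le> c - \<rho>" unfolding c_def using bb by (intro cInf_lower) auto
    then show False using \<rho> by simp
  qed
  have "\<exists>y. \<bar>J y - c\<bar> \<le> \<delta> / 2 * inverse (real (Suc n)) \<and> norm (dJ y) \<le> \<delta> / 2 * inverse (real (Suc n))" for n
    by (rule palais_smale) (use \<delta> in \<open>auto simp: divide_simps\<close>)
  then obtain y where y: "\<And>n. \<bar>J (y n) - c\<bar> \<le> \<delta> / 2 * inverse (real (Suc n))"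
    "\<And>n. norm (dJ (y n)) \<le> \<delta> / 2 * inverse (real (Suc n))" by metis
  have null: "(\<lambda>n. \<delta> / 2 * inverse (real (Suc n))) \<longlonglongrightarrow> 0"
    using tendsto_mult_left[OF LIMSEQ_inverse_real_of_nat, of "\<delta>/2"] by simp
  have yJ: "(\<lambda>n. J (y n)) \<longlonglongrightarrow> c"
    by (rule Lim_null[THEN iffD2]) (rule Lim_null_comparison[OF _ null], use y(1) in auto)
  have ydJ: "(\<lambda>n. dJ (y n)) \<longlonglongrightarrow> 0"
    by (rule Lim_null_comparison[OF _ null]) (use y(2) in auto)
  have yR: "norm (y n) \<le> R" for n
  proof (rule bounded)
    have "\<delta> / 2 * inverse (real (Suc n)) \<le> \<delta> / 2 * 1"
      using \<delta> by (intro mult_left_mono) (auto simp: inverse_le_1_iff)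
    then show "J (y n) \<ge> 0" using y(1)[of n] c_low \<delta> by linarith
  qed
  obtain r z \<rho> where r: "strict_mono r" and z: "\<And>x. (\<lambda>n. inner (y (r n)) x) \<longlonglongrightarrow> inner z x"
    and \<rho>: "(\<lambda>n. norm (y (r n))) \<longlonglongrightarrow> \<rho>" and "norm z \<le> \<rho>"
    using bounded_weak_limit[of y R, OF yR] by blast
  have m: "(\<lambda>n. \<mu> ((norm (y (r n)))\<^sup>2)) \<longlonglongrightarrow> \<mu> (\<rho>\<^sup>2)" by (intro \<mu>_tendsto tendsto_intros \<rho>)
  have dJr: "(\<lambda>n. dJ (y (r n))) \<longlonglongrightarrow> 0" using LIMSEQ_subseq_LIMSEQ[OF ydJ r] by (simp add: o_def)
  have Jr: "(\<lambda>n. J (y (r n))) \<longlonglongrightarrow> c" using LIMSEQ_subseq_LIMSEQ[OF yJ r] by (simp add: o_def)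
  have Gr: "(\<lambda>n. G (y (r n))) \<longlonglongrightarrow> G z" by (rule G_weak[OF yR z])
  have my: "(\<lambda>n. \<mu> ((norm (y (r n)))\<^sup>2) *\<^sub>R y (r n)) \<longlonglongrightarrow> G z"
    using tendsto_add[OF dJr Gr] by (simp add: dJ_def)
  show ?thesis
  \<comment> \<open>The degenerate case is excluded by the level; in the other case division by the
    coefficient turns the convergence of \<open>\<mu> y\<close> into strong convergence of
    \<open>y\<close>.\<close>
  proof (cases "\<mu> (\<rho>\<^sup>2) = 0")
    case True
    have "(\<lambda>n. \<mu> ((norm (y (r n)))\<^sup>2) *\<^sub>R y (r n)) \<longlonglongrightarrow> 0"
    proof (rule Lim_null_comparison)
      show "(\<lambda>n. \<bar>\<mu> ((norm (y (r n)))\<^sup>2)\<bar> * R) \<longlonglongrightarrow> 0"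
        using tendsto_mult_right[OF tendsto_rabs[OF m], of R] True by simp
    qed (use yR in \<open>auto intro!: always_eventually mult_left_mono\<close>)
    then have "G z = 0" using my LIMSEQ_unique by blast
    then have "\<Phi> z = 0" by (rule deg)
    have "(\<lambda>n. J (y (r n))) \<longlonglongrightarrow> M (\<rho>\<^sup>2) / 2 - \<Phi> z"
      unfolding J_def by (intro tendsto_intros M_tendsto \<Phi>_weak[OF yR z] \<rho>) auto
    then have cM: "c = M (\<rho>\<^sup>2) / 2" using Jr LIMSEQ_unique \<open>\<Phi> z = 0\<close> by fastforce
    have "\<rho>\<^sup>2 = 0 \<or> \<rho>\<^sup>2 = T"
      using True \<mu>1[of "\<rho>\<^sup>2"] \<mu>2[of "\<rho>\<^sup>2"] zero_le_power2[of \<rho>] by force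
    then show ?thesis using cM c_up c_low \<delta> M_0 by auto
  next
    case False
    define z' where "z' = inverse (\<mu> (\<rho>\<^sup>2)) *\<^sub>R G z"
    have "(\<lambda>n. inverse (\<mu> ((norm (y (r n)))\<^sup>2)) *\<^sub>R (\<mu> ((norm (y (r n)))\<^sup>2) *\<^sub>R y (r n))) \<longlonglongrightarrow> z'"
      unfolding z'_def by (intro tendsto_scaleR tendsto_inverse m my False)
    moreover have "\<forall>\<^sub>F n in sequentially. \<mu> ((norm (y (r n)))\<^sup>2) \<noteq> 0"
      using tendsto_imp_eventually_ne[OF m False] .
    then have "\<forall>\<^sub>F n in sequentially.
        inverse (\<mu> ((norm (y (r n)))\<^sup>2)) *\<^sub>R (\<mu> ((norm (y (r n)))\<^sup>2) *\<^sub>R y (r n)) = y (r n)"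
      by eventually_elim simp
    ultimately have yz': "(\<lambda>n. y (r n)) \<longlonglongrightarrow> z'" using Lim_transform_eventually by fast
    have n\<rho>: "norm z' = \<rho>" using LIMSEQ_unique[OF tendsto_norm[OF yz'] \<rho>] .
    have "G z' = G z" using LIMSEQ_unique[OF G_tendsto[OF yz'] Gr] .
    then have crit: "\<mu> ((norm z')\<^sup>2) *\<^sub>R z' = G z'" using False by (simp add: n\<rho>) (simp add: z'_def)
    have "J z' = c" using LIMSEQ_unique[OF J_tendsto[OF yz'] Jr] .
    then have nz: "z' \<noteq> 0" using c_low \<delta> J_0 by auto
    \<comment> \<open>Beyond \<open>T\<close> the coefficient is negative, so the equation tested
      with \<open>z'\<close> would contradict \<open>inner (G z') z' \<ge> 0\<close>.\<close>
    have "\<not> (norm z')\<^sup>2 > T"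
    proof
      assume "(norm z')\<^sup>2 > T"
      then have "\<mu> ((norm z')\<^sup>2) * (norm z')\<^sup>2 < 0" using \<mu>2 T by (intro mult_neg_pos) auto
      also have "\<mu> ((norm z')\<^sup>2) * (norm z')\<^sup>2 = inner (G z') z'"
        by (simp add: crit[symmetric] power2_norm_eq_inner)
      finally show False using G_nn[of z'] by simp
    qed
    moreover have "(norm z')\<^sup>2 \<noteq> T" using \<mu>T False n\<rho> by auto
    ultimately show ?thesis using crit nz by (intro exI[of _ z']) auto
  qed
qed

end

section \<open>The space of square integrable functions\<close>

text \<open>Functions live on the whole space, so that translations act on them; a function on the
  domain is extended by zero.\<close>

definition sqint :: "('a::euclidean_space \<Rightarrow> 'b::euclidean_space) \<Rightarrow> bool" where
  "sqint f \<longleftrightarrow> f \<in> borel_measurable lebesgue \<and> integrable lebesgue (\<lambda>x. (norm (f x))\<^sup>2)"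

lemma sqint_measurable: "sqint f \<Longrightarrow> f \<in> borel_measurable lebesgue"
  by (simp add: sqint_def)

lemma sqint_integrable: "sqint f \<Longrightarrow> integrable lebesgue (\<lambda>x. (norm (f x))\<^sup>2)"
  by (simp add: sqint_def)

lemma sqint_bound:
  assumes "f \<in> borel_measurable lebesgue" "integrable lebesgue g" "AE x in lebesgue. (norm (f x))\<^sup>2 \<le> g x"
  shows "sqint f"
  unfolding sqint_def
proof
  show "integrable lebesgue (\<lambda>x. (norm (f x))\<^sup>2)"
    by (rule Bochner_Integration.integrable_bound[OF assms(2)]) (use assms in auto)
qed (rule assms(1))

lemma sqint_zero: "sqint (\<lambda>x. 0)"
  by (simp add: sqint_def)

lemma sqint_scaleR: "sqint f \<Longrightarrow> sqint (\<lambda>x. c *\<^sub>R f x)"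
  by (auto simp: sqint_def power_mult_distrib)

lemma norm_add_squared_le:
  fixes a b :: "'b::real_normed_vector"
  shows "(norm (a + b))\<^sup>2 \<le> 2 * (norm a)\<^sup>2 + 2 * (norm b)\<^sup>2"
proof -
  have "(norm (a + b))\<^sup>2 \<le> (norm a + norm b)\<^sup>2" by (simp add: norm_triangle_ineq power_mono)
  also have "\<dots> \<le> 2 * (norm a)\<^sup>2 + 2 * (norm b)\<^sup>2"
    using sum_squares_bound[of "norm a" "norm b"] by (simp add: power2_sum)
  finally show ?thesis .
qed

lemma sqint_add: "sqint f \<Longrightarrow> sqint g \<Longrightarrow> sqint (\<lambda>x. f x + g x)"
  by (rule sqint_bound[where g = "\<lambda>x. 2 * (norm (f x))\<^sup>2 + 2 * (norm (g x))\<^sup>2"])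
    (auto simp: sqint_def norm_add_squared_le)

lemma sqint_uminus: "sqint f \<Longrightarrow> sqint (\<lambda>x. - f x)"
  by (auto simp: sqint_def)

lemma sqint_diff: "sqint f \<Longrightarrow> sqint g \<Longrightarrow> sqint (\<lambda>x. f x - g x)"
  using sqint_add[of f "\<lambda>x. - g x"] sqint_uminus[of g] by simp

lemma sqint_inner_integrable:
  assumes "sqint f" "sqint g" shows "integrable lebesgue (\<lambda>x. f x \<bullet> g x)"
proof (rule Bochner_Integration.integrable_bound)
  show "integrable lebesgue (\<lambda>x. (norm (f x))\<^sup>2 + (norm (g x))\<^sup>2)" using assms by (auto simp: sqint_def)
  show "(\<lambda>x. f x \<bullet> g x) \<in> borel_measurable lebesgue" using assms by (auto simp: sqint_def)
  have "\<bar>f x \<bullet> g x\<bar> \<le> (norm (f x))\<^sup>2 + (norm (g x))\<^sup>2" for x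
  proof -
    have "\<bar>f x \<bullet> g x\<bar> \<le> norm (f x) * norm (g x)" by (rule Cauchy_Schwarz_ineq2)
    also have "\<dots> \<le> (norm (f x))\<^sup>2 + (norm (g x))\<^sup>2"
      using sum_squares_bound[of "norm (f x)" "norm (g x)"] mult_nonneg_nonneg[OF norm_ge_zero[of "f x"] norm_ge_zero[of "g x"]]
      by linarith
    finally show ?thesis .
  qed
  then show "AE x in lebesgue. norm (f x \<bullet> g x) \<le> norm ((norm (f x))\<^sup>2 + (norm (g x))\<^sup>2)" by auto
qed

lemma sqint_norm: "sqint f \<Longrightarrow> sqint (\<lambda>x. norm (f x))"
  by (auto simp: sqint_def intro: borel_measurable_norm)

lemma sqint_mult_integrable:
  fixes f :: "'a::euclidean_space \<Rightarrow> real" and g :: "'a \<Rightarrow> 'b::euclidean_space"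
  assumes "sqint f" "sqint g" shows "integrable lebesgue (\<lambda>x. f x *\<^sub>R g x)"
  using sqint_inner_integrable[OF sqint_norm[OF assms(1)] sqint_norm[OF assms(2)]] assms
  by (subst integrable_norm_iff[symmetric]) (auto simp: sqint_def)

\<comment> \<open>The Hilbert space results above range over a type of class
  \<open>real_inner\<close> and \<open>complete_space\<close>, so the classes of square integrable
  functions have to form a type. The relation is partial because functions that are not square
  integrable must not be represented.\<close>
quotient_type (overloaded) ('a, 'b) L2 = "'a::euclidean_space \<Rightarrow> 'b::euclidean_space" /
  partial: "\<lambda>f g. sqint f \<and> sqint g \<and> (AE x in lebesgue. f x = g x)"
proof (rule part_equivpI)
  show "\<exists>f :: 'a \<Rightarrow> 'b. sqint f \<and> sqint f \<and> (AE x in lebesgue. f x = f x)"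
    by (intro exI[of _ "\<lambda>x. 0"]) (simp add: sqint_zero)
  show "symp (\<lambda>f g :: 'a \<Rightarrow> 'b. sqint f \<and> sqint g \<and> (AE x in lebesgue. f x = g x))"
    by (auto simp: symp_def)
  show "transp (\<lambda>f g :: 'a \<Rightarrow> 'b. sqint f \<and> sqint g \<and> (AE x in lebesgue. f x = g x))"
    unfolding transp_def
  proof (intro allI impI; elim conjE)
    fix f g h :: "'a \<Rightarrow> 'b"
    assume "sqint f" "sqint h" "AE x in lebesgue. f x = g x" "AE x in lebesgue. g x = h x"
    from this(3,4) have "AE x in lebesgue. f x = h x" by eventually_elim simp
    then show "sqint f \<and> sqint h \<and> (AE x in lebesgue. f x = h x)" using \<open>sqint f\<close> \<open>sqint h\<close> by simp
  qed
qed

instantiation L2 :: (euclidean_space, euclidean_space) real_vector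
begin

lift_definition zero_L2 :: "('a, 'b) L2" is "\<lambda>x. 0" by (simp add: sqint_zero)
lift_definition plus_L2 :: "('a, 'b) L2 \<Rightarrow> ('a, 'b) L2 \<Rightarrow> ('a, 'b) L2" is "\<lambda>f g x. f x + g x"
  by (auto intro: sqint_add)
lift_definition uminus_L2 :: "('a, 'b) L2 \<Rightarrow> ('a, 'b) L2" is "\<lambda>f x. - f x"
  by (auto intro: sqint_uminus)
lift_definition minus_L2 :: "('a, 'b) L2 \<Rightarrow> ('a, 'b) L2 \<Rightarrow> ('a, 'b) L2" is "\<lambda>f g x. f x - g x"
  by (auto intro: sqint_diff)
lift_definition scaleR_L2 :: "real \<Rightarrow> ('a, 'b) L2 \<Rightarrow> ('a, 'b) L2" is "\<lambda>c f x. c *\<^sub>R f x"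
  by (auto intro: sqint_scaleR)

instance
  by standard (transfer, auto simp: algebra_simps intro: sqint_add sqint_diff sqint_scaleR sqint_uminus sqint_zero)+

end

instantiation L2 :: (euclidean_space, euclidean_space) real_inner
begin

lift_definition inner_L2 :: "('a, 'b) L2 \<Rightarrow> ('a, 'b) L2 \<Rightarrow> real" is "\<lambda>f g. \<integral>x. f x \<bullet> g x \<partial>lebesgue"
proof -
  fix f f' g g' :: "'a \<Rightarrow> 'b"
  assume A: "sqint f \<and> sqint f' \<and> (AE x in lebesgue. f x = f' x)" "sqint g \<and> sqint g' \<and> (AE x in lebesgue. g x = g' x)"
  show "(\<integral>x. f x \<bullet> g x \<partial>lebesgue) = (\<integral>x. f' x \<bullet> g' x \<partial>lebesgue)"
  proof (rule integral_cong_AE)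
    from A have "AE x in lebesgue. f x = f' x" "AE x in lebesgue. g x = g' x" by auto
    then show "AE x in lebesgue. f x \<bullet> g x = f' x \<bullet> g' x" by eventually_elim simp
  qed (use A in \<open>auto simp: sqint_def\<close>)
qed

definition norm_L2 :: "('a, 'b) L2 \<Rightarrow> real" where "norm_L2 x = sqrt (x \<bullet> x)"
definition sgn_L2 :: "('a, 'b) L2 \<Rightarrow> ('a, 'b) L2" where "sgn_L2 x = inverse (norm x) *\<^sub>R x"
definition dist_L2 :: "('a, 'b) L2 \<Rightarrow> ('a, 'b) L2 \<Rightarrow> real" where "dist_L2 x y = norm (x - y)"
definition uniformity_L2 :: "(('a, 'b) L2 \<times> ('a, 'b) L2) filter" where
  "uniformity_L2 = (INF e\<in>{0<..}. principal {(x, y). dist x y < e})"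
definition open_L2 :: "('a, 'b) L2 set \<Rightarrow> bool" where
  "open_L2 U \<longleftrightarrow> (\<forall>x\<in>U. \<forall>\<^sub>F (x', y) in uniformity. x' = x \<longrightarrow> y \<in> U)"

instance
proof
  fix x y z :: "('a, 'b) L2" and c :: real and U :: "('a, 'b) L2 set"
  show "dist x y = norm (x - y)" "sgn x = inverse (norm x) *\<^sub>R x" "norm x = sqrt (x \<bullet> x)"
    "uniformity = (INF e\<in>{0<..}. principal {(x :: ('a, 'b) L2, y). dist x y < e})"
    "open U \<longleftrightarrow> (\<forall>x\<in>U. \<forall>\<^sub>F (x', y) in uniformity. x' = x \<longrightarrow> y \<in> U)"
    by (simp_all add: dist_L2_def sgn_L2_def norm_L2_def uniformity_L2_def open_L2_def)
  show "x \<bullet> y = y \<bullet> x" by transfer (simp add: inner_commute)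
  show "(x + y) \<bullet> z = x \<bullet> z + y \<bullet> z"
    by transfer (simp add: inner_simps sqint_inner_integrable)
  show "(c *\<^sub>R x) \<bullet> y = c * (x \<bullet> y)" by transfer simp
  show "0 \<le> x \<bullet> x" by transfer simp
  show "x \<bullet> x = 0 \<longleftrightarrow> x = 0"
  proof transfer
    fix f :: "'a \<Rightarrow> 'b" assume f: "sqint f \<and> sqint f \<and> (AE x in lebesgue. f x = f x)"
    then have "(\<integral>x. f x \<bullet> f x \<partial>lebesgue) = 0 \<longleftrightarrow> (AE x in lebesgue. f x \<bullet> f x = 0)"
      by (intro integral_nonneg_eq_0_iff_AE sqint_inner_integrable) auto
    then show "(\<integral>x. f x \<bullet> f x \<partial>lebesgue) = 0 \<longleftrightarrow> sqint f \<and> sqint (\<lambda>x. 0) \<and> (AE x in lebesgue. f x = 0)"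
      using f by (simp add: sqint_zero)
  qed
qed

end

section \<open>Representatives, completeness and convergence\<close>

lemma sqint_rep: "sqint (rep_L2 y)"
  using Quotient_rep_reflp[OF Quotient_L2, of y] by simp

lemma abs_rep_L2: "abs_L2 (rep_L2 y) = y"
  by (rule Quotient_abs_rep[OF Quotient_L2])

lemma rep_abs_L2: "sqint f \<Longrightarrow> AE x in lebesgue. rep_L2 (abs_L2 f) x = f x"
  using Quotient_rep_abs[OF Quotient_L2, of f] by simp

lemma abs_L2_eq_iff: "sqint f \<Longrightarrow> sqint g \<Longrightarrow> abs_L2 f = abs_L2 g \<longleftrightarrow> (AE x in lebesgue. f x = g x)"
  using Quotient_rel[OF Quotient_L2, of f g] by auto

lemma abs_L2_zero: "abs_L2 (\<lambda>x. 0) = 0"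
  by (simp add: zero_L2_def)

lemma abs_L2_add: "sqint f \<Longrightarrow> sqint g \<Longrightarrow> abs_L2 (\<lambda>x. f x + g x) = abs_L2 f + abs_L2 g"
  by (simp add: plus_L2.abs_eq)

lemma abs_L2_diff: "sqint f \<Longrightarrow> sqint g \<Longrightarrow> abs_L2 (\<lambda>x. f x - g x) = abs_L2 f - abs_L2 g"
  by (simp add: minus_L2.abs_eq)

lemma abs_L2_scaleR: "sqint f \<Longrightarrow> abs_L2 (\<lambda>x. c *\<^sub>R f x) = c *\<^sub>R abs_L2 f"
  by (simp add: scaleR_L2.abs_eq)

lemma inner_abs_L2: "sqint f \<Longrightarrow> sqint g \<Longrightarrow> abs_L2 f \<bullet> abs_L2 g = (\<integral>x. f x \<bullet> g x \<partial>lebesgue)"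
  by (simp add: inner_L2.abs_eq)

lemma norm_abs_L2: "sqint f \<Longrightarrow> (norm (abs_L2 f))\<^sup>2 = (\<integral>x. (norm (f x))\<^sup>2 \<partial>lebesgue)"
  by (simp add: power2_norm_eq_inner inner_abs_L2)

lemma norm_rep_L2: "(norm y)\<^sup>2 = (\<integral>x. (norm (rep_L2 y x))\<^sup>2 \<partial>lebesgue)"
  using norm_abs_L2[OF sqint_rep, of y] by (simp add: abs_rep_L2)

text \<open>Fatou's lemma for the squared norms: an almost everywhere limit inherits square
  integrability and the bound.\<close>

lemma sqint_Fatou:
  fixes f :: "nat \<Rightarrow> 'a::euclidean_space \<Rightarrow> 'b::euclidean_space"
  assumes f: "\<And>n. sqint (f n)" and g: "g \<in> borel_measurable lebesgue"
    and lim: "AE x in lebesgue. (\<lambda>n. f n x) \<longlonglongrightarrow> g x"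
    and B: "\<And>n. (\<integral>x. (norm (f n x))\<^sup>2 \<partial>lebesgue) \<le> B"
  shows "sqint g" "(\<integral>x. (norm (g x))\<^sup>2 \<partial>lebesgue) \<le> B"
proof -
  have B0: "B \<ge> 0" using B[of 0] by (meson Bochner_Integration.integral_nonneg order_trans zero_le_power2)
  have "(\<integral>\<^sup>+x. ennreal ((norm (g x))\<^sup>2) \<partial>lebesgue) = (\<integral>\<^sup>+x. liminf (\<lambda>n. ennreal ((norm (f n x))\<^sup>2)) \<partial>lebesgue)"
  proof (rule nn_integral_cong_AE, use lim in eventually_elim)
    case (elim x)
    then have "(\<lambda>n. ennreal ((norm (f n x))\<^sup>2)) \<longlonglongrightarrow> ennreal ((norm (g x))\<^sup>2)"
      by (intro tendsto_intros) auto
    then show ?case by (rule lim_imp_Liminf[OF trivial_limit_sequentially, symmetric])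
  qed
  also have "\<dots> \<le> liminf (\<lambda>n. \<integral>\<^sup>+x. ennreal ((norm (f n x))\<^sup>2) \<partial>lebesgue)"
    using f by (intro nn_integral_liminf) (auto simp: sqint_def)
  also have "\<dots> \<le> ennreal B"
    using f B by (intro Liminf_le trivial_limit_sequentially always_eventually allI)
      (subst nn_integral_eq_integral, auto simp: sqint_def ennreal_leI)
  finally have le: "(\<integral>\<^sup>+x. ennreal ((norm (g x))\<^sup>2) \<partial>lebesgue) \<le> ennreal B" .
  then have "integrable lebesgue (\<lambda>x. (norm (g x))\<^sup>2)"
    using g by (intro integrableI_bounded) (auto intro: le_less_trans)
  then show g2: "sqint g" using g by (simp add: sqint_def)
  then show "(\<integral>x. (norm (g x))\<^sup>2 \<partial>lebesgue) \<le> B"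
    using le B0 by (subst (asm) nn_integral_eq_integral) (auto simp: sqint_def)
qed

text \<open>The Riesz-Fischer argument. A fast subsequence converges almost everywhere, and Fatou's
  lemma upgrades this to convergence in norm. Completeness and the extraction of pointwise
  convergent subsequences both come from this statement.\<close>

lemma L2_Cauchy_AE_subsequence:
  fixes X :: "nat \<Rightarrow> ('a::euclidean_space, 'b::euclidean_space) L2"
  assumes X: "Cauchy X"
  shows "\<exists>r g. strict_mono r \<and> sqint g \<and> (AE x in lebesgue. (\<lambda>n. rep_L2 (X (r n)) x) \<longlonglongrightarrow> g x) \<and> X \<longlonglongrightarrow> abs_L2 g"
proof -
  have "\<exists>N. \<forall>m\<ge>N. \<forall>n\<ge>N. norm (X m - X n) < (1/8)^k" for k :: nat
    using X by (intro CauchyD) auto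
  then obtain N where N: "\<And>k m n. m \<ge> N k \<Longrightarrow> n \<ge> N k \<Longrightarrow> norm (X m - X n) < (1/8)^k" by metis
  define r where "r = rec_nat (N 0) (\<lambda>k m. max (Suc m) (N (Suc k)))"
  have r_Suc: "r (Suc k) = max (Suc (r k)) (N (Suc k))" for k by (simp add: r_def)
  have r: "strict_mono r" unfolding strict_mono_Suc_iff r_Suc by auto
  have rN: "r k \<ge> N k" for k by (cases k) (auto simp: r_Suc, simp add: r_def)
  define f where "f k = rep_L2 (X (r k))" for k
  have f: "sqint (f k)" and fX: "abs_L2 (f k) = X (r k)" for k
    by (simp_all add: f_def sqint_rep abs_rep_L2)
  have [measurable]: "f k \<in> borel_measurable lebesgue" for k using f by (simp add: sqint_def)
  \<comment> \<open>Increments of the fast subsequence. The integrals of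
    \<open>4^k * (d k x)\<^sup>2\<close> are still summable, and where the weighted sum is finite it
    gives the geometric bound \<open>d k x \<le> sqrt C * (1/2)^k\<close>.\<close>
  define d where "d k x = norm (f (Suc k) x - f k x)" for k x
  have d_int: "(\<integral>x. (d k x)\<^sup>2 \<partial>lebesgue) \<le> (1/8)^k" for k
  proof -
    have "(\<integral>x. (d k x)\<^sup>2 \<partial>lebesgue) = (norm (X (r (Suc k)) - X (r k)))\<^sup>2"
      unfolding d_def fX[symmetric] using f by (simp add: abs_L2_diff[symmetric] norm_abs_L2 sqint_diff)
    also have "\<dots> \<le> ((1/8)^k)\<^sup>2"
      using N[where k = k and m = "r (Suc k)" and n = "r k"] rN[of k] strict_monoD[OF r, of k "Suc k"]
      by (intro power_mono) auto
    also have "\<dots> \<le> (1/8)^k" by (simp add: power2_eq_square mult_le_cancel_left1 power_le_one)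
    finally show ?thesis .
  qed
  have d2: "integrable lebesgue (\<lambda>x. (d k x)\<^sup>2)" for k
    unfolding d_def using sqint_diff[OF f f] by (simp add: sqint_def)
  have "(\<integral>\<^sup>+x. (\<Sum>k. ennreal (4^k * (d k x)\<^sup>2)) \<partial>lebesgue) = (\<Sum>k. \<integral>\<^sup>+x. ennreal (4^k * (d k x)\<^sup>2) \<partial>lebesgue)"
    by (rule nn_integral_suminf) (auto simp: d_def)
  also have "\<dots> \<le> (\<Sum>k. ennreal ((1/2)^k))"
  proof (rule suminf_le)
    fix k
    have "(\<integral>\<^sup>+x. ennreal (4^k * (d k x)\<^sup>2) \<partial>lebesgue) = ennreal (4^k * (\<integral>x. (d k x)\<^sup>2 \<partial>lebesgue))"
      using d2 by (subst nn_integral_eq_integral) auto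
    also have "\<dots> \<le> ennreal (4^k * (1/8)^k)" using d_int by (intro ennreal_leI mult_left_mono) auto
    also have "\<dots> = ennreal ((1/2)^k)" by (simp add: power_mult_distrib[symmetric])
    finally show "(\<integral>\<^sup>+x. ennreal (4^k * (d k x)\<^sup>2) \<partial>lebesgue) \<le> ennreal ((1/2)^k)" .
  qed auto
  also have "\<dots> < \<infinity>" by (subst suminf_ennreal2) auto
  finally have "(\<integral>\<^sup>+x. (\<Sum>k. ennreal (4^k * (d k x)\<^sup>2)) \<partial>lebesgue) \<noteq> \<infinity>" by simp
  then have "AE x in lebesgue. (\<Sum>k. ennreal (4^k * (d k x)\<^sup>2)) \<noteq> \<infinity>"
    by (intro nn_integral_PInf_AE) (auto simp: d_def)
  then have conv: "AE x in lebesgue. convergent (\<lambda>n. f n x)"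
  proof eventually_elim
    case (elim x)
    then have "summable (\<lambda>k. 4^k * (d k x)\<^sup>2)"
      by (intro summable_suminf_not_top) auto
    then have "bounded (range (\<lambda>k. 4^k * (d k x)\<^sup>2))"
      using summable_LIMSEQ_zero convergentI convergent_imp_bounded by blast
    then obtain C where C: "C > 0" "\<And>k. 4^k * (d k x)\<^sup>2 \<le> C" unfolding bounded_pos by force
    have "d k x \<le> sqrt C * (1/2)^k" for k
    proof -
      have "sqrt (4^k * (d k x)\<^sup>2) \<le> sqrt C" using C(2) by simp
      moreover have "sqrt (4^k * (d k x)\<^sup>2) = 2^k * d k x"
        by (simp add: real_sqrt_mult real_sqrt_power d_def)
      ultimately show ?thesis by (simp add: field_simps)
    qed
    then have geo: "\<And>k. norm (f (Suc k) x - f k x) \<le> sqrt C * (1/2)^k" by (simp only: d_def)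
    have summ: "summable (\<lambda>k. sqrt C * (1/2::real)^k)" by (intro summable_mult summable_geometric) simp
    have "summable (\<lambda>k. f (Suc k) x - f k x)"
      by (rule summable_comparison_test'[OF summ, of 0]) (rule geo)
    then have "convergent (\<lambda>n. \<Sum>k<n. f (Suc k) x - f k x)" by (simp add: summable_iff_convergent)
    moreover have "(\<Sum>k<n. f (Suc k) x - f k x) = f n x - f 0 x" for n
      by (rule sum_lessThan_telescope[of "\<lambda>k. f k x"])
    ultimately have "convergent (\<lambda>n. f n x - f 0 x)" by simp
    then have "convergent (\<lambda>n. (f n x - f 0 x) + f 0 x)" by (intro convergent_add convergent_const)
    then show ?case by simp
  qed
  define g where "g x = lim (\<lambda>n. f n x)" for x
  have g[measurable]: "g \<in> borel_measurable lebesgue" unfolding g_def by measurable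
  have fg: "AE x in lebesgue. (\<lambda>n. f n x) \<longlonglongrightarrow> g x"
    using conv by eventually_elim (simp add: g_def convergent_LIMSEQ_iff)
  \<comment> \<open>For fixed \<open>m\<close> the differences to later members are small in norm,
    and Fatou's lemma passes the bound to the difference with the limit.\<close>
  have tail: "sqint (\<lambda>x. f m x - g x) \<and> (\<integral>x. (norm (f m x - g x))\<^sup>2 \<partial>lebesgue) \<le> ((1/8)^k)\<^sup>2" if "m \<ge> k" for m k
  proof -
    have fd: "sqint (\<lambda>x. f m x - f (n + k) x)" for n by (intro sqint_diff f)
    have "AE x in lebesgue. (\<lambda>n. f m x - f (n + k) x) \<longlonglongrightarrow> f m x - g x"
      using fg by eventually_elim (intro tendsto_intros LIMSEQ_ignore_initial_segment)
    moreover have "(\<integral>x. (norm (f m x - f (n + k) x))\<^sup>2 \<partial>lebesgue) \<le> ((1/8)^k)\<^sup>2" for n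
    proof -
      have "(\<integral>x. (norm (f m x - f (n + k) x))\<^sup>2 \<partial>lebesgue) = (norm (X (r m) - X (r (n + k))))\<^sup>2"
        unfolding fX[symmetric] using f by (simp add: abs_L2_diff[symmetric] norm_abs_L2 sqint_diff)
      also have "\<dots> \<le> ((1/8)^k)\<^sup>2"
      proof (rule power_mono[OF less_imp_le])
        have "r k \<le> r m" "r k \<le> r (n + k)" using that r by (simp_all add: strict_mono_less_eq)
        then show "norm (X (r m) - X (r (n + k))) < (1/8)^k" using rN[of k] by (intro N) auto
      qed simp
      finally show ?thesis .
    qed
    moreover have "(\<lambda>x. f m x - g x) \<in> borel_measurable lebesgue" by measurable
    ultimately show ?thesis 
      using sqint_Fatou[of "\<lambda>n x. f m x - f (n + k) x" "\<lambda>x. f m x - g x" "((1/8)^k)\<^sup>2", OF fd] by blast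
  qed
  have sg: "sqint g" using sqint_diff[OF f[of 0] conjunct1[OF tail[of 0 0]]] by simp
  have "(\<lambda>n. X (r n)) \<longlonglongrightarrow> abs_L2 g"
  proof (rule LIMSEQ_I)
    fix e :: real assume "e > 0"
    then obtain k where k: "(1/8::real)^k < e" using real_arch_pow_inv[of e "1/8"] by auto
    have "norm (X (r m) - abs_L2 g) < e" if "m \<ge> k" for m
    proof -
      have "(norm (X (r m) - abs_L2 g))\<^sup>2 \<le> ((1/8)^k)\<^sup>2"
        unfolding fX[symmetric] using conjunct2[OF tail[OF that]] f sg
        by (simp add: abs_L2_diff[symmetric] norm_abs_L2 sqint_diff)
      then have "norm (X (r m) - abs_L2 g) \<le> (1/8)^k" by (rule power2_le_imp_le) simp
      then show ?thesis using k by simp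
    qed
    then show "\<exists>n0. \<forall>n\<ge>n0. norm (X (r n) - abs_L2 g) < e" by blast
  qed
  then have "X \<longlonglongrightarrow> abs_L2 g" using Cauchy_converges_subseq[OF X r, of "abs_L2 g"] by (simp add: o_def)
  then show ?thesis using r sg fg unfolding f_def by blast
qed

instance L2 :: (euclidean_space, euclidean_space) complete_space
  by standard (use L2_Cauchy_AE_subsequence convergent_def in blast)

lemma L2_convergent_AE_subsequence:
  assumes "X \<longlonglongrightarrow> L"
  shows "\<exists>r. strict_mono r \<and> (AE x in lebesgue. (\<lambda>n. rep_L2 (X (r n)) x) \<longlonglongrightarrow> rep_L2 L x)"
proof -
  obtain r g where r: "strict_mono r" and g: "sqint g" "X \<longlonglongrightarrow> abs_L2 g"
    and ae: "AE x in lebesgue. (\<lambda>n. rep_L2 (X (r n)) x) \<longlonglongrightarrow> g x"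
    using L2_Cauchy_AE_subsequence[OF LIMSEQ_imp_Cauchy[OF assms]] by blast
  have "L = abs_L2 g" using LIMSEQ_unique[OF assms g(2)] .
  then have "AE x in lebesgue. rep_L2 L x = g x" using rep_abs_L2[OF g(1)] by simp
  with ae have "AE x in lebesgue. (\<lambda>n. rep_L2 (X (r n)) x) \<longlonglongrightarrow> rep_L2 L x" by eventually_elim simp
  then show ?thesis using r by blast
qed

text \<open>The majorant controls the square of the norm; the squared difference to the limit is
  then at most \<open>4 * h\<close>, and scalar dominated convergence applies.\<close>

lemma L2_dominated_convergence:
  fixes f :: "nat \<Rightarrow> 'a::euclidean_space \<Rightarrow> 'b::euclidean_space"
  assumes f: "\<And>n. f n \<in> borel_measurable lebesgue" and g: "g \<in> borel_measurable lebesgue"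
    and h: "integrable lebesgue (h :: 'a \<Rightarrow> real)"
    and bd: "\<And>n. AE x in lebesgue. (norm (f n x))\<^sup>2 \<le> h x"
    and lim: "AE x in lebesgue. (\<lambda>n. f n x) \<longlonglongrightarrow> g x"
  shows "\<And>n. sqint (f n)" "sqint g" "(\<lambda>n. abs_L2 (f n)) \<longlonglongrightarrow> abs_L2 g"
proof -
  show sf: "sqint (f n)" for n by (rule sqint_bound[OF f h bd])
  have "AE x in lebesgue. \<forall>n. (norm (f n x))\<^sup>2 \<le> h x" using bd by (simp add: AE_all_countable)
  with lim have gh: "AE x in lebesgue. (norm (g x))\<^sup>2 \<le> h x"
  proof eventually_elim
    case (elim x)
    have "(\<lambda>n. (norm (f n x))\<^sup>2) \<longlonglongrightarrow> (norm (g x))\<^sup>2" using elim(1) by (intro tendsto_intros)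
    then show ?case using elim(2) by (intro LIMSEQ_le_const2) auto
  qed
  then show sg: "sqint g" by (rule sqint_bound[OF g h])
  have "(\<lambda>n. \<integral>x. (norm (f n x - g x))\<^sup>2 \<partial>lebesgue) \<longlonglongrightarrow> (\<integral>x. 0 \<partial>(lebesgue :: 'a measure))"
  proof (rule integral_dominated_convergence)
    show "integrable lebesgue (\<lambda>x. 4 * h x)" using h by simp
    show "AE x in lebesgue. (\<lambda>n. (norm (f n x - g x))\<^sup>2) \<longlonglongrightarrow> 0"
      using lim
    proof eventually_elim
      case (elim x)
      have "(\<lambda>n. (norm (f n x - g x))\<^sup>2) \<longlonglongrightarrow> (norm (g x - g x))\<^sup>2" by (intro tendsto_intros elim)
      then show ?case by simp
    qed
    show "AE x in lebesgue. norm ((norm (f n x - g x))\<^sup>2) \<le> 4 * h x" for n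
      using bd[of n] gh
    proof eventually_elim
      case (elim x)
      then show ?case using norm_add_squared_le[of "f n x" "- g x"] by simp
    qed
  qed (use f g in auto)
  then have "(\<lambda>n. (norm (abs_L2 (f n) - abs_L2 g))\<^sup>2) \<longlonglongrightarrow> 0"
    using sf sg by (simp add: abs_L2_diff[symmetric] norm_abs_L2 sqint_diff)
  from tendsto_real_sqrt[OF this]
  have "(\<lambda>n. norm (abs_L2 (f n) - abs_L2 g)) \<longlonglongrightarrow> 0" by simp
  then show "(\<lambda>n. abs_L2 (f n)) \<longlonglongrightarrow> abs_L2 g"
    by (rule LIM_zero_cancel[OF tendsto_norm_zero_cancel])
qed

section \<open>Smooth functions\<close>

lemma Ck_SucI:
  assumes "\<And>x. (f has_derivative f' x) (at x)" "\<And>b. b \<in> Basis \<Longrightarrow> Ck k (\<lambda>x. f' x b)"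
  shows "Ck (Suc k) f"
proof -
  have "frechet_derivative f (at x) = f' x" for x
    using frechet_derivative_at[OF assms(1)] by simp
  then show ?thesis
    using assms by (auto simp: differentiable_on_def differentiable_def intro: has_derivative_at_withinI)
qed

lemma Ck_SucD:
  assumes "Ck (Suc k) f"
  shows "(f has_derivative frechet_derivative f (at x)) (at x)"
    "b \<in> Basis \<Longrightarrow> Ck k (\<lambda>x. frechet_derivative f (at x) b)"
  using assms by (auto simp: differentiable_on_def frechet_derivative_works)

lemma Ck_continuous: "Ck k f \<Longrightarrow> continuous_on UNIV f"
  by (cases k) (auto intro: differentiable_imp_continuous_on)

lemma Ck_Suc_imp: "Ck (Suc k) f \<Longrightarrow> Ck k f"
proof (induction k arbitrary: f)
  case 0
  show ?case using Ck_continuous[OF 0] by simp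
next
  case (Suc k)
  show ?case
    by (rule Ck_SucI[OF Ck_SucD(1)[OF Suc.prems]]) (rule Suc.IH[OF Ck_SucD(2)[OF Suc.prems]])
qed

lemma Ck_const: "Ck k (\<lambda>x. c)"
proof (induction k arbitrary: c)
  case (Suc k)
  show ?case by (rule Ck_SucI[where f' = "\<lambda>x h. 0"]) (auto intro: Suc.IH)
qed simp

lemma Ck_inner: "Ck k (\<lambda>x. x \<bullet> a)"
proof (cases k)
  case (Suc j)
  show ?thesis unfolding Suc
    by (rule Ck_SucI[where f' = "\<lambda>x h. h \<bullet> a"]) (auto intro!: derivative_eq_intros Ck_const)
qed (auto intro!: continuous_intros)

lemma Ck_add: "Ck k f \<Longrightarrow> Ck k g \<Longrightarrow> Ck k (\<lambda>x. f x + g x)"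
proof (induction k arbitrary: f g)
  case (Suc k)
  show ?case
    by (rule Ck_SucI[OF has_derivative_add[OF Ck_SucD(1)[OF Suc.prems(1)] Ck_SucD(1)[OF Suc.prems(2)]]])
      (intro Suc.IH Ck_SucD(2) Suc.prems)
qed (auto intro: continuous_on_add)

lemma Ck_mult: "Ck k f \<Longrightarrow> Ck k g \<Longrightarrow> Ck k (\<lambda>x. f x * g x)"
proof (induction k arbitrary: f g)
  case (Suc k)
  show ?case
    by (rule Ck_SucI[OF has_derivative_mult[OF Ck_SucD(1)[OF Suc.prems(1)] Ck_SucD(1)[OF Suc.prems(2)]]])
      (intro Ck_add Suc.IH Ck_SucD(2) Suc.prems Ck_Suc_imp)
qed (auto intro: continuous_on_mult)

lemma Ck_real_SucI:
  fixes h :: "real \<Rightarrow> real"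
  assumes "\<And>t. (h has_real_derivative h' t) (at t)" "Ck k h'"
  shows "Ck (Suc k) h"
  by (rule Ck_SucI[OF assms(1)[THEN has_field_derivative_imp_has_derivative]]) (use assms(2) in simp)

lemma Ck_real_SucD:
  fixes h :: "real \<Rightarrow> real"
  assumes "Ck (Suc k) h"
  shows "(h has_real_derivative frechet_derivative h (at t) 1) (at t)"
    "Ck k (\<lambda>t. frechet_derivative h (at t) 1)"
proof -
  note d = Ck_SucD(1)[OF assms, of t]
  have "x * frechet_derivative h (at t) 1 = frechet_derivative h (at t) x" for x
    using linear_scale[OF has_derivative_linear[OF d], of x 1] by simp
  then show "(h has_real_derivative frechet_derivative h (at t) 1) (at t)"
    by (rule has_derivative_imp_has_field_derivative[OF d])
  show "Ck k (\<lambda>t. frechet_derivative h (at t) 1)" using Ck_SucD(2)[OF assms, of 1] by simp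
qed

lemma Ck_compose:
  fixes h :: "real \<Rightarrow> real"
  shows "Ck k h \<Longrightarrow> Ck k f \<Longrightarrow> Ck k (\<lambda>x. h (f x))"
proof (induction k arbitrary: h f)
  case 0
  then show ?case by (auto intro: continuous_on_compose2)
next
  case (Suc k)
  have d: "((\<lambda>x. h (f x)) has_derivative
      (\<lambda>y. frechet_derivative h (at (f x)) 1 * frechet_derivative f (at x) y)) (at x)" for x
    using has_derivative_compose[OF Ck_SucD(1)[OF Suc.prems(2)]
        has_field_derivative_imp_has_derivative[OF Ck_real_SucD(1)[OF Suc.prems(1)]]] .
  show ?case
    by (rule Ck_SucI[OF d], rule Ck_mult[OF Suc.IH[OF Ck_real_SucD(2)[OF Suc.prems(1)]
            Ck_Suc_imp[OF Suc.prems(2)]] Ck_SucD(2)[OF Suc.prems(2)]])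
qed

section \<open>Closure rules for smooth functions and their gradients\<close>

lemma smooth_const: "smooth (\<lambda>x. c)"
  by (simp add: smooth_def Ck_const)

lemma smooth_inner: "smooth (\<lambda>x. x \<bullet> a)"
  by (simp add: smooth_def Ck_inner)

lemma smooth_ident: "smooth (\<lambda>x::real. x)"
  using smooth_inner[of "1::real"] by simp

lemma smooth_add: "smooth f \<Longrightarrow> smooth g \<Longrightarrow> smooth (\<lambda>x. f x + g x)"
  by (simp add: smooth_def Ck_add)

lemma smooth_mult: "smooth f \<Longrightarrow> smooth g \<Longrightarrow> smooth (\<lambda>x. f x * g x)"
  by (simp add: smooth_def Ck_mult)

lemma smooth_minus: "smooth f \<Longrightarrow> smooth (\<lambda>x. - f x)"
  using smooth_mult[OF smooth_const[of "-1"]] by simp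

lemma smooth_diff: "smooth f \<Longrightarrow> smooth g \<Longrightarrow> smooth (\<lambda>x. f x - g x)"
  using smooth_add[OF _ smooth_minus] by simp

lemma smooth_compose:
  fixes h :: "real \<Rightarrow> real"
  shows "smooth h \<Longrightarrow> smooth f \<Longrightarrow> smooth (\<lambda>x. h (f x))"
  by (simp add: smooth_def Ck_compose)

lemma smooth_prod: "(\<And>i. i \<in> I \<Longrightarrow> smooth (f i)) \<Longrightarrow> smooth (\<lambda>x. \<Prod>i\<in>I. f i x)"
  by (induction I rule: infinite_finite_induct) (auto intro: smooth_const smooth_mult)

lemma smooth_continuous: "smooth f \<Longrightarrow> continuous_on UNIV f"
  using Ck_continuous by (auto simp: smooth_def)

lemma smooth_derivative:
  fixes h :: "real \<Rightarrow> real"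
  assumes h: "\<And>t. (h has_real_derivative h' t) (at t)" and "smooth h"
  shows "smooth h'"
proof -
  have "frechet_derivative h (at t) 1 = h' t" for t
    using DERIV_unique[OF h Ck_real_SucD(1)] assms(2) by (metis smooth_def)
  then show ?thesis using assms(2) Ck_real_SucD(2) unfolding smooth_def by (metis (no_types, lifting) ext)
qed

lemma has_derivative_grad:
  assumes "smooth f"
  shows "(f has_derivative (\<lambda>h. grad f x \<bullet> h)) (at x)"
proof -
  have d: "(f has_derivative frechet_derivative f (at x)) (at x)"
    using assms Ck_SucD(1)[of 0 f] by (auto simp: smooth_def)
  have "frechet_derivative f (at x) h = grad f x \<bullet> h" for h
  proof -
    have "frechet_derivative f (at x) h = frechet_derivative f (at x) (\<Sum>b\<in>Basis. (h \<bullet> b) *\<^sub>R b)"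
      by (simp add: euclidean_representation)
    also have "\<dots> = (\<Sum>b\<in>Basis. (h \<bullet> b) * frechet_derivative f (at x) b)"
      using has_derivative_linear[OF d] by (simp add: linear_sum linear_scale)
    also have "\<dots> = grad f x \<bullet> h"
      unfolding grad_def inner_sum_left by (simp add: inner_commute mult.commute)
    finally show ?thesis .
  qed
  then show ?thesis using d by presburger
qed

lemma grad_eqI:
  assumes "(f has_derivative (\<lambda>h. v \<bullet> h)) (at x)"
  shows "grad f x = v"
proof -
  have "frechet_derivative f (at x) = (\<lambda>h. v \<bullet> h)" using frechet_derivative_at[OF assms] by simp
  then show ?thesis by (simp add: grad_def euclidean_representation)
qed

lemma continuous_grad:
  assumes "smooth f" shows "continuous_on UNIV (grad f)"
proof -
  have "Ck (Suc 0) f" using assms by (simp add: smooth_def)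
  from Ck_SucD(2)[OF this] show ?thesis unfolding grad_def by (auto intro!: continuous_intros)
qed

lemma grad_add:
  assumes "smooth f" "smooth g" shows "grad (\<lambda>x. f x + g x) x = grad f x + grad g x"
  using has_derivative_add[OF assms[THEN has_derivative_grad]] by (intro grad_eqI) (simp add: inner_simps)

lemma grad_mult:
  assumes "smooth f" "smooth g" shows "grad (\<lambda>x. f x * g x) x = f x *\<^sub>R grad g x + g x *\<^sub>R grad f x"
  using has_derivative_mult[OF assms[THEN has_derivative_grad]]
  by (intro grad_eqI) (simp add: inner_simps mult.commute)

lemma grad_const: "grad (\<lambda>x. c) x = 0"
  by (rule grad_eqI) simp

lemma grad_inner: "grad (\<lambda>x. x \<bullet> a) x = a"
  by (rule grad_eqI) (auto intro!: derivative_eq_intros simp: inner_commute)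

lemma grad_compose:
  assumes "smooth f" "(h has_real_derivative h') (at (f x))"
  shows "grad (\<lambda>x. h (f x)) x = h' *\<^sub>R grad f x"
  using has_derivative_compose[OF has_derivative_grad[OF assms(1)]
      has_field_derivative_imp_has_derivative[OF assms(2)]]
  by (intro grad_eqI) simp

subsection \<open>Flat functions and bumps\<close>

text \<open>The standard function exp(-1/t) with powers of 1/t in front. The index makes the family
  closed under differentiation, so smoothness of all members follows by one induction on the
  order.\<close>

definition flat :: "nat \<Rightarrow> real \<Rightarrow> real" where
  "flat n t = (if t \<le> 0 then 0 else inverse t ^ n * exp (- inverse t))"

lemma flat_nonneg: "0 \<le> flat n t"
  by (simp add: flat_def)

lemma flat_0_less: "0 < t \<Longrightarrow> 0 < flat n t"
  by (simp add: flat_def)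

lemma flat_0_eq: "t \<le> 0 \<Longrightarrow> flat n t = 0"
  by (simp add: flat_def)

lemma flat_tendsto_0: "(flat n \<longlongrightarrow> 0) (at 0)"
proof (rule filterlim_split_at)
  show "(flat n \<longlongrightarrow> 0) (at_left 0)"
    by (rule tendsto_eventually) (auto simp: flat_def eventually_at_filter)
  have "((\<lambda>t::real. inverse t ^ n / exp (inverse t)) \<longlongrightarrow> 0) (at_right 0)"
    by (rule filterlim_compose[OF tendsto_power_div_exp_0 filterlim_inverse_at_top_right])
  moreover have "\<forall>\<^sub>F t in at_right (0::real). inverse t ^ n / exp (inverse t) = flat n t"
    by (auto simp: flat_def eventually_at_filter exp_minus divide_inverse)
  ultimately show "(flat n \<longlongrightarrow> 0) (at_right 0)" by (rule Lim_transform_eventually)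
qed

lemma flat_deriv: "(flat n has_real_derivative flat (n + 2) t - real n * flat (n + 1) t) (at t)"
proof -
  consider "t < 0" | "t = 0" | "t > 0" by linarith
  then show ?thesis
  proof cases
    case 1
    have "((\<lambda>t. 0) has_real_derivative 0) (at t)" by simp
    moreover have "\<forall>\<^sub>F s in nhds t. flat n s = 0"
      using eventually_nhds_in_open[of "{..<0}" t] 1 by (auto elim!: eventually_mono simp: flat_def)
    ultimately have "(flat n has_real_derivative 0) (at t)"
      using DERIV_cong_ev[OF refl _ refl, of "flat n" "\<lambda>t. 0" t 0] by simp
    then show ?thesis using 1 by (simp add: flat_def)
  next
    \<comment> \<open>At 0 the difference quotient of \<open>flat n\<close> is
      \<open>flat (n + 1)\<close>, which tends to 0.\<close>
    case 2
    have "((\<lambda>s. (flat n s - flat n 0) / (s - 0)) \<longlongrightarrow> 0) (at 0)"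
    proof (rule Lim_transform_eventually[OF flat_tendsto_0[of "n + 1"]])
      show "\<forall>\<^sub>F s in at 0. flat (n + 1) s = (flat n s - flat n 0) / (s - 0)"
        by (auto simp: flat_def eventually_at_filter divide_inverse)
    qed
    then have "(flat n has_real_derivative 0) (at 0)" by (simp add: has_field_derivative_iff)
    then show ?thesis using 2 by (simp add: flat_def)
  next
    case 3
    have "((\<lambda>s. inverse s ^ n * exp (- inverse s)) has_real_derivative
        flat (n + 2) t - real n * flat (n + 1) t) (at t)"
      using 3
      by (auto intro!: derivative_eq_intros simp: flat_def power2_eq_square)
        (cases n, auto simp: algebra_simps)
    moreover have "\<forall>\<^sub>F s in nhds t. flat n s = inverse s ^ n * exp (- inverse s)"
      using eventually_nhds_in_open[of "{0<..}" t] 3 by (auto elim!: eventually_mono simp: flat_def)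
    ultimately show ?thesis by (simp add: DERIV_cong_ev[OF refl _ refl])
  qed
qed

lemma smooth_flat: "smooth (flat n)"
proof -
  have "Ck k (flat n)" for k
  proof (induction k arbitrary: n)
    case 0
    show ?case by (auto intro!: continuous_at_imp_continuous_on DERIV_isCont[OF flat_deriv])
  next
    case (Suc k)
    have "Ck k (\<lambda>t. flat (n + 2) t + (- real n) * flat (n + 1) t)"
      by (intro Ck_add Ck_mult Ck_const Suc.IH)
    then show ?case by (intro Ck_real_SucI[OF flat_deriv]) simp
  qed
  then show ?thesis by (simp add: smooth_def)
qed

lemma smooth_exp: "smooth (exp :: real \<Rightarrow> real)"
proof -
  have "Ck k (exp :: real \<Rightarrow> real)" for k
    by (induction k) (auto intro!: continuous_intros Ck_real_SucI[OF DERIV_exp] simp del: Ck.simps(2))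
  then show ?thesis by (simp add: smooth_def)
qed

text \<open>The product is smooth and positive exactly inside the box. Composing it with 1 - exp(-n
  p) keeps the values between 0 and 1 and lets them converge to the indicator of the open
  box.\<close>

definition box_bump :: "'a::euclidean_space \<Rightarrow> 'a \<Rightarrow> nat \<Rightarrow> 'a \<Rightarrow> real" where
  "box_bump c d n x =
    1 - exp (- real n * (\<Prod>b\<in>Basis. flat 0 (x \<bullet> b - c \<bullet> b) * flat 0 (d \<bullet> b - x \<bullet> b)))"

lemma smooth_box_bump: "smooth (box_bump c d n)"
  unfolding box_bump_def
  by (intro smooth_diff smooth_const smooth_mult smooth_compose[OF smooth_exp] smooth_prod
      smooth_compose[OF smooth_flat] smooth_inner)

lemma box_bump_prod:
  fixes x c d :: "'a::euclidean_space"
  defines "p \<equiv> (\<Prod>b\<in>Basis. flat 0 (x \<bullet> b - c \<bullet> b) * flat 0 (d \<bullet> b - x \<bullet> b))"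
  shows "p \<ge> 0" "x \<in> box c d \<Longrightarrow> p > 0" "x \<notin> box c d \<Longrightarrow> p = 0"
proof -
  show "p \<ge> 0" unfolding p_def by (intro prod_nonneg mult_nonneg_nonneg flat_nonneg)
  show "p > 0" if "x \<in> box c d"
    using that unfolding p_def by (intro prod_pos) (auto simp: mem_box intro!: mult_pos_pos flat_0_less)
  assume "x \<notin> box c d"
  then obtain b where "b \<in> Basis" "x \<bullet> b \<le> c \<bullet> b \<or> d \<bullet> b \<le> x \<bullet> b" by (auto simp: mem_box not_less)
  then show "p = 0" unfolding p_def by (intro prod_zero) (auto simp: flat_0_eq intro!: bexI[of _ b])
qed

lemma box_bump_range: "0 \<le> box_bump c d n x" "box_bump c d n x \<le> 1"
  using box_bump_prod(1)[where x = x] by (auto simp: box_bump_def intro!: mult_nonneg_nonneg)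

lemma box_bump_outside: "x \<notin> box c d \<Longrightarrow> box_bump c d n x = 0"
  using box_bump_prod(3)[where x = x] by (simp add: box_bump_def)

lemma box_bump_tendsto: "(\<lambda>n. box_bump c d n x) \<longlonglongrightarrow> indicator (box c d) x"
proof (cases "x \<in> box c d")
  case True
  define p where "p = (\<Prod>b\<in>Basis. flat 0 (x \<bullet> b - c \<bullet> b) * flat 0 (d \<bullet> b - x \<bullet> b))"
  have "p > 0" unfolding p_def using box_bump_prod(2)[OF True] .
  have "box_bump c d n x = 1 - exp (- p) ^ n" for n
    by (simp add: box_bump_def p_def[symmetric] exp_of_nat_mult[symmetric])
  moreover have "(\<lambda>n. 1 - exp (- p) ^ n) \<longlonglongrightarrow> 1 - 0"
    using \<open>p > 0\<close> by (intro tendsto_intros LIMSEQ_power_zero) simp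
  ultimately show ?thesis using True by simp
qed (simp add: box_bump_outside)

subsection \<open>Test functions\<close>

lemma test_funI:
  assumes "smooth \<phi>" "compact C" "C \<subseteq> \<Omega>" "\<And>x. x \<notin> C \<Longrightarrow> \<phi> x = 0"
  shows "test_fun \<Omega> \<phi>"
proof -
  have "closure {x. \<phi> x \<noteq> 0} \<subseteq> C"
    using assms by (intro closure_minimal compact_imp_closed) auto
  moreover have "bounded {x. \<phi> x \<noteq> 0}"
    using assms(4) by (intro bounded_subset[OF compact_imp_bounded[OF assms(2)]]) auto
  ultimately show ?thesis using assms(1,3) unfolding test_fun_def by (simp add: compact_closure)
qed

lemma test_funE:
  assumes "test_fun \<Omega> \<phi>"
  obtains C where "smooth \<phi>" "compact C" "C \<subseteq> \<Omega>" "\<And>x. x \<notin> C \<Longrightarrow> \<phi> x = 0" "\<And>x. x \<notin> C \<Longrightarrow> grad \<phi> x = 0"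
proof
  let ?C = "closure {x. \<phi> x \<noteq> 0}"
  show "smooth \<phi>" "compact ?C" "?C \<subseteq> \<Omega>" using assms by (auto simp: test_fun_def)
  show 0: "\<phi> x = 0" if "x \<notin> ?C" for x using that closure_subset by force
  show "grad \<phi> x = 0" if "x \<notin> ?C" for x
  proof (rule grad_eqI)
    have "((\<lambda>y. 0::real) has_derivative (\<lambda>h. 0 \<bullet> h)) (at x)" by simp
    then show "(\<phi> has_derivative (\<lambda>h. 0 \<bullet> h)) (at x)"
    proof (rule has_derivative_transform_within_open)
      show "open (- ?C)" "x \<in> - ?C" using that by auto
      show "0 = \<phi> y" if "y \<in> - ?C" for y using 0[of y] that by simp
    qed
  qed
qed

lemma test_fun_smooth: "test_fun \<Omega> \<phi> \<Longrightarrow> smooth \<phi>"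
  by (simp add: test_fun_def)

lemma test_fun_outside:
  assumes "test_fun \<Omega> \<phi>" "x \<notin> \<Omega>" shows "\<phi> x = 0" "grad \<phi> x = 0"
  using assms by (auto elim!: test_funE)

lemma test_fun_zero: "test_fun \<Omega> (\<lambda>x. 0)"
  by (rule test_funI[of _ "{}"]) (auto intro: smooth_const)

lemma test_fun_mult: "test_fun \<Omega> \<phi> \<Longrightarrow> smooth \<psi> \<Longrightarrow> test_fun \<Omega> (\<lambda>x. \<psi> x * \<phi> x)"
  by (elim test_funE, rule test_funI) (auto intro: smooth_mult)

lemma test_fun_add:
  assumes "test_fun \<Omega> \<phi>" "test_fun \<Omega> \<psi>" shows "test_fun \<Omega> (\<lambda>x. \<phi> x + \<psi> x)"
proof -
  obtain C where C: "smooth \<phi>" "compact C" "C \<subseteq> \<Omega>" "\<And>x. x \<notin> C \<Longrightarrow> \<phi> x = 0"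
    using assms(1) by (rule test_funE) blast
  obtain D where D: "smooth \<psi>" "compact D" "D \<subseteq> \<Omega>" "\<And>x. x \<notin> D \<Longrightarrow> \<psi> x = 0"
    using assms(2) by (rule test_funE) blast
  show ?thesis by (rule test_funI[of _ "C \<union> D"]) (use C D in \<open>auto intro: smooth_add\<close>)
qed

lemma test_fun_scale: "test_fun \<Omega> \<phi> \<Longrightarrow> test_fun \<Omega> (\<lambda>x. c * \<phi> x)"
  using test_fun_mult[OF _ smooth_const] .

lemma test_fun_compose:
  assumes "test_fun \<Omega> \<phi>" "smooth h" "h 0 = 0" shows "test_fun \<Omega> (\<lambda>x. h (\<phi> x))"
  using assms(1)
proof (rule test_funE)
  fix C assume "smooth \<phi>" "compact C" "C \<subseteq> \<Omega>" "\<And>x. x \<notin> C \<Longrightarrow> \<phi> x = 0"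
  then show ?thesis by (intro test_funI[of _ C]) (use assms in \<open>auto intro: smooth_compose\<close>)
qed

lemma test_fun_box_bump: "cbox c d \<subseteq> \<Omega> \<Longrightarrow> test_fun \<Omega> (box_bump c d n)"
  by (rule test_funI[of _ "cbox c d"]) (auto intro: smooth_box_bump box_bump_outside[OF contra_subsetD[OF box_subset_cbox]])

lemma compact_support_bounded_integrable:
  fixes f :: "'a::euclidean_space \<Rightarrow> 'b::euclidean_space"
  assumes f: "continuous_on UNIV f" and C: "compact C" "\<And>x. x \<notin> C \<Longrightarrow> f x = 0"
  shows "\<exists>B\<ge>0. \<forall>x. norm (f x) \<le> B" "sqint f" "integrable lebesgue f"
proof -
  have "compact (f ` C)" using f C by (meson compact_continuous_image continuous_on_subset subset_UNIV)
  then obtain B where B: "B > 0" "\<forall>y\<in>f ` C. norm y \<le> B" using compact_imp_bounded bounded_pos by blast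
  have fB: "norm (f x) \<le> B" for x using B C(2) by (cases "x \<in> C") (auto intro: less_imp_le)
  then show "\<exists>B\<ge>0. \<forall>x. norm (f x) \<le> B" using B(1) less_imp_le by blast
  have m[measurable]: "f \<in> borel_measurable lebesgue"
    by (rule measurable_completion) (use borel_measurable_continuous_onI[OF f] in simp)
  have i: "integrable lebesgue (\<lambda>x. k * indicator C x)" for k :: real
    using lmeasurable_compact[OF C(1)]
    by (intro integrable_mult_right integrable_real_indicator) (auto simp: fmeasurable_def)
  show "sqint f"
  proof (rule sqint_bound[OF m i[of "B\<^sup>2"]])
    show "AE x in lebesgue. (norm (f x))\<^sup>2 \<le> B\<^sup>2 * indicator C x"
      using fB C(2) by (intro AE_I2) (auto simp: indicator_def power_mono)
  qed
  have "norm (f x) \<le> norm (B * indicat_real C x)" for x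
    using fB[of x] C(2)[of x] B(1) by (auto simp: indicator_def)
  then show "integrable lebesgue f"
    by (intro Bochner_Integration.integrable_bound[OF i[of B] m] AE_I2)
qed

lemma test_fun_integrable:
  assumes "test_fun \<Omega> \<phi>"
  shows "\<exists>B\<ge>0. \<forall>x. \<bar>\<phi> x\<bar> \<le> B" "sqint \<phi>" "integrable lebesgue \<phi>"
    "\<exists>B\<ge>0. \<forall>x. norm (grad \<phi> x) \<le> B" "sqint (grad \<phi>)" "integrable lebesgue (grad \<phi>)"
proof -
  obtain C where C: "smooth \<phi>" "compact C" "\<And>x. x \<notin> C \<Longrightarrow> \<phi> x = 0" "\<And>x. x \<notin> C \<Longrightarrow> grad \<phi> x = 0"
    using assms by (rule test_funE) blast
  show "\<exists>B\<ge>0. \<forall>x. \<bar>\<phi> x\<bar> \<le> B" "sqint \<phi>" "integrable lebesgue \<phi>"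
    using compact_support_bounded_integrable[OF smooth_continuous[OF C(1)] C(2,3)] by auto
  show "\<exists>B\<ge>0. \<forall>x. norm (grad \<phi> x) \<le> B" "sqint (grad \<phi>)" "integrable lebesgue (grad \<phi>)"
    using compact_support_bounded_integrable[OF continuous_grad[OF C(1)] C(2,4)] by auto
qed

section \<open>Translations and integration by parts\<close>

lemma translation_lebesgue:
  fixes h :: "'a::euclidean_space"
  shows measurable_translation_lebesgue: "(+) h \<in> lebesgue \<rightarrow>\<^sub>M lebesgue"
    and distr_translation_lebesgue: "distr lebesgue lebesgue ((+) h) = lebesgue"
proof -
  have T: "(\<lambda>x. h + (\<Sum>j\<in>Basis. (1 * (x \<bullet> j)) *\<^sub>R j)) = (+) h" by (simp add: euclidean_representation)
  show "(+) h \<in> lebesgue \<rightarrow>\<^sub>M lebesgue"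
    using lebesgue_affine_measurable[of "\<lambda>_. 1" h] unfolding T by simp
  show "distr lebesgue lebesgue ((+) h) = lebesgue"
    using lebesgue_affine_euclidean[of "\<lambda>_. 1" h] unfolding T by (simp add: density_1)
qed

lemma integral_translation:
  fixes f :: "'a::euclidean_space \<Rightarrow> 'b::euclidean_space"
  assumes "f \<in> borel_measurable lebesgue"
  shows "(\<integral>x. f (h + x) \<partial>lebesgue) = (\<integral>x. f x \<partial>lebesgue)"
  using integral_distr[OF measurable_translation_lebesgue assms, of h] by (simp add: distr_translation_lebesgue)

lemma AE_translation:
  assumes "AE x in lebesgue. P x"
  shows "AE x in lebesgue. P (h + x)"
  by (rule AE_distrD[OF measurable_translation_lebesgue]) (unfold distr_translation_lebesgue, rule assms)

lemma sqint_translation: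
  assumes "sqint f" shows "sqint (\<lambda>x. f (h + x))"
  unfolding sqint_def
proof
  show m: "(\<lambda>x. f (h + x)) \<in> borel_measurable lebesgue"
    using measurable_comp[OF measurable_translation_lebesgue sqint_measurable[OF assms], of h] by (simp add: o_def)
  have "(\<lambda>x. (norm (f x))\<^sup>2) \<in> borel_measurable lebesgue" using sqint_integrable[OF assms] by simp
  from integrable_distr_eq[OF measurable_translation_lebesgue this, of h]
  show "integrable lebesgue (\<lambda>x. (norm (f (h + x)))\<^sup>2)"
    using sqint_integrable[OF assms] by (simp add: distr_translation_lebesgue)
qed

section \<open>Translation operators and difference quotients\<close>

definition shift :: "'a \<Rightarrow> ('a::euclidean_space, 'b::euclidean_space) L2 \<Rightarrow> ('a, 'b) L2" where
  "shift h y = abs_L2 (\<lambda>x. rep_L2 y (h + x))"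

lemma shift_abs_L2:
  assumes "sqint f" shows "shift h (abs_L2 f) = abs_L2 (\<lambda>x. f (h + x))"
  unfolding shift_def
  by (subst abs_L2_eq_iff)
    (intro sqint_translation sqint_rep assms AE_translation rep_abs_L2)+

lemma shift_diff: "shift h (y - z) = shift h y - shift h z"
proof -
  have "y - z = abs_L2 (\<lambda>x. rep_L2 y x - rep_L2 z x)"
    by (simp add: abs_L2_diff sqint_rep abs_rep_L2)
  then have "shift h (y - z) = abs_L2 (\<lambda>x. rep_L2 y (h + x) - rep_L2 z (h + x))"
    by (simp add: shift_abs_L2 sqint_diff sqint_rep)
  then show ?thesis by (simp add: shift_def abs_L2_diff sqint_translation sqint_rep)
qed

lemma norm_shift: "norm (shift h y) = norm y"
proof -
  have "(\<lambda>x. (norm (rep_L2 y x))\<^sup>2) \<in> borel_measurable lebesgue" using sqint_integrable[OF sqint_rep] by auto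
  then have "(norm (shift h y))\<^sup>2 = (norm y)\<^sup>2"
    unfolding shift_def norm_rep_L2[of y]
    by (subst norm_abs_L2[OF sqint_translation[OF sqint_rep]]) (rule integral_translation)
  then show ?thesis by simp
qed

lemma shift_0: "shift 0 y = y"
  by (simp add: shift_def abs_rep_L2)

lemma shift_shift: "shift h (shift k y) = shift (k + h) y"
  unfolding shift_def[of k] by (subst shift_abs_L2) (simp_all add: sqint_translation sqint_rep shift_def add.assoc)

text \<open>Telescoping over \<open>k\<close> equal steps, each an isometric copy of the first; this
  turns infinitesimal estimates into finite ones.\<close>

lemma norm_shift_multiple: "norm (shift (real k *\<^sub>R v) y - y) \<le> real k * norm (shift v y - y)"
proof (induction k)
  case 0
  then show ?case by (simp add: shift_0)
next
  case (Suc k)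
  have "shift (real (Suc k) *\<^sub>R v) y - y = shift v (shift (real k *\<^sub>R v) y - y) + (shift v y - y)"
    by (simp add: shift_diff shift_shift algebra_simps)
  then have "norm (shift (real (Suc k) *\<^sub>R v) y - y)
      \<le> norm (shift v (shift (real k *\<^sub>R v) y - y)) + norm (shift v y - y)"
    by (metis norm_triangle_ineq)
  also have "\<dots> \<le> real (Suc k) * norm (shift v y - y)"
    using Suc.IH by (simp add: norm_shift algebra_simps)
  finally show ?case .
qed

lemma difference_quotient_tendsto:
  assumes "smooth \<phi>" "\<And>n. s n \<noteq> 0" "s \<longlonglongrightarrow> 0"
  shows "(\<lambda>n. (\<phi> (s n *\<^sub>R h + x) - \<phi> x) / s n) \<longlonglongrightarrow> grad \<phi> x \<bullet> h"
proof -
  have "((\<lambda>t. \<phi> (t *\<^sub>R h + x)) has_derivative (\<lambda>t. grad \<phi> (0 *\<^sub>R h + x) \<bullet> (t *\<^sub>R h))) (at 0)"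
    by (rule has_derivative_compose[OF _ has_derivative_grad[OF assms(1)]]) (auto intro!: derivative_eq_intros)
  then have "((\<lambda>t. \<phi> (t *\<^sub>R h + x)) has_real_derivative grad \<phi> x \<bullet> h) (at 0)"
    by (rule has_derivative_imp_has_field_derivative) simp
  then have "((\<lambda>t. (\<phi> (t *\<^sub>R h + x) - \<phi> x) / t) \<longlongrightarrow> grad \<phi> x \<bullet> h) (at 0)"
    by (simp add: has_field_derivative_iff)
  moreover have "filterlim s (at 0) sequentially" using assms(2,3) by (simp add: filterlim_at)
  ultimately show ?thesis by (rule filterlim_compose)
qed

lemma integrable_indicator_cball:
  fixes a :: "'a::euclidean_space"
  shows "integrable lebesgue (\<lambda>x. k * indicat_real (cball a r) x)"
  using lmeasurable_cball[of a r]
  by (intro integrable_mult_right integrable_real_indicator) (auto simp: fmeasurable_def)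

text \<open>A majorant independent of the step: the mean value theorem bounds the quotient, and for
  steps up to 1 its support stays in an enlarged ball.\<close>

lemma difference_quotient_bound:
  fixes \<phi> :: "'a::euclidean_space \<Rightarrow> real"
  assumes "test_fun \<Omega> \<phi>"
  shows "\<exists>B r. B \<ge> 0 \<and> (\<forall>s x. \<bar>s\<bar> \<le> 1 \<longrightarrow> \<bar>(\<phi> (s *\<^sub>R h + x) - \<phi> x) / s\<bar> \<le> B * indicator (cball 0 r) x)"
proof -
  obtain C where C: "smooth \<phi>" "compact C" "\<And>x. x \<notin> C \<Longrightarrow> \<phi> x = 0" using assms by (rule test_funE) blast
  obtain R where "\<forall>x\<in>C. norm x \<le> R" using compact_imp_bounded[OF C(2)] unfolding bounded_iff by blast
  then have R: "C \<subseteq> cball 0 R" by auto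
  obtain B where B: "B \<ge> 0" "\<And>x. norm (grad \<phi> x) \<le> B" using test_fun_integrable(4)[OF assms] by blast
  have lip: "\<bar>\<phi> (s *\<^sub>R h + x) - \<phi> x\<bar> \<le> B * \<bar>s\<bar> * norm h" for s x
  proof -
    have "norm (\<phi> (s *\<^sub>R h + x) - \<phi> x) \<le> B * norm (s *\<^sub>R h + x - x)"
    proof (rule differentiable_bound[OF convex_UNIV has_derivative_grad[OF C(1)]])
      show "onorm (\<lambda>k. grad \<phi> y \<bullet> k) \<le> B" for y
      proof (rule onorm_le)
        show "norm (grad \<phi> y \<bullet> k) \<le> B * norm k" for k
          using Cauchy_Schwarz_ineq2[of "grad \<phi> y" k] mult_right_mono[OF B(2)[of y] norm_ge_zero[of k]] by simp
      qed
    qed auto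
    then show ?thesis by simp
  qed
  have "\<bar>(\<phi> (s *\<^sub>R h + x) - \<phi> x) / s\<bar> \<le> B * norm h * indicator (cball 0 (R + norm h)) x" if s: "\<bar>s\<bar> \<le> 1" for s x
  proof (cases "x \<in> cball 0 (R + norm h)")
    case True
    then show ?thesis using lip[of s x] B by (cases "s = 0") (auto simp: abs_divide field_simps)
  next
    case False
    have "norm x \<le> norm (s *\<^sub>R h + x) + norm (s *\<^sub>R h)" using norm_triangle_ineq4[of "s *\<^sub>R h + x" "s *\<^sub>R h"] by simp
    moreover have "norm (s *\<^sub>R h) \<le> norm h" using s by (simp add: mult_left_le_one_le)
    ultimately have "s *\<^sub>R h + x \<notin> cball 0 R" "x \<notin> cball 0 R" using False norm_ge_zero[of h] unfolding mem_cball_0 by linarith+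
    then have "\<phi> (s *\<^sub>R h + x) = 0" "\<phi> x = 0" using C(3) R by blast+
    then show ?thesis using False by simp
  qed
  then show ?thesis using B(1) by (intro exI[of _ "B * norm h"] exI[of _ "R + norm h"]) auto
qed

text \<open>Difference quotients have integral zero by translation invariance, and they converge
  dominatedly to the directional derivative.\<close>

lemma integral_grad_eq_0:
  assumes \<phi>: "test_fun \<Omega> \<phi>"
  shows "(\<integral>x. grad \<phi> x \<partial>lebesgue) = 0"
proof (rule euclidean_eqI)
  fix b :: 'a assume "b \<in> Basis"
  define s where "s n = inverse (real (Suc n))" for n
  have s: "s n \<noteq> 0" "\<bar>s n\<bar> \<le> 1" "s \<longlonglongrightarrow> 0" for n
    unfolding s_def using LIMSEQ_inverse_real_of_nat by (auto simp: field_simps)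
  obtain B r where Br: "\<And>s x. \<bar>s\<bar> \<le> 1 \<Longrightarrow> \<bar>(\<phi> (s *\<^sub>R b + x) - \<phi> x) / s\<bar> \<le> B * indicator (cball 0 r) x"
    using difference_quotient_bound[OF \<phi>, of b] by blast
  have m: "\<phi> \<in> borel_measurable lebesgue" using test_fun_integrable(3)[OF \<phi>] by simp
  have sq: "sqint (\<lambda>x. \<phi> (h + x))" for h by (intro sqint_translation test_fun_integrable(2)[OF \<phi>])
  have int: "integrable lebesgue (\<lambda>x. \<phi> (h + x))" for h
    using integrable_distr_eq[OF measurable_translation_lebesgue m, of h] test_fun_integrable(3)[OF \<phi>]
    by (simp add: distr_translation_lebesgue)
  have lim: "(\<lambda>n. \<integral>x. (\<phi> (s n *\<^sub>R b + x) - \<phi> x) / s n \<partial>lebesgue) \<longlonglongrightarrow> (\<integral>x. grad \<phi> x \<bullet> b \<partial>lebesgue)"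
  proof (rule integral_dominated_convergence)
    show "integrable lebesgue (\<lambda>x. B * indicat_real (cball 0 r) x)" by (rule integrable_indicator_cball)
    show "AE x in lebesgue. (\<lambda>n. (\<phi> (s n *\<^sub>R b + x) - \<phi> x) / s n) \<longlonglongrightarrow> grad \<phi> x \<bullet> b"
      using difference_quotient_tendsto[OF test_fun_smooth[OF \<phi>] s(1,3)] by simp
    show "AE x in lebesgue. norm ((\<phi> (s n *\<^sub>R b + x) - \<phi> x) / s n) \<le> B * indicat_real (cball 0 r) x" for n
      using Br[OF s(2)[of n]] by simp
    show "(\<lambda>x. (\<phi> (s n *\<^sub>R b + x) - \<phi> x) / s n) \<in> borel_measurable lebesgue" for n
      using int[of "s n *\<^sub>R b"] m by (intro borel_measurable_divide borel_measurable_diff) auto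
    show "(\<lambda>x. grad \<phi> x \<bullet> b) \<in> borel_measurable lebesgue"
      using test_fun_integrable(6)[OF \<phi>] by auto
  qed
  have z: "(\<integral>x. (\<phi> (s n *\<^sub>R b + x) - \<phi> x) / s n \<partial>lebesgue) = 0" for n
    using int[of "s n *\<^sub>R b"] test_fun_integrable(3)[OF \<phi>] integral_translation[OF m, of "s n *\<^sub>R b"]
    by simp
  have "(\<integral>x. grad \<phi> x \<bullet> b \<partial>lebesgue) = 0" using LIMSEQ_unique[OF lim[unfolded z] tendsto_const] .
  then show "(\<integral>x. grad \<phi> x \<partial>lebesgue) \<bullet> b = 0 \<bullet> b"
    using test_fun_integrable(6)[OF \<phi>] by simp
qed

lemma integration_by_parts:
  assumes \<phi>: "test_fun \<Omega> \<phi>" and \<psi>: "test_fun \<Omega> \<psi>"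
  shows "(\<integral>x. \<phi> x *\<^sub>R grad \<psi> x \<partial>lebesgue) = - (\<integral>x. \<psi> x *\<^sub>R grad \<phi> x \<partial>lebesgue)"
proof -
  have "(\<integral>x. \<phi> x *\<^sub>R grad \<psi> x + \<psi> x *\<^sub>R grad \<phi> x \<partial>lebesgue) = 0"
    using integral_grad_eq_0[OF test_fun_mult[OF \<psi> test_fun_smooth[OF \<phi>]]]
      grad_mult[OF test_fun_smooth[OF \<phi>] test_fun_smooth[OF \<psi>]] by simp
  moreover have "integrable lebesgue (\<lambda>x. \<phi> x *\<^sub>R grad \<psi> x)" "integrable lebesgue (\<lambda>x. \<psi> x *\<^sub>R grad \<phi> x)"
    using \<phi> \<psi> by (auto intro!: sqint_mult_integrable test_fun_integrable)
  ultimately show ?thesis by (simp add: eq_neg_iff_add_eq_0)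
qed

text \<open>Fix one coordinate direction \<open>b\<close>. The derivative of
  \<open>(x \<bullet> b) * \<phi> x * \<phi> x\<close> along \<open>b\<close> has zero integral,
  which expresses the integral of the squared function through
  \<open>2 * (x \<bullet> b) * \<phi> * (grad \<phi> \<bullet> b)\<close>; the coordinate is at most
  \<open>R\<close> on the domain.\<close>

lemma poincare_test_fun:
  fixes \<phi> :: "'a::euclidean_space \<Rightarrow> real"
  assumes \<phi>: "test_fun \<Omega> \<phi>" and R: "\<Omega> \<subseteq> cball 0 R" "R \<ge> 0"
  shows "norm (abs_L2 \<phi>) \<le> 2 * R * norm (abs_L2 (grad \<phi>))"
proof -
  obtain b :: 'a where b: "b \<in> Basis" using nonempty_Basis by blast
  note sm = test_fun_smooth[OF \<phi>]
  note sq = test_fun_integrable(2,5)[OF \<phi>]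
  \<comment> \<open>Passing to pointwise norms makes both factors scalar, so that Cauchy-Schwarz is
    available as the inner product of two elements of \<open>L2\<close>.\<close>
  define N D where "N = abs_L2 (\<lambda>x. norm (\<phi> x))" and "D = abs_L2 (\<lambda>x. norm (grad \<phi> x))"
  have N: "norm N = norm (abs_L2 \<phi>)" and D: "norm D = norm (abs_L2 (grad \<phi>))"
    unfolding N_def D_def
    by (rule power2_eq_imp_eq[OF _ norm_ge_zero norm_ge_zero],
        unfold norm_abs_L2[OF sqint_norm[OF sq(1)]] norm_abs_L2[OF sqint_norm[OF sq(2)]] norm_abs_L2[OF sq(1)] norm_abs_L2[OF sq(2)],
        simp)+
  have \<psi>: "test_fun \<Omega> (\<lambda>x. (x \<bullet> b) * \<phi> x)" by (rule test_fun_mult[OF \<phi> smooth_inner])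
  have gr: "grad (\<lambda>x. \<phi> x * ((x \<bullet> b) * \<phi> x)) x \<bullet> b = \<phi> x * \<phi> x + 2 * ((x \<bullet> b) * (\<phi> x * (grad \<phi> x \<bullet> b)))" for x
    unfolding grad_mult[OF sm test_fun_smooth[OF \<psi>]] grad_mult[OF smooth_inner sm] grad_inner
    using b by (simp add: inner_simps algebra_simps)
  have gi: "integrable lebesgue (\<lambda>x. grad (\<lambda>x. \<phi> x * ((x \<bullet> b) * \<phi> x)) x)"
    and g0: "(\<integral>x. grad (\<lambda>x. \<phi> x * ((x \<bullet> b) * \<phi> x)) x \<partial>lebesgue) = 0"
    using test_fun_integrable(6) integral_grad_eq_0 test_fun_mult[OF \<psi> sm] by blast+
  have \<phi>2: "integrable lebesgue (\<lambda>x. \<phi> x * \<phi> x)"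
    using sqint_mult_integrable[OF sq(1) sq(1)] by simp
  have i1: "integrable lebesgue (\<lambda>x. grad (\<lambda>x. \<phi> x * ((x \<bullet> b) * \<phi> x)) x \<bullet> b)" using gi by simp
  have "(\<integral>x. grad (\<lambda>x. \<phi> x * ((x \<bullet> b) * \<phi> x)) x \<bullet> b \<partial>lebesgue) = 0" using gi g0 by simp
  then have "(\<integral>x. \<phi> x * \<phi> x \<partial>lebesgue) = (\<integral>x. \<phi> x * \<phi> x - grad (\<lambda>x. \<phi> x * ((x \<bullet> b) * \<phi> x)) x \<bullet> b \<partial>lebesgue)"
    by (subst Bochner_Integration.integral_diff[OF \<phi>2 i1]) simp
  also have "\<dots> \<le> (\<integral>x. 2 * R * (norm (\<phi> x) \<bullet> norm (grad \<phi> x)) \<partial>lebesgue)"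
  proof (rule integral_mono)
    show "integrable lebesgue (\<lambda>x. \<phi> x * \<phi> x - grad (\<lambda>x. \<phi> x * ((x \<bullet> b) * \<phi> x)) x \<bullet> b)"
      by (rule Bochner_Integration.integrable_diff[OF \<phi>2 i1])
    show "integrable lebesgue (\<lambda>x. 2 * R * (norm (\<phi> x) \<bullet> norm (grad \<phi> x)))"
      by (intro integrable_mult_right sqint_inner_integrable sqint_norm sq)
    fix x
    show "\<phi> x * \<phi> x - grad (\<lambda>x. \<phi> x * ((x \<bullet> b) * \<phi> x)) x \<bullet> b \<le> 2 * R * (norm (\<phi> x) \<bullet> norm (grad \<phi> x))"
    proof (cases "x \<in> \<Omega>")
      case True
      have "\<bar>x \<bullet> b\<bar> \<le> R" using R True Basis_le_norm[OF b, of x] by (force simp: subset_iff)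
      moreover have "\<bar>grad \<phi> x \<bullet> b\<bar> \<le> norm (grad \<phi> x)" by (rule Basis_le_norm[OF b])
      ultimately have "\<bar>(x \<bullet> b) * (\<phi> x * (grad \<phi> x \<bullet> b))\<bar> \<le> R * (\<bar>\<phi> x\<bar> * norm (grad \<phi> x))"
        unfolding abs_mult using R(2) by (intro mult_mono) auto
      from abs_le_D2[OF this] show ?thesis unfolding gr real_norm_def inner_real_def by linarith
    qed (simp add: gr test_fun_outside[OF \<phi>])
  qed
  also have "\<dots> = 2 * R * (N \<bullet> D)"
    unfolding N_def D_def inner_abs_L2[OF sqint_norm[OF sq(1)] sqint_norm[OF sq(2)]]
    by (rule integral_mult_right_zero)
  also have "\<dots> \<le> 2 * R * (norm N * norm D)"
    using R(2) Cauchy_Schwarz_ineq2[of N D] by (intro mult_left_mono) auto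
  finally have "norm (abs_L2 \<phi>) * norm (abs_L2 \<phi>) \<le> (2 * R * norm (abs_L2 (grad \<phi>))) * norm (abs_L2 \<phi>)"
    using norm_abs_L2[OF sq(1)] by (simp add: N D power2_eq_square ac_simps)
  then show ?thesis using R(2)
    by (cases "norm (abs_L2 \<phi>) = 0") (auto simp: mult_le_cancel_right)
qed

text \<open>Splitting \<open>h\<close> into \<open>Suc n\<close> equal steps bounds the left side by
  the norm of a difference quotient along \<open>h\<close>, which converges in norm to the
  directional derivative.\<close>

lemma translation_estimate_test_fun:
  assumes \<phi>: "test_fun \<Omega> \<phi>"
  shows "norm (shift h (abs_L2 \<phi>) - abs_L2 \<phi>) \<le> norm h * norm (abs_L2 (grad \<phi>))"
proof -
  define s where "s n = inverse (real (Suc n))" for n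
  have s: "s n \<noteq> 0" "\<bar>s n\<bar> \<le> 1" "s \<longlonglongrightarrow> 0" "real (Suc n) * s n = 1" for n
    unfolding s_def using LIMSEQ_inverse_real_of_nat by (auto simp: field_simps)
  note sq = test_fun_integrable(2,5)[OF \<phi>]
  obtain B r where Br: "B \<ge> 0" "\<And>s x. \<bar>s\<bar> \<le> 1 \<Longrightarrow> \<bar>(\<phi> (s *\<^sub>R h + x) - \<phi> x) / s\<bar> \<le> B * indicator (cball 0 r) x"
    using difference_quotient_bound[OF \<phi>, of h] by blast
  define q where "q n = (\<lambda>x. (1 / s n) *\<^sub>R (\<phi> (s n *\<^sub>R h + x) - \<phi> x))" for n
  have sqq: "sqint (\<lambda>x. \<phi> (s n *\<^sub>R h + x) - \<phi> x)" for n
    by (intro sqint_diff sqint_translation sq)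
  have m: "q n \<in> borel_measurable lebesgue" for n
    unfolding q_def by (rule sqint_measurable[OF sqint_scaleR[OF sqq]])
  have q2: "AE x in lebesgue. (norm (q n x))\<^sup>2 \<le> B\<^sup>2 * indicat_real (cball 0 r) x" for n
  proof (rule AE_I2)
    fix x
    have "norm (q n x) \<le> B * indicator (cball 0 r) x" using Br(2)[OF s(2)[of n], of x] by (simp add: q_def)
    from power_mono[OF this norm_ge_zero, of 2] show "(norm (q n x))\<^sup>2 \<le> B\<^sup>2 * indicat_real (cball 0 r) x"
      by (cases "x \<in> cball 0 r") auto
  qed
  have lim: "AE x in lebesgue. (\<lambda>n. q n x) \<longlonglongrightarrow> grad \<phi> x \<bullet> h"
    using difference_quotient_tendsto[OF test_fun_smooth[OF \<phi>] s(1,3)] by (simp add: q_def)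
  have mg: "(\<lambda>x. grad \<phi> x \<bullet> h) \<in> borel_measurable lebesgue" using test_fun_integrable(6)[OF \<phi>] by auto
  note L = L2_dominated_convergence[OF m mg integrable_indicator_cball q2 lim]
  have "(\<lambda>n. norm (abs_L2 (q n))) \<longlonglongrightarrow> norm (abs_L2 (\<lambda>x. grad \<phi> x \<bullet> h))"
    using L(3) by (rule tendsto_norm)
  moreover have "norm (shift h (abs_L2 \<phi>) - abs_L2 \<phi>) \<le> norm (abs_L2 (q n))" for n
  proof -
    have "norm (shift h (abs_L2 \<phi>) - abs_L2 \<phi>)
        = norm (shift (real (Suc n) *\<^sub>R (s n *\<^sub>R h)) (abs_L2 \<phi>) - abs_L2 \<phi>)" unfolding scaleR_scaleR s(4) by simp
    also have "\<dots> \<le> real (Suc n) * norm (shift (s n *\<^sub>R h) (abs_L2 \<phi>) - abs_L2 \<phi>)"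
      by (rule norm_shift_multiple)
    also have "\<dots> = norm ((1 / s n) *\<^sub>R (shift (s n *\<^sub>R h) (abs_L2 \<phi>) - abs_L2 \<phi>))"
    proof -
      have "1 / s n = real (Suc n)" by (simp add: s_def divide_inverse del: of_nat_Suc)
      then show ?thesis by (simp del: of_nat_Suc)
    qed
    also have "(1 / s n) *\<^sub>R (shift (s n *\<^sub>R h) (abs_L2 \<phi>) - abs_L2 \<phi>) = abs_L2 (q n)"
      unfolding q_def shift_abs_L2[OF sq(1)] abs_L2_scaleR[OF sqq]
        abs_L2_diff[OF sqint_translation[OF sq(1)] sq(1)] ..
    finally show ?thesis .
  qed
  ultimately have "norm (shift h (abs_L2 \<phi>) - abs_L2 \<phi>) \<le> norm (abs_L2 (\<lambda>x. grad \<phi> x \<bullet> h))"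
    by (intro LIMSEQ_le_const) auto
  also have "\<dots> \<le> norm h * norm (abs_L2 (grad \<phi>))"
  proof (rule power2_le_imp_le)
    have "(norm (abs_L2 (\<lambda>x. grad \<phi> x \<bullet> h)))\<^sup>2 = (\<integral>x. (norm (grad \<phi> x \<bullet> h))\<^sup>2 \<partial>lebesgue)" by (rule norm_abs_L2[OF L(2)])
    also have "\<dots> \<le> (\<integral>x. (norm h)\<^sup>2 * (norm (grad \<phi> x))\<^sup>2 \<partial>lebesgue)"
    proof (rule integral_mono)
      fix x
      have "(norm (grad \<phi> x \<bullet> h))\<^sup>2 \<le> (norm (grad \<phi> x) * norm h)\<^sup>2"
        using Cauchy_Schwarz_ineq2[of "grad \<phi> x" h] by (intro power_mono) auto
      then show "(norm (grad \<phi> x \<bullet> h))\<^sup>2 \<le> (norm h)\<^sup>2 * (norm (grad \<phi> x))\<^sup>2"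
        by (simp add: power_mult_distrib mult.commute)
    qed (use sqint_integrable[OF L(2)] sqint_integrable[OF sq(2)] in auto)
    also have "\<dots> = (norm h * norm (abs_L2 (grad \<phi>)))\<^sup>2" by (simp add: power_mult_distrib norm_abs_L2[OF sq(2)])
    finally show "(norm (abs_L2 (\<lambda>x. grad \<phi> x \<bullet> h)))\<^sup>2 \<le> (norm h * norm (abs_L2 (grad \<phi>)))\<^sup>2" .
  qed simp
  finally show ?thesis .
qed

subsection \<open>The fundamental lemma of the calculus of variations\<close>

text \<open>Open boxes are stable under intersection and generate the Borel sets, so vanishing
  integrals over boxes propagate to all Borel subsets of the big box. Applied to the sets where
  \<open>g\<close> is positive and where it is negative, this gives the claim.\<close>

lemma integral_box_eq_0_imp_AE:
  fixes g :: "'a::euclidean_space \<Rightarrow> real"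
  assumes g: "integrable lebesgue g" "g \<in> borel_measurable borel"
    and box0: "\<And>a b. box a b \<noteq> {} \<Longrightarrow> cbox a b \<subseteq> cbox c d \<Longrightarrow> (\<integral>x. indicator (box a b) x * g x \<partial>lebesgue) = 0"
  shows "AE x in lebesgue. x \<in> box c d \<longrightarrow> g x = 0"
proof -
  have set: "A \<in> sets lebesgue" if "A \<in> sets borel" for A :: "'a set"
    by (rule sets_completionI_sets) (use that in simp)
  have int: "integrable lebesgue (\<lambda>x. indicator A x * g x)" if "A \<in> sets borel" for A
    using integrable_mult_indicator[OF set[OF that] g(1)] by simp
  have zero: "(\<integral>x. indicator (A \<inter> box c d) x * g x \<partial>lebesgue) = 0" if A: "A \<in> sets borel" for A
  proof -
    define G where "G = range (\<lambda>(a, b). box a b :: 'a set)"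
    have "Int_stable G"
      unfolding G_def Int_stable_def by (force simp: box_Int_box)
    moreover have "G \<subseteq> Pow UNIV" by simp
    moreover have sG: "sigma_sets UNIV G = sets borel" unfolding G_def borel_eq_box by simp
    then have "A \<in> sigma_sets UNIV G" using A by simp
    ultimately show ?thesis
    proof (induction rule: sigma_sets_induct_disjoint)
      case (basic A)
      then obtain a b where A: "A = box a b" by (auto simp: G_def)
      obtain a' b' where I: "A \<inter> box c d = box a' b'" unfolding A box_Int_box by blast
      show ?case
      proof (cases "box a' b' = {}")
        case False
        \<comment> \<open>A nonempty open box has the corresponding closed box as its closure; this
          is why \<open>box0\<close> is demanded for nonempty boxes only.\<close>
        have "cbox a' b' \<subseteq> cbox c d"
        proof -
          have "box a' b' \<subseteq> cbox c d" using I box_subset_cbox by blast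
          from closure_mono[OF this] show ?thesis using closure_box[OF False] by simp
        qed
        then show ?thesis unfolding I by (rule box0[OF False])
      qed (simp add: I)
    next
      case (compl A)
      have eq: "indicator ((UNIV - A) \<inter> box c d) x * g x = indicator (box c d) x * g x - indicator (A \<inter> box c d) x * g x" for x
        by (auto simp: indicator_def)
      have "(\<integral>x. indicator (box c d) x * g x \<partial>lebesgue) = 0"
        by (cases "box c d = {}") (auto intro: box0)
      then show ?case
        unfolding eq using compl int[of "box c d"] int[of "A \<inter> box c d"] sG
        by (subst Bochner_Integration.integral_diff) auto
    next
      case (union A)
      have A[measurable]: "A i \<in> sets borel" for i using union(2) sG by auto
      have fin: "(\<integral>x. indicator (\<Union>i<k. A i \<inter> box c d) x * g x \<partial>lebesgue) = 0" for k :: nat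
      proof (induction k)
        case (Suc k)
        have "indicator (\<Union>i<Suc k. A i \<inter> box c d) x * g x
            = indicator (\<Union>i<k. A i \<inter> box c d) x * g x + indicator (A k \<inter> box c d) x * g x" for x
        proof -
          have "x \<notin> (\<Union>i<k. A i)" if "x \<in> A k" 
          proof
            assume "x \<in> (\<Union>i<k. A i)"
            then obtain i where "i < k" "x \<in> A i" by blast
            then show False using disjoint_family_onD[OF union(1), of i k] that by auto
          qed
          then show ?thesis by (auto simp: indicator_def lessThan_Suc)
        qed
        moreover have "(\<Union>i<k. A i \<inter> box c d) \<in> sets borel" "A k \<inter> box c d \<in> sets borel" by measurable
        ultimately show ?case
          using Suc union(3)[of k] int[of "\<Union>i<k. A i \<inter> box c d"] int[of "A k \<inter> box c d"]
          by (simp only: Bochner_Integration.integral_add add_0_left)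
      qed simp
      have "(\<lambda>k. \<integral>x. indicator (\<Union>i<k. A i \<inter> box c d) x * g x \<partial>lebesgue) \<longlonglongrightarrow>
          (\<integral>x. indicator (\<Union>i. A i \<inter> box c d) x * g x \<partial>lebesgue)"
      proof (rule integral_dominated_convergence[where w = "\<lambda>x. \<bar>g x\<bar>"])
        show "AE x in lebesgue. (\<lambda>k. indicator (\<Union>i<k. A i \<inter> box c d) x * g x) \<longlonglongrightarrow> indicator (\<Union>i. A i \<inter> box c d) x * g x"
          by (intro AE_I2 tendsto_intros LIMSEQ_indicator_UN)
        show "AE x in lebesgue. norm (indicator (\<Union>i<k. A i \<inter> box c d) x * g x) \<le> \<bar>g x\<bar>" for k
          by (auto simp: indicator_def)
        show "(\<lambda>x. indicator (\<Union>i<k. A i \<inter> box c d) x * g x) \<in> borel_measurable lebesgue" for k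
        proof -
          have "(\<Union>i<k. A i \<inter> box c d) \<in> sets borel" by measurable
          then show ?thesis using int by blast
        qed
        have "(\<Union>i. A i \<inter> box c d) \<in> sets borel" by measurable
        then show "(\<lambda>x. indicator (\<Union>i. A i \<inter> box c d) x * g x) \<in> borel_measurable lebesgue" using int by blast
      qed (use g in auto)
      then have "(\<integral>x. indicator (\<Union>i. A i \<inter> box c d) x * g x \<partial>lebesgue) = 0"
        unfolding fin by (simp add: LIMSEQ_const_iff)
      then show ?case by simp
    qed simp
  qed
  have pos: "AE x in lebesgue. indicator (A \<inter> box c d) x * g x = 0"
    if "A = {x. g x > 0} \<or> A = {x. g x < 0}" for A
  proof -
    have Ab: "A \<in> sets borel" using that g(2) by auto
    then have "integrable lebesgue (\<lambda>x. indicator (A \<inter> box c d) x * g x)" by (intro int) auto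
    then have i: "integrable lebesgue (\<lambda>x. \<bar>indicator (A \<inter> box c d) x * g x\<bar>)" by (rule integrable_abs)
    have "(\<integral>x. \<bar>indicator (A \<inter> box c d) x * g x\<bar> \<partial>lebesgue) = \<bar>\<integral>x. indicator (A \<inter> box c d) x * g x \<partial>lebesgue\<bar>"
    proof (cases "A = {x. g x > 0}")
      case True
      then have eq: "\<bar>indicator (A \<inter> box c d) x * g x\<bar> = indicator (A \<inter> box c d) x * g x" for x
        by (auto simp: indicator_def)
      show ?thesis unfolding eq zero[OF Ab] by simp
    next
      case False
      then have eq: "\<bar>indicator (A \<inter> box c d) x * g x\<bar> = - (indicator (A \<inter> box c d) x * g x)" for x
        using that by (auto simp: indicator_def)
      show ?thesis unfolding eq integral_minus zero[OF Ab] by simp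
    qed
    then have "(\<integral>x. \<bar>indicator (A \<inter> box c d) x * g x\<bar> \<partial>lebesgue) = 0" unfolding zero[OF Ab] by simp
    then have "AE x in lebesgue. \<bar>indicator (A \<inter> box c d) x * g x\<bar> = 0"
      by (subst (asm) integral_nonneg_eq_0_iff_AE[OF i]) auto
    then show ?thesis by simp
  qed
  have "AE x in lebesgue. indicator ({x. g x > 0} \<inter> box c d) x * g x = 0"
    "AE x in lebesgue. indicator ({x. g x < 0} \<inter> box c d) x * g x = 0" by (rule pos; simp)+
  then show ?thesis by eventually_elim (auto simp: indicator_def split: if_splits)
qed

text \<open>Box bumps transfer the hypothesis to indicators of boxes. Countably many closed boxes
  inside the set cover it, and their faces are null sets.\<close>

lemma fundamental_lemma:
  fixes g :: "'a::euclidean_space \<Rightarrow> real"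
  assumes \<Omega>: "open \<Omega>" and g: "integrable lebesgue g"
    and test: "\<And>\<phi>. test_fun \<Omega> \<phi> \<Longrightarrow> (\<integral>x. \<phi> x * g x \<partial>lebesgue) = 0"
  shows "AE x in lebesgue. x \<in> \<Omega> \<longrightarrow> g x = 0"
proof -
  \<comment> \<open>A Borel representative: the argument with generators of the Borel sets does not
    see sets that are merely Lebesgue measurable.\<close>
  obtain g' where g'm: "g' \<in> borel_measurable lborel" and "AE x in lborel. g x = g' x"
    using completion_ex_borel_measurable_real[of g lborel] g by auto
  then have gg': "AE x in lebesgue. g x = g' x" by (intro AE_completion)
  have g'm': "g' \<in> borel_measurable borel" using g'm by simp
  have g'l: "g' \<in> borel_measurable lebesgue" using measurable_completion[OF g'm] .
  have g'i: "integrable lebesgue g'"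
    using integrable_cong_AE[OF _ g'l gg'] g by auto
  have box0: "(\<integral>x. indicator (box a b) x * g' x \<partial>lebesgue) = 0" if "cbox a b \<subseteq> \<Omega>" for a b
  proof -
    have "(\<lambda>n. \<integral>x. box_bump a b n x * g x \<partial>lebesgue) \<longlonglongrightarrow> (\<integral>x. indicator (box a b) x * g' x \<partial>lebesgue)"
    proof (rule integral_dominated_convergence[where w = "\<lambda>x. \<bar>g x\<bar>"])
      show "AE x in lebesgue. (\<lambda>n. box_bump a b n x * g x) \<longlonglongrightarrow> indicator (box a b) x * g' x"
        using gg' by eventually_elim (auto intro!: tendsto_intros box_bump_tendsto)
      show "AE x in lebesgue. norm (box_bump a b n x * g x) \<le> \<bar>g x\<bar>" for n
        using box_bump_range[of a b n] by (auto simp: abs_mult intro!: mult_left_le_one_le)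
      show "(\<lambda>x. box_bump a b n x * g x) \<in> borel_measurable lebesgue" for n
        using test_fun_integrable(3)[OF test_fun_box_bump[OF that]] g by (intro borel_measurable_times) auto
      show "(\<lambda>x. indicator (box a b) x * g' x) \<in> borel_measurable lebesgue"
        using g'l by (intro borel_measurable_times borel_measurable_indicator) auto
    qed (use g in auto)
    then show ?thesis using test[OF test_fun_box_bump[OF that]] by (simp add: LIMSEQ_const_iff)
  qed
  obtain D where D: "countable D" "D \<subseteq> Pow \<Omega>" "\<And>X. X \<in> D \<Longrightarrow> \<exists>a b. X = cbox a b" "\<Union>D = \<Omega>"
    by (rule open_countable_Union_open_cbox[OF \<Omega>]) (rule that, auto)
  have "AE x in lebesgue. x \<in> X \<longrightarrow> g x = 0" if "X \<in> D" for X
  proof -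
    obtain a b where X: "X = cbox a b" using D(3)[OF \<open>X \<in> D\<close>] by blast
    then have "cbox a b \<subseteq> \<Omega>" using D(2) \<open>X \<in> D\<close> by blast
    then have "AE x in lebesgue. x \<in> box a b \<longrightarrow> g' x = 0"
      by (intro integral_box_eq_0_imp_AE[OF g'i g'm'] box0) auto
    moreover have "AE x in lebesgue. x \<notin> cbox a b - box a b"
      by (intro AE_completion AE_not_in null_sets_cbox_Diff_box)
    ultimately show ?thesis using gg' unfolding X by eventually_elim auto
  qed
  then have "AE x in lebesgue. \<forall>X\<in>D. x \<in> X \<longrightarrow> g x = 0" by (subst AE_ball_countable[OF D(1)]) blast
  then show ?thesis by eventually_elim (use D(4) in blast)
qed

section \<open>The Sobolev space as a closed graph\<close>

lemma norm_abs_L2_le: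
  assumes "sqint f" "sqint k" "c \<ge> 0" "AE x in lebesgue. norm (f x) \<le> c * norm (k x)"
  shows "norm (abs_L2 f) \<le> c * norm (abs_L2 k)"
proof (rule power2_le_imp_le)
  have "(norm (abs_L2 f))\<^sup>2 \<le> (\<integral>x. c\<^sup>2 * (norm (k x))\<^sup>2 \<partial>lebesgue)"
    unfolding norm_abs_L2[OF assms(1)]
  proof (rule integral_mono_AE)
    show "AE x in lebesgue. (norm (f x))\<^sup>2 \<le> c\<^sup>2 * (norm (k x))\<^sup>2"
      using assms(4)
    proof eventually_elim
      case (elim x)
      from power_mono[OF this norm_ge_zero, of 2] show ?case by (simp add: power_mult_distrib)
    qed
  qed (use sqint_integrable[OF assms(1)] sqint_integrable[OF assms(2)] in auto)
  also have "\<dots> = (c * norm (abs_L2 k))\<^sup>2" by (simp add: power_mult_distrib norm_abs_L2[OF assms(2)])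
  finally show "(norm (abs_L2 f))\<^sup>2 \<le> (c * norm (abs_L2 k))\<^sup>2" .
qed (use assms in auto)

lemma L2_tendsto_abs_bound:
  assumes "\<And>n. sqint (f n)" "sqint g" "\<And>n. sqint (k n)" "c \<ge> 0"
    "\<And>n. AE x in lebesgue. norm (f n x - g x) \<le> c * norm (k n x)" "(\<lambda>n. abs_L2 (k n)) \<longlonglongrightarrow> 0"
  shows "(\<lambda>n. abs_L2 (f n)) \<longlonglongrightarrow> abs_L2 g"
proof (rule LIM_zero_cancel, rule Lim_null_comparison)
  show "\<forall>\<^sub>F n in sequentially. norm (abs_L2 (f n) - abs_L2 g) \<le> c * norm (abs_L2 (k n))"
    unfolding abs_L2_diff[OF assms(1,2), symmetric]
    by (intro always_eventually allI norm_abs_L2_le sqint_diff assms)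
  show "(\<lambda>n. c * norm (abs_L2 (k n))) \<longlonglongrightarrow> 0"
    using tendsto_mult_left[OF tendsto_norm[OF assms(6)], of c] by simp
qed

section \<open>Functions on the domain, extended by zero, and the closed graph\<close>

locale bounded_domain =
  fixes \<Omega> :: "'a::euclidean_space set"
  assumes open_\<Omega>: "open \<Omega>" and bounded_\<Omega>: "bounded \<Omega>"
begin

lemma \<Omega>_lebesgue: "\<Omega> \<in> sets lebesgue"
  by (rule sets_completionI_sets) (use open_\<Omega> in simp)

lemma \<Omega>_lmeasurable: "\<Omega> \<in> lmeasurable"
  by (rule lmeasurable_open[OF bounded_\<Omega> open_\<Omega>])

definition radius :: real where "radius = (SOME R. R \<ge> 0 \<and> \<Omega> \<subseteq> cball 0 R)"

lemma radius: "radius \<ge> 0" "\<Omega> \<subseteq> cball 0 radius"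
proof -
  obtain B where "B > 0" "\<forall>x\<in>\<Omega>. norm x \<le> B" using bounded_\<Omega> unfolding bounded_pos by blast
  then have "\<exists>R. R \<ge> 0 \<and> \<Omega> \<subseteq> cball 0 R" by (intro exI[of _ B]) auto
  from someI_ex[OF this] show "radius \<ge> 0" "\<Omega> \<subseteq> cball 0 radius" unfolding radius_def by auto
qed

text \<open>The bridge between integrals with respect to \<open>lebesgue_on \<Omega>\<close> and the
  whole-space setting of \<open>L2\<close>.\<close>

definition zext :: "('a \<Rightarrow> 'b::euclidean_space) \<Rightarrow> 'a \<Rightarrow> 'b" where
  "zext u x = (if x \<in> \<Omega> then u x else 0)"

lemma integral_zext:
  fixes u :: "'a \<Rightarrow> 'b::euclidean_space"
  shows "(LINT x|lebesgue_on \<Omega>. u x) = (\<integral>x. zext u x \<partial>lebesgue)"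
  unfolding zext_def by (rule Lebesgue_Measure.integral_restrict_UNIV[OF \<Omega>_lebesgue, symmetric])

lemma integrable_zext:
  fixes u :: "'a \<Rightarrow> 'b::euclidean_space"
  shows "integrable (lebesgue_on \<Omega>) u \<longleftrightarrow> integrable lebesgue (zext u)"
proof -
  have "zext u = (\<lambda>x. indicator \<Omega> x *\<^sub>R u x)" by (auto simp: zext_def)
  then show ?thesis using \<Omega>_lebesgue by (subst integrable_restrict_space) auto
qed

lemma L2_fun_zext: "L2_fun \<Omega> u \<longleftrightarrow> sqint (zext u)"
proof -
  have "zext (\<lambda>x. (norm (u x))\<^sup>2) = (\<lambda>x. (norm (zext u x))\<^sup>2)" by (auto simp: zext_def)
  then show ?thesis
    unfolding L2_fun_def sqint_def integrable_zext
    by (simp add: zext_def[abs_def] borel_measurable_if[OF \<Omega>_lebesgue])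
qed

lemma L2_norm_zext: "L2_fun \<Omega> u \<Longrightarrow> L2_norm \<Omega> u = norm (abs_L2 (zext u))"
proof -
  assume u: "L2_fun \<Omega> u"
  have "zext (\<lambda>x. (norm (u x))\<^sup>2) = (\<lambda>x. (norm (zext u x))\<^sup>2)" by (auto simp: zext_def)
  then have "(L2_norm \<Omega> u)\<^sup>2 = (norm (abs_L2 (zext u)))\<^sup>2"
    using u by (simp add: L2_norm_def integral_zext norm_abs_L2 L2_fun_zext)
  moreover have "L2_norm \<Omega> u \<ge> 0" by (simp add: L2_norm_def)
  ultimately show ?thesis by simp
qed

lemma AE_lebesgue_on: "(AE x in lebesgue_on \<Omega>. P x) \<longleftrightarrow> (AE x in lebesgue. x \<in> \<Omega> \<longrightarrow> P x)"
  using \<Omega>_lebesgue by (subst AE_restrict_space_iff) auto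

lemma integrable_indicator_\<Omega>: "integrable lebesgue (\<lambda>x. c * indicat_real \<Omega> x)"
  using \<Omega>_lmeasurable by (intro integrable_mult_right integrable_real_indicator) (auto simp: fmeasurable_def)

text \<open>The domain has finite measure, and the norm is at most 1 plus its square.\<close>

lemma sqint_supported_integrable:
  fixes f :: "'a \<Rightarrow> 'b::euclidean_space"
  assumes "sqint f" "AE x in lebesgue. x \<notin> \<Omega> \<longrightarrow> f x = 0"
  shows "integrable lebesgue f"
proof (rule Bochner_Integration.integrable_bound)
  show "integrable lebesgue (\<lambda>x. indicat_real \<Omega> x + (norm (f x))\<^sup>2)"
    using integrable_indicator_\<Omega>[of 1] sqint_integrable[OF assms(1)] by simp
  show "AE x in lebesgue. norm (f x) \<le> norm (indicat_real \<Omega> x + (norm (f x))\<^sup>2)"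
    using assms(2)
  proof eventually_elim
    case (elim x)
    have "2 * norm (f x) \<le> 1 + (norm (f x))\<^sup>2" using sum_squares_bound[of 1 "norm (f x)"] by simp
    then have "norm (f x) \<le> 1 + (norm (f x))\<^sup>2" using norm_ge_zero[of "f x"] by linarith
    then show ?case using elim by (cases "x \<in> \<Omega>") auto
  qed
qed (rule sqint_measurable[OF assms(1)])

definition W :: "(('a, real) L2 \<times> ('a, 'a) L2) set" where
  "W = closure ((\<lambda>\<phi>. (abs_L2 \<phi>, abs_L2 (grad \<phi>))) ` {\<phi>. test_fun \<Omega> \<phi>})"

lemma test_fun_in_W: "test_fun \<Omega> \<phi> \<Longrightarrow> (abs_L2 \<phi>, abs_L2 (grad \<phi>)) \<in> W"
  unfolding W_def by (rule subsetD[OF closure_subset]) auto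

lemma W_E:
  assumes "(u, g) \<in> W"
  shows "\<exists>\<phi>. (\<forall>n. test_fun \<Omega> (\<phi> n)) \<and> (\<lambda>n. abs_L2 (\<phi> n)) \<longlonglongrightarrow> u \<and> (\<lambda>n. abs_L2 (grad (\<phi> n))) \<longlonglongrightarrow> g"
proof -
  obtain s where s: "\<And>n. s n \<in> (\<lambda>\<phi>. (abs_L2 \<phi>, abs_L2 (grad \<phi>))) ` {\<phi>. test_fun \<Omega> \<phi>}" "s \<longlonglongrightarrow> (u, g)"
    using assms unfolding W_def closure_sequential by blast
  then have "\<forall>n. \<exists>\<phi>. test_fun \<Omega> \<phi> \<and> s n = (abs_L2 \<phi>, abs_L2 (grad \<phi>))" by blast
  then obtain \<phi> where \<phi>: "\<And>n. test_fun \<Omega> (\<phi> n)" "\<And>n. s n = (abs_L2 (\<phi> n), abs_L2 (grad (\<phi> n)))" by metis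
  show ?thesis
    using \<phi>(1) tendsto_fst[OF s(2)] tendsto_snd[OF s(2)] by (intro exI[of _ \<phi>]) (simp add: \<phi>(2))
qed

lemma W_I:
  assumes "\<And>n. (u n, g n) \<in> W" "u \<longlonglongrightarrow> u'" "g \<longlonglongrightarrow> g'"
  shows "(u', g') \<in> W"
proof -
  have "(\<lambda>n. (u n, g n)) \<longlonglongrightarrow> (u', g')" by (rule tendsto_Pair[OF assms(2,3)])
  moreover have "closed W" by (simp add: W_def)
  ultimately show ?thesis using closed_sequentially[of W "\<lambda>n. (u n, g n)"] assms(1) by blast
qed

lemma W_add: assumes "(u, g) \<in> W" "(v, k) \<in> W" shows "(u + v, g + k) \<in> W"
proof -
  obtain \<phi> where \<phi>: "\<And>n. test_fun \<Omega> (\<phi> n)" "(\<lambda>n. abs_L2 (\<phi> n)) \<longlonglongrightarrow> u" "(\<lambda>n. abs_L2 (grad (\<phi> n))) \<longlonglongrightarrow> g"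
    using W_E[OF assms(1)] by blast
  obtain \<psi> where \<psi>: "\<And>n. test_fun \<Omega> (\<psi> n)" "(\<lambda>n. abs_L2 (\<psi> n)) \<longlonglongrightarrow> v" "(\<lambda>n. abs_L2 (grad (\<psi> n))) \<longlonglongrightarrow> k"
    using W_E[OF assms(2)] by blast
  have gr: "grad (\<lambda>x. \<phi> n x + \<psi> n x) = (\<lambda>x. grad (\<phi> n) x + grad (\<psi> n) x)" for n
    by (rule ext) (rule grad_add[OF test_fun_smooth[OF \<phi>(1)] test_fun_smooth[OF \<psi>(1)]])
  have eq: "abs_L2 (\<lambda>x. \<phi> n x + \<psi> n x) = abs_L2 (\<phi> n) + abs_L2 (\<psi> n)"
    "abs_L2 (grad (\<lambda>x. \<phi> n x + \<psi> n x)) = abs_L2 (grad (\<phi> n)) + abs_L2 (grad (\<psi> n))" for n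
    unfolding gr by (rule abs_L2_add; rule test_fun_integrable[OF \<phi>(1)] test_fun_integrable[OF \<psi>(1)])+
  have "(abs_L2 (\<phi> n) + abs_L2 (\<psi> n), abs_L2 (grad (\<phi> n)) + abs_L2 (grad (\<psi> n))) \<in> W" for n
    using test_fun_in_W[OF test_fun_add[OF \<phi>(1)[of n] \<psi>(1)[of n]]] unfolding eq .
  then show ?thesis by (rule W_I[OF _ tendsto_add[OF \<phi>(2) \<psi>(2)] tendsto_add[OF \<phi>(3) \<psi>(3)]])
qed

lemma W_scale: assumes "(u, g) \<in> W" shows "(c *\<^sub>R u, c *\<^sub>R g) \<in> W"
proof -
  obtain \<phi> where \<phi>: "\<And>n. test_fun \<Omega> (\<phi> n)" "(\<lambda>n. abs_L2 (\<phi> n)) \<longlonglongrightarrow> u" "(\<lambda>n. abs_L2 (grad (\<phi> n))) \<longlonglongrightarrow> g"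
    using W_E[OF assms(1)] by blast
  have gr: "grad (\<lambda>x. c * \<phi> n x) = (\<lambda>x. c *\<^sub>R grad (\<phi> n) x)" for n
    using grad_mult[OF smooth_const[of c] test_fun_smooth[OF \<phi>(1)[of n]]] by (auto simp: grad_const)
  have eq: "abs_L2 (\<lambda>x. c * \<phi> n x) = c *\<^sub>R abs_L2 (\<phi> n)"
    "abs_L2 (grad (\<lambda>x. c * \<phi> n x)) = c *\<^sub>R abs_L2 (grad (\<phi> n))" for n
    using abs_L2_scaleR[OF test_fun_integrable(2)[OF \<phi>(1)[of n]], of c]
      abs_L2_scaleR[OF test_fun_integrable(5)[OF \<phi>(1)[of n]], of c] unfolding gr by simp_all
  have "(c *\<^sub>R abs_L2 (\<phi> n), c *\<^sub>R abs_L2 (grad (\<phi> n))) \<in> W" for n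
    using test_fun_in_W[OF test_fun_scale[OF \<phi>(1)[of n]], of c] unfolding eq .
  then show ?thesis
    by (rule W_I[OF _ tendsto_scaleR[OF tendsto_const \<phi>(2)] tendsto_scaleR[OF tendsto_const \<phi>(3)]])
qed

lemma W_diff: assumes "(u, g) \<in> W" "(v, k) \<in> W" shows "(u - v, g - k) \<in> W"
  using W_add[OF assms(1) W_scale[OF assms(2), of "-1"]] by simp

lemma W_zero: "(0, 0) \<in> W"
  using W_scale[OF test_fun_in_W[OF test_fun_zero], of 0] by simp

lemma W_poincare: assumes "(u, g) \<in> W" shows "norm u \<le> 2 * radius * norm g"
proof -
  obtain \<phi> where \<phi>: "\<And>n. test_fun \<Omega> (\<phi> n)" "(\<lambda>n. abs_L2 (\<phi> n)) \<longlonglongrightarrow> u" "(\<lambda>n. abs_L2 (grad (\<phi> n))) \<longlonglongrightarrow> g"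
    using W_E[OF assms(1)] by blast
  show ?thesis
    by (rule LIMSEQ_le[OF tendsto_norm[OF \<phi>(2)] tendsto_mult_left[OF tendsto_norm[OF \<phi>(3)]]])
      (intro exI allI impI poincare_test_fun[OF \<phi>(1) radius(2,1)])
qed

text \<open>Two successive extractions, for the functions and then for the gradients, give almost
  everywhere convergence of both along one sequence of test functions.\<close>

lemma W_AE_sequence:
  assumes "(u, g) \<in> W"
  shows "\<exists>\<phi>. (\<forall>n. test_fun \<Omega> (\<phi> n)) \<and> (\<lambda>n. abs_L2 (\<phi> n)) \<longlonglongrightarrow> u \<and> (\<lambda>n. abs_L2 (grad (\<phi> n))) \<longlonglongrightarrow> g \<and>
    (AE x in lebesgue. (\<lambda>n. \<phi> n x) \<longlonglongrightarrow> rep_L2 u x) \<and> (AE x in lebesgue. (\<lambda>n. grad (\<phi> n) x) \<longlonglongrightarrow> rep_L2 g x)"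
proof -
  obtain \<phi> where \<phi>: "\<And>n. test_fun \<Omega> (\<phi> n)" "(\<lambda>n. abs_L2 (\<phi> n)) \<longlonglongrightarrow> u" "(\<lambda>n. abs_L2 (grad (\<phi> n))) \<longlonglongrightarrow> g"
    using W_E[OF assms(1)] by blast
  obtain r where r: "strict_mono r" "AE x in lebesgue. (\<lambda>n. rep_L2 (abs_L2 (\<phi> (r n))) x) \<longlonglongrightarrow> rep_L2 u x"
    using L2_convergent_AE_subsequence[OF \<phi>(2)] by blast
  have g: "(\<lambda>n. abs_L2 (grad (\<phi> (r n)))) \<longlonglongrightarrow> g" and u: "(\<lambda>n. abs_L2 (\<phi> (r n))) \<longlonglongrightarrow> u"
    using LIMSEQ_subseq_LIMSEQ[OF \<phi>(3) r(1)] LIMSEQ_subseq_LIMSEQ[OF \<phi>(2) r(1)] by (simp_all add: o_def)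
  obtain s where s: "strict_mono s" "AE x in lebesgue. (\<lambda>n. rep_L2 (abs_L2 (grad (\<phi> (r (s n))))) x) \<longlonglongrightarrow> rep_L2 g x"
    using L2_convergent_AE_subsequence[OF g] by blast
  have a1: "AE x in lebesgue. \<forall>n. rep_L2 (abs_L2 (\<phi> n)) x = \<phi> n x"
    using rep_abs_L2[OF test_fun_integrable(2)[OF \<phi>(1)]] by (simp add: AE_all_countable)
  have a2: "AE x in lebesgue. \<forall>n. rep_L2 (abs_L2 (grad (\<phi> n))) x = grad (\<phi> n) x"
    using rep_abs_L2[OF test_fun_integrable(5)[OF \<phi>(1)]] by (simp add: AE_all_countable)
  show ?thesis
  proof (intro exI[of _ "\<lambda>n. \<phi> (r (s n))"] conjI allI)
    show "(\<lambda>n. abs_L2 (\<phi> (r (s n)))) \<longlonglongrightarrow> u" "(\<lambda>n. abs_L2 (grad (\<phi> (r (s n))))) \<longlonglongrightarrow> g"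
      using LIMSEQ_subseq_LIMSEQ[OF u s(1)] LIMSEQ_subseq_LIMSEQ[OF g s(1)] by (simp_all add: o_def)
    show "AE x in lebesgue. (\<lambda>n. \<phi> (r (s n)) x) \<longlonglongrightarrow> rep_L2 u x"
      using r(2) a1
    proof eventually_elim
      case (elim x)
      from LIMSEQ_subseq_LIMSEQ[OF elim(1) s(1)] elim(2) show ?case by (simp add: o_def)
    qed
    show "AE x in lebesgue. (\<lambda>n. grad (\<phi> (r (s n))) x) \<longlonglongrightarrow> rep_L2 g x"
      using s(2) a2 by eventually_elim simp
  qed (rule \<phi>(1))
qed

lemma W_support:
  assumes "(u, g) \<in> W"
  shows "AE x in lebesgue. x \<notin> \<Omega> \<longrightarrow> rep_L2 u x = 0" "AE x in lebesgue. x \<notin> \<Omega> \<longrightarrow> rep_L2 g x = 0"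
proof -
  obtain \<phi> where \<phi>: "\<And>n. test_fun \<Omega> (\<phi> n)"
    and ae: "AE x in lebesgue. (\<lambda>n. \<phi> n x) \<longlonglongrightarrow> rep_L2 u x" "AE x in lebesgue. (\<lambda>n. grad (\<phi> n) x) \<longlonglongrightarrow> rep_L2 g x"
    using W_AE_sequence[OF assms] by blast
  show "AE x in lebesgue. x \<notin> \<Omega> \<longrightarrow> rep_L2 u x = 0"
    using ae(1) by eventually_elim (auto simp: test_fun_outside[OF \<phi>] LIMSEQ_const_iff)
  show "AE x in lebesgue. x \<notin> \<Omega> \<longrightarrow> rep_L2 g x = 0"
    using ae(2) by eventually_elim (auto simp: test_fun_outside[OF \<phi>] LIMSEQ_const_iff)
qed

text \<open>The second component of a pair in \<open>W\<close> is a weak gradient of the first.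
  Paired with a basis vector, both sides are continuous in the norm of \<open>L2\<close>, so the
  identity passes from test functions to their limits.\<close>

lemma W_integration_by_parts:
  assumes W: "(u, g) \<in> W" and \<psi>: "test_fun \<Omega> \<psi>"
  shows "(\<integral>x. rep_L2 u x *\<^sub>R grad \<psi> x \<partial>lebesgue) = - (\<integral>x. \<psi> x *\<^sub>R rep_L2 g x \<partial>lebesgue)"
proof (rule euclidean_eqI)
  fix b :: 'a assume b: "b \<in> Basis"
  obtain \<phi> where \<phi>: "\<And>n. test_fun \<Omega> (\<phi> n)" "(\<lambda>n. abs_L2 (\<phi> n)) \<longlonglongrightarrow> u" "(\<lambda>n. abs_L2 (grad (\<phi> n))) \<longlonglongrightarrow> g"
    using W_E[OF W] by blast
  have s\<psi>: "sqint (\<lambda>x. \<psi> x *\<^sub>R b)"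
    using \<psi> test_fun_integrable(2)[OF \<psi>] sqint_scaleR
    by (intro sqint_bound[where g = "\<lambda>x. (norm (\<psi> x))\<^sup>2"]) (auto simp: sqint_def b)
  have sg: "sqint (\<lambda>x. grad \<psi> x \<bullet> b)"
  proof (rule sqint_bound)
    show "AE x in lebesgue. (norm (grad \<psi> x \<bullet> b))\<^sup>2 \<le> (norm (grad \<psi> x))\<^sup>2"
      using Basis_le_norm[OF b] by (intro AE_I2 power_mono) auto
  qed (intro borel_measurable_inner borel_measurable_const sqint_measurable sqint_integrable test_fun_integrable(5)[OF \<psi>])+
  have eq: "abs_L2 (\<phi> n) \<bullet> abs_L2 (\<lambda>x. grad \<psi> x \<bullet> b) = - (abs_L2 (grad (\<phi> n)) \<bullet> abs_L2 (\<lambda>x. \<psi> x *\<^sub>R b))" for n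
  proof -
    have i: "integrable lebesgue (\<lambda>x. \<phi> n x *\<^sub>R grad \<psi> x)" "integrable lebesgue (\<lambda>x. \<psi> x *\<^sub>R grad (\<phi> n) x)"
      by (intro sqint_mult_integrable test_fun_integrable[OF \<psi>] test_fun_integrable[OF \<phi>(1)])+
    have "abs_L2 (\<phi> n) \<bullet> abs_L2 (\<lambda>x. grad \<psi> x \<bullet> b) = (\<integral>x. (\<phi> n x *\<^sub>R grad \<psi> x) \<bullet> b \<partial>lebesgue)"
      using inner_abs_L2[OF test_fun_integrable(2)[OF \<phi>(1)] sg] by simp
    also have "\<dots> = (\<integral>x. \<phi> n x *\<^sub>R grad \<psi> x \<partial>lebesgue) \<bullet> b"
      by (rule integral_inner_left) (use i in auto)
    also have "\<dots> = - ((\<integral>x. \<psi> x *\<^sub>R grad (\<phi> n) x \<partial>lebesgue) \<bullet> b)"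
      unfolding integration_by_parts[OF \<phi>(1) \<psi>] by simp
    also have "(\<integral>x. \<psi> x *\<^sub>R grad (\<phi> n) x \<partial>lebesgue) \<bullet> b = (\<integral>x. (\<psi> x *\<^sub>R grad (\<phi> n) x) \<bullet> b \<partial>lebesgue)"
      by (rule integral_inner_left[symmetric]) (use i in auto)
    also have "\<dots> = abs_L2 (grad (\<phi> n)) \<bullet> abs_L2 (\<lambda>x. \<psi> x *\<^sub>R b)"
      using inner_abs_L2[OF test_fun_integrable(5)[OF \<phi>(1)] s\<psi>] by simp
    finally show ?thesis .
  qed
  have "(\<lambda>n. abs_L2 (\<phi> n) \<bullet> abs_L2 (\<lambda>x. grad \<psi> x \<bullet> b)) \<longlonglongrightarrow> - (g \<bullet> abs_L2 (\<lambda>x. \<psi> x *\<^sub>R b))"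
    unfolding eq by (intro tendsto_minus tendsto_inner tendsto_const \<phi>(3))
  from LIMSEQ_unique[OF tendsto_inner[OF \<phi>(2) tendsto_const] this]
  have "u \<bullet> abs_L2 (\<lambda>x. grad \<psi> x \<bullet> b) = - (g \<bullet> abs_L2 (\<lambda>x. \<psi> x *\<^sub>R b))" .
  moreover have "u \<bullet> abs_L2 (\<lambda>x. grad \<psi> x \<bullet> b) = (\<integral>x. (rep_L2 u x *\<^sub>R grad \<psi> x) \<bullet> b \<partial>lebesgue)"
    using inner_abs_L2[OF sqint_rep[of u] sg] by (simp add: abs_rep_L2)
  moreover have "\<dots> = (\<integral>x. rep_L2 u x *\<^sub>R grad \<psi> x \<partial>lebesgue) \<bullet> b"
    by (rule integral_inner_left) (intro sqint_mult_integrable sqint_rep test_fun_integrable(5)[OF \<psi>])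
  moreover have "g \<bullet> abs_L2 (\<lambda>x. \<psi> x *\<^sub>R b) = (\<integral>x. (\<psi> x *\<^sub>R rep_L2 g x) \<bullet> b \<partial>lebesgue)"
    using inner_abs_L2[OF sqint_rep[of g] s\<psi>] by (simp add: abs_rep_L2)
  moreover have "\<dots> = (\<integral>x. \<psi> x *\<^sub>R rep_L2 g x \<partial>lebesgue) \<bullet> b"
    by (rule integral_inner_left) (intro sqint_mult_integrable sqint_rep test_fun_integrable(2)[OF \<psi>])
  ultimately show "(\<integral>x. rep_L2 u x *\<^sub>R grad \<psi> x \<partial>lebesgue) \<bullet> b = - (\<integral>x. \<psi> x *\<^sub>R rep_L2 g x \<partial>lebesgue) \<bullet> b"
    by simp
qed

text \<open>The chain rule (\<open>a = 1\<close>, \<open>h 0 = 0\<close>) and the product rule (\<open>a\<close> a test function) in one.\<close>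

lemma W_chain_rule:
  fixes h h' :: "real \<Rightarrow> real" and a :: "'a \<Rightarrow> real"
  assumes W: "(u, g) \<in> W"
    and h: "smooth h" "\<And>t. (h has_real_derivative h' t) (at t)" "\<And>t. \<bar>h' t\<bar> \<le> L"
    and a: "smooth a" "\<And>x. \<bar>a x\<bar> \<le> A" "\<And>x. norm (grad a x) \<le> A'"
    and test: "\<And>\<phi>. test_fun \<Omega> \<phi> \<Longrightarrow> test_fun \<Omega> (\<lambda>x. a x * h (\<phi> x))"
  defines "v \<equiv> \<lambda>x. a x * h (rep_L2 u x)"
    and "k \<equiv> \<lambda>x. (a x * h' (rep_L2 u x)) *\<^sub>R rep_L2 g x + h (rep_L2 u x) *\<^sub>R grad a x"
  shows "sqint v" "sqint k" "(abs_L2 v, abs_L2 k) \<in> W"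
proof -
  obtain \<phi> where \<phi>: "\<And>n. test_fun \<Omega> (\<phi> n)" "(\<lambda>n. abs_L2 (\<phi> n)) \<longlonglongrightarrow> u" "(\<lambda>n. abs_L2 (grad (\<phi> n))) \<longlonglongrightarrow> g"
    and ae: "AE x in lebesgue. (\<lambda>n. \<phi> n x) \<longlonglongrightarrow> rep_L2 u x"
    using W_AE_sequence[OF W] by blast
  have L: "L \<ge> 0" and A: "A \<ge> 0" and A': "A' \<ge> 0"
    using order_trans[OF abs_ge_zero h(3)[of 0]] order_trans[OF abs_ge_zero a(2)[of 0]]
      order_trans[OF norm_ge_zero a(3)[of 0]] by auto
  have lip: "\<bar>h s - h t\<bar> \<le> L * \<bar>s - t\<bar>" for s t
    using field_differentiable_bound[OF convex_UNIV, of h h' L s t] h(2,3)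
    by (auto simp: has_field_derivative_at_within)
  have [measurable]: "h \<in> borel_measurable borel" "h' \<in> borel_measurable borel"
    using smooth_continuous[OF h(1)] smooth_continuous[OF smooth_derivative[OF h(2,1)]]
    by (auto intro: borel_measurable_continuous_onI)
  have lebm: "f \<in> borel_measurable lebesgue" if "continuous_on UNIV f" for f :: "'a \<Rightarrow> 'c::euclidean_space"
    by (rule measurable_completion) (use borel_measurable_continuous_onI[OF that] in simp)
  note [measurable] = lebm[OF smooth_continuous[OF a(1)]] lebm[OF continuous_grad[OF a(1)]]
    sqint_measurable[OF sqint_rep[of u]] sqint_measurable[OF sqint_rep[of g]]
    test_fun_integrable(2)[OF \<phi>(1), THEN sqint_measurable] test_fun_integrable(5)[OF \<phi>(1), THEN sqint_measurable]
  define d where "d n x = \<phi> n x - rep_L2 u x" for n x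
  have sd: "sqint (d n)" for n
    unfolding d_def by (intro sqint_diff sqint_rep test_fun_integrable(2)[OF \<phi>(1)])
  have d0: "(\<lambda>n. abs_L2 (d n)) \<longlonglongrightarrow> 0"
    using LIM_zero[OF \<phi>(2)] unfolding d_def
    by (simp add: abs_L2_diff test_fun_integrable(2)[OF \<phi>(1)] sqint_rep abs_rep_L2)
  define e where "e n x = grad (\<phi> n) x - rep_L2 g x" for n x
  have se: "sqint (e n)" for n
    unfolding e_def by (intro sqint_diff sqint_rep test_fun_integrable(5)[OF \<phi>(1)])
  have e0: "(\<lambda>n. abs_L2 (e n)) \<longlonglongrightarrow> 0"
    using LIM_zero[OF \<phi>(3)] unfolding e_def
    by (simp add: abs_L2_diff test_fun_integrable(5)[OF \<phi>(1)] sqint_rep abs_rep_L2)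
  \<comment> \<open>The approximants; by \<open>test\<close> they are test functions again, which is
    what membership of the limit in \<open>W\<close> requires.\<close>
  define p where "p n x = a x * h (\<phi> n x)" for n x
  have tp: "test_fun \<Omega> (p n)" for n unfolding p_def by (rule test[OF \<phi>(1)])
  have pv: "norm (p n x - v x) \<le> (A * L) * norm (d n x)" for n x
  proof -
    have "norm (p n x - v x) = \<bar>a x\<bar> * \<bar>h (\<phi> n x) - h (rep_L2 u x)\<bar>"
      by (simp add: p_def v_def abs_mult[symmetric] algebra_simps)
    also have "\<dots> \<le> A * (L * \<bar>d n x\<bar>)" unfolding d_def using A by (intro mult_mono a lip) auto
    finally show ?thesis by simp
  qed
  have vm[measurable]: "v \<in> borel_measurable lebesgue" unfolding v_def by measurable
  have mp[measurable]: "p n \<in> borel_measurable lebesgue" for n by (rule sqint_measurable[OF test_fun_integrable(2)[OF tp]])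
  have sqdiff: "sqint (\<lambda>x. p n x - v x)" for n
  proof (rule sqint_bound[where g = "\<lambda>x. (norm ((A * L) *\<^sub>R d n x))\<^sup>2"])
    show "AE x in lebesgue. (norm (p n x - v x))\<^sup>2 \<le> (norm ((A * L) *\<^sub>R d n x))\<^sup>2"
    proof (rule AE_I2)
      fix x show "(norm (p n x - v x))\<^sup>2 \<le> (norm ((A * L) *\<^sub>R d n x))\<^sup>2"
        using power_mono[OF pv norm_ge_zero, of n x 2] A L by (simp add: abs_mult)
    qed
  qed (use sqint_integrable[OF sqint_scaleR[OF sd[of n]], of "A * L"] in \<open>simp_all\<close>)
  show sv: "sqint v" using sqint_diff[OF test_fun_integrable(2)[OF tp[of 0]] sqdiff[of 0]] by simp
  have lim_v: "(\<lambda>n. abs_L2 (p n)) \<longlonglongrightarrow> abs_L2 v"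
    by (rule L2_tendsto_abs_bound[OF test_fun_integrable(2)[OF tp] sv sd mult_nonneg_nonneg[OF A L] AE_I2[OF pv] d0])
  \<comment> \<open>The gradient of \<open>p n\<close> is split in two. In \<open>q n\<close> the
    factor \<open>h'\<close> is evaluated at the approximant but the limit gradient is used, so
    pointwise convergence and domination suffice; the rest, \<open>r n\<close>, is controlled in
    norm by the errors \<open>d n\<close> and \<open>e n\<close>.\<close>
  define q where "q n x = (a x * h' (\<phi> n x)) *\<^sub>R rep_L2 g x" for n x
  define q' where "q' x = (a x * h' (rep_L2 u x)) *\<^sub>R rep_L2 g x" for x
  have ah': "\<bar>a x * h' t\<bar> \<le> A * L" for x t unfolding abs_mult by (intro mult_mono a h A) auto
  have qb: "(norm (q n x))\<^sup>2 \<le> (norm ((A * L) *\<^sub>R rep_L2 g x))\<^sup>2" for n x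
    unfolding q_def norm_scaleR using A L by (intro power_mono mult_right_mono order_trans[OF ah' abs_ge_self]) auto
  have h'cont: "isCont h' t" for t
    using smooth_continuous[OF smooth_derivative[OF h(2,1)]] by (simp add: continuous_on_eq_continuous_at)
  have mq: "q n \<in> borel_measurable lebesgue" "q' \<in> borel_measurable lebesgue" for n
    unfolding q_def[abs_def] q'_def[abs_def] by measurable
  have q_ae: "AE x in lebesgue. (\<lambda>n. q n x) \<longlonglongrightarrow> q' x"
    using ae
  proof eventually_elim
    case (elim x)
    show ?case unfolding q_def q'_def by (intro tendsto_intros isCont_tendsto_compose[OF h'cont] elim)
  qed
  note Q = L2_dominated_convergence[OF mq sqint_integrable[OF sqint_scaleR[OF sqint_rep[of g]], of "A * L"] AE_I2[OF qb] q_ae]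
  have grp: "grad (p n) x = (a x * h' (\<phi> n x)) *\<^sub>R grad (\<phi> n) x + h (\<phi> n x) *\<^sub>R grad a x" for n x
    unfolding p_def[abs_def]
    using grad_mult[OF a(1) smooth_compose[OF h(1) test_fun_smooth[OF \<phi>(1)[of n]]]]
      grad_compose[OF test_fun_smooth[OF \<phi>(1)[of n]] h(2)] by simp
  define r where "r n x = grad (p n) x - q n x" for n x
  define r' where "r' x = h (rep_L2 u x) *\<^sub>R grad a x" for x
  have sr: "sqint (r n)" for n
    unfolding r_def by (intro sqint_diff test_fun_integrable(5)[OF tp] Q(1))
  have mr': "r' \<in> borel_measurable lebesgue" unfolding r'_def by measurable
  have rr: "norm (r n x - r' x) \<le> (A * L) * norm (e n x) + (L * A') * norm (d n x)" for n x
  proof -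
    have "r n x - r' x = (a x * h' (\<phi> n x)) *\<^sub>R e n x + (h (\<phi> n x) - h (rep_L2 u x)) *\<^sub>R grad a x"
      by (simp add: r_def r'_def q_def e_def grp algebra_simps)
    then have "norm (r n x - r' x) \<le> \<bar>a x * h' (\<phi> n x)\<bar> * norm (e n x) + \<bar>h (\<phi> n x) - h (rep_L2 u x)\<bar> * norm (grad a x)"
      using norm_triangle_ineq[of "(a x * h' (\<phi> n x)) *\<^sub>R e n x" "(h (\<phi> n x) - h (rep_L2 u x)) *\<^sub>R grad a x"] by simp
    also have "\<dots> \<le> (A * L) * norm (e n x) + (L * \<bar>d n x\<bar>) * A'"
      unfolding d_def using L by (intro add_mono mult_mono mult_right_mono ah' lip a) auto
    finally show ?thesis by (simp add: ac_simps)
  qed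
  define w where "w n x = (A * L) * norm (e n x) + (L * A') * norm (d n x)" for n x
  have s1: "sqint (\<lambda>x. (A * L) *\<^sub>R norm (e n x))" "sqint (\<lambda>x. (L * A') *\<^sub>R norm (d n x))" for n
    by (intro sqint_scaleR sqint_norm se sd)+
  have sw: "sqint (w n)" for n using sqint_add[OF s1] by (simp add: w_def[abs_def])
  have norm_eq: "norm (abs_L2 (\<lambda>x. norm (f x))) = norm (abs_L2 f)" if "sqint f" for f :: "'a \<Rightarrow> 'c::euclidean_space"
    by (rule power2_eq_imp_eq[OF _ norm_ge_zero norm_ge_zero])
      (unfold norm_abs_L2[OF sqint_norm[OF that]] norm_abs_L2[OF that], simp)
  have w0: "(\<lambda>n. abs_L2 (w n)) \<longlonglongrightarrow> 0"
  proof (rule Lim_null_comparison)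
    show "\<forall>\<^sub>F n in sequentially. norm (abs_L2 (w n)) \<le> (A * L) * norm (abs_L2 (e n)) + (L * A') * norm (abs_L2 (d n))"
    proof (intro always_eventually allI)
      fix n
      have "abs_L2 (w n) = (A * L) *\<^sub>R abs_L2 (\<lambda>x. norm (e n x)) + (L * A') *\<^sub>R abs_L2 (\<lambda>x. norm (d n x))"
        unfolding w_def[abs_def] abs_L2_scaleR[OF sqint_norm[OF se], symmetric] abs_L2_scaleR[OF sqint_norm[OF sd], symmetric]
          abs_L2_add[OF s1, symmetric] by simp
      then have "norm (abs_L2 (w n)) \<le> norm ((A * L) *\<^sub>R abs_L2 (\<lambda>x. norm (e n x))) + norm ((L * A') *\<^sub>R abs_L2 (\<lambda>x. norm (d n x)))"
        using norm_triangle_ineq by metis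
      also have "\<dots> = (A * L) * norm (abs_L2 (e n)) + (L * A') * norm (abs_L2 (d n))"
        unfolding norm_scaleR norm_eq[OF se] norm_eq[OF sd] using A L A' by simp
      finally show "norm (abs_L2 (w n)) \<le> (A * L) * norm (abs_L2 (e n)) + (L * A') * norm (abs_L2 (d n))" .
    qed
    show "(\<lambda>n. (A * L) * norm (abs_L2 (e n)) + (L * A') * norm (abs_L2 (d n))) \<longlonglongrightarrow> 0"
      using tendsto_add[OF tendsto_mult_left[OF tendsto_norm[OF e0], of "A * L"]
          tendsto_mult_left[OF tendsto_norm[OF d0], of "L * A'"]] by simp
  qed
  have sqdiff': "sqint (\<lambda>x. r n x - r' x)" for n
  proof (rule sqint_bound[OF _ sqint_integrable[OF sw[of n]]])
    show "(\<lambda>x. r n x - r' x) \<in> borel_measurable lebesgue"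
      by (intro borel_measurable_diff sqint_measurable[OF sr] mr')
    show "AE x in lebesgue. (norm (r n x - r' x))\<^sup>2 \<le> (norm (w n x))\<^sup>2"
      using order_trans[OF rr[folded w_def] abs_ge_self] by (intro AE_I2 power_mono) auto
  qed
  have sr': "sqint r'" using sqint_diff[OF sr[of 0] sqdiff'[of 0]] by simp
  have lim_r: "(\<lambda>n. abs_L2 (r n)) \<longlonglongrightarrow> abs_L2 r'"
    by (rule L2_tendsto_abs_bound[OF sr sr' sw zero_le_one AE_I2 w0])
      (use order_trans[OF rr[folded w_def] abs_ge_self] in simp)
  have k: "k = (\<lambda>x. q' x + r' x)" by (simp add: k_def q'_def r'_def)
  show sk: "sqint k" unfolding k by (rule sqint_add[OF Q(2) sr'])
  have "(\<lambda>n. abs_L2 (q n) + abs_L2 (r n)) \<longlonglongrightarrow> abs_L2 q' + abs_L2 r'" by (intro tendsto_add Q(3) lim_r)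
  moreover have "abs_L2 (q n) + abs_L2 (r n) = abs_L2 (grad (p n))" for n
    unfolding abs_L2_add[OF Q(1) sr, symmetric] by (simp add: r_def)
  moreover have "abs_L2 q' + abs_L2 r' = abs_L2 k" unfolding k by (rule abs_L2_add[OF Q(2) sr', symmetric])
  ultimately have "(\<lambda>n. abs_L2 (grad (p n))) \<longlonglongrightarrow> abs_L2 k" by simp
  then show "(abs_L2 v, abs_L2 k) \<in> W" by (rule W_I[OF test_fun_in_W[OF tp] lim_v])
qed

end

context bounded_domain
begin

subsection \<open>Weak gradients and the closed graph\<close>

lemma zext_indicator: "zext f = (\<lambda>x. indicator \<Omega> x *\<^sub>R f x)"
  by (auto simp: zext_def)

lemma sqint_zext: assumes "sqint f" shows "sqint (zext f)"
proof (rule sqint_bound[OF _ sqint_integrable[OF assms]])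
  show "zext f \<in> borel_measurable lebesgue"
    unfolding zext_indicator
    by (intro borel_measurable_scaleR borel_measurable_indicator \<Omega>_lebesgue sqint_measurable assms)
qed (auto simp: zext_def)

lemma zext_AE_eq: "AE x in lebesgue. x \<notin> \<Omega> \<longrightarrow> f x = 0 \<Longrightarrow> AE x in lebesgue. zext f x = f x"
  by (erule AE_mp) (auto simp: zext_def)

lemma integral_test_zext:
  assumes "test_fun \<Omega> \<phi>"
  shows "(LINT x|lebesgue_on \<Omega>. \<phi> x *\<^sub>R g x) = (\<integral>x. \<phi> x *\<^sub>R zext g x \<partial>lebesgue)"
    and "(LINT x|lebesgue_on \<Omega>. u x *\<^sub>R grad \<phi> x) = (\<integral>x. zext u x *\<^sub>R grad \<phi> x \<partial>lebesgue)"
proof -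
  have "zext (\<lambda>x. \<phi> x *\<^sub>R g x) = (\<lambda>x. \<phi> x *\<^sub>R zext g x)" "zext (\<lambda>x. u x *\<^sub>R grad \<phi> x) = (\<lambda>x. zext u x *\<^sub>R grad \<phi> x)"
    by (auto simp: zext_def)
  then show "(LINT x|lebesgue_on \<Omega>. \<phi> x *\<^sub>R g x) = (\<integral>x. \<phi> x *\<^sub>R zext g x \<partial>lebesgue)"
    "(LINT x|lebesgue_on \<Omega>. u x *\<^sub>R grad \<phi> x) = (\<integral>x. zext u x *\<^sub>R grad \<phi> x \<partial>lebesgue)"
    by (simp_all add: integral_zext)
qed

text \<open>Each component of the difference integrates to zero against all test functions, so the
  fundamental lemma applies.\<close>

lemma weak_grad_unique:
  assumes g1: "L2_fun \<Omega> g1" "has_weak_grad \<Omega> u g1" and g2: "L2_fun \<Omega> g2" "has_weak_grad \<Omega> u g2"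
  shows "AE x in lebesgue. x \<in> \<Omega> \<longrightarrow> g1 x = g2 x"
proof -
  define d where "d x = zext g1 x - zext g2 x" for x
  have s: "sqint (zext g1)" "sqint (zext g2)" using g1 g2 by (simp_all add: L2_fun_zext)
  have sd: "sqint d" unfolding d_def[abs_def] by (intro sqint_diff s)
  have id: "integrable lebesgue d"
    by (rule sqint_supported_integrable[OF sd]) (auto simp: d_def zext_def)
  have "AE x in lebesgue. x \<in> \<Omega> \<longrightarrow> d x \<bullet> b = 0" for b
  proof (rule fundamental_lemma[OF open_\<Omega>])
    show "integrable lebesgue (\<lambda>x. d x \<bullet> b)" using id by simp
    fix \<phi> assume \<phi>: "test_fun \<Omega> \<phi>"
    note s\<phi> = test_fun_integrable(2)[OF \<phi>]
    have "(\<integral>x. \<phi> x *\<^sub>R zext g1 x \<partial>lebesgue) = (\<integral>x. \<phi> x *\<^sub>R zext g2 x \<partial>lebesgue)"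
      using g1(2)[unfolded has_weak_grad_def, rule_format, OF \<phi>] g2(2)[unfolded has_weak_grad_def, rule_format, OF \<phi>]
      unfolding integral_test_zext(1)[OF \<phi>] by simp
    then have "(\<integral>x. \<phi> x *\<^sub>R d x \<partial>lebesgue) = 0"
      using sqint_mult_integrable[OF s\<phi> s(1)] sqint_mult_integrable[OF s\<phi> s(2)]
      by (simp add: d_def scaleR_diff_right)
    moreover have "(\<integral>x. (\<phi> x *\<^sub>R d x) \<bullet> b \<partial>lebesgue) = (\<integral>x. \<phi> x *\<^sub>R d x \<partial>lebesgue) \<bullet> b"
      by (rule integral_inner_left) (rule sqint_mult_integrable[OF s\<phi> sd])
    ultimately show "(\<integral>x. \<phi> x * (d x \<bullet> b) \<partial>lebesgue) = 0" by simp
  qed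
  then have "AE x in lebesgue. \<forall>b\<in>Basis. x \<in> \<Omega> \<longrightarrow> d x \<bullet> b = 0" by (intro AE_finite_allI) auto
  then show ?thesis
  proof eventually_elim
    case (elim x)
    then show ?case by (auto simp: d_def zext_def intro!: euclidean_eqI[where 'a = 'a]) (simp add: inner_diff_left)
  qed
qed

lemma W_has_weak_grad:
  assumes u: "L2_fun \<Omega> u" and W: "(abs_L2 (zext u), g) \<in> W"
  shows "L2_fun \<Omega> (rep_L2 g)" "has_weak_grad \<Omega> u (rep_L2 g)"
proof -
  have su: "sqint (zext u)" using u by (simp add: L2_fun_zext)
  show "L2_fun \<Omega> (rep_L2 g)" unfolding L2_fun_zext by (rule sqint_zext[OF sqint_rep])
  show "has_weak_grad \<Omega> u (rep_L2 g)"
    unfolding has_weak_grad_def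
  proof (intro allI impI)
    fix \<phi> assume \<phi>: "test_fun \<Omega> \<phi>"
    have "(LINT x|lebesgue_on \<Omega>. u x *\<^sub>R grad \<phi> x) = (\<integral>x. rep_L2 (abs_L2 (zext u)) x *\<^sub>R grad \<phi> x \<partial>lebesgue)"
      unfolding integral_test_zext(2)[OF \<phi>]
    proof (rule integral_cong_AE)
      show "AE x in lebesgue. zext u x *\<^sub>R grad \<phi> x = rep_L2 (abs_L2 (zext u)) x *\<^sub>R grad \<phi> x"
        using rep_abs_L2[OF su] by eventually_elim simp
    qed (intro borel_measurable_scaleR sqint_measurable su sqint_rep test_fun_integrable(5)[OF \<phi>])+
    also have "\<dots> = - (\<integral>x. \<phi> x *\<^sub>R rep_L2 g x \<partial>lebesgue)" by (rule W_integration_by_parts[OF W \<phi>])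
    also have "(\<integral>x. \<phi> x *\<^sub>R rep_L2 g x \<partial>lebesgue) = (LINT x|lebesgue_on \<Omega>. \<phi> x *\<^sub>R rep_L2 g x)"
      unfolding integral_test_zext(1)[OF \<phi>]
      by (rule Bochner_Integration.integral_cong) (auto simp: zext_def test_fun_outside[OF \<phi>])
    finally show "(LINT x|lebesgue_on \<Omega>. u x *\<^sub>R grad \<phi> x) = - (LINT x|lebesgue_on \<Omega>. \<phi> x *\<^sub>R rep_L2 g x)" .
  qed
qed

text \<open>Whichever weak gradient the choice operator in \<open>wgrad\<close> picks, its class in
  \<open>L2\<close> is determined.\<close>

lemma wgrad_eq:
  assumes "L2_fun \<Omega> g" "has_weak_grad \<Omega> u g"
  shows "L2_fun \<Omega> (wgrad \<Omega> u)" "has_weak_grad \<Omega> u (wgrad \<Omega> u)" "abs_L2 (zext (wgrad \<Omega> u)) = abs_L2 (zext g)"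
proof -
  have "L2_fun \<Omega> (wgrad \<Omega> u) \<and> has_weak_grad \<Omega> u (wgrad \<Omega> u)"
    unfolding wgrad_def by (rule someI[of "\<lambda>g. L2_fun \<Omega> g \<and> has_weak_grad \<Omega> u g" g]) (use assms in blast)
  then show w: "L2_fun \<Omega> (wgrad \<Omega> u)" "has_weak_grad \<Omega> u (wgrad \<Omega> u)" by auto
  have "AE x in lebesgue. zext (wgrad \<Omega> u) x = zext g x"
    using weak_grad_unique[OF w assms] by eventually_elim (simp add: zext_def)
  moreover have "sqint (zext (wgrad \<Omega> u))" "sqint (zext g)" using w(1) assms(1) by (simp_all add: L2_fun_zext)
  ultimately show "abs_L2 (zext (wgrad \<Omega> u)) = abs_L2 (zext g)" by (simp add: abs_L2_eq_iff)
qed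

lemma W_wgrad:
  assumes u: "L2_fun \<Omega> u" and W: "(abs_L2 (zext u), g) \<in> W"
  shows "L2_fun \<Omega> (wgrad \<Omega> u)" "abs_L2 (zext (wgrad \<Omega> u)) = g" "L2_norm \<Omega> (wgrad \<Omega> u) = norm g"
proof -
  note w = wgrad_eq[OF W_has_weak_grad[OF u W]]
  show "L2_fun \<Omega> (wgrad \<Omega> u)" by (rule w(1))
  have "abs_L2 (zext (rep_L2 g)) = abs_L2 (rep_L2 g)"
    by (subst abs_L2_eq_iff) (intro sqint_zext sqint_rep zext_AE_eq W_support(2)[OF W])+
  then show eq: "abs_L2 (zext (wgrad \<Omega> u)) = g" unfolding w(3) by (simp add: abs_rep_L2)
  show "L2_norm \<Omega> (wgrad \<Omega> u) = norm g" unfolding L2_norm_zext[OF w(1)] eq ..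
qed

lemma zext_test_fun: "test_fun \<Omega> \<phi> \<Longrightarrow> zext \<phi> = \<phi>" "test_fun \<Omega> \<phi> \<Longrightarrow> zext (grad \<phi>) = grad \<phi>"
  by (auto simp: zext_def test_fun_outside)

lemma zext_diff: "zext (\<lambda>x. f x - g x) = (\<lambda>x. zext f x - zext g x)"
  by (auto simp: zext_def)

text \<open>Together with the converse below this identifies \<open>H10\<close> with the closed
  graph \<open>W\<close>. The norm of \<open>u - \<phi> n\<close> can be computed because these
  differences lie in \<open>W\<close> again.\<close>

lemma H10_I:
  assumes u: "L2_fun \<Omega> u" and W: "(abs_L2 (zext u), g) \<in> W"
  shows "u \<in> H10 \<Omega>" "H10_norm \<Omega> u = norm g"
proof -
  show "H10_norm \<Omega> u = norm g" using W_wgrad[OF u W] by (simp add: H10_norm_def)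
  have su: "sqint (zext u)" using u by (simp add: L2_fun_zext)
  obtain \<phi> where \<phi>: "\<And>n. test_fun \<Omega> (\<phi> n)" "(\<lambda>n. abs_L2 (\<phi> n)) \<longlonglongrightarrow> abs_L2 (zext u)"
    "(\<lambda>n. abs_L2 (grad (\<phi> n))) \<longlonglongrightarrow> g"
    using W_E[OF W] by blast
  have z: "zext (\<lambda>x. u x - \<phi> n x) = (\<lambda>x. zext u x - \<phi> n x)" for n
    unfolding zext_diff zext_test_fun[OF \<phi>(1)] ..
  have L: "L2_fun \<Omega> (\<lambda>x. u x - \<phi> n x)" for n
    unfolding L2_fun_zext z by (intro sqint_diff su test_fun_integrable(2)[OF \<phi>(1)])
  have a: "abs_L2 (zext (\<lambda>x. u x - \<phi> n x)) = abs_L2 (zext u) - abs_L2 (\<phi> n)" for n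
    unfolding z by (rule abs_L2_diff[OF su test_fun_integrable(2)[OF \<phi>(1)]])
  have WW: "(abs_L2 (zext (\<lambda>x. u x - \<phi> n x)), g - abs_L2 (grad (\<phi> n))) \<in> W" for n
    unfolding a by (rule W_diff[OF W test_fun_in_W[OF \<phi>(1)]])
  have "H1_norm \<Omega> (\<lambda>x. u x - \<phi> n x) = sqrt ((norm (abs_L2 (zext u) - abs_L2 (\<phi> n)))\<^sup>2 + (norm (g - abs_L2 (grad (\<phi> n))))\<^sup>2)" for n
    unfolding H1_norm_def L2_norm_zext[OF L] a W_wgrad(3)[OF L WW] ..
  moreover have "(\<lambda>n. sqrt ((norm (abs_L2 (zext u) - abs_L2 (\<phi> n)))\<^sup>2 + (norm (g - abs_L2 (grad (\<phi> n))))\<^sup>2))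
      \<longlonglongrightarrow> sqrt ((norm (abs_L2 (zext u) - abs_L2 (zext u)))\<^sup>2 + (norm (g - g))\<^sup>2)"
    by (intro tendsto_intros \<phi>)
  ultimately have "(\<lambda>n. H1_norm \<Omega> (\<lambda>x. u x - \<phi> n x)) \<longlonglongrightarrow> 0" by simp
  moreover have "u \<in> H1 \<Omega>" unfolding H1_def using u W_has_weak_grad[OF u W] by blast
  ultimately show "u \<in> H10 \<Omega>" unfolding H10_def using \<phi>(1) by blast
qed

text \<open>The definition only speaks about the chosen weak gradients of
  \<open>u - \<phi> n\<close>. Uniqueness identifies them with \<open>g - grad (\<phi> n)\<close>,
  so convergence in \<open>H1_norm\<close> is convergence of the graph pairs.\<close>

lemma H10_D:
  assumes "u \<in> H10 \<Omega>"
  shows "L2_fun \<Omega> u" "(abs_L2 (zext u), abs_L2 (zext (wgrad \<Omega> u))) \<in> W"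
proof -
  obtain g \<phi> where u: "L2_fun \<Omega> u" and g: "L2_fun \<Omega> g" "has_weak_grad \<Omega> u g"
    and \<phi>: "\<And>n. test_fun \<Omega> (\<phi> n)" and lim: "(\<lambda>n. H1_norm \<Omega> (\<lambda>x. u x - \<phi> n x)) \<longlonglongrightarrow> 0"
    using assms unfolding H10_def H1_def by blast
  show "L2_fun \<Omega> u" by (rule u)
  have su: "sqint (zext u)" and sg: "sqint (zext g)" using u g by (simp_all add: L2_fun_zext)
  have z: "zext (\<lambda>x. u x - \<phi> n x) = (\<lambda>x. zext u x - \<phi> n x)"
    "zext (\<lambda>x. g x - grad (\<phi> n) x) = (\<lambda>x. zext g x - grad (\<phi> n) x)" for n
    unfolding zext_diff zext_test_fun[OF \<phi>] by rule+
  have L: "L2_fun \<Omega> (\<lambda>x. u x - \<phi> n x)" "L2_fun \<Omega> (\<lambda>x. g x - grad (\<phi> n) x)" for n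
    unfolding L2_fun_zext z by (intro sqint_diff su sg test_fun_integrable(2,5)[OF \<phi>])+
  have a: "abs_L2 (zext (\<lambda>x. u x - \<phi> n x)) = abs_L2 (zext u) - abs_L2 (\<phi> n)"
    "abs_L2 (zext (\<lambda>x. g x - grad (\<phi> n) x)) = abs_L2 (zext g) - abs_L2 (grad (\<phi> n))" for n
    unfolding z by (rule abs_L2_diff[OF su test_fun_integrable(2)[OF \<phi>]] abs_L2_diff[OF sg test_fun_integrable(5)[OF \<phi>]])+
  have wg: "has_weak_grad \<Omega> (\<lambda>x. u x - \<phi> n x) (\<lambda>x. g x - grad (\<phi> n) x)" for n
    unfolding has_weak_grad_def
  proof (intro allI impI)
    fix \<psi> assume \<psi>: "test_fun \<Omega> \<psi>"
    note s\<psi> = test_fun_integrable(2,5)[OF \<psi>] and s\<phi> = test_fun_integrable(2,5)[OF \<phi>[of n]]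
    have "(LINT x|lebesgue_on \<Omega>. (u x - \<phi> n x) *\<^sub>R grad \<psi> x)
        = (\<integral>x. zext u x *\<^sub>R grad \<psi> x - \<phi> n x *\<^sub>R grad \<psi> x \<partial>lebesgue)"
      unfolding integral_test_zext(2)[OF \<psi>] z by (simp add: scaleR_diff_left)
    also have "\<dots> = (\<integral>x. zext u x *\<^sub>R grad \<psi> x \<partial>lebesgue) - (\<integral>x. \<phi> n x *\<^sub>R grad \<psi> x \<partial>lebesgue)"
      by (intro Bochner_Integration.integral_diff sqint_mult_integrable su s\<psi> s\<phi>)
    also have "(\<integral>x. zext u x *\<^sub>R grad \<psi> x \<partial>lebesgue) = - (\<integral>x. \<psi> x *\<^sub>R zext g x \<partial>lebesgue)"
      using g(2)[unfolded has_weak_grad_def, rule_format, OF \<psi>] unfolding integral_test_zext[OF \<psi>] .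
    also have "(\<integral>x. \<phi> n x *\<^sub>R grad \<psi> x \<partial>lebesgue) = - (\<integral>x. \<psi> x *\<^sub>R grad (\<phi> n) x \<partial>lebesgue)"
      by (rule integration_by_parts[OF \<phi> \<psi>])
    also have "- (\<integral>x. \<psi> x *\<^sub>R zext g x \<partial>lebesgue) - - (\<integral>x. \<psi> x *\<^sub>R grad (\<phi> n) x \<partial>lebesgue)
        = - ((\<integral>x. \<psi> x *\<^sub>R zext g x \<partial>lebesgue) - (\<integral>x. \<psi> x *\<^sub>R grad (\<phi> n) x \<partial>lebesgue))" by simp
    also have "(\<integral>x. \<psi> x *\<^sub>R zext g x \<partial>lebesgue) - (\<integral>x. \<psi> x *\<^sub>R grad (\<phi> n) x \<partial>lebesgue)
        = (\<integral>x. \<psi> x *\<^sub>R zext g x - \<psi> x *\<^sub>R grad (\<phi> n) x \<partial>lebesgue)"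
      by (intro Bochner_Integration.integral_diff[symmetric] sqint_mult_integrable sg s\<psi> s\<phi>)
    also have "\<dots> = (LINT x|lebesgue_on \<Omega>. \<psi> x *\<^sub>R (g x - grad (\<phi> n) x))"
      unfolding integral_test_zext(1)[OF \<psi>] z by (simp add: scaleR_diff_right)
    finally show "(LINT x|lebesgue_on \<Omega>. (u x - \<phi> n x) *\<^sub>R grad \<psi> x) = - (LINT x|lebesgue_on \<Omega>. \<psi> x *\<^sub>R (g x - grad (\<phi> n) x))" .
  qed
  note w = wgrad_eq[OF L(2) wg]
  have nrm: "H1_norm \<Omega> (\<lambda>x. u x - \<phi> n x) = sqrt ((norm (abs_L2 (\<phi> n) - abs_L2 (zext u)))\<^sup>2 + (norm (abs_L2 (grad (\<phi> n)) - abs_L2 (zext g)))\<^sup>2)" for n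
    unfolding H1_norm_def L2_norm_zext[OF L(1)] L2_norm_zext[OF w(1)] w(3) a by (simp add: norm_minus_commute)
  have "(\<lambda>n. abs_L2 (\<phi> n) - abs_L2 (zext u)) \<longlonglongrightarrow> 0"
    by (rule Lim_null_comparison[OF _ lim]) (auto simp: nrm intro!: always_eventually real_le_rsqrt)
  then have 1: "(\<lambda>n. abs_L2 (\<phi> n)) \<longlonglongrightarrow> abs_L2 (zext u)" by (rule LIM_zero_cancel)
  have "(\<lambda>n. abs_L2 (grad (\<phi> n)) - abs_L2 (zext g)) \<longlonglongrightarrow> 0"
    by (rule Lim_null_comparison[OF _ lim]) (auto simp: nrm intro!: always_eventually real_le_rsqrt)
  then have 2: "(\<lambda>n. abs_L2 (grad (\<phi> n))) \<longlonglongrightarrow> abs_L2 (zext g)" by (rule LIM_zero_cancel)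
  have "(abs_L2 (zext u), abs_L2 (zext g)) \<in> W" by (rule W_I[OF test_fun_in_W[OF \<phi>] 1 2])
  then show "(abs_L2 (zext u), abs_L2 (zext (wgrad \<Omega> u))) \<in> W" unfolding wgrad_eq(3)[OF g] .
qed

subsection \<open>Recovering a function from its gradient\<close>

lemma snd_W_iff: "g \<in> snd ` W \<longleftrightarrow> (\<exists>u. (u, g) \<in> W)"
proof
  assume "g \<in> snd ` W"
  then obtain p where "p \<in> W" "g = snd p" by (rule imageE)
  then show "\<exists>u. (u, g) \<in> W" by (cases p) auto
next
  assume "\<exists>u. (u, g) \<in> W"
  then obtain u where "(u, g) \<in> W" ..
  from imageI[OF this, of snd] show "g \<in> snd ` W" by simp
qed

lemma subspace_snd_W: "subspace (snd ` W)"
  unfolding subspace_def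
proof (intro conjI ballI allI)
  show "0 \<in> snd ` W" using W_zero snd_W_iff by blast
  show "x + y \<in> snd ` W" if xy: "x \<in> snd ` W" "y \<in> snd ` W" for x y
  proof -
    obtain u v where "(u, x) \<in> W" "(v, y) \<in> W" using xy unfolding snd_W_iff by blast
    then have "(u + v, x + y) \<in> W" by (rule W_add)
    then show ?thesis unfolding snd_W_iff by blast
  qed
  show "c *\<^sub>R x \<in> snd ` W" if x: "x \<in> snd ` W" for c x
  proof -
    obtain u where "(u, x) \<in> W" using x unfolding snd_W_iff by blast
    then have "(c *\<^sub>R u, c *\<^sub>R x) \<in> W" by (rule W_scale)
    then show ?thesis unfolding snd_W_iff by blast
  qed
qed

text \<open>By the Poincare inequality convergence of the gradients makes the potentials a Cauchy
  sequence; closedness of the gradients then follows from that of the graph.\<close>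

lemma closed_snd_W: "closed (snd ` W)"
  unfolding closed_sequential_limits
proof (intro allI impI; elim conjE)
  fix g l assume g: "\<forall>n. g n \<in> snd ` W" "g \<longlonglongrightarrow> l"
  then have "\<forall>n. \<exists>u. (u, g n) \<in> W" unfolding snd_W_iff by blast
  then obtain u where u: "\<And>n. (u n, g n) \<in> W" by metis
  have "Cauchy u"
  proof (rule CauchyI)
    fix e :: real assume e: "e > 0"
    define c where "c = 2 * radius + 1"
    have c: "c > 0" using radius(1) by (simp add: c_def)
    have "e / c > 0" using e c by simp
    then obtain M where M: "\<And>m n. m \<ge> M \<Longrightarrow> n \<ge> M \<Longrightarrow> norm (g m - g n) < e / c"
      using CauchyD[OF LIMSEQ_imp_Cauchy[OF g(2)]] by blast
    have "norm (u m - u n) < e" if "m \<ge> M" "n \<ge> M" for m n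
    proof -
      have "norm (u m - u n) \<le> 2 * radius * norm (g m - g n)" by (rule W_poincare[OF W_diff[OF u u]])
      also have "\<dots> \<le> c * norm (g m - g n)" by (intro mult_right_mono) (auto simp: c_def)
      also have "\<dots> < c * (e / c)" using M[OF that] c by (intro mult_strict_left_mono) auto
      finally show ?thesis using c by simp
    qed
    then show "\<exists>M. \<forall>m\<ge>M. \<forall>n\<ge>M. norm (u m - u n) < e" by blast
  qed
  then obtain u' where "u \<longlonglongrightarrow> u'" using Cauchy_convergent convergent_def by blast
  then have "(u', l) \<in> W" by (rule W_I[OF u _ g(2)])
  then show "l \<in> snd ` W" unfolding snd_W_iff by blast
qed

definition W_proj :: "('a, 'a) L2 \<Rightarrow> ('a, real) L2 \<times> ('a, 'a) L2 \<Rightarrow> bool" where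
  "W_proj y ug \<longleftrightarrow> ug \<in> W \<and> (\<forall>k\<in>snd ` W. (y - snd ug) \<bullet> k = 0)"

text \<open>The potential of the orthogonal projection of \<open>y\<close> onto gradients, that is,
  the weak solution of \<open>\<Delta> u = div y\<close> with zero boundary values. It is defined
  for every field, so that functionals of \<open>u\<close> become functionals on a whole Hilbert
  space.\<close>

definition sol :: "('a, 'a) L2 \<Rightarrow> ('a, real) L2" where
  "sol y = fst (SOME ug. W_proj y ug)"

lemma W_proj_exists: "\<exists>ug. W_proj y ug"
proof -
  obtain p where p: "p \<in> snd ` W" "\<forall>k\<in>snd ` W. (y - p) \<bullet> k = 0"
    using orthogonal_projection_exists[OF subspace_snd_W closed_snd_W, of y] by blast
  then obtain u where "(u, p) \<in> W" unfolding snd_W_iff by blast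
  then have "W_proj y (u, p)" unfolding W_proj_def snd_conv using p(2) by blast
  then show ?thesis by blast
qed

lemma W_proj_unique:
  assumes "W_proj y (u, g)" "W_proj y (v, k)"
  shows "u = v" "g = k"
proof -
  have d: "(u - v, g - k) \<in> W" using assms W_diff by (auto simp: W_proj_def)
  then have "g - k \<in> snd ` W" unfolding snd_W_iff by blast
  then have "(y - g) \<bullet> (g - k) = 0" "(y - k) \<bullet> (g - k) = 0" using assms by (auto simp: W_proj_def)
  then have "(g - k) \<bullet> (g - k) = 0" by (simp add: inner_simps)
  then show gk: "g = k" by simp
  have "norm (u - v) \<le> 2 * radius * norm (g - k)" by (rule W_poincare[OF d])
  then show "u = v" using gk by simp
qed

lemma sol_eqI:
  assumes "W_proj y (u, g)" shows "sol y = u"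
proof -
  obtain v k where vk: "(SOME ug. W_proj y ug) = (v, k)" by (rule prod.exhaust)
  from someI[of "W_proj y", OF assms] have "W_proj y (v, k)" unfolding vk .
  from W_proj_unique(1)[OF this assms] show ?thesis unfolding sol_def vk by simp
qed

lemma sol_in_W: "(u, g) \<in> W \<Longrightarrow> sol g = u"
  by (rule sol_eqI[where g = g]) (simp add: W_proj_def)

lemma sol_W: "y \<in> snd ` W \<Longrightarrow> (sol y, y) \<in> W"
  using sol_in_W unfolding snd_W_iff by blast

lemma sol_orthogonal: "(\<And>k. k \<in> snd ` W \<Longrightarrow> y \<bullet> k = 0) \<Longrightarrow> sol y = 0"
  by (rule sol_eqI[where g = 0]) (simp add: W_proj_def W_zero)

lemma sol_proj:
  "\<exists>g. (sol y, g) \<in> W \<and> W_proj y (sol y, g) \<and> norm g \<le> norm y"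
proof -
  obtain u g where p: "W_proj y (u, g)" using W_proj_exists[of y] by auto
  have gW: "(u, g) \<in> W" "g \<in> snd ` W" using p unfolding W_proj_def snd_W_iff by blast+
  then have "(y - g) \<bullet> g = 0" using p by (auto simp: W_proj_def)
  then have "norm g * norm g = y \<bullet> g" by (simp add: inner_diff_left power2_norm_eq_inner flip: power2_eq_square)
  also have "\<dots> \<le> norm y * norm g" by (rule norm_cauchy_schwarz)
  finally have "norm g \<le> norm y" by (cases "norm g = 0") (auto simp: mult_le_cancel_right)
  then show ?thesis using sol_eqI[OF p] p gW by blast
qed

lemma bounded_linear_sol: "bounded_linear sol"
proof (rule bounded_linear_intro[where K = "2 * radius"])
  show "sol (x + y) = sol x + sol y" for x y
  proof -
    obtain g where g: "(sol x, g) \<in> W" "W_proj x (sol x, g)" using sol_proj[of x] by blast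
    obtain k where k: "(sol y, k) \<in> W" "W_proj y (sol y, k)" using sol_proj[of y] by blast
    have e: "(x + y) - (g + k) = (x - g) + (y - k)" by simp
    have "W_proj (x + y) (sol x + sol y, g + k)"
      using g k W_add[OF g(1) k(1)] unfolding W_proj_def snd_conv e inner_add_left by simp
    then show ?thesis by (rule sol_eqI)
  qed
  show "sol (c *\<^sub>R x) = c *\<^sub>R sol x" for c x
  proof -
    obtain g where g: "(sol x, g) \<in> W" "W_proj x (sol x, g)" using sol_proj[of x] by blast
    have e: "c *\<^sub>R x - c *\<^sub>R g = c *\<^sub>R (x - g)" by (simp add: scaleR_diff_right)
    have "W_proj (c *\<^sub>R x) (c *\<^sub>R sol x, c *\<^sub>R g)"
      using g W_scale[OF g(1)] unfolding W_proj_def snd_conv e inner_scaleR_left by simp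
    then show ?thesis by (rule sol_eqI)
  qed
  show "norm (sol x) \<le> norm x * (2 * radius)" for x
  proof -
    obtain g where g: "(sol x, g) \<in> W" "norm g \<le> norm x" using sol_proj[of x] by blast
    have "norm (sol x) \<le> 2 * radius * norm g" by (rule W_poincare[OF g(1)])
    also have "\<dots> \<le> 2 * radius * norm x" using g(2) radius(1) by (intro mult_left_mono) auto
    finally show ?thesis by (simp add: ac_simps)
  qed
qed

text \<open>A vector that sees fields only through \<open>sol\<close> annihilates the orthogonal
  complement of the gradients, where \<open>sol\<close> vanishes, and so equals its own
  projection.\<close>

lemma sol_adjoint_in_snd_W:
  assumes adj: "\<And>x. k \<bullet> x = w \<bullet> sol x"
  shows "k \<in> snd ` W"
proof -
  obtain g where g: "(sol k, g) \<in> W" "W_proj k (sol k, g)" using sol_proj[of k] by blast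
  have gW: "g \<in> snd ` W" using g(1) unfolding snd_W_iff by blast
  have o: "(k - g) \<bullet> x = 0" if "x \<in> snd ` W" for x
    using g(2) that unfolding W_proj_def snd_conv by blast
  have "k \<bullet> (k - g) = 0" unfolding adj using sol_orthogonal[OF o] by simp
  moreover have "g \<bullet> (k - g) = 0" using o[OF gW] by (simp add: inner_commute)
  ultimately have "(k - g) \<bullet> (k - g) = 0" by (simp add: inner_diff_left)
  then show ?thesis using gW by simp
qed

end

section \<open>Rellich's theorem\<close>

lemma sqint_indicator_cball: "sqint (indicat_real (cball a r))"
proof (rule sqint_bound[OF _ integrable_indicator_cball[of 1 a r]])
  show "indicat_real (cball a r) \<in> borel_measurable lebesgue"
    using integrable_indicator_cball[of 1 a r] by simp
qed (auto simp: indicator_def)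

lemma borel_measurable_cball_product:
  fixes \<phi> :: "'a::euclidean_space \<Rightarrow> real"
  assumes \<phi>: "continuous_on UNIV \<phi>"
  shows "(\<lambda>z. indicat_real (cball 0 \<delta>) (snd z) * \<phi> (fst z + snd z)) \<in> borel_measurable (lborel \<Otimes>\<^sub>M lborel)"
    and "(\<lambda>h. indicat_real (cball 0 \<delta>) h * \<phi> (x + h)) \<in> borel_measurable lborel"
    and "(\<lambda>z::'a \<times> 'a. \<phi> (fst z)) \<in> borel_measurable (lborel \<Otimes>\<^sub>M lborel)"
    and "(\<lambda>x. \<phi> x * \<phi> (x + h)) \<in> borel_measurable lborel"
    and "\<phi> \<in> borel_measurable lborel"
proof -
  have i: "indicat_real (cball (0::'a) \<delta>) \<in> borel_measurable borel" by (intro borel_measurable_indicator) simp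
  have s: "(snd :: 'a \<times> 'a \<Rightarrow> 'a) \<in> borel \<rightarrow>\<^sub>M borel"
    by (intro borel_measurable_continuous_onI continuous_intros)
  have p: "continuous_on UNIV (\<lambda>z::'a \<times> 'a. \<phi> (fst z + snd z))"
    by (rule continuous_on_compose2[OF \<phi>]) (auto intro!: continuous_intros)
  have q: "continuous_on UNIV (\<lambda>h. \<phi> (x + h))" "continuous_on UNIV (\<lambda>x. \<phi> (x + h))" for x h
    by (rule continuous_on_compose2[OF \<phi>]; auto intro!: continuous_intros)+
  have r: "continuous_on UNIV (\<lambda>z::'a \<times> 'a. \<phi> (fst z))"
    by (rule continuous_on_compose2[OF \<phi>]) (auto intro!: continuous_intros)
  show "(\<lambda>z. indicat_real (cball 0 \<delta>) (snd z) * \<phi> (fst z + snd z)) \<in> borel_measurable (lborel \<Otimes>\<^sub>M lborel)"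
    unfolding lborel_prod measurable_lborel2 measurable_lborel1
    by (rule borel_measurable_times[OF measurable_compose[OF s i] borel_measurable_continuous_onI[OF p]])
  show "(\<lambda>h. indicat_real (cball 0 \<delta>) h * \<phi> (x + h)) \<in> borel_measurable lborel"
    unfolding measurable_lborel2 measurable_lborel1 by (rule borel_measurable_times[OF i borel_measurable_continuous_onI[OF q(1)]])
  show "(\<lambda>z::'a \<times> 'a. \<phi> (fst z)) \<in> borel_measurable (lborel \<Otimes>\<^sub>M lborel)"
    unfolding lborel_prod measurable_lborel2 measurable_lborel1 by (rule borel_measurable_continuous_onI[OF r])
  show "(\<lambda>x. \<phi> x * \<phi> (x + h)) \<in> borel_measurable lborel"
    unfolding measurable_lborel2 measurable_lborel1
    by (rule borel_measurable_times[OF borel_measurable_continuous_onI[OF \<phi>] borel_measurable_continuous_onI[OF q(2)]])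
  show "\<phi> \<in> borel_measurable lborel"
    unfolding measurable_lborel2 measurable_lborel1 by (rule borel_measurable_continuous_onI[OF \<phi>])
qed

text \<open>An unnormalised mean over the ball of radius \<open>\<delta>\<close> around
  \<open>x\<close>. It is the smoothing operator of the compactness proof: as the pairing with an
  indicator, it turns weak convergence into pointwise convergence.\<close>

definition ball_sum :: "real \<Rightarrow> ('a::euclidean_space \<Rightarrow> real) \<Rightarrow> 'a \<Rightarrow> real" where
  "ball_sum \<delta> \<phi> x = (\<integral>h. indicator (cball 0 \<delta>) h * \<phi> (x + h) \<partial>lborel)"

lemma ball_sum_eq_inner:
  fixes \<phi> :: "'a::euclidean_space \<Rightarrow> real"
  assumes \<phi>: "continuous_on UNIV \<phi>" "sqint \<phi>"
  shows "ball_sum \<delta> \<phi> x = abs_L2 \<phi> \<bullet> abs_L2 (indicat_real (cball x \<delta>))"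
proof -
  have "ball_sum \<delta> \<phi> x = (\<integral>h. indicator (cball 0 \<delta>) h * \<phi> (x + h) \<partial>lebesgue)"
    unfolding ball_sum_def by (rule integral_completion[OF borel_measurable_cball_product(2)[OF \<phi>(1)], symmetric])
  also have "\<dots> = (\<integral>h. indicator (cball x \<delta>) (x + h) * \<phi> (x + h) \<partial>lebesgue)"
    by (rule Bochner_Integration.integral_cong) (auto simp: indicator_def dist_norm)
  also have "\<dots> = (\<integral>z. indicator (cball x \<delta>) z * \<phi> z \<partial>lebesgue)"
    by (rule integral_translation[where f = "\<lambda>z. indicator (cball x \<delta>) z * \<phi> z"])
      (intro borel_measurable_times sqint_measurable[OF sqint_indicator_cball] sqint_measurable[OF \<phi>(2)])
  also have "\<dots> = abs_L2 \<phi> \<bullet> abs_L2 (indicat_real (cball x \<delta>))"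
    unfolding inner_abs_L2[OF \<phi>(2) sqint_indicator_cball] by (simp add: mult.commute)
  finally show ?thesis .
qed

lemma norm_indicator_cball:
  fixes x :: "'a::euclidean_space"
  shows "norm (abs_L2 (indicat_real (cball x \<delta>))) = norm (abs_L2 (indicat_real (cball (0::'a) \<delta>)))"
proof -
  have "shift (- x) (abs_L2 (indicat_real (cball 0 \<delta>))) = abs_L2 (\<lambda>z. indicat_real (cball 0 \<delta>) (- x + z))"
    by (rule shift_abs_L2[OF sqint_indicator_cball])
  also have "(\<lambda>z. indicat_real (cball 0 \<delta>) (- x + z)) = indicat_real (cball x \<delta>)"
    by (auto simp: indicator_def dist_norm norm_minus_commute fun_eq_iff)
  finally show ?thesis using norm_shift[of "- x" "abs_L2 (indicat_real (cball 0 \<delta>))"] by simp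
qed

lemma ball_sum_measurable:
  fixes \<phi> :: "'a::euclidean_space \<Rightarrow> real"
  assumes \<phi>: "continuous_on UNIV \<phi>"
  shows "ball_sum \<delta> \<phi> \<in> borel_measurable lborel"
  unfolding ball_sum_def[abs_def]
  by (rule lborel.borel_measurable_lebesgue_integral)
    (use borel_measurable_cball_product(1)[OF \<phi>] in \<open>simp add: case_prod_beta'\<close>)

text \<open>A function with bounded gradient correlates strongly with its own small translates;
  averaging over translations of length at most \<open>\<delta>\<close> and exchanging the integrals
  bounds its norm by its pairing with the ball sums.\<close>

lemma ball_sum_estimate:
  fixes \<phi> :: "'a::euclidean_space \<Rightarrow> real"
  assumes \<phi>: "test_fun \<Omega> \<phi>" and \<delta>: "\<delta> > 0" and K: "norm (abs_L2 (grad \<phi>)) \<le> K"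
  shows "measure lborel (cball (0::'a) \<delta>) * ((norm (abs_L2 \<phi>))\<^sup>2 - (\<delta> * K)\<^sup>2 / 2)
    \<le> (\<integral>x. \<phi> x * ball_sum \<delta> \<phi> x \<partial>lborel)"
proof -
  define a where "a = abs_L2 \<phi>"
  note sq = test_fun_integrable(2)[OF \<phi>]
  have c\<phi>: "continuous_on UNIV \<phi>" by (rule smooth_continuous[OF test_fun_smooth[OF \<phi>]])
  obtain C where C: "compact C" "\<And>x. x \<notin> C \<Longrightarrow> \<phi> x = 0" using \<phi> by (rule test_funE) blast
  obtain B where B: "B \<ge> 0" "\<And>x. \<bar>\<phi> x\<bar> \<le> B" using test_fun_integrable(1)[OF \<phi>] by blast
  define f where "f x h = indicator (cball 0 \<delta>) h * (\<phi> x * \<phi> (x + h))" for x h :: 'a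
  have fm: "case_prod f \<in> borel_measurable (lborel \<Otimes>\<^sub>M lborel)"
    using borel_measurable_times[OF borel_measurable_cball_product(3)[OF c\<phi>] borel_measurable_cball_product(1)[OF c\<phi>, of \<delta>]]
    by (simp add: f_def case_prod_beta' ac_simps)
  have int: "integrable (lborel \<Otimes>\<^sub>M lborel) (case_prod f)"
  proof (rule Bochner_Integration.integrable_bound[OF _ fm])
    have "compact (C \<times> cball (0::'a) \<delta>)" by (intro compact_Times C compact_cball)
    then have "emeasure lborel (C \<times> cball (0::'a) \<delta>) < \<infinity>" "C \<times> cball (0::'a) \<delta> \<in> sets borel"
      by (rule emeasure_bounded_finite[OF compact_imp_bounded], rule borel_compact)
    then have "integrable lborel (\<lambda>z. (B * B) * indicat_real (C \<times> cball (0::'a) \<delta>) z)"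
      by (intro integrable_mult_right integrable_real_indicator) auto
    then show "integrable (lborel \<Otimes>\<^sub>M lborel) (\<lambda>z. (B * B) * indicat_real (C \<times> cball (0::'a) \<delta>) z)"
      by (simp add: lborel_prod)
    have "\<bar>f x h\<bar> \<le> (B * B) * indicator (C \<times> cball 0 \<delta>) (x, h)" for x h
    proof (cases "x \<in> C \<and> h \<in> cball 0 \<delta>")
      case True
      have "\<bar>\<phi> x\<bar> * \<bar>\<phi> (x + h)\<bar> \<le> B * B" by (intro mult_mono B) auto
      then show ?thesis using True by (simp add: f_def abs_mult)
    next
      case False
      then have "f x h = 0" using C(2)[of x] by (auto simp: f_def)
      then show ?thesis using B(1) by simp
    qed
    then show "AE z in lborel \<Otimes>\<^sub>M lborel. norm (case_prod f z) \<le> norm ((B * B) * indicat_real (C \<times> cball (0::'a) \<delta>) z)"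
      using B(1) by (intro AE_I2) (auto split: prod.split)
  qed
  have inner: "(\<integral>x. f x h \<partial>lborel) = indicator (cball 0 \<delta>) h * (shift h a \<bullet> a)" for h
  proof -
    have "(\<integral>x. \<phi> x * \<phi> (x + h) \<partial>lborel) = (\<integral>x. \<phi> x * \<phi> (x + h) \<partial>lebesgue)"
      by (rule integral_completion[OF borel_measurable_cball_product(4)[OF c\<phi>], symmetric])
    also have "\<dots> = shift h a \<bullet> a"
      unfolding a_def shift_abs_L2[OF sq] inner_abs_L2[OF sqint_translation[OF sq] sq]
      by (simp add: ac_simps)
    finally show ?thesis unfolding f_def by simp
  qed
  \<comment> \<open>Polarisation: shifts preserve the norm, so the inner product is the squared norm
    minus half the squared distance.\<close>
  have low: "(norm a)\<^sup>2 - (\<delta> * K)\<^sup>2 / 2 \<le> shift h a \<bullet> a" if "norm h \<le> \<delta>" for h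
  proof -
    have "norm (shift h a - a) \<le> norm h * norm (abs_L2 (grad \<phi>))"
      unfolding a_def by (rule translation_estimate_test_fun[OF \<phi>])
    also have "\<dots> \<le> \<delta> * K" using that K \<delta> by (intro mult_mono) auto
    finally have "(norm (shift h a - a))\<^sup>2 \<le> (\<delta> * K)\<^sup>2" by (intro power_mono) auto
    moreover have "(norm (shift h a - a))\<^sup>2 = (norm (shift h a))\<^sup>2 - 2 * (shift h a \<bullet> a) + (norm a)\<^sup>2"
      using power2_norm_diff_scaleR[of "shift h a" 1 a] by simp
    ultimately show ?thesis by (simp add: norm_shift)
  qed
  have ii: "integrable lborel (\<lambda>h. indicator (cball (0::'a) \<delta>) h * k)" for k :: real
    using integrable_real_indicator[of "cball (0::'a) \<delta>" lborel] emeasure_compact_finite[OF compact_cball, of "0::'a" \<delta>] by auto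
  have "measure lborel (cball (0::'a) \<delta>) * ((norm a)\<^sup>2 - (\<delta> * K)\<^sup>2 / 2)
      = (\<integral>h. indicator (cball (0::'a) \<delta>) h * ((norm a)\<^sup>2 - (\<delta> * K)\<^sup>2 / 2) \<partial>lborel)" by simp
  also have "\<dots> \<le> (\<integral>h. (\<integral>x. f x h \<partial>lborel) \<partial>lborel)"
  proof (rule integral_mono[OF ii])
    show "integrable lborel (\<lambda>h. \<integral>x. f x h \<partial>lborel)"
      using lborel_pair.integrable_snd[OF int] .
    show "indicator (cball (0::'a) \<delta>) h * ((norm a)\<^sup>2 - (\<delta> * K)\<^sup>2 / 2) \<le> (\<integral>x. f x h \<partial>lborel)" for h
      unfolding inner using low[of h] by (auto simp: indicator_def)
  qed
  also have "\<dots> = (\<integral>x. (\<integral>h. f x h \<partial>lborel) \<partial>lborel)" by (rule lborel_pair.Fubini_integral[OF int])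
  also have "\<dots> = (\<integral>x. \<phi> x * ball_sum \<delta> \<phi> x \<partial>lborel)"
  proof (rule Bochner_Integration.integral_cong[OF refl])
    fix x
    have "(\<integral>h. f x h \<partial>lborel) = (\<integral>h. \<phi> x * (indicator (cball 0 \<delta>) h * \<phi> (x + h)) \<partial>lborel)"
      unfolding f_def by (simp add: ac_simps)
    then show "(\<integral>h. f x h \<partial>lborel) = \<phi> x * ball_sum \<delta> \<phi> x" by (simp add: ball_sum_def)
  qed
  finally show ?thesis by (simp add: a_def)
qed

context bounded_domain
begin

text \<open>For fixed \<open>\<delta>\<close> the ball sums tend to zero pointwise and boundedly, so
  their pairing with the functions tends to zero. The estimate above then bounds the norms up to an
  error of order \<open>\<delta> * K\<close>, and \<open>\<delta>\<close> is arbitrary.\<close>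

lemma rellich_test_fun:
  assumes \<phi>: "\<And>n. test_fun \<Omega> (\<phi> n)" and K: "\<And>n. norm (abs_L2 (grad (\<phi> n))) \<le> K"
    and weak: "\<And>w. (\<lambda>n. abs_L2 (\<phi> n) \<bullet> w) \<longlonglongrightarrow> 0"
  shows "(\<lambda>n. abs_L2 (\<phi> n)) \<longlonglongrightarrow> 0"
proof -
  have K0: "K \<ge> 0" using order_trans[OF norm_ge_zero K[of 0]] .
  define P where "P = 2 * radius * K"
  have P: "norm (abs_L2 (\<phi> n)) \<le> P" for n
  proof -
    have "norm (abs_L2 (\<phi> n)) \<le> 2 * radius * norm (abs_L2 (grad (\<phi> n)))" by (rule poincare_test_fun[OF \<phi> radius(2,1)])
    also have "\<dots> \<le> P" unfolding P_def using radius(1) K by (intro mult_left_mono) auto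
    finally show ?thesis .
  qed
  have lim: "(\<lambda>n. \<integral>x. \<phi> n x * ball_sum \<delta> (\<phi> n) x \<partial>lborel) \<longlonglongrightarrow> 0" for \<delta>
  proof -
    define \<kappa> where "\<kappa> = norm (abs_L2 (indicat_real (cball (0::'a) \<delta>)))"
    \<comment> \<open>Restricting the ball sums to a ball containing the domain makes them square
      integrable; the pairing with functions supported in the domain is unchanged.\<close>
    define s where "s n x = indicat_real (cball 0 radius) x * ball_sum \<delta> (\<phi> n) x" for n x
    have c\<phi>: "continuous_on UNIV (\<phi> n)" for n by (rule smooth_continuous[OF test_fun_smooth[OF \<phi>]])
    note bs = ball_sum_eq_inner[OF c\<phi> test_fun_integrable(2)[OF \<phi>]]
    have sm: "s n \<in> borel_measurable lebesgue" for n
      unfolding s_def[abs_def]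
      by (intro borel_measurable_times sqint_measurable[OF sqint_indicator_cball]
          measurable_completion[OF ball_sum_measurable[OF c\<phi>]])
    have sb: "AE x in lebesgue. (norm (s n x))\<^sup>2 \<le> (P * \<kappa>)\<^sup>2 * indicat_real (cball 0 radius) x" for n
    proof (rule AE_I2)
      fix x
      have "\<bar>ball_sum \<delta> (\<phi> n) x\<bar> \<le> norm (abs_L2 (\<phi> n)) * \<kappa>"
        unfolding bs \<kappa>_def norm_indicator_cball[symmetric, of \<delta> x] by (rule Cauchy_Schwarz_ineq2)
      also have "\<dots> \<le> P * \<kappa>" using P by (intro mult_right_mono) (auto simp: \<kappa>_def)
      finally have "(norm (ball_sum \<delta> (\<phi> n) x))\<^sup>2 \<le> (P * \<kappa>)\<^sup>2" by (intro power_mono) auto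
      then show "(norm (s n x))\<^sup>2 \<le> (P * \<kappa>)\<^sup>2 * indicat_real (cball 0 radius) x"
        by (cases "x \<in> cball 0 radius") (auto simp: s_def)
    qed
    have sl: "AE x in lebesgue. (\<lambda>n. s n x) \<longlonglongrightarrow> 0"
    proof (rule AE_I2)
      fix x
      have "(\<lambda>n. ball_sum \<delta> (\<phi> n) x) \<longlonglongrightarrow> 0" unfolding bs by (rule weak)
      from tendsto_mult_left[OF this, of "indicat_real (cball 0 radius) x"] show "(\<lambda>n. s n x) \<longlonglongrightarrow> 0" by (simp add: s_def)
    qed
    note L = L2_dominated_convergence[OF sm borel_measurable_const integrable_indicator_cball sb sl]
    have eq: "(\<integral>x. \<phi> n x * ball_sum \<delta> (\<phi> n) x \<partial>lborel) = abs_L2 (\<phi> n) \<bullet> abs_L2 (s n)" for n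
    proof -
      have "(\<integral>x. \<phi> n x * ball_sum \<delta> (\<phi> n) x \<partial>lborel) = (\<integral>x. \<phi> n x * ball_sum \<delta> (\<phi> n) x \<partial>lebesgue)"
        by (rule integral_completion[symmetric])
          (intro borel_measurable_times borel_measurable_cball_product(5)[OF c\<phi>] ball_sum_measurable[OF c\<phi>])
      also have "\<dots> = (\<integral>x. \<phi> n x \<bullet> s n x \<partial>lebesgue)"
      proof (rule Bochner_Integration.integral_cong[OF refl])
        fix x show "\<phi> n x * ball_sum \<delta> (\<phi> n) x = \<phi> n x \<bullet> s n x"
          using radius(2) test_fun_outside(1)[OF \<phi>, of x n] by (cases "x \<in> \<Omega>") (auto simp: s_def)
      qed
      also have "\<dots> = abs_L2 (\<phi> n) \<bullet> abs_L2 (s n)"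
        by (rule inner_abs_L2[OF test_fun_integrable(2)[OF \<phi>] L(1), symmetric])
      finally show ?thesis .
    qed
    have s0: "(\<lambda>n. P * norm (abs_L2 (s n))) \<longlonglongrightarrow> 0"
      using tendsto_mult_left[OF tendsto_norm[OF L(3)], of P] by (simp add: abs_L2_zero)
    show ?thesis
      unfolding eq
    proof (rule Lim_null_comparison[OF _ s0], intro always_eventually allI)
      fix n
      have "norm (abs_L2 (\<phi> n) \<bullet> abs_L2 (s n)) \<le> norm (abs_L2 (\<phi> n)) * norm (abs_L2 (s n))"
        using Cauchy_Schwarz_ineq2 by simp
      also have "\<dots> \<le> P * norm (abs_L2 (s n))" using P by (intro mult_right_mono) auto
      finally show "norm (abs_L2 (\<phi> n) \<bullet> abs_L2 (s n)) \<le> P * norm (abs_L2 (s n))" .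
    qed
  qed
  show ?thesis
  proof (rule LIMSEQ_I)
    fix e :: real assume e: "e > 0"
    \<comment> \<open>Makes \<open>(\<delta> * K)\<^sup>2\<close> at most \<open>e\<^sup>2\<close>,
      so that the smoothing error and the vanishing pairing contribute one half of
      \<open>e\<^sup>2\<close> each.\<close>
    define \<delta> where "\<delta> = e / (K + 1)"
    have \<delta>: "\<delta> > 0" using e K0 by (simp add: \<delta>_def)
    have \<delta>K: "(\<delta> * K)\<^sup>2 \<le> e\<^sup>2"
      using e K0 by (intro power_mono) (auto simp: \<delta>_def field_simps)
    define b where "b = measure lborel (cball (0::'a) \<delta>)"
    have b: "b > 0" unfolding b_def using content_cball_pos[OF \<delta>, of "0::'a"] by simp
    have "b * e\<^sup>2 / 2 > 0" using b e by simp
    from LIMSEQ_D[OF lim[of \<delta>] this] obtain N where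
      N: "\<And>n. n \<ge> N \<Longrightarrow> \<bar>\<integral>x. \<phi> n x * ball_sum \<delta> (\<phi> n) x \<partial>lborel\<bar> < b * e\<^sup>2 / 2" by auto
    have "norm (abs_L2 (\<phi> n) - 0) < e" if "n \<ge> N" for n
    proof -
      have "b * ((norm (abs_L2 (\<phi> n)))\<^sup>2 - (\<delta> * K)\<^sup>2 / 2) \<le> (\<integral>x. \<phi> n x * ball_sum \<delta> (\<phi> n) x \<partial>lborel)"
        unfolding b_def by (rule ball_sum_estimate[OF \<phi> \<delta> K])
      also have "\<dots> < b * (e\<^sup>2 / 2)" using N[OF that] by simp
      finally have "(norm (abs_L2 (\<phi> n)))\<^sup>2 - (\<delta> * K)\<^sup>2 / 2 < e\<^sup>2 / 2" using b by (simp add: mult_less_cancel_left)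
      then have "(norm (abs_L2 (\<phi> n)))\<^sup>2 < e\<^sup>2" using \<delta>K by simp
      then show ?thesis using e by (simp add: power2_less_imp_less)
    qed
    then show "\<exists>N. \<forall>n\<ge>N. norm (abs_L2 (\<phi> n) - 0) < e" by blast
  qed
qed

text \<open>Each pair of the graph is replaced by a test function at distance less than 1 / (n + 1),
  with gradient bound \<open>K + 1\<close>; weak convergence to zero survives the
  replacement.\<close>

lemma rellich:
  assumes W: "\<And>n. (v n, g n) \<in> W" and K: "\<And>n. norm (g n) \<le> K"
    and weak: "\<And>w. (\<lambda>n. v n \<bullet> w) \<longlonglongrightarrow> 0"
  shows "v \<longlonglongrightarrow> 0"
proof -
  have "\<exists>\<phi>. test_fun \<Omega> \<phi> \<and> norm (abs_L2 \<phi> - v n) < inverse (real (Suc n)) \<and> norm (abs_L2 (grad \<phi>)) \<le> K + 1" for n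
  proof -
    obtain \<phi> where \<phi>: "\<And>k. test_fun \<Omega> (\<phi> k)" "(\<lambda>k. abs_L2 (\<phi> k)) \<longlonglongrightarrow> v n" "(\<lambda>k. abs_L2 (grad (\<phi> k))) \<longlonglongrightarrow> g n"
      using W_E[OF W[of n]] by blast
    obtain k1 where k1: "\<And>k. k \<ge> k1 \<Longrightarrow> norm (abs_L2 (\<phi> k) - v n) < inverse (real (Suc n))"
      using LIMSEQ_D[OF \<phi>(2), of "inverse (real (Suc n))"] by auto
    obtain k2 where k2: "\<And>k. k \<ge> k2 \<Longrightarrow> norm (abs_L2 (grad (\<phi> k)) - g n) < 1"
      using LIMSEQ_D[OF \<phi>(3), of 1] by auto
    define k where "k = max k1 k2"
    have "norm (abs_L2 (grad (\<phi> k))) \<le> norm (abs_L2 (grad (\<phi> k)) - g n) + norm (g n)"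
      using norm_triangle_sub[of "abs_L2 (grad (\<phi> k))" "g n"] by simp
    also have "\<dots> \<le> K + 1" using k2[of k] K[of n] by (simp add: k_def)
    finally show ?thesis using \<phi>(1)[of k] k1[of k] by (auto simp: k_def)
  qed
  then obtain \<phi> where \<phi>: "\<And>n. test_fun \<Omega> (\<phi> n)" "\<And>n. norm (abs_L2 (\<phi> n) - v n) < inverse (real (Suc n))"
    "\<And>n. norm (abs_L2 (grad (\<phi> n))) \<le> K + 1" by metis
  have d: "(\<lambda>n. abs_L2 (\<phi> n) - v n) \<longlonglongrightarrow> 0"
    by (rule Lim_null_comparison[OF _ LIMSEQ_inverse_real_of_nat])
      (intro always_eventually allI less_imp_le[OF \<phi>(2)])
  have "(\<lambda>n. abs_L2 (\<phi> n) \<bullet> w) \<longlonglongrightarrow> 0" for w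
    using tendsto_add[OF tendsto_inner[OF d tendsto_const[of w]] weak[of w]] by (simp add: inner_diff_left)
  then have "(\<lambda>n. abs_L2 (\<phi> n)) \<longlonglongrightarrow> 0" by (rule rellich_test_fun[OF \<phi>(1,3)])
  from tendsto_diff[OF this d] show ?thesis by simp
qed

end

section \<open>Functions with vanishing weak gradient\<close>

lemma Ck_translate: "Ck k f \<Longrightarrow> Ck k (\<lambda>x. f (a + x))"
proof (induction k arbitrary: f)
  case 0
  then show ?case by (auto intro!: continuous_on_compose2[of UNIV f] continuous_intros)
next
  case (Suc k)
  have "((\<lambda>x. f (a + x)) has_derivative frechet_derivative f (at (a + x))) (at x)" for x
  proof -
    have "((\<lambda>x. a + x) has_derivative (\<lambda>h. h)) (at x)" by (auto intro!: derivative_eq_intros)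
    from has_derivative_compose[OF this Ck_SucD(1)[OF Suc.prems]] show ?thesis .
  qed
  then show ?case by (rule Ck_SucI) (rule Suc.IH[OF Ck_SucD(2)[OF Suc.prems]])
qed

lemma test_fun_translate:
  assumes \<phi>: "test_fun U \<phi>" and sub: "\<And>x. x \<in> U \<Longrightarrow> x - a \<in> \<Omega>"
  shows "test_fun \<Omega> (\<lambda>x. \<phi> (a + x))"
proof -
  obtain C where C: "smooth \<phi>" "compact C" "C \<subseteq> U" "\<And>x. x \<notin> C \<Longrightarrow> \<phi> x = 0"
    using \<phi> by (rule test_funE) blast
  show ?thesis
  proof (rule test_funI[of _ "(\<lambda>x. x - a) ` C"])
    show "smooth (\<lambda>x. \<phi> (a + x))" using C(1) by (simp add: smooth_def Ck_translate)
    show "compact ((\<lambda>x. x - a) ` C)" by (intro compact_continuous_image continuous_intros C(2))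
    show "(\<lambda>x. x - a) ` C \<subseteq> \<Omega>" using sub C(3) by auto
    fix x assume "x \<notin> (\<lambda>x. x - a) ` C"
    then have "a + x \<notin> C" by (metis add_diff_cancel_left' imageI)
    then show "\<phi> (a + x) = 0" by (rule C(4))
  qed
qed

lemma bounded_times_test_fun_integrable:
  fixes \<xi> :: "'a::euclidean_space \<Rightarrow> real"
  assumes "\<xi> \<in> borel_measurable lebesgue" "\<And>x. \<bar>\<xi> x\<bar> \<le> 1" "integrable lebesgue g"
  shows "integrable lebesgue (\<lambda>x. \<xi> x * g x)"
proof (rule Bochner_Integration.integrable_bound[OF assms(3)])
  show "(\<lambda>x. \<xi> x * g x) \<in> borel_measurable lebesgue" using assms by (intro borel_measurable_times) auto
  show "AE x in lebesgue. norm (\<xi> x * g x) \<le> norm (g x)"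
    using assms(2) by (intro AE_I2) (simp add: abs_mult mult_left_le_one_le)
qed

text \<open>As a function of \<open>s\<close>, the integral of \<open>\<xi>\<close> against the test
  function moved along \<open>s *\<^sub>R k\<close> has derivative zero, since that derivative is a
  pairing of \<open>\<xi>\<close> with a directional derivative of a test function. The moved
  functions must therefore be test functions along the whole way.\<close>

lemma zero_weak_grad_translation:
  fixes \<xi> :: "'a::euclidean_space \<Rightarrow> real"
  assumes \<xi>: "\<xi> \<in> borel_measurable lebesgue" "\<And>x. \<bar>\<xi> x\<bar> \<le> 1"
    and zero: "\<And>\<psi> b. test_fun \<Omega> \<psi> \<Longrightarrow> (\<integral>x. \<xi> x * (grad \<psi> x \<bullet> b) \<partial>lebesgue) = 0"
    and \<phi>: "\<And>s. s \<in> {0..1} \<Longrightarrow> test_fun \<Omega> (\<lambda>x. \<phi> (- (s *\<^sub>R k) + x))"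
  shows "(\<integral>x. \<xi> x * \<phi> (- k + x) \<partial>lebesgue) = (\<integral>x. \<xi> x * \<phi> x \<partial>lebesgue)"
proof -
  define I where "I s = (\<integral>x. \<xi> x * \<phi> (- (s *\<^sub>R k) + x) \<partial>lebesgue)" for s
  have "(I has_real_derivative 0) (at s within {0..1})" if s: "s \<in> {0..1}" for s
  proof -
    define \<psi> where "\<psi> x = \<phi> (- (s *\<^sub>R k) + x)" for x
    have \<psi>: "test_fun \<Omega> \<psi>" unfolding \<psi>_def[abs_def] by (rule \<phi>[OF s])
    obtain B r where Br: "\<And>t x. \<bar>t\<bar> \<le> 1 \<Longrightarrow> \<bar>(\<psi> (t *\<^sub>R (- k) + x) - \<psi> x) / t\<bar> \<le> B * indicator (cball 0 r) x"
      using difference_quotient_bound[OF \<psi>, of "- k"] by blast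
    have m: "\<psi> \<in> borel_measurable lebesgue" by (rule sqint_measurable[OF test_fun_integrable(2)[OF \<psi>]])
    have i: "integrable lebesgue (\<lambda>x. \<psi> (h + x))" for h
      using integrable_distr_eq[OF measurable_translation_lebesgue m, of h] test_fun_integrable(3)[OF \<psi>]
      by (simp add: distr_translation_lebesgue)
    have I_eq: "I (s + t) = (\<integral>x. \<xi> x * \<psi> (t *\<^sub>R (- k) + x) \<partial>lebesgue)" for t
      unfolding I_def \<psi>_def by (simp add: algebra_simps)
    have I0: "I s = (\<integral>x. \<xi> x * \<psi> x \<partial>lebesgue)" using I_eq[of 0] by simp
    have quot: "(\<lambda>n. (I (s + X n) - I s) / X n) \<longlonglongrightarrow> 0"
      if X: "\<And>n. X n \<noteq> 0" "X \<longlonglongrightarrow> 0" "\<And>n. \<bar>X n\<bar> \<le> 1" for X :: "nat \<Rightarrow> real"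
    proof -
      have eq: "(I (s + X n) - I s) / X n = (\<integral>x. \<xi> x * ((\<psi> (X n *\<^sub>R (- k) + x) - \<psi> x) / X n) \<partial>lebesgue)" for n
      proof -
        have "I (s + X n) - I s = (\<integral>x. \<xi> x * \<psi> (X n *\<^sub>R (- k) + x) - \<xi> x * \<psi> x \<partial>lebesgue)"
          unfolding I_eq I0
          by (rule Bochner_Integration.integral_diff[OF bounded_times_test_fun_integrable[OF \<xi> i]
                bounded_times_test_fun_integrable[OF \<xi> test_fun_integrable(3)[OF \<psi>]], symmetric])
        then show ?thesis by (simp add: right_diff_distrib[symmetric])
      qed
      have "(\<lambda>n. \<integral>x. \<xi> x * ((\<psi> (X n *\<^sub>R (- k) + x) - \<psi> x) / X n) \<partial>lebesgue) \<longlonglongrightarrow> (\<integral>x. \<xi> x * (grad \<psi> x \<bullet> (- k)) \<partial>lebesgue)"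
      proof (rule integral_dominated_convergence)
        show "integrable lebesgue (\<lambda>x. B * indicat_real (cball 0 r) x)" by (rule integrable_indicator_cball)
        show "AE x in lebesgue. (\<lambda>n. \<xi> x * ((\<psi> (X n *\<^sub>R (- k) + x) - \<psi> x) / X n)) \<longlonglongrightarrow> \<xi> x * (grad \<psi> x \<bullet> (- k))"
          by (intro AE_I2 tendsto_mult_left difference_quotient_tendsto[OF test_fun_smooth[OF \<psi>] X(1,2)])
        show "AE x in lebesgue. norm (\<xi> x * ((\<psi> (X n *\<^sub>R (- k) + x) - \<psi> x) / X n)) \<le> B * indicat_real (cball 0 r) x" for n
        proof (rule AE_I2)
          fix x
          have "\<bar>\<xi> x\<bar> * \<bar>(\<psi> (X n *\<^sub>R (- k) + x) - \<psi> x) / X n\<bar> \<le> 1 * (B * indicat_real (cball 0 r) x)"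
            by (intro mult_mono \<xi>(2) Br X(3)) auto
          then show "norm (\<xi> x * ((\<psi> (X n *\<^sub>R (- k) + x) - \<psi> x) / X n)) \<le> B * indicat_real (cball 0 r) x"
            by (simp only: real_norm_def abs_mult mult_1)
        qed
        show "(\<lambda>x. \<xi> x * ((\<psi> (X n *\<^sub>R (- k) + x) - \<psi> x) / X n)) \<in> borel_measurable lebesgue" for n
          using i[of "X n *\<^sub>R (- k)"] m by (intro borel_measurable_times borel_measurable_divide borel_measurable_diff \<xi>(1)) auto
        show "(\<lambda>x. \<xi> x * (grad \<psi> x \<bullet> (- k))) \<in> borel_measurable lebesgue"
          using test_fun_integrable(6)[OF \<psi>] by (intro borel_measurable_times borel_measurable_inner \<xi>(1)) auto
      qed
      then show ?thesis unfolding eq zero[OF \<psi>] .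
    qed
    have "((\<lambda>t. (I (s + t) - I s) / t) \<longlongrightarrow> 0) (at 0)"
      unfolding tendsto_at_iff_sequentially
    proof (intro allI impI)
      fix X :: "nat \<Rightarrow> real" assume X: "\<forall>i. X i \<in> UNIV - {0}" "X \<longlonglongrightarrow> 0"
      obtain N where N: "\<And>n. n \<ge> N \<Longrightarrow> \<bar>X n\<bar> < 1" using LIMSEQ_D[OF X(2), of 1] by auto
      have "(\<lambda>n. (I (s + X (n + N)) - I s) / X (n + N)) \<longlonglongrightarrow> 0"
        using X N by (intro quot LIMSEQ_ignore_initial_segment) (auto intro: less_imp_le)
      from LIMSEQ_offset[OF this] show "((\<lambda>t. (I (s + t) - I s) / t) \<circ> X) \<longlonglongrightarrow> 0" by (simp add: o_def)
    qed
    then have "(I has_real_derivative 0) (at s)" by (simp add: DERIV_def)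
    then show ?thesis by (rule has_field_derivative_at_within)
  qed
  from has_field_derivative_zero_constant[OF convex_real_interval(5) this] have "I 1 = I 0" by force
  then show ?thesis by (simp add: I_def)
qed

text \<open>Test functions of the ball of radius \<open>r\<close> stay in the doubled ball when
  moved by less than \<open>r\<close>; the fundamental lemma turns the equality of the integrals
  into one almost everywhere.\<close>

lemma zero_weak_grad_translation_invariant:
  fixes \<xi> :: "'a::euclidean_space \<Rightarrow> real"
  assumes \<xi>: "\<xi> \<in> borel_measurable lebesgue" "\<And>x. \<bar>\<xi> x\<bar> \<le> 1"
    and zero: "\<And>\<psi> b. test_fun \<Omega> \<psi> \<Longrightarrow> (\<integral>x. \<xi> x * (grad \<psi> x \<bullet> b) \<partial>lebesgue) = 0"
    and ball: "ball x0 (2 * r) \<subseteq> \<Omega>" and h: "norm h < r"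
  shows "AE x in lebesgue. x \<in> ball x0 r \<longrightarrow> \<xi> (h + x) = \<xi> x"
proof -
  define d where "d x = indicat_real (ball x0 r) x * (\<xi> (h + x) - \<xi> x)" for x
  have m: "(\<lambda>x. \<xi> (h + x)) \<in> borel_measurable lebesgue"
    using measurable_comp[OF measurable_translation_lebesgue \<xi>(1), of h] by (simp add: o_def)
  have dm: "d \<in> borel_measurable lebesgue" unfolding d_def[abs_def]
    by (intro borel_measurable_times borel_measurable_indicator borel_measurable_diff m \<xi>(1)) simp
  have ind: "integrable lebesgue (\<lambda>x. 2 * indicat_real (ball x0 r) x)"
    using lmeasurable_ball[of x0 r]
    by (intro integrable_mult_right integrable_real_indicator) (auto simp: fmeasurable_def)
  have di: "integrable lebesgue d"
  proof (rule Bochner_Integration.integrable_bound[OF ind dm])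
    have "\<bar>\<xi> (h + x) - \<xi> x\<bar> \<le> 2" for x using \<xi>(2)[of "h + x"] \<xi>(2)[of x] by linarith
    then show "AE x in lebesgue. norm (d x) \<le> norm (2 * indicat_real (ball x0 r) x)"
      by (intro AE_I2) (auto simp: d_def indicator_def)
  qed
  have "AE x in lebesgue. x \<in> ball x0 r \<longrightarrow> d x = 0"
  proof (rule fundamental_lemma[OF open_ball di])
    fix \<phi> assume \<phi>: "test_fun (ball x0 r) \<phi>"
    note i\<phi> = test_fun_integrable(3)[OF \<phi>]
    have tr: "test_fun \<Omega> (\<lambda>x. \<phi> (- (s *\<^sub>R h) + x))" if s: "s \<in> {0..1}" for s
    proof (rule test_fun_translate[OF \<phi>])
      fix x assume x: "x \<in> ball x0 r"
      have "norm (s *\<^sub>R h) \<le> norm h" using s by (simp add: mult_left_le_one_le)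
      then have "dist x0 (x - - (s *\<^sub>R h)) < 2 * r"
        using x h norm_triangle_ineq[of "x - x0" "s *\<^sub>R h"] by (simp add: dist_norm norm_minus_commute algebra_simps)
      then show "x - - (s *\<^sub>R h) \<in> \<Omega>" using ball by auto
    qed
    have "(\<integral>x. \<phi> x * \<xi> (h + x) \<partial>lebesgue) = (\<integral>x. \<phi> (- h + (h + x)) * \<xi> (h + x) \<partial>lebesgue)" by simp
    also have "\<dots> = (\<integral>x. \<phi> (- h + x) * \<xi> x \<partial>lebesgue)"
    proof (rule integral_translation)
      show "(\<lambda>x. \<phi> (- h + x) * \<xi> x) \<in> borel_measurable lebesgue"
        using test_fun_integrable(3)[OF tr[of 1]] \<xi>(1) by (intro borel_measurable_times) auto
    qed
    also have "\<dots> = (\<integral>x. \<xi> x * \<phi> x \<partial>lebesgue)"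
    proof -
      have "(\<integral>x. \<xi> x * \<phi> (- h + x) \<partial>lebesgue) = (\<integral>x. \<xi> x * \<phi> x \<partial>lebesgue)"
        by (rule zero_weak_grad_translation[OF \<xi>]) (rule zero tr; assumption)+
      then show ?thesis by (simp only: mult.commute)
    qed
    finally have eq: "(\<integral>x. \<phi> x * \<xi> (h + x) \<partial>lebesgue) = (\<integral>x. \<phi> x * \<xi> x \<partial>lebesgue)" by (simp add: mult.commute)
    have i1: "integrable lebesgue (\<lambda>x. \<phi> x * \<xi> (h + x))"
      using bounded_times_test_fun_integrable[OF m \<xi>(2) i\<phi>] by (simp add: mult.commute)
    have i2: "integrable lebesgue (\<lambda>x. \<phi> x * \<xi> x)"
      using bounded_times_test_fun_integrable[OF \<xi> i\<phi>] by (simp add: mult.commute)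
    have "(\<lambda>x. \<phi> x * d x) = (\<lambda>x. \<phi> x * \<xi> (h + x) - \<phi> x * \<xi> x)"
    proof
      fix x show "\<phi> x * d x = \<phi> x * \<xi> (h + x) - \<phi> x * \<xi> x"
        using test_fun_outside(1)[OF \<phi>, of x] by (cases "x \<in> ball x0 r") (simp_all add: d_def right_diff_distrib)
    qed
    then show "(\<integral>x. \<phi> x * d x \<partial>lebesgue) = 0"
      using Bochner_Integration.integral_diff[OF i1 i2] eq by simp
  qed
  then show ?thesis by eventually_elim (simp add: d_def)
qed

text \<open>Invariance holds for every \<open>h\<close> and almost every \<open>x\<close>.
  Exchanging the quantifiers yields a single point \<open>x\<close> for which \<open>\<xi>\<close>
  agrees at almost every neighbour with its value there. Half the radius keeps differences of points
  below \<open>r\<close>.\<close>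

lemma zero_weak_grad_locally_const:
  fixes \<xi> :: "'a::euclidean_space \<Rightarrow> real"
  assumes \<xi>: "\<xi> \<in> borel_measurable lebesgue" "\<And>x. \<bar>\<xi> x\<bar> \<le> 1"
    and zero: "\<And>\<psi> b. test_fun \<Omega> \<psi> \<Longrightarrow> (\<integral>x. \<xi> x * (grad \<psi> x \<bullet> b) \<partial>lebesgue) = 0"
    and ball: "ball x0 (2 * r) \<subseteq> \<Omega>" and r: "r > 0"
  shows "\<exists>c. AE x in lebesgue. x \<in> ball x0 (r / 2) \<longrightarrow> \<xi> x = c"
proof -
  \<comment> \<open>A Borel representative makes the good set measurable in the product space, as
    the exchange of quantifiers requires.\<close>
  obtain \<xi>' where \<xi>'m: "\<xi>' \<in> borel_measurable lborel" and ae: "AE x in lborel. \<xi> x = \<xi>' x"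
    using completion_ex_borel_measurable_real[OF \<xi>(1)] by blast
  have aeL: "AE x in lebesgue. \<xi> x = \<xi>' x" by (rule AE_completion[OF ae])
  have [measurable]: "\<xi>' \<in> borel_measurable borel" using \<xi>'m by simp
  define P where "P x h \<longleftrightarrow> (x \<in> ball x0 r \<and> norm h < r \<longrightarrow> \<xi>' (h + x) = \<xi>' x)" for x h :: 'a
  have "AE x in lborel. P x h" for h
  proof (cases "norm h < r")
    case True
    have inv: "AE x in lebesgue. x \<in> ball x0 r \<longrightarrow> \<xi> (h + x) = \<xi> x"
      by (rule zero_weak_grad_translation_invariant[OF \<xi> _ ball True]) (rule zero)
    have "AE x in lebesgue. P x h"
      using inv aeL AE_translation[OF aeL, of h]
      by eventually_elim (auto simp: P_def)
    then show ?thesis by (simp add: AE_completion_iff)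
  qed (simp add: P_def)
  moreover have "{z \<in> space (lborel \<Otimes>\<^sub>M lborel). P (fst z) (snd z)} \<in> sets (lborel \<Otimes>\<^sub>M lborel)"
  proof -
    have m1: "(\<lambda>z::'a \<times> 'a. \<xi>' (snd z + fst z)) \<in> borel_measurable borel" "(\<lambda>z::'a \<times> 'a. \<xi>' (fst z)) \<in> borel_measurable borel"
      by (rule measurable_compose[of _ borel borel];
          auto intro!: borel_measurable_continuous_onI continuous_intros)+
    have m2: "{z::'a \<times> 'a. dist x0 (fst z) < r \<and> norm (snd z) < r} \<in> sets borel"
      by (intro borel_open open_Collect_conj open_Collect_less continuous_intros)
    have m3: "{z::'a \<times> 'a. \<xi>' (snd z + fst z) = \<xi>' (fst z)} \<in> sets borel"
      using borel_measurable_eq[OF m1] by simp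
    have "{z::'a \<times> 'a. P (fst z) (snd z)} = - {z. dist x0 (fst z) < r \<and> norm (snd z) < r} \<union> {z. \<xi>' (snd z + fst z) = \<xi>' (fst z)}"
      by (auto simp: P_def)
    also have "\<dots> \<in> sets borel" by (intro sets.Un borel_comp m2 m3)
    finally show ?thesis unfolding lborel_prod by simp
  qed
  ultimately have aeP: "AE x in lborel. AE h in lborel. P x h"
    using lborel_pair.AE_commute[of P] by simp
  have "\<exists>x. x \<in> ball x0 (r / 2) \<and> (AE h in lborel. P x h)"
  proof (rule ccontr)
    assume "\<not> ?thesis"
    then have "AE x in lborel. x \<notin> ball x0 (r / 2)" using aeP by (auto elim!: eventually_mono)
    then have "emeasure lborel (ball x0 (r / 2)) = 0"
      by (subst (asm) AE_iff_measurable[of "ball x0 (r / 2)"]) auto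
    then show False using content_ball_pos[of "r / 2" x0] r by (simp add: measure_def)
  qed
  then obtain x where x: "x \<in> ball x0 (r / 2)" "AE h in lborel. P x h" by blast
  have "AE y in lebesgue. P x (- x + y)" by (rule AE_translation[OF AE_completion[OF x(2)]])
  then have "AE y in lebesgue. y \<in> ball x0 (r / 2) \<longrightarrow> \<xi> y = \<xi>' x"
    using aeL
  proof eventually_elim
    case (elim y)
    show ?case
    proof
      assume y: "y \<in> ball x0 (r / 2)"
      have "norm (- x + y) \<le> dist x x0 + dist x0 y"
        using dist_triangle[of x y x0] by (simp add: dist_norm norm_minus_commute)
      then have "norm (- x + y) < r" using x(1) y by (simp add: dist_commute)
      moreover have "x \<in> ball x0 r" using x(1) r by simp
      ultimately show "\<xi> y = \<xi>' x" using elim by (simp add: P_def)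
    qed
  qed
  then show ?thesis by blast
qed

text \<open>The union of the open sets on which \<open>\<xi>\<close> has the value of a first
  neighbourhood and the union of those with another constant value are disjoint and cover the
  domain, so connectedness leaves only the first. Lindelof's theorem keeps the union of exceptional
  sets null.\<close>

lemma zero_weak_grad_const:
  fixes \<xi> :: "'a::euclidean_space \<Rightarrow> real"
  assumes \<Omega>: "open \<Omega>" "connected \<Omega>"
    and \<xi>: "\<xi> \<in> borel_measurable lebesgue" "\<And>x. \<bar>\<xi> x\<bar> \<le> 1"
    and zero: "\<And>\<psi> b. test_fun \<Omega> \<psi> \<Longrightarrow> (\<integral>x. \<xi> x * (grad \<psi> x \<bullet> b) \<partial>lebesgue) = 0"
  shows "\<exists>c. AE x in lebesgue. x \<in> \<Omega> \<longrightarrow> \<xi> x = c"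
proof (cases "\<Omega> = {}")
  case False
  then obtain x0 where x0: "x0 \<in> \<Omega>" by blast
  define Q where "Q c U \<longleftrightarrow> open U \<and> (AE x in lebesgue. x \<in> U \<longrightarrow> \<xi> x = c)" for c U
  have loc: "\<exists>c U. x \<in> U \<and> Q c U" if x: "x \<in> \<Omega>" for x
  proof -
    obtain e where e: "e > 0" "ball x e \<subseteq> \<Omega>" using \<Omega>(1) x open_contains_ball by blast
    have "\<exists>c. AE y in lebesgue. y \<in> ball x (e / 2 / 2) \<longrightarrow> \<xi> y = c"
      by (rule zero_weak_grad_locally_const[OF \<xi>, of \<Omega>]) (rule zero, use e in auto)
    then obtain c where "AE y in lebesgue. y \<in> ball x (e / 2 / 2) \<longrightarrow> \<xi> y = c" ..
    then have "x \<in> ball x (e / 2 / 2) \<and> Q c (ball x (e / 2 / 2))" using e by (simp add: Q_def)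
    then show ?thesis by blast
  qed
  obtain c U0 where c: "x0 \<in> U0" "Q c U0" using loc[OF x0] by blast
  define A where "A = \<Union>{U. Q c U}"
  define A' where "A' = \<Union>{U. \<exists>c'. c' \<noteq> c \<and> Q c' U}"
  have op: "open A" "open A'" unfolding A_def A'_def by (auto simp: Q_def)
  have "A \<inter> A' = {}"
  proof (rule ccontr)
    assume "A \<inter> A' \<noteq> {}"
    then obtain x U V c' where x: "x \<in> U \<inter> V" "Q c U" "Q c' V" "c' \<noteq> c" by (auto simp: A_def A'_def)
    then have UV: "open (U \<inter> V)" by (auto simp: Q_def)
    have "AE y in lebesgue. y \<in> U \<longrightarrow> \<xi> y = c" "AE y in lebesgue. y \<in> V \<longrightarrow> \<xi> y = c'" using x(2,3) by (auto simp: Q_def)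
    then have "AE y in lebesgue. y \<notin> U \<inter> V" by eventually_elim (use x(4) in auto)
    then have "AE y in lborel. y \<notin> U \<inter> V" by (simp add: AE_completion_iff)
    then have "emeasure lborel (U \<inter> V) = 0"
      using UV by (subst (asm) AE_iff_measurable[of "U \<inter> V"]) auto
    moreover obtain e where e: "e > 0" "ball x e \<subseteq> U \<inter> V" using UV x(1) open_contains_ball by blast
    ultimately have "emeasure lborel (ball x e) = 0"
      using emeasure_mono[OF e(2), of lborel] UV by (simp add: borel_open)
    then show False using content_ball_pos[of e x] e by (simp add: measure_def)
  qed
  moreover have "\<Omega> \<subseteq> A \<union> A'"
  proof
    fix x assume "x \<in> \<Omega>"
    from loc[OF this] obtain c' U where "x \<in> U" "Q c' U" by blast
    then show "x \<in> A \<union> A'" by (cases "c' = c") (auto simp: A_def A'_def)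
  qed
  ultimately have "A \<inter> \<Omega> = {} \<or> A' \<inter> \<Omega> = {}" by (intro connectedD[OF \<Omega>(2) op]) auto
  moreover have "x0 \<in> A \<inter> \<Omega>" using c x0 by (auto simp: A_def)
  ultimately have "\<Omega> \<subseteq> A" using \<open>\<Omega> \<subseteq> A \<union> A'\<close> by blast
  obtain F where F: "F \<subseteq> {U. Q c U}" "countable F" "\<Union>F = A"
    using Lindelof[of "{U. Q c U}"] unfolding A_def Q_def by (metis (no_types, lifting) mem_Collect_eq)
  have "AE x in lebesgue. \<forall>U\<in>F. x \<in> U \<longrightarrow> \<xi> x = c"
    using F(1) by (subst AE_ball_countable[OF F(2)]) (auto simp: Q_def)
  then have "AE x in lebesgue. x \<in> \<Omega> \<longrightarrow> \<xi> x = c"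
    by eventually_elim (use F(3) \<open>\<Omega> \<subseteq> A\<close> in blast)
  then show ?thesis by blast
qed simp

section \<open>Strict positivity\<close>

text \<open>The derivative is a polynomial in \<open>t\<close> and \<open>q t\<close>, so smoothness
  follows by induction on the order.\<close>

lemma smooth_inverse_sqrt:
  assumes \<epsilon>: "\<epsilon> > (0::real)"
  defines "q \<equiv> \<lambda>t. 1 / sqrt (t\<^sup>2 + \<epsilon>\<^sup>2)"
  shows "(q has_real_derivative - (t * (q t * (q t * q t)))) (at t)" "smooth q"
proof -
  have pos: "t\<^sup>2 + \<epsilon>\<^sup>2 > 0" for t using \<epsilon> by (simp add: add_nonneg_pos)
  show d: "(q has_real_derivative - (t * (q t * (q t * q t)))) (at t)" for t
  proof -
    define s where "s = sqrt (t\<^sup>2 + \<epsilon>\<^sup>2)"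
    have s: "s > 0" using pos by (simp add: s_def)
    have "((\<lambda>t. sqrt (t\<^sup>2 + \<epsilon>\<^sup>2)) has_real_derivative t / s) (at t)"
      using pos[of t] \<epsilon> by (auto intro!: derivative_eq_intros simp: s_def divide_simps)
    then have "((\<lambda>t. inverse (sqrt (t\<^sup>2 + \<epsilon>\<^sup>2))) has_real_derivative - (inverse s * (t / s) * inverse s)) (at t)"
      unfolding s_def by (rule DERIV_inverse') (use s[unfolded s_def] in linarith)
    then show ?thesis unfolding q_def s_def[symmetric] by (simp add: divide_inverse s_def[symmetric] ac_simps)
  qed
  have "Ck k q" for k
  proof (induction k)
    case 0
    show ?case by (auto intro!: continuous_at_imp_continuous_on DERIV_isCont[OF d])
  next
    case (Suc k)
    have "Ck k (\<lambda>t. (-1) * (t * (q t * (q t * q t))))"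
      using Ck_inner[of k "1::real"] by (intro Ck_mult Ck_const Suc) simp
    then show ?case by (intro Ck_real_SucI[OF d]) simp
  qed
  then show "smooth q" by (simp add: smooth_def)
qed

section \<open>Logarithmic gradient estimates and the strong maximum principle\<close>

context bounded_domain
begin

lemma sqint_indicator_\<Omega>: "sqint (indicat_real \<Omega>)"
proof (rule sqint_bound[OF _ integrable_indicator_\<Omega>[of 1]])
  show "indicat_real \<Omega> \<in> borel_measurable lebesgue" by (rule borel_measurable_indicator[OF \<Omega>_lebesgue])
qed (auto simp: indicator_def)

text \<open>The mean of a gradient is its pairing with the field that equals \<open>b\<close> on the
  domain, and this pairing is zero for test functions and continuous.\<close>

lemma W_integral_eq_0:
  assumes W: "(v, k) \<in> W"
  shows "(\<integral>x. rep_L2 k x \<bullet> b \<partial>lebesgue) = 0"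
proof -
  have s: "sqint (\<lambda>x. indicat_real \<Omega> x *\<^sub>R b)"
  proof (rule sqint_bound[OF _ integrable_indicator_\<Omega>[of "(norm b)\<^sup>2"]])
    show "(\<lambda>x. indicat_real \<Omega> x *\<^sub>R b) \<in> borel_measurable lebesgue"
      by (intro borel_measurable_scaleR borel_measurable_indicator \<Omega>_lebesgue borel_measurable_const)
  qed (auto simp: indicator_def)
  obtain \<phi> where \<phi>: "\<And>n. test_fun \<Omega> (\<phi> n)" "(\<lambda>n. abs_L2 (grad (\<phi> n))) \<longlonglongrightarrow> k"
    using W_E[OF W] by blast
  have z: "abs_L2 (grad (\<phi> n)) \<bullet> abs_L2 (\<lambda>x. indicat_real \<Omega> x *\<^sub>R b) = 0" for n
  proof -
    have "abs_L2 (grad (\<phi> n)) \<bullet> abs_L2 (\<lambda>x. indicat_real \<Omega> x *\<^sub>R b) = (\<integral>x. grad (\<phi> n) x \<bullet> b \<partial>lebesgue)"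
      unfolding inner_abs_L2[OF test_fun_integrable(5)[OF \<phi>(1)] s]
      by (rule Bochner_Integration.integral_cong[OF refl]) (auto simp: indicator_def test_fun_outside[OF \<phi>(1)])
    also have "\<dots> = (\<integral>x. grad (\<phi> n) x \<partial>lebesgue) \<bullet> b"
      by (rule integral_inner_left) (intro test_fun_integrable(6)[OF \<phi>(1)])
    also have "\<dots> = 0" by (simp add: integral_grad_eq_0[OF \<phi>(1)])
    finally show ?thesis .
  qed
  have "k \<bullet> abs_L2 (\<lambda>x. indicat_real \<Omega> x *\<^sub>R b) = 0"
    using LIMSEQ_unique[OF tendsto_inner[OF \<phi>(2) tendsto_const, of "abs_L2 (\<lambda>x. indicat_real \<Omega> x *\<^sub>R b)", unfolded z] tendsto_const] .
  moreover have "k \<bullet> abs_L2 (\<lambda>x. indicat_real \<Omega> x *\<^sub>R b) = (\<integral>x. rep_L2 k x \<bullet> (indicat_real \<Omega> x *\<^sub>R b) \<partial>lebesgue)"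
    using inner_abs_L2[OF sqint_rep[of k] s] by (simp add: abs_rep_L2)
  moreover have "\<dots> = (\<integral>x. rep_L2 k x \<bullet> b \<partial>lebesgue)"
  proof (rule integral_cong_AE)
    show "AE x in lebesgue. rep_L2 k x \<bullet> (indicat_real \<Omega> x *\<^sub>R b) = rep_L2 k x \<bullet> b"
      using W_support(2)[OF W] by eventually_elim (auto simp: indicator_def)
    show "(\<lambda>x. rep_L2 k x \<bullet> (indicat_real \<Omega> x *\<^sub>R b)) \<in> borel_measurable lebesgue"
      "(\<lambda>x. rep_L2 k x \<bullet> b) \<in> borel_measurable lebesgue"
      by (intro borel_measurable_inner sqint_measurable[OF sqint_rep] sqint_measurable[OF s] borel_measurable_const)+
  qed
  ultimately show ?thesis by simp
qed

text \<open>Testing with \<open>\<phi>\<^sup>2 / (u + sqrt (u\<^sup>2 + \<epsilon>\<^sup>2))\<close>, a smooth substitute for \<open>\<phi>\<^sup>2 / (u + \<epsilon>)\<close>, bounds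
  the gradient of \<open>ln (u + \<epsilon>)\<close> locally, uniformly in \<open>\<epsilon>\<close>.\<close>

lemma log_gradient_estimate:
  assumes W: "(w, g) \<in> W"
    and super: "\<forall>v k. (v, k) \<in> W \<longrightarrow> (AE x in lebesgue. rep_L2 v x \<ge> 0) \<longrightarrow> g \<bullet> k \<ge> 0"
    and nonneg: "AE x in lebesgue. rep_L2 w x \<ge> 0"
    and \<phi>: "test_fun \<Omega> \<phi>" and \<epsilon>: "\<epsilon> > 0"
  defines "X \<equiv> \<lambda>x. (\<phi> x)\<^sup>2 * (norm (rep_L2 g x))\<^sup>2 / ((rep_L2 w x)\<^sup>2 + \<epsilon>\<^sup>2)"
  shows "integrable lebesgue X" "(\<integral>x. X x \<partial>lebesgue) \<le> 16 * (\<integral>x. (norm (grad \<phi> x))\<^sup>2 \<partial>lebesgue)"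
proof -
  define q where "q = (\<lambda>t. 1 / sqrt (t\<^sup>2 + \<epsilon>\<^sup>2))"
  have pos: "t\<^sup>2 + \<epsilon>\<^sup>2 > 0" for t using \<epsilon> by (simp add: add_nonneg_pos)
  have q: "(q has_real_derivative - (t * (q t * (q t * q t)))) (at t)" "smooth q" for t
    unfolding q_def using smooth_inverse_sqrt[OF \<epsilon>] by blast+
  have qpos: "q t > 0" for t using pos[of t] by (simp add: q_def)
  have q2: "(t\<^sup>2 + \<epsilon>\<^sup>2) * (q t * q t) = 1" for t using pos[of t] \<epsilon> by (simp add: q_def)
  have tq: "\<bar>t * q t\<bar> \<le> 1" for t
    using pos[of t] \<epsilon> by (simp add: q_def abs_mult divide_le_eq real_le_rsqrt)
  \<comment> \<open>Here \<open>(t\<^sup>2 + \<epsilon>\<^sup>2) * q t\<close> is the square root of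
    \<open>t\<^sup>2 + \<epsilon>\<^sup>2\<close>, so after rationalising the numerator this is the
    reciprocal of \<open>t\<close> plus that root. The form chosen divides only by a constant, and
    smoothness is inherited from \<open>q\<close>.\<close>
  define h where "h t = ((t\<^sup>2 + \<epsilon>\<^sup>2) * q t - t) / \<epsilon>\<^sup>2" for t
  define h' where "h' t = (t * q t - 1) / \<epsilon>\<^sup>2" for t
  have hd: "(h has_real_derivative h' t) (at t)" for t
  proof -
    have "((\<lambda>t. ((t\<^sup>2 + \<epsilon>\<^sup>2) * q t - t) / \<epsilon>\<^sup>2) has_real_derivative
        (2 * t * q t + (t\<^sup>2 + \<epsilon>\<^sup>2) * - (t * (q t * (q t * q t))) - 1) / \<epsilon>\<^sup>2) (at t)"
      by (rule DERIV_cdivide) (auto intro!: derivative_eq_intros q(1) simp: algebra_simps)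
    moreover have "(t\<^sup>2 + \<epsilon>\<^sup>2) * - (t * (q t * (q t * q t))) = - (t * q t) * ((t\<^sup>2 + \<epsilon>\<^sup>2) * (q t * q t))"
      by (simp only: mult_minus_left mult_minus_right ac_simps)
    then have "(t\<^sup>2 + \<epsilon>\<^sup>2) * - (t * (q t * (q t * q t))) = - (t * q t)" unfolding q2 by simp
    ultimately have "((\<lambda>t. ((t\<^sup>2 + \<epsilon>\<^sup>2) * q t - t) / \<epsilon>\<^sup>2) has_real_derivative (2 * t * q t + - (t * q t) - 1) / \<epsilon>\<^sup>2) (at t)"
      by (simp only:)
    then show ?thesis by (simp add: h_def[abs_def] h'_def)
  qed
  have hs: "smooth h"
  proof -
    have "smooth (\<lambda>t. ((t * t + \<epsilon>\<^sup>2) * q t - t) * (1 / \<epsilon>\<^sup>2))"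
      by (intro smooth_mult smooth_diff smooth_add smooth_ident smooth_const q(2))
    then show ?thesis by (simp add: h_def[abs_def] power2_eq_square)
  qed
  have hb: "\<bar>h' t\<bar> \<le> 2 / \<epsilon>\<^sup>2" for t
  proof -
    have "\<bar>t * q t - 1\<bar> \<le> 2" using tq[of t] by linarith
    then show ?thesis using \<epsilon> by (simp add: h'_def abs_divide divide_right_mono)
  qed
  \<comment> \<open>With \<open>s\<close> the square root, \<open>h t = 1 / (s + t)\<close> and
    \<open>- h' t = 1 / (s * (s + t))\<close>. For \<open>t \<ge> 0\<close> the sum
    \<open>s + t\<close> lies between \<open>s\<close> and \<open>2 * s\<close>, which gives both
    comparisons with \<open>q t = 1 / s\<close>.\<close>
  have h_pos: "0 \<le> h t \<and> h t \<le> q t \<and> (q t)\<^sup>2 / 2 \<le> - h' t" if t: "t \<ge> 0" for t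
  proof -
    define s where "s = sqrt (t\<^sup>2 + \<epsilon>\<^sup>2)"
    have s: "s > 0" "s\<^sup>2 = t\<^sup>2 + \<epsilon>\<^sup>2" using pos[of t] by (auto simp: s_def)
    have st: "t \<le> s" unfolding s_def by (rule real_le_rsqrt) simp
    have e: "\<epsilon>\<^sup>2 = (s - t) * (s + t)" using s(2) by (simp add: power2_eq_square algebra_simps)
    have sp: "s + t > 0" using s t by simp
    have snt: "s - t > 0" 
    proof -
      have "(s - t) * (s + t) > 0" unfolding e[symmetric] using \<epsilon> by simp
      then show ?thesis using sp by (simp add: zero_less_mult_iff)
    qed
    have qs: "q t = 1 / s" by (simp add: q_def s_def)
    have "h t = (s - t) / \<epsilon>\<^sup>2" unfolding h_def s(2)[symmetric] qs using s(1) by (simp add: power2_eq_square)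
    also have "\<dots> = 1 / (s + t)" unfolding e using snt by simp
    finally have ht: "h t = 1 / (s + t)" .
    have "- h' t = (1 - t / s) / \<epsilon>\<^sup>2" unfolding h'_def qs by (simp add: divide_simps)
    also have "1 - t / s = (s - t) / s" using s(1) by (simp add: field_simps)
    also have "(s - t) / s / \<epsilon>\<^sup>2 = 1 / (s * (s + t))" unfolding e using snt by simp
    finally have h't: "- h' t = 1 / (s * (s + t))" .
    have "(q t)\<^sup>2 / 2 = 1 / (s * (2 * s))" unfolding qs by (simp add: power2_eq_square)
    also have "\<dots> \<le> 1 / (s * (s + t))" using s(1) st sp by (intro divide_left_mono mult_left_mono mult_pos_pos) auto
    finally have "(q t)\<^sup>2 / 2 \<le> - h' t" unfolding h't .
    moreover have "1 / (s + t) \<le> 1 / s" using s(1) t by (intro divide_left_mono) auto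
    ultimately show ?thesis using ht qs sp by simp
  qed
  have \<phi>\<phi>: "test_fun \<Omega> (\<lambda>x. \<phi> x * \<phi> x)" by (rule test_fun_mult[OF \<phi> test_fun_smooth[OF \<phi>]])
  obtain A where A: "\<And>x. \<bar>\<phi> x * \<phi> x\<bar> \<le> A" using test_fun_integrable(1)[OF \<phi>\<phi>] by blast
  obtain A' where A': "\<And>x. norm (grad (\<lambda>x. \<phi> x * \<phi> x) x) \<le> A'" using test_fun_integrable(4)[OF \<phi>\<phi>] by blast
  have test: "test_fun \<Omega> (\<lambda>x. (\<phi> x * \<phi> x) * h (\<psi> x))" if "test_fun \<Omega> \<psi>" for \<psi>
    using test_fun_mult[OF \<phi>\<phi> smooth_compose[OF hs test_fun_smooth[OF that]]] by (simp add: mult.commute)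
  define v where "v x = (\<phi> x * \<phi> x) * h (rep_L2 w x)" for x
  define k where "k x = ((\<phi> x * \<phi> x) * h' (rep_L2 w x)) *\<^sub>R rep_L2 g x + h (rep_L2 w x) *\<^sub>R grad (\<lambda>x. \<phi> x * \<phi> x) x" for x
  have sv: "sqint v" and sk: "sqint k" and vk: "(abs_L2 v, abs_L2 k) \<in> W"
    unfolding v_def[abs_def] k_def[abs_def]
    using W_chain_rule[OF W hs hd hb test_fun_smooth[OF \<phi>\<phi>] A A' test] by blast+
  have "AE x in lebesgue. rep_L2 (abs_L2 v) x \<ge> 0"
    using rep_abs_L2[OF sv] nonneg
  proof eventually_elim
    case (elim x)
    then show ?case using h_pos[of "rep_L2 w x"] by (simp add: v_def)
  qed
  from super[rule_format, OF vk this] have "0 \<le> g \<bullet> abs_L2 k" .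
  also have "\<dots> = (\<integral>x. rep_L2 g x \<bullet> k x \<partial>lebesgue)"
    using inner_abs_L2[OF sqint_rep[of g] sk] by (simp add: abs_rep_L2)
  finally have k0: "0 \<le> (\<integral>x. rep_L2 g x \<bullet> k x \<partial>lebesgue)" .
  have Xq: "X x = (\<phi> x)\<^sup>2 * (norm (rep_L2 g x))\<^sup>2 * (q (rep_L2 w x))\<^sup>2" for x
    using pos[of "rep_L2 w x"] by (simp add: X_def q_def power_divide)
  show Xi: "integrable lebesgue X"
  proof (rule Bochner_Integration.integrable_bound)
    show "integrable lebesgue (\<lambda>x. (A / \<epsilon>\<^sup>2) * (norm (rep_L2 g x))\<^sup>2)"
      using sqint_integrable[OF sqint_rep[of g]] by simp
    show "X \<in> borel_measurable lebesgue" unfolding X_def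
      by (intro borel_measurable_divide borel_measurable_times borel_measurable_power borel_measurable_add borel_measurable_const
          sqint_measurable[OF sqint_norm[OF sqint_rep]] sqint_measurable[OF sqint_rep] sqint_measurable[OF test_fun_integrable(2)[OF \<phi>]])
    show "AE x in lebesgue. norm (X x) \<le> norm ((A / \<epsilon>\<^sup>2) * (norm (rep_L2 g x))\<^sup>2)"
    proof (rule AE_I2)
      fix x
      have "(\<phi> x)\<^sup>2 * (norm (rep_L2 g x))\<^sup>2 / ((rep_L2 w x)\<^sup>2 + \<epsilon>\<^sup>2) \<le> A * (norm (rep_L2 g x))\<^sup>2 / \<epsilon>\<^sup>2"
      proof (rule frac_le)
        have "(\<phi> x)\<^sup>2 \<le> A" using A[of x] by (simp add: power2_eq_square)
        then show "(\<phi> x)\<^sup>2 * (norm (rep_L2 g x))\<^sup>2 \<le> A * (norm (rep_L2 g x))\<^sup>2" by (intro mult_right_mono) auto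
        then show "0 \<le> A * (norm (rep_L2 g x))\<^sup>2" by (rule order_trans[rotated]) simp
      qed (use \<epsilon> in auto)
      then have "X x \<le> (A / \<epsilon>\<^sup>2) * (norm (rep_L2 g x))\<^sup>2" by (simp add: X_def)
      moreover have "X x \<ge> 0" unfolding Xq by simp
      ultimately show "norm (X x) \<le> norm ((A / \<epsilon>\<^sup>2) * (norm (rep_L2 g x))\<^sup>2)"
        using abs_ge_self[of "(A / \<epsilon>\<^sup>2) * (norm (rep_L2 g x))\<^sup>2"] unfolding real_norm_def by linarith
    qed
  qed
  have gi: "integrable lebesgue (\<lambda>x. (norm (grad \<phi> x))\<^sup>2)" by (rule sqint_integrable[OF test_fun_integrable(5)[OF \<phi>]])
  have "(\<integral>x. rep_L2 g x \<bullet> k x \<partial>lebesgue) \<le> (\<integral>x. 4 * (norm (grad \<phi> x))\<^sup>2 - X x / 4 \<partial>lebesgue)"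
  proof (rule integral_mono_AE)
    show "integrable lebesgue (\<lambda>x. rep_L2 g x \<bullet> k x)" by (rule sqint_inner_integrable[OF sqint_rep sk])
    show "integrable lebesgue (\<lambda>x. 4 * (norm (grad \<phi> x))\<^sup>2 - X x / 4)" using gi Xi by simp
    show "AE x in lebesgue. rep_L2 g x \<bullet> k x \<le> 4 * (norm (grad \<phi> x))\<^sup>2 - X x / 4"
      using nonneg
    proof eventually_elim
      case (elim x)
      define u where "u = rep_L2 w x"
      define G where "G = rep_L2 g x"
      define a where "a = \<bar>\<phi> x\<bar> * norm G * q u"
      define b where "b = norm (grad \<phi> x)"
      note hu = h_pos[OF elim, folded u_def]
      have Xa: "X x = a\<^sup>2" unfolding Xq a_def u_def G_def by (simp add: power_mult_distrib)
      have "rep_L2 g x \<bullet> k x = (\<phi> x)\<^sup>2 * h' u * (norm G)\<^sup>2 + 2 * (\<phi> x * h u * (G \<bullet> grad \<phi> x))"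
        unfolding k_def u_def G_def grad_mult[OF test_fun_smooth[OF \<phi>] test_fun_smooth[OF \<phi>]]
        by (simp add: inner_add_right inner_scaleR_right dot_square_norm power2_eq_square algebra_simps)
      also have "(\<phi> x)\<^sup>2 * h' u * (norm G)\<^sup>2 \<le> - (a\<^sup>2 / 2)"
      proof -
        have "((\<phi> x)\<^sup>2 * (norm G)\<^sup>2) * ((q u)\<^sup>2 / 2) \<le> ((\<phi> x)\<^sup>2 * (norm G)\<^sup>2) * (- h' u)"
          using hu by (intro mult_left_mono) auto
        then show ?thesis by (simp add: a_def power_mult_distrib algebra_simps)
      qed
      also have "\<phi> x * h u * (G \<bullet> grad \<phi> x) \<le> a * b"
      proof -
        have "\<phi> x * h u * (G \<bullet> grad \<phi> x) \<le> \<bar>\<phi> x\<bar> * \<bar>h u\<bar> * \<bar>G \<bullet> grad \<phi> x\<bar>"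
          using abs_ge_self[of "\<phi> x * h u * (G \<bullet> grad \<phi> x)"] by (simp only: abs_mult)
        also have "\<dots> \<le> \<bar>\<phi> x\<bar> * q u * (norm G * b)"
          unfolding b_def using hu qpos[of u] Cauchy_Schwarz_ineq2 by (intro mult_mono) auto
        finally show ?thesis by (simp add: a_def ac_simps)
      qed
      finally have "rep_L2 g x \<bullet> k x \<le> - (a\<^sup>2 / 2) + 2 * (a * b)" by simp
      \<comment> \<open>Young's inequality, weighted so that half of the good term
        \<open>a\<^sup>2 / 2\<close> survives; the quotient of the remaining coefficients 4 and 1/4
        is the constant 16.\<close>
      moreover have "2 * (a * b) \<le> a\<^sup>2 / 4 + 4 * b\<^sup>2"
        using zero_le_power2[of "a / 2 - 2 * b"] by (simp add: power2_diff power_divide power_mult_distrib)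
      ultimately show ?case unfolding Xa b_def by linarith
    qed
  qed
  also have "\<dots> = 4 * (\<integral>x. (norm (grad \<phi> x))\<^sup>2 \<partial>lebesgue) - (\<integral>x. X x \<partial>lebesgue) / 4"
    using gi Xi by simp
  finally show "(\<integral>x. X x \<partial>lebesgue) \<le> 16 * (\<integral>x. (norm (grad \<phi> x))\<^sup>2 \<partial>lebesgue)" using k0 by linarith
qed

text \<open>The product of \<open>\<phi>\<close> with the logarithm of \<open>w\<close> lies in the
  Sobolev space, so its gradient has mean zero and the derivative can be moved from
  \<open>\<phi>\<close> to the logarithm. There the preceding estimate applies, with a bound free of
  \<open>\<epsilon>\<close>.\<close>

lemma log_weak_gradient_bound:
  assumes W: "(w, g) \<in> W"
    and super: "\<forall>v k. (v, k) \<in> W \<longrightarrow> (AE x in lebesgue. rep_L2 v x \<ge> 0) \<longrightarrow> g \<bullet> k \<ge> 0"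
    and nonneg: "AE x in lebesgue. rep_L2 w x \<ge> 0"
    and \<phi>: "test_fun \<Omega> \<phi>" and \<epsilon>: "\<epsilon> > 0"
  shows "\<bar>\<integral>x. ln (1 + (rep_L2 w x)\<^sup>2 / \<epsilon>\<^sup>2) / 2 * (grad \<phi> x \<bullet> b) \<partial>lebesgue\<bar>
    \<le> 16 * (\<integral>x. (norm (grad \<phi> x))\<^sup>2 \<partial>lebesgue) + (norm b)\<^sup>2 * measure lebesgue \<Omega>"
proof -
  define q where "q = (\<lambda>t. 1 / sqrt (t\<^sup>2 + \<epsilon>\<^sup>2))"
  have pos: "t\<^sup>2 + \<epsilon>\<^sup>2 > 0" for t using \<epsilon> by (simp add: add_nonneg_pos)
  have qs: "smooth q" unfolding q_def by (rule smooth_inverse_sqrt(2)[OF \<epsilon>])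
  have qpos: "q t > 0" for t using pos[of t] by (simp add: q_def)
  have qq: "q t * q t = 1 / (t\<^sup>2 + \<epsilon>\<^sup>2)" for t using pos[of t] by (simp add: q_def)
  have tq: "\<bar>t * q t\<bar> \<le> 1" for t
    using pos[of t] \<epsilon> by (simp add: q_def abs_mult divide_le_eq real_le_rsqrt)
  \<comment> \<open>A smooth even substitute for \<open>ln (1 + t / \<epsilon>)\<close>. Its
    derivative \<open>t / (t\<^sup>2 + \<epsilon>\<^sup>2)\<close> is at most \<open>q t\<close>,
    which the gradient estimate controls.\<close>
  define L where "L t = ln (1 + t\<^sup>2 / \<epsilon>\<^sup>2) / 2" for t
  define L' where "L' t = t * (q t * q t)" for t
  have Ld: "(L has_real_derivative L' t) (at t)" for t
  proof -
    have p: "1 + t\<^sup>2 / \<epsilon>\<^sup>2 > 0" by (intro add_pos_nonneg) auto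
    have a: "((\<lambda>t. t\<^sup>2) has_real_derivative 2 * t) (at t)" by (auto intro!: derivative_eq_intros)
    from DERIV_cdivide[OF DERIV_chain2[OF DERIV_ln_divide[OF p] DERIV_add[OF DERIV_const DERIV_cdivide[OF a]]], of 2]
    have "((\<lambda>t. ln (1 + t\<^sup>2 / \<epsilon>\<^sup>2) / 2) has_real_derivative 1 / (1 + t\<^sup>2 / \<epsilon>\<^sup>2) * (0 + 2 * t / \<epsilon>\<^sup>2) / 2) (at t)" .
    moreover have "1 / (1 + t\<^sup>2 / \<epsilon>\<^sup>2) * (0 + 2 * t / \<epsilon>\<^sup>2) / 2 = L' t"
    proof -
      have "1 + t\<^sup>2 / \<epsilon>\<^sup>2 = (t\<^sup>2 + \<epsilon>\<^sup>2) / \<epsilon>\<^sup>2" using \<epsilon> by (simp add: add_divide_distrib)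
      moreover have "1 / (D / e) * (0 + 2 * t / e) / 2 = t * (1 / D)" if "D > 0" "e > 0" for D e :: real
        using that by (simp add: field_simps)
      ultimately show ?thesis unfolding L'_def qq using pos[of t] \<epsilon> by (simp only: zero_less_power)
    qed
    ultimately show ?thesis by (simp add: L_def[abs_def])
  qed
  have Ls: "smooth L"
  proof -
    have c: "Ck (Suc k) L" for k
    proof (rule Ck_real_SucI[OF Ld])
      show "Ck k L'" unfolding L'_def[abs_def]
        using smooth_mult[OF smooth_ident smooth_mult[OF qs qs]] by (simp add: smooth_def)
    qed
    show ?thesis unfolding smooth_def by (rule allI) (rule Ck_Suc_imp[OF c])
  qed
  have L'q: "\<bar>L' t\<bar> \<le> q t" for t
  proof -
    have "\<bar>L' t\<bar> = \<bar>t * q t\<bar> * q t" using qpos[of t] by (simp add: L'_def abs_mult)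
    also have "\<dots> \<le> 1 * q t" using tq qpos[of t] by (intro mult_right_mono) auto
    finally show ?thesis by simp
  qed
  have qb: "q t \<le> 1 / \<epsilon>" for t
  proof -
    have "\<epsilon> \<le> sqrt (t\<^sup>2 + \<epsilon>\<^sup>2)" using \<epsilon> by (intro real_le_rsqrt) simp
    then show ?thesis unfolding q_def
      by (intro divide_left_mono mult_pos_pos) (use \<epsilon> pos[of t] in \<open>simp_all\<close>)
  qed
  obtain A where A: "\<And>x. \<bar>\<phi> x\<bar> \<le> A" using test_fun_integrable(1)[OF \<phi>] by blast
  obtain A' where A': "\<And>x. norm (grad \<phi> x) \<le> A'" using test_fun_integrable(4)[OF \<phi>] by blast
  have test: "test_fun \<Omega> (\<lambda>x. \<phi> x * L (\<psi> x))" if "test_fun \<Omega> \<psi>" for \<psi>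
    using test_fun_mult[OF \<phi> smooth_compose[OF Ls test_fun_smooth[OF that]]] by (simp add: mult.commute)
  define v where "v x = \<phi> x * L (rep_L2 w x)" for x
  define k1 where "k1 x = (\<phi> x * L' (rep_L2 w x)) *\<^sub>R rep_L2 g x" for x
  define k2 where "k2 x = L (rep_L2 w x) *\<^sub>R grad \<phi> x" for x
  have sk: "sqint (\<lambda>x. k1 x + k2 x)" and vk: "(abs_L2 v, abs_L2 (\<lambda>x. k1 x + k2 x)) \<in> W"
    unfolding v_def[abs_def] k1_def k2_def
    using W_chain_rule[OF W Ls Ld order_trans[OF L'q qb] test_fun_smooth[OF \<phi>] A A' test] by blast+
  have k1m: "k1 \<in> borel_measurable lebesgue"
  proof -
    have "L' \<in> borel_measurable borel"
      by (rule borel_measurable_continuous_onI[OF smooth_continuous[OF smooth_derivative[OF Ld Ls]]])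
    from measurable_compose[OF sqint_measurable[OF sqint_rep[of w]] this] show ?thesis
      unfolding k1_def[abs_def]
      by (intro borel_measurable_scaleR borel_measurable_times sqint_measurable[OF sqint_rep] sqint_measurable[OF test_fun_integrable(2)[OF \<phi>]])
  qed
  define X where "X x = (\<phi> x)\<^sup>2 * (norm (rep_L2 g x))\<^sup>2 / ((rep_L2 w x)\<^sup>2 + \<epsilon>\<^sup>2)" for x
  have X: "integrable lebesgue X" "(\<integral>x. X x \<partial>lebesgue) \<le> 16 * (\<integral>x. (norm (grad \<phi> x))\<^sup>2 \<partial>lebesgue)"
    unfolding X_def[abs_def] using log_gradient_estimate[OF W super nonneg \<phi> \<epsilon>] by blast+
  have k1X: "(norm (k1 x))\<^sup>2 \<le> X x" for x
  proof -
    have "norm (k1 x) \<le> \<bar>\<phi> x\<bar> * q (rep_L2 w x) * norm (rep_L2 g x)"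
      unfolding k1_def norm_scaleR abs_mult by (intro mult_mono L'q) (use less_imp_le[OF qpos] in auto)
    from power_mono[OF this norm_ge_zero, of 2]
    have "(norm (k1 x))\<^sup>2 \<le> (\<phi> x)\<^sup>2 * (q (rep_L2 w x))\<^sup>2 * (norm (rep_L2 g x))\<^sup>2"
      by (simp add: power_mult_distrib)
    then show ?thesis unfolding power2_eq_square[of "q _"] qq X_def by simp
  qed
  have k1s: "sqint k1" by (rule sqint_bound[OF k1m X(1)]) (use k1X in auto)
  have k10: "x \<notin> \<Omega> \<Longrightarrow> k1 x = 0" for x using test_fun_outside(1)[OF \<phi>] by (simp add: k1_def)
  have k1i: "integrable lebesgue k1" by (rule sqint_supported_integrable[OF k1s]) (use k10 in auto)
  have k2s: "sqint k2" using sqint_diff[OF sk k1s] by simp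
  have k2i: "integrable lebesgue k2"
    by (rule sqint_supported_integrable[OF k2s]) (auto simp: k2_def test_fun_outside[OF \<phi>])
  have "(\<integral>x. rep_L2 (abs_L2 (\<lambda>x. k1 x + k2 x)) x \<bullet> b \<partial>lebesgue) = (\<integral>x. (k1 x + k2 x) \<bullet> b \<partial>lebesgue)"
  proof (rule integral_cong_AE)
    show "AE x in lebesgue. rep_L2 (abs_L2 (\<lambda>x. k1 x + k2 x)) x \<bullet> b = (k1 x + k2 x) \<bullet> b"
      using rep_abs_L2[OF sk] by eventually_elim simp
  qed (intro borel_measurable_inner sqint_measurable[OF sqint_rep] sqint_measurable[OF sk] borel_measurable_const)+
  then have "(\<integral>x. (k1 x + k2 x) \<bullet> b \<partial>lebesgue) = 0" using W_integral_eq_0[OF vk] by simp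
  then have eq: "(\<integral>x. k2 x \<bullet> b \<partial>lebesgue) = - (\<integral>x. k1 x \<bullet> b \<partial>lebesgue)"
    using k1i k2i by (simp add: inner_add_left)
  have "\<bar>\<integral>x. k1 x \<bullet> b \<partial>lebesgue\<bar> \<le> (\<integral>x. \<bar>k1 x \<bullet> b\<bar> \<partial>lebesgue)" by (rule integral_abs_bound)
  also have "\<dots> \<le> (\<integral>x. X x + (norm b)\<^sup>2 * indicat_real \<Omega> x \<partial>lebesgue)"
    proof (rule integral_mono)
      show "integrable lebesgue (\<lambda>x. X x + (norm b)\<^sup>2 * indicat_real \<Omega> x)"
        by (rule Bochner_Integration.integrable_add[OF X(1) integrable_indicator_\<Omega>])
      fix x
      show "\<bar>k1 x \<bullet> b\<bar> \<le> X x + (norm b)\<^sup>2 * indicat_real \<Omega> x"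
      proof (cases "x \<in> \<Omega>")
        case True
        have "\<bar>k1 x \<bullet> b\<bar> \<le> norm (k1 x) * norm b" by (rule Cauchy_Schwarz_ineq2)
        also have "\<dots> \<le> (norm (k1 x))\<^sup>2 + (norm b)\<^sup>2"
          using sum_squares_bound[of "norm (k1 x)" "norm b"] mult_nonneg_nonneg[OF norm_ge_zero[of "k1 x"] norm_ge_zero[of b]]
          by linarith
        finally show ?thesis using k1X[of x] True by simp
      next
        case False
        then show ?thesis using k10[of x] k1X[of x] by simp
      qed
    qed (use k1i in auto)
  also have "\<dots> = (\<integral>x. X x \<partial>lebesgue) + (norm b)\<^sup>2 * measure lebesgue \<Omega>"
    using X(1) integrable_indicator_\<Omega>[of "(norm b)\<^sup>2"] \<Omega>_lebesgue by simp
  finally have "\<bar>\<integral>x. k2 x \<bullet> b \<partial>lebesgue\<bar> \<le> 16 * (\<integral>x. (norm (grad \<phi> x))\<^sup>2 \<partial>lebesgue) + (norm b)\<^sup>2 * measure lebesgue \<Omega>"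
    unfolding eq using X(2) by simp
  then show ?thesis by (simp add: k2_def L_def)
qed

text \<open>The logarithms divided by their value at \<open>S\<close> converge to the indicator of
  the set where \<open>w\<close> is positive, while their weak gradients, bounded before division,
  tend to zero. The indicator is therefore constant on the connected domain.\<close>

theorem strong_maximum_principle:
  assumes conn: "connected \<Omega>" and W: "(w, g) \<in> W"
    and super: "\<forall>v k. (v, k) \<in> W \<longrightarrow> (AE x in lebesgue. rep_L2 v x \<ge> 0) \<longrightarrow> g \<bullet> k \<ge> 0"
    and bounds: "AE x in lebesgue. 0 \<le> rep_L2 w x \<and> rep_L2 w x \<le> S" and S: "S > 0"
  shows "(AE x in lebesgue. x \<in> \<Omega> \<longrightarrow> rep_L2 w x = 0) \<or> (AE x in lebesgue. x \<in> \<Omega> \<longrightarrow> rep_L2 w x > 0)"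
proof -
  define \<xi> where "\<xi> x = (if rep_L2 w x > 0 then 1 else 0 :: real)" for x
  have wm: "rep_L2 w \<in> borel_measurable lebesgue" by (rule sqint_measurable[OF sqint_rep])
  have nonneg: "AE x in lebesgue. rep_L2 w x \<ge> 0" using bounds by eventually_elim simp
  have \<xi>m: "\<xi> \<in> borel_measurable lebesgue" unfolding \<xi>_def[abs_def] using wm by measurable
  have zero: "(\<integral>x. \<xi> x * (grad \<phi> x \<bullet> b) \<partial>lebesgue) = 0" if \<phi>: "test_fun \<Omega> \<phi>" for \<phi> b
  proof -
    \<comment> \<open>The value of \<open>L n\<close> at the upper bound \<open>S\<close>, with
      \<open>\<epsilon>\<close> equal to 1 / (n + 1). The quotient stays in the unit interval; it
      tends to 1 at every positive \<open>t\<close>, because both logarithms grow at the same rate,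
      and it is 0 at \<open>t = 0\<close>.\<close>
    define N where "N n = ln (1 + S\<^sup>2 * (real (Suc n))\<^sup>2) / 2" for n
    define L where "L n t = ln (1 + t\<^sup>2 * (real (Suc n))\<^sup>2) / 2" for n t
    have Npos: "N n > 0" for n using S by (simp add: N_def ln_gt_zero)
    define M where "M = 16 * (\<integral>x. (norm (grad \<phi> x))\<^sup>2 \<partial>lebesgue) + (norm b)\<^sup>2 * measure lebesgue \<Omega>"
    have bound: "\<bar>\<integral>x. L n (rep_L2 w x) * (grad \<phi> x \<bullet> b) \<partial>lebesgue\<bar> \<le> M" for n
    proof -
      have "\<bar>\<integral>x. ln (1 + (rep_L2 w x)\<^sup>2 / (inverse (real (Suc n)))\<^sup>2) / 2 * (grad \<phi> x \<bullet> b) \<partial>lebesgue\<bar> \<le> M"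
        unfolding M_def by (rule log_weak_gradient_bound[OF W super nonneg \<phi>]) simp
      moreover have "t / (inverse (real (Suc n)))\<^sup>2 = t * (real (Suc n))\<^sup>2" for t
        by (simp only: divide_inverse power_inverse inverse_inverse_eq)
      ultimately show ?thesis unfolding L_def by simp
    qed
    have "(\<lambda>n. \<integral>x. L n (rep_L2 w x) / N n * (grad \<phi> x \<bullet> b) \<partial>lebesgue) \<longlonglongrightarrow> (\<integral>x. \<xi> x * (grad \<phi> x \<bullet> b) \<partial>lebesgue)"
    proof (rule integral_dominated_convergence)
      show "integrable lebesgue (\<lambda>x. \<bar>grad \<phi> x \<bullet> b\<bar>)" using test_fun_integrable(6)[OF \<phi>] by auto
      show "AE x in lebesgue. (\<lambda>n. L n (rep_L2 w x) / N n * (grad \<phi> x \<bullet> b)) \<longlonglongrightarrow> \<xi> x * (grad \<phi> x \<bullet> b)"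
        using nonneg
      proof eventually_elim
        case (elim x)
        have "(\<lambda>n. L n (rep_L2 w x) / N n) \<longlonglongrightarrow> \<xi> x"
        proof (cases "rep_L2 w x > 0")
          case True
          have "(\<lambda>n. ln (1 + t\<^sup>2 * (real (Suc n))\<^sup>2) / 2 / (ln (1 + S\<^sup>2 * (real (Suc n))\<^sup>2) / 2)) \<longlonglongrightarrow> 1"
            if "t > 0" for t :: real
            using that S by real_asymp
          from this[OF True] show ?thesis using True by (simp add: L_def N_def \<xi>_def)
        next
          case False
          then have "rep_L2 w x = 0" using elim by simp
          then show ?thesis by (simp add: L_def \<xi>_def)
        qed
        then show ?case by (intro tendsto_mult_right)
      qed
      show "AE x in lebesgue. norm (L n (rep_L2 w x) / N n * (grad \<phi> x \<bullet> b)) \<le> \<bar>grad \<phi> x \<bullet> b\<bar>" for n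
        using bounds
      proof eventually_elim
        case (elim x)
        define t where "t = rep_L2 w x"
        have t: "0 \<le> t" "t \<le> S" using elim by (auto simp: t_def)
        have "1 + t\<^sup>2 * (real (Suc n))\<^sup>2 \<le> 1 + S\<^sup>2 * (real (Suc n))\<^sup>2"
          using t by (intro add_left_mono mult_right_mono power_mono) auto
        moreover have p: "1 \<le> 1 + t\<^sup>2 * (real (Suc n))\<^sup>2" by simp
        ultimately have "ln (1 + t\<^sup>2 * (real (Suc n))\<^sup>2) \<le> ln (1 + S\<^sup>2 * (real (Suc n))\<^sup>2)"
          by (subst ln_le_cancel_iff) linarith+
        moreover note ln_ge_zero[OF p]
        ultimately have "L n t \<le> N n" "L n t \<ge> 0" unfolding L_def N_def by auto
        then have "\<bar>L n t / N n\<bar> \<le> 1" using Npos[of n] by simp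
        then have "\<bar>L n t / N n\<bar> * \<bar>grad \<phi> x \<bullet> b\<bar> \<le> 1 * \<bar>grad \<phi> x \<bullet> b\<bar>" by (rule mult_right_mono) simp
        then show ?case by (simp add: t_def abs_mult)
      qed
      have lm: "(\<lambda>x. L n (rep_L2 w x)) \<in> borel_measurable lebesgue" for n unfolding L_def using wm by measurable
      have gm: "(\<lambda>x. grad \<phi> x \<bullet> b) \<in> borel_measurable lebesgue" using test_fun_integrable(6)[OF \<phi>] by auto
      show "(\<lambda>x. L n (rep_L2 w x) / N n * (grad \<phi> x \<bullet> b)) \<in> borel_measurable lebesgue" for n
        by (intro borel_measurable_times borel_measurable_divide lm gm borel_measurable_const)
      show "(\<lambda>x. \<xi> x * (grad \<phi> x \<bullet> b)) \<in> borel_measurable lebesgue"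
        by (intro borel_measurable_times \<xi>m gm)
    qed
    moreover have "(\<lambda>n. \<integral>x. L n (rep_L2 w x) / N n * (grad \<phi> x \<bullet> b) \<partial>lebesgue) \<longlonglongrightarrow> 0"
    proof (rule Lim_null_comparison)
      show "\<forall>\<^sub>F n in sequentially. norm (\<integral>x. L n (rep_L2 w x) / N n * (grad \<phi> x \<bullet> b) \<partial>lebesgue) \<le> M / N n"
      proof (intro always_eventually allI)
        fix n
        have "(\<integral>x. L n (rep_L2 w x) / N n * (grad \<phi> x \<bullet> b) \<partial>lebesgue) = (\<integral>x. L n (rep_L2 w x) * (grad \<phi> x \<bullet> b) / N n \<partial>lebesgue)"
          by (simp add: ac_simps)
        also have "\<dots> = (\<integral>x. L n (rep_L2 w x) * (grad \<phi> x \<bullet> b) \<partial>lebesgue) / N n"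
          by (rule integral_divide_zero)
        finally show "norm (\<integral>x. L n (rep_L2 w x) / N n * (grad \<phi> x \<bullet> b) \<partial>lebesgue) \<le> M / N n"
          using bound[of n] Npos[of n] by (simp add: abs_divide divide_right_mono)
      qed
      show "(\<lambda>n. M / N n) \<longlonglongrightarrow> 0" unfolding N_def using S by real_asymp
    qed
    ultimately show ?thesis by (rule LIMSEQ_unique)
  qed
  have "\<exists>c. AE x in lebesgue. x \<in> \<Omega> \<longrightarrow> \<xi> x = c"
    by (rule zero_weak_grad_const[OF open_\<Omega> conn \<xi>m]) (auto simp: \<xi>_def intro: zero[unfolded \<xi>_def])
  then obtain c where c: "AE x in lebesgue. x \<in> \<Omega> \<longrightarrow> \<xi> x = c" ..
  show ?thesis
  proof (cases "c = 1")
    case True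
    have "AE x in lebesgue. x \<in> \<Omega> \<longrightarrow> rep_L2 w x > 0"
      using c by eventually_elim (use True in \<open>auto simp: \<xi>_def split: if_splits\<close>)
    then show ?thesis ..
  next
    case False
    have "AE x in lebesgue. x \<in> \<Omega> \<longrightarrow> rep_L2 w x = 0"
      using c bounds by eventually_elim (use False in \<open>auto simp: \<xi>_def split: if_splits\<close>)
    then show ?thesis ..
  qed
qed

end

section \<open>The functional and its critical points\<close>

lemma integral_abs_bound_integral_AE:
  fixes f g :: "'a \<Rightarrow> real"
  assumes "integrable M f" "integrable M g" "AE x in M. \<bar>f x\<bar> \<le> g x"
  shows "\<bar>\<integral>x. f x \<partial>M\<bar> \<le> (\<integral>x. g x \<partial>M)"
  using integral_abs_bound[of M f] integral_mono_AE[OF integrable_abs[OF assms(1)] assms(2,3)] by linarith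

text \<open>\<open>f_modulus\<close> is uniform continuity in an integrable form: the linear term
  takes over for distant arguments, so the inequality can be integrated without splitting the
  domain.\<close>

locale semilinear = bounded_domain \<Omega> for \<Omega> :: "'a::euclidean_space set" +
  fixes f F :: "real \<Rightarrow> real" and B :: real
  assumes f_bound: "\<And>t. \<bar>f t\<bar> \<le> B"
    and f_cont: "continuous_on UNIV f"
    and f_modulus: "\<And>\<epsilon>. \<epsilon> > 0 \<Longrightarrow> \<exists>C\<ge>0. \<forall>a b. \<bar>f a - f b\<bar> \<le> \<epsilon> + C * \<bar>a - b\<bar>"
    and F_deriv: "\<And>t. (F has_real_derivative f t) (at t)"
    and F_0: "F 0 = 0"
begin

lemma B_nonneg: "B \<ge> 0"
  using order_trans[OF abs_ge_zero f_bound[of 0]] .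

lemma measurable_f: "w \<in> borel_measurable lebesgue \<Longrightarrow> (\<lambda>x. f (w x)) \<in> borel_measurable lebesgue"
  using measurable_compose[of w lebesgue borel f borel] borel_measurable_continuous_onI[OF f_cont] by blast

lemma measurable_F: "w \<in> borel_measurable lebesgue \<Longrightarrow> (\<lambda>x. F (w x)) \<in> borel_measurable lebesgue"
proof -
  have "continuous_on UNIV F" by (auto intro!: continuous_at_imp_continuous_on DERIV_isCont[OF F_deriv])
  then show "w \<in> borel_measurable lebesgue \<Longrightarrow> (\<lambda>x. F (w x)) \<in> borel_measurable lebesgue"
    using measurable_compose[of w lebesgue borel F borel] borel_measurable_continuous_onI by blast
qed

lemma F_lipschitz: "\<bar>F a - F b\<bar> \<le> B * \<bar>a - b\<bar>"
  using field_differentiable_bound[OF convex_UNIV, of F f B a b] F_deriv f_bound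
  by (auto simp: has_field_derivative_at_within)

text \<open>Mean value inequality for \<open>F t - f a * t\<close> on the segment, with the modulus
  of \<open>f\<close> as the bound on its derivative.\<close>

lemma F_expansion:
  assumes C: "\<forall>a b. \<bar>f a - f b\<bar> \<le> \<epsilon> + C * \<bar>a - b\<bar>" and C0: "C \<ge> 0"
  shows "\<bar>F (a + b) - F a - f a * b\<bar> \<le> (\<epsilon> + C * \<bar>b\<bar>) * \<bar>b\<bar>"
proof -
  have d: "((\<lambda>t. F t - f a * t) has_field_derivative (f t - f a)) (at t within closed_segment a (a + b))" for t
    by (rule has_field_derivative_at_within) (auto intro!: derivative_eq_intros F_deriv)
  have "norm (f t - f a) \<le> \<epsilon> + C * \<bar>b\<bar>" if t: "t \<in> closed_segment a (a + b)" for t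
  proof -
    have "\<bar>t - a\<bar> \<le> \<bar>b\<bar>" using t by (auto simp: closed_segment_eq_real_ivl split: if_splits)
    then have "C * \<bar>t - a\<bar> \<le> C * \<bar>b\<bar>" using C0 by (rule mult_left_mono)
    then show ?thesis using C[rule_format, of t a] by simp
  qed
  from field_differentiable_bound[OF convex_closed_segment d this, of "a + b" a]
  show ?thesis by (simp add: algebra_simps)
qed

text \<open>The Nemytskii (superposition) operator of \<open>f\<close>. The indicator is essential:
  \<open>f 0\<close> may be positive, and then \<open>f\<close> of a function vanishing outside the
  domain is not square integrable.\<close>

definition nem :: "('a, real) L2 \<Rightarrow> ('a, real) L2" where
  "nem w = abs_L2 (\<lambda>x. indicator \<Omega> x * f (rep_L2 w x))"

definition energy :: "('a, real) L2 \<Rightarrow> real" where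
  "energy w = (\<integral>x. indicator \<Omega> x * F (rep_L2 w x) \<partial>lebesgue)"

lemma sqint_nem: "sqint (\<lambda>x. indicator \<Omega> x * f (rep_L2 w x))"
proof (rule sqint_bound[OF _ integrable_indicator_\<Omega>[of "B\<^sup>2"]])
  show "(\<lambda>x. indicator \<Omega> x * f (rep_L2 w x)) \<in> borel_measurable lebesgue"
    by (intro borel_measurable_times borel_measurable_indicator \<Omega>_lebesgue measurable_f sqint_measurable sqint_rep)
  have "(f t)\<^sup>2 \<le> B\<^sup>2" for t using power_mono[OF f_bound abs_ge_zero, of t 2] by simp
  then show "AE x in lebesgue. (norm (indicator \<Omega> x * f (rep_L2 w x)))\<^sup>2 \<le> B\<^sup>2 * indicat_real \<Omega> x"
    by (intro AE_I2) (auto simp: indicator_def)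
qed

lemma inner_nem: "nem w \<bullet> v = (\<integral>x. indicator \<Omega> x * f (rep_L2 w x) * rep_L2 v x \<partial>lebesgue)"
  using inner_abs_L2[OF sqint_nem[of w] sqint_rep[of v]] by (simp add: nem_def abs_rep_L2)

lemma norm_nem: "norm (nem w) \<le> B * norm (abs_L2 (indicat_real \<Omega>))"
  unfolding nem_def
  by (rule norm_abs_L2_le[OF sqint_nem sqint_indicator_\<Omega> B_nonneg])
    (use f_bound in \<open>auto simp: indicator_def\<close>)

lemma integrable_energy: "integrable lebesgue (\<lambda>x. indicator \<Omega> x * F (rep_L2 w x))"
proof (rule Bochner_Integration.integrable_bound)
  show "integrable lebesgue (\<lambda>x. B * (indicat_real \<Omega> x *\<^sub>R rep_L2 w x))"
    by (intro integrable_mult_right sqint_mult_integrable sqint_indicator_\<Omega> sqint_rep)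
  show "(\<lambda>x. indicator \<Omega> x * F (rep_L2 w x)) \<in> borel_measurable lebesgue"
    by (intro borel_measurable_times borel_measurable_indicator \<Omega>_lebesgue measurable_F sqint_measurable sqint_rep)
  have "\<bar>F t\<bar> \<le> B * \<bar>t\<bar>" for t using F_lipschitz[of t 0] F_0 by simp
  then show "AE x in lebesgue. norm (indicator \<Omega> x * F (rep_L2 w x)) \<le> norm (B * (indicat_real \<Omega> x *\<^sub>R rep_L2 w x))"
    using B_nonneg by (intro AE_I2) (auto simp: indicator_def abs_mult)
qed

lemma integral_\<Omega>_abs_le:
  fixes v :: "('a, real) L2"
  shows "integrable lebesgue (\<lambda>x. indicat_real \<Omega> x * \<bar>rep_L2 v x\<bar>)"
    "(\<integral>x. indicat_real \<Omega> x * \<bar>rep_L2 v x\<bar> \<partial>lebesgue) \<le> norm (abs_L2 (indicat_real \<Omega>)) * norm v"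
proof -
  have s: "sqint (\<lambda>x. norm (rep_L2 v x))" by (rule sqint_norm[OF sqint_rep])
  show "integrable lebesgue (\<lambda>x. indicat_real \<Omega> x * \<bar>rep_L2 v x\<bar>)"
    using sqint_mult_integrable[OF sqint_indicator_\<Omega> s] by simp
  have n: "norm (abs_L2 (\<lambda>x. norm (rep_L2 v x))) \<le> 1 * norm (abs_L2 (rep_L2 v))"
    by (rule norm_abs_L2_le[OF s sqint_rep]) auto
  have "(\<integral>x. indicat_real \<Omega> x * \<bar>rep_L2 v x\<bar> \<partial>lebesgue) = abs_L2 (indicat_real \<Omega>) \<bullet> abs_L2 (\<lambda>x. norm (rep_L2 v x))"
    unfolding inner_abs_L2[OF sqint_indicator_\<Omega> s] by simp
  also have "\<dots> \<le> norm (abs_L2 (indicat_real \<Omega>)) * norm (abs_L2 (\<lambda>x. norm (rep_L2 v x)))" by (rule norm_cauchy_schwarz)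
  also have "\<dots> \<le> norm (abs_L2 (indicat_real \<Omega>)) * norm v"
    using n by (intro mult_left_mono) (auto simp: abs_rep_L2)
  finally show "(\<integral>x. indicat_real \<Omega> x * \<bar>rep_L2 v x\<bar> \<partial>lebesgue) \<le> norm (abs_L2 (indicat_real \<Omega>)) * norm v" .
qed

lemma rep_L2_add: "AE x in lebesgue. rep_L2 (u + v) x = rep_L2 u x + rep_L2 v x"
  using rep_abs_L2[OF sqint_add[OF sqint_rep[of u] sqint_rep[of v]]]
  by (simp add: abs_L2_add sqint_rep abs_rep_L2)

lemma rep_L2_diff: "AE x in lebesgue. rep_L2 (u - v) x = rep_L2 u x - rep_L2 v x"
  using rep_abs_L2[OF sqint_diff[OF sqint_rep[of u] sqint_rep[of v]]]
  by (simp add: abs_L2_diff sqint_rep abs_rep_L2)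

lemma rep_L2_0: "AE x in lebesgue. rep_L2 (0 :: ('a, real) L2) x = 0"
  using rep_abs_L2[OF sqint_zero] by (simp add: abs_L2_zero)

lemma energy_0: "energy 0 = 0"
proof -
  have "energy 0 = (\<integral>x. 0 \<partial>(lebesgue :: 'a measure))" unfolding energy_def
  proof (rule integral_cong_AE)
    show "AE x in lebesgue. indicator \<Omega> x * F (rep_L2 0 x) = 0"
      using rep_L2_0 by eventually_elim (simp add: F_0)
  qed (use integrable_energy in auto)
  then show ?thesis by simp
qed

lemma energy_lipschitz: "\<bar>energy w - energy v\<bar> \<le> B * norm (abs_L2 (indicat_real \<Omega>)) * norm (w - v)"
proof -
  have "\<bar>energy w - energy v\<bar> = \<bar>\<integral>x. indicator \<Omega> x * F (rep_L2 w x) - indicator \<Omega> x * F (rep_L2 v x) \<partial>lebesgue\<bar>"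
    unfolding energy_def by (simp add: Bochner_Integration.integral_diff[OF integrable_energy integrable_energy])
  also have "\<dots> \<le> (\<integral>x. B * (indicat_real \<Omega> x * \<bar>rep_L2 (w - v) x\<bar>) \<partial>lebesgue)"
  proof (rule integral_abs_bound_integral_AE)
    show "integrable lebesgue (\<lambda>x. B * (indicat_real \<Omega> x * \<bar>rep_L2 (w - v) x\<bar>))"
      by (intro integrable_mult_right integral_\<Omega>_abs_le)
    show "AE x in lebesgue. \<bar>indicator \<Omega> x * F (rep_L2 w x) - indicator \<Omega> x * F (rep_L2 v x)\<bar>
        \<le> B * (indicat_real \<Omega> x * \<bar>rep_L2 (w - v) x\<bar>)"
      using rep_L2_diff[of w v]
    proof eventually_elim
      case (elim x)
      then show ?case using F_lipschitz[of "rep_L2 w x" "rep_L2 v x"] by (auto simp: indicator_def)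
    qed
  qed (intro Bochner_Integration.integrable_diff integrable_energy)
  also have "\<dots> \<le> B * (norm (abs_L2 (indicat_real \<Omega>)) * norm (w - v))"
    unfolding integral_mult_right_zero by (intro mult_left_mono integral_\<Omega>_abs_le B_nonneg)
  finally show ?thesis by (simp add: ac_simps)
qed

text \<open>\<open>nem w\<close> is the gradient of the energy on \<open>L2\<close>, with an error
  independent of the base point: the modulus gives one term that is small and linear and one that is
  quadratic in \<open>norm v\<close>.\<close>

lemma energy_expansion:
  assumes C: "\<forall>a b. \<bar>f a - f b\<bar> \<le> \<epsilon> + C * \<bar>a - b\<bar>" and C0: "C \<ge> 0" and \<epsilon>: "\<epsilon> \<ge> 0"
  shows "\<bar>energy (w + v) - energy w - nem w \<bullet> v\<bar> \<le> \<epsilon> * (norm (abs_L2 (indicat_real \<Omega>)) * norm v) + C * (norm v)\<^sup>2"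
proof -
  have in1: "integrable lebesgue (\<lambda>x. indicator \<Omega> x * f (rep_L2 w x) * rep_L2 v x)"
    using sqint_mult_integrable[OF sqint_nem sqint_rep[of v]] by simp
  have in2: "integrable lebesgue (\<lambda>x. (rep_L2 v x)\<^sup>2)" using sqint_integrable[OF sqint_rep[of v]] by simp
  have "\<bar>energy (w + v) - energy w - nem w \<bullet> v\<bar> = \<bar>\<integral>x. indicator \<Omega> x * F (rep_L2 (w + v) x)
      - indicator \<Omega> x * F (rep_L2 w x) - indicator \<Omega> x * f (rep_L2 w x) * rep_L2 v x \<partial>lebesgue\<bar>"
    unfolding energy_def inner_nem
    by (simp add: Bochner_Integration.integral_diff[OF Bochner_Integration.integrable_diff[OF integrable_energy integrable_energy] in1]
        Bochner_Integration.integral_diff[OF integrable_energy integrable_energy])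
  also have "\<dots> \<le> (\<integral>x. \<epsilon> * (indicat_real \<Omega> x * \<bar>rep_L2 v x\<bar>) + C * (rep_L2 v x)\<^sup>2 \<partial>lebesgue)"
  proof (rule integral_abs_bound_integral_AE)
    show "integrable lebesgue (\<lambda>x. \<epsilon> * (indicat_real \<Omega> x * \<bar>rep_L2 v x\<bar>) + C * (rep_L2 v x)\<^sup>2)"
      by (intro Bochner_Integration.integrable_add integrable_mult_right integral_\<Omega>_abs_le in2)
    show "AE x in lebesgue. \<bar>indicator \<Omega> x * F (rep_L2 (w + v) x) - indicator \<Omega> x * F (rep_L2 w x)
        - indicator \<Omega> x * f (rep_L2 w x) * rep_L2 v x\<bar> \<le> \<epsilon> * (indicat_real \<Omega> x * \<bar>rep_L2 v x\<bar>) + C * (rep_L2 v x)\<^sup>2"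
      using rep_L2_add[of w v]
    proof eventually_elim
      case (elim x)
      show ?case
      proof (cases "x \<in> \<Omega>")
        case True
        have "\<bar>F (rep_L2 w x + rep_L2 v x) - F (rep_L2 w x) - f (rep_L2 w x) * rep_L2 v x\<bar>
            \<le> (\<epsilon> + C * \<bar>rep_L2 v x\<bar>) * \<bar>rep_L2 v x\<bar>" by (rule F_expansion[OF C C0])
        also have "\<dots> = \<epsilon> * \<bar>rep_L2 v x\<bar> + C * (rep_L2 v x)\<^sup>2"
          by (simp add: distrib_right mult.assoc power2_eq_square abs_mult_self_eq)
        finally show ?thesis using True elim by simp
      qed (use C0 in simp)
    qed
  qed (intro Bochner_Integration.integrable_diff integrable_energy in1)
  also have "\<dots> = \<epsilon> * (\<integral>x. indicat_real \<Omega> x * \<bar>rep_L2 v x\<bar> \<partial>lebesgue) + C * (norm v)\<^sup>2"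
    using integral_\<Omega>_abs_le(1)[of v] in2 norm_rep_L2[of v] by simp
  also have "\<dots> \<le> \<epsilon> * (norm (abs_L2 (indicat_real \<Omega>)) * norm v) + C * (norm v)\<^sup>2"
    by (intro add_right_mono mult_left_mono integral_\<Omega>_abs_le \<epsilon>)
  finally show ?thesis .
qed

lemma nem_modulus:
  assumes C: "\<forall>a b. \<bar>f a - f b\<bar> \<le> \<epsilon> + C * \<bar>a - b\<bar>" and C0: "C \<ge> 0" and \<epsilon>: "\<epsilon> \<ge> 0"
  shows "norm (nem w - nem v) \<le> \<epsilon> * norm (abs_L2 (indicat_real \<Omega>)) + C * norm (w - v)"
proof -
  define k where "k x = \<epsilon> *\<^sub>R indicat_real \<Omega> x + C *\<^sub>R norm (rep_L2 (w - v) x)" for x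
  have s: "sqint (\<lambda>x. norm (rep_L2 (w - v) x))" by (rule sqint_norm[OF sqint_rep])
  have sk: "sqint k" unfolding k_def[abs_def] by (intro sqint_add sqint_scaleR sqint_indicator_\<Omega> s)
  have "norm (nem w - nem v) \<le> 1 * norm (abs_L2 k)"
    unfolding nem_def abs_L2_diff[OF sqint_nem sqint_nem, symmetric]
  proof (rule norm_abs_L2_le[OF sqint_diff[OF sqint_nem sqint_nem] sk zero_le_one])
    show "AE x in lebesgue. norm (indicator \<Omega> x * f (rep_L2 w x) - indicator \<Omega> x * f (rep_L2 v x)) \<le> 1 * norm (k x)"
      using rep_L2_diff[of w v]
    proof eventually_elim
      case (elim x)
      have "\<bar>f (rep_L2 w x) - f (rep_L2 v x)\<bar> \<le> \<epsilon> + C * \<bar>rep_L2 w x - rep_L2 v x\<bar>" using C by blast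
      then show ?case using elim C0 \<epsilon> by (cases "x \<in> \<Omega>") (auto simp: k_def)
    qed
  qed
  also have "abs_L2 k = \<epsilon> *\<^sub>R abs_L2 (indicat_real \<Omega>) + C *\<^sub>R abs_L2 (\<lambda>x. norm (rep_L2 (w - v) x))"
    unfolding k_def[abs_def] abs_L2_scaleR[OF sqint_indicator_\<Omega>, symmetric] abs_L2_scaleR[OF s, symmetric]
    by (rule abs_L2_add) (intro sqint_scaleR sqint_indicator_\<Omega> s)+
  also have "1 * norm \<dots> \<le> \<epsilon> * norm (abs_L2 (indicat_real \<Omega>)) + C * norm (abs_L2 (\<lambda>x. norm (rep_L2 (w - v) x)))"
    using norm_triangle_ineq[of "\<epsilon> *\<^sub>R abs_L2 (indicat_real \<Omega>)" "C *\<^sub>R abs_L2 (\<lambda>x. norm (rep_L2 (w - v) x))"] C0 \<epsilon> by simp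
  also have "norm (abs_L2 (\<lambda>x. norm (rep_L2 (w - v) x))) \<le> 1 * norm (abs_L2 (rep_L2 (w - v)))"
    by (rule norm_abs_L2_le[OF s sqint_rep]) auto
  finally show ?thesis using C0 by (simp add: abs_rep_L2 mult_left_mono)
qed

lemma nem_tendsto:
  assumes "w \<longlonglongrightarrow> v" shows "(\<lambda>n. nem (w n)) \<longlonglongrightarrow> nem v"
proof (rule LIMSEQ_I)
  fix e :: real assume e: "e > 0"
  define m where "m = norm (abs_L2 (indicat_real \<Omega>)) + 1"
  have m: "m > 0" unfolding m_def by (rule add_nonneg_pos) auto
  have em: "e / (2 * m) > 0" using e m by simp
  from f_modulus[OF em] obtain C where C: "C \<ge> 0" "\<forall>a b. \<bar>f a - f b\<bar> \<le> e / (2 * m) + C * \<bar>a - b\<bar>" by blast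
  have "e / (2 * (C + 1)) > 0" using e C by simp
  from LIMSEQ_D[OF assms this] obtain N where N: "\<And>n. n \<ge> N \<Longrightarrow> norm (w n - v) < e / (2 * (C + 1))" by blast
  have "norm (nem (w n) - nem v) < e" if "n \<ge> N" for n
  proof -
    have "norm (nem (w n) - nem v) \<le> e / (2 * m) * norm (abs_L2 (indicat_real \<Omega>)) + C * norm (w n - v)"
      by (rule nem_modulus[OF C(2,1) less_imp_le[OF em]])
    moreover have "e / (2 * m) * norm (abs_L2 (indicat_real \<Omega>)) < e / (2 * m) * m"
      using em by (intro mult_strict_left_mono) (auto simp: m_def)
    moreover have "C * norm (w n - v) \<le> (C + 1) * (e / (2 * (C + 1)))"
      using N[OF that] C by (intro mult_mono) auto
    moreover have "e / (2 * m) * m = e / 2" "(C + 1) * (e / (2 * (C + 1))) = e / 2" using m C(1) by (auto simp: field_simps)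
    ultimately show ?thesis by linarith
  qed
  then show "\<exists>N. \<forall>n\<ge>N. norm (nem (w n) - nem v) < e" by blast
qed

text \<open>The adjoint of \<open>sol\<close>, which carries gradients with respect to the potential
  back to gradients with respect to the field.\<close>

definition adj :: "('a, real) L2 \<Rightarrow> ('a, 'a) L2" where
  "adj = (SOME S'. bounded_linear S' \<and> (\<forall>w x. S' w \<bullet> x = w \<bullet> sol x))"

lemma adj: "bounded_linear adj" "adj w \<bullet> x = w \<bullet> sol x"
proof -
  obtain S' where "bounded_linear S'" "\<And>w x. S' w \<bullet> x = w \<bullet> sol x"
    using adjoint_exists[OF bounded_linear_sol] by blast
  then have "\<exists>S'. bounded_linear S' \<and> (\<forall>w x. S' w \<bullet> x = w \<bullet> sol x)" by blast
  from someI_ex[OF this] have "bounded_linear adj \<and> (\<forall>w x. adj w \<bullet> x = w \<bullet> sol x)" unfolding adj_def .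
  then show "bounded_linear adj" "adj w \<bullet> x = w \<bullet> sol x" by auto
qed

definition \<Phi> :: "('a, 'a) L2 \<Rightarrow> real" where "\<Phi> y = energy (sol y)"

definition G :: "('a, 'a) L2 \<Rightarrow> ('a, 'a) L2" where "G y = adj (nem (sol y))"

lemma inner_G: "G y \<bullet> x = nem (sol y) \<bullet> sol x"
  by (simp add: G_def adj)

text \<open>Weak convergence of the fields gives weak convergence of the potentials through the
  adjoint, and Rellich's theorem makes it strong.\<close>

lemma sol_compact:
  assumes C: "\<And>n. norm (y n) \<le> C" and weak: "\<And>x. (\<lambda>n. y n \<bullet> x) \<longlonglongrightarrow> z \<bullet> x"
  shows "(\<lambda>n. sol (y n)) \<longlonglongrightarrow> sol z"
proof -
  interpret sol: bounded_linear sol by (rule bounded_linear_sol)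
  have "\<forall>n. \<exists>g. (sol (y n - z), g) \<in> W \<and> norm g \<le> norm (y n - z)" using sol_proj by blast
  then obtain g where g: "\<And>n. (sol (y n - z), g n) \<in> W" "\<And>n. norm (g n) \<le> norm (y n - z)" by metis
  have "norm (g n) \<le> C + norm z" for n
    using g(2)[of n] norm_triangle_ineq4[of "y n" z] C[of n] by linarith
  moreover have "(\<lambda>n. sol (y n - z) \<bullet> w) \<longlonglongrightarrow> 0" for w
  proof -
    have "(\<lambda>n. y n \<bullet> adj w - z \<bullet> adj w) \<longlonglongrightarrow> z \<bullet> adj w - z \<bullet> adj w" by (intro tendsto_diff weak tendsto_const)
    moreover have "sol (y n - z) \<bullet> w = y n \<bullet> adj w - z \<bullet> adj w" for n
      by (simp add: adj(2)[symmetric] inner_commute[of _ w] inner_diff_right inner_commute[of _ "adj w"])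
    ultimately show ?thesis by simp
  qed
  ultimately have "(\<lambda>n. sol (y n - z)) \<longlonglongrightarrow> 0" by (rule rellich[OF g(1)])
  then show ?thesis unfolding sol.diff by (rule LIM_zero_cancel)
qed

lemma \<Phi>_expansion:
  assumes \<epsilon>: "\<epsilon> > 0"
  shows "\<exists>\<eta>>0. \<forall>y h. norm h \<le> \<eta> \<longrightarrow> \<bar>\<Phi> (y + h) - \<Phi> y - G y \<bullet> h\<bar> \<le> \<epsilon> * norm h"
proof -
  interpret sol: bounded_linear sol by (rule bounded_linear_sol)
  obtain L where L: "L > 0" "\<And>x. norm (sol x) \<le> norm x * L" using sol.pos_bounded by blast
  define m where "m = norm (abs_L2 (indicat_real \<Omega>)) + 1"
  have m: "m > 0" "norm (abs_L2 (indicat_real \<Omega>)) \<le> m" unfolding m_def by (auto intro: add_nonneg_pos)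
  \<comment> \<open>Chosen so that the linear error is at most half of the target;
    \<open>\<eta>\<close> below does the same for the quadratic error.\<close>
  define \<epsilon>1 where "\<epsilon>1 = \<epsilon> / (2 * m * L)"
  have e1: "\<epsilon>1 > 0" using \<epsilon> m L by (simp add: \<epsilon>1_def)
  from f_modulus[OF e1] obtain C where C: "C \<ge> 0" "\<forall>a b. \<bar>f a - f b\<bar> \<le> \<epsilon>1 + C * \<bar>a - b\<bar>" by blast
  define d where "d = (C + 1) * L\<^sup>2"
  have d: "d > 0" using C(1) L(1) by (simp add: d_def)
  define \<eta> where "\<eta> = \<epsilon> / (2 * d)"
  have "\<eta> > 0" using \<epsilon> d by (simp add: \<eta>_def)
  moreover have "\<bar>\<Phi> (y + h) - \<Phi> y - G y \<bullet> h\<bar> \<le> \<epsilon> * norm h" if h: "norm h \<le> \<eta>" for y h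
  proof -
    have "\<bar>\<Phi> (y + h) - \<Phi> y - G y \<bullet> h\<bar> \<le> \<epsilon>1 * (norm (abs_L2 (indicat_real \<Omega>)) * norm (sol h)) + C * (norm (sol h))\<^sup>2"
      unfolding \<Phi>_def inner_G sol.add by (rule energy_expansion[OF C(2,1) less_imp_le[OF e1]])
    also have "\<epsilon>1 * (norm (abs_L2 (indicat_real \<Omega>)) * norm (sol h)) \<le> \<epsilon>1 * (m * (norm h * L))"
      using e1 m L by (intro mult_left_mono mult_mono) auto
    also have "\<dots> = \<epsilon> / 2 * norm h" using m L by (simp add: \<epsilon>1_def)
    also have "C * (norm (sol h))\<^sup>2 \<le> (C + 1) * (norm h * L)\<^sup>2"
      using C L by (intro mult_mono power_mono) auto
    also have "\<dots> = (d * norm h) * norm h" by (simp add: d_def power2_eq_square)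
    also have "\<dots> \<le> (d * \<eta>) * norm h"
      using h d by (intro mult_right_mono mult_left_mono) auto
    also have "d * \<eta> = \<epsilon> / 2" using d by (simp add: \<eta>_def)
    finally show ?thesis by simp
  qed
  ultimately show ?thesis by blast
qed

lemma G_bounded: "\<exists>b. \<forall>y. norm (G y) \<le> b"
proof -
  obtain L where L: "L > 0" "\<And>x. norm (adj x) \<le> norm x * L" using bounded_linear.pos_bounded[OF adj(1)] by blast
  have "norm (G y) \<le> B * norm (abs_L2 (indicat_real \<Omega>)) * L" for y
    unfolding G_def using L(2)[of "nem (sol y)"] mult_right_mono[OF norm_nem[of "sol y"] less_imp_le[OF L(1)]] by linarith
  then show ?thesis by blast
qed

lemma energy_tendsto: "w \<longlonglongrightarrow> v \<Longrightarrow> (\<lambda>n. energy (w n)) \<longlonglongrightarrow> energy v"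
proof (rule LIM_zero_cancel, rule Lim_null_comparison)
  assume w: "w \<longlonglongrightarrow> v"
  show "\<forall>\<^sub>F n in sequentially. norm (energy (w n) - energy v) \<le> B * norm (abs_L2 (indicat_real \<Omega>)) * norm (w n - v)"
    using energy_lipschitz by simp
  show "(\<lambda>n. B * norm (abs_L2 (indicat_real \<Omega>)) * norm (w n - v)) \<longlonglongrightarrow> 0"
    using tendsto_mult_left[OF tendsto_norm[OF LIM_zero[OF w]]] by simp
qed

lemma nonlocal_energy_\<Phi>:
  assumes "continuous_on UNIV \<mu>" "\<And>r. (M has_real_derivative \<mu> r) (at r)" "M 0 = 0"
  shows "nonlocal_energy \<Phi> G \<mu> M"
proof
  interpret sol: bounded_linear sol by (rule bounded_linear_sol)
  show "\<Phi> 0 = 0" by (simp add: \<Phi>_def sol.zero energy_0)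
  fix y :: "nat \<Rightarrow> ('a, 'a) L2" and z C
  assume yz: "\<And>n. norm (y n) \<le> C" "\<And>x. (\<lambda>n. y n \<bullet> x) \<longlonglongrightarrow> z \<bullet> x"
  show "(\<lambda>n. G (y n)) \<longlonglongrightarrow> G z"
    unfolding G_def by (rule bounded_linear.tendsto[OF adj(1) nem_tendsto[OF sol_compact[OF yz]]])
  show "(\<lambda>n. \<Phi> (y n)) \<longlonglongrightarrow> \<Phi> z"
    unfolding \<Phi>_def by (rule energy_tendsto[OF sol_compact[OF yz]])
qed (use assms \<Phi>_expansion G_bounded in blast)+

text \<open>The maximum that defines \<open>alpha\<close> is attained because \<open>\<Phi>\<close> is weakly continuous.\<close>

lemma \<Phi>_max:
  assumes T: "T \<ge> 0"
  obtains z where "norm z \<le> sqrt T" "\<And>y. norm y \<le> sqrt T \<Longrightarrow> \<Phi> y \<le> \<Phi> z"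
proof -
  interpret sol: bounded_linear sol by (rule bounded_linear_sol)
  define A where "A = \<Phi> ` {y. norm y \<le> sqrt T}"
  have A0: "A \<noteq> {}" using T by (auto simp: A_def intro!: exI[of _ 0])
  obtain L where L: "L > 0" "\<And>x. norm (sol x) \<le> norm x * L" using sol.pos_bounded by blast
  define k where "k = B * norm (abs_L2 (indicat_real \<Omega>))"
  have k0: "k \<ge> 0" unfolding k_def using B_nonneg by simp
  have "\<Phi> y \<le> k * (sqrt T * L)" if "norm y \<le> sqrt T" for y
  proof -
    have "\<Phi> y \<le> k * norm (sol y)"
      using energy_lipschitz[of "sol y" 0] by (simp add: \<Phi>_def energy_0 k_def)
    also have "\<dots> \<le> k * (sqrt T * L)"
      using L(2)[of y] mult_right_mono[OF that less_imp_le[OF L(1)]] k0 by (intro mult_left_mono) linarith+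
    finally show ?thesis .
  qed
  then have bA: "bdd_above A" unfolding A_def by (auto intro!: bdd_aboveI)
  have "\<exists>y. norm y \<le> sqrt T \<and> Sup A - inverse (real (Suc n)) < \<Phi> y" for n
  proof -
    have "Sup A - inverse (real (Suc n)) < Sup A" by simp
    from less_cSupD[OF A0 this] show ?thesis by (auto simp: A_def)
  qed
  then obtain y where y: "\<And>n. norm (y n) \<le> sqrt T" "\<And>n. Sup A - inverse (real (Suc n)) < \<Phi> (y n)" by metis
  obtain r z \<rho> where r: "strict_mono r" and z: "\<And>x. (\<lambda>n. y (r n) \<bullet> x) \<longlonglongrightarrow> z \<bullet> x"
    and \<rho>: "(\<lambda>n. norm (y (r n))) \<longlonglongrightarrow> \<rho>" "norm z \<le> \<rho>"
    using bounded_weak_limit[of y, OF y(1)] by blast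
  have "\<rho> \<le> sqrt T" by (rule LIMSEQ_le_const2[OF \<rho>(1)]) (use y(1) in blast)
  then have zT: "norm z \<le> sqrt T" using \<rho>(2) by simp
  have "(\<lambda>n. \<Phi> (y (r n))) \<longlonglongrightarrow> \<Phi> z"
    unfolding \<Phi>_def by (rule energy_tendsto[OF sol_compact[OF y(1) z]])
  moreover have "(\<lambda>n. Sup A - inverse (real (Suc (r n)))) \<longlonglongrightarrow> Sup A"
    using tendsto_diff[OF tendsto_const LIMSEQ_subseq_LIMSEQ[OF LIMSEQ_inverse_real_of_nat r], of "Sup A"] by (simp add: o_def)
  ultimately have "Sup A \<le> \<Phi> z"
    using LIMSEQ_le[of "\<lambda>n. Sup A - inverse (real (Suc (r n)))"] less_imp_le[OF y(2)] by blast
  moreover have "\<Phi> x \<le> Sup A" if "norm x \<le> sqrt T" for x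
    using that bA by (intro cSup_upper) (auto simp: A_def)
  ultimately show thesis using that[OF zT] order_trans by blast
qed

text \<open>An element of \<open>H10\<close> is recovered from its gradient \<open>y\<close> as \<open>rep_L2 (sol y)\<close>.\<close>

lemma H10_rep:
  assumes "(w, y) \<in> W"
  shows "rep_L2 w \<in> H10 \<Omega>" "H10_norm \<Omega> (rep_L2 w) = norm y" "abs_L2 (zext (wgrad \<Omega> (rep_L2 w))) = y"
    "L2_fun \<Omega> (wgrad \<Omega> (rep_L2 w))"
proof -
  have L: "L2_fun \<Omega> (rep_L2 w)" unfolding L2_fun_zext by (rule sqint_zext[OF sqint_rep])
  have "abs_L2 (zext (rep_L2 w)) = abs_L2 (rep_L2 w)"
    by (subst abs_L2_eq_iff) (intro sqint_zext sqint_rep zext_AE_eq W_support(1)[OF assms])+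
  then have W': "(abs_L2 (zext (rep_L2 w)), y) \<in> W" using assms by (simp add: abs_rep_L2)
  show "rep_L2 w \<in> H10 \<Omega>" "H10_norm \<Omega> (rep_L2 w) = norm y" by (rule H10_I[OF L W'])+
  show "abs_L2 (zext (wgrad \<Omega> (rep_L2 w))) = y" "L2_fun \<Omega> (wgrad \<Omega> (rep_L2 w))" using W_wgrad[OF L W'] by auto
qed

lemma energy_eq: assumes "L2_fun \<Omega> u" shows "(LINT x|lebesgue_on \<Omega>. F (u x)) = energy (abs_L2 (zext u))"
  unfolding integral_zext energy_def
proof (rule integral_cong_AE)
  have s: "sqint (zext u)" using assms by (simp add: L2_fun_zext)
  have eq: "zext (\<lambda>x. F (u x)) = (\<lambda>x. indicator \<Omega> x * F (zext u x))" by (auto simp: zext_def)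
  show "zext (\<lambda>x. F (u x)) \<in> borel_measurable lebesgue" unfolding eq
    by (intro borel_measurable_times borel_measurable_indicator \<Omega>_lebesgue measurable_F sqint_measurable s)
  show "AE x in lebesgue. zext (\<lambda>x. F (u x)) x = indicator \<Omega> x * F (rep_L2 (abs_L2 (zext u)) x)"
    unfolding eq using rep_abs_L2[OF s] by eventually_elim simp
qed (use integrable_energy in blast)

text \<open>\<open>GREATEST\<close> has the intended meaning only because the maximum is attained. A
  maximising field may be replaced by its projection onto gradients, which has the same potential
  and no larger norm, so the maximum over fields is the one over \<open>H10\<close>.\<close>

lemma alpha_upper_bound:
  assumes T: "T \<ge> 0" and y: "(norm y)\<^sup>2 \<le> T"
  shows "\<Phi> y \<le> (GREATEST a. a \<in> (\<lambda>u. LINT x|lebesgue_on \<Omega>. F (u x)) ` {u \<in> H10 \<Omega>. H10_norm \<Omega> u \<le> sqrt T})"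
proof -
  obtain z where z: "norm z \<le> sqrt T" "\<And>y. norm y \<le> sqrt T \<Longrightarrow> \<Phi> y \<le> \<Phi> z" using \<Phi>_max[OF T] by blast
  obtain g where g: "(sol z, g) \<in> W" "norm g \<le> norm z" using sol_proj[of z] by blast
  have L: "L2_fun \<Omega> (rep_L2 (sol z))" by (rule H10_D(1)[OF H10_rep(1)[OF g(1)]])
  have "abs_L2 (zext (rep_L2 (sol z))) = abs_L2 (rep_L2 (sol z))"
    by (subst abs_L2_eq_iff) (intro sqint_zext sqint_rep zext_AE_eq W_support(1)[OF g(1)])+
  then have e: "(LINT x|lebesgue_on \<Omega>. F (rep_L2 (sol z) x)) = \<Phi> z"
    unfolding energy_eq[OF L] \<Phi>_def by (simp add: abs_rep_L2)
  have "(GREATEST a. a \<in> (\<lambda>u. LINT x|lebesgue_on \<Omega>. F (u x)) ` {u \<in> H10 \<Omega>. H10_norm \<Omega> u \<le> sqrt T}) = \<Phi> z"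
  proof (rule Greatest_equality)
    show "\<Phi> z \<in> (\<lambda>u. LINT x|lebesgue_on \<Omega>. F (u x)) ` {u \<in> H10 \<Omega>. H10_norm \<Omega> u \<le> sqrt T}"
      by (rule image_eqI[where x = "rep_L2 (sol z)"]) (use e H10_rep[OF g(1)] g(2) z(1) in auto)
    fix a assume "a \<in> (\<lambda>u. LINT x|lebesgue_on \<Omega>. F (u x)) ` {u \<in> H10 \<Omega>. H10_norm \<Omega> u \<le> sqrt T}"
    then obtain u where u: "u \<in> H10 \<Omega>" "H10_norm \<Omega> u \<le> sqrt T" and a: "a = (LINT x|lebesgue_on \<Omega>. F (u x))" by blast
    note D = H10_D[OF u(1)]
    have "a = \<Phi> (abs_L2 (zext (wgrad \<Omega> u)))" unfolding a energy_eq[OF D(1)] \<Phi>_def sol_in_W[OF D(2)] ..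
    then show "a \<le> \<Phi> z" using z(2) u(2) H10_I(2)[OF D] by simp
  qed
  then show ?thesis using z(2)[of y] y by (simp add: real_le_rsqrt)
qed

text \<open>\<open>G y\<close> is a gradient, being an adjoint image under \<open>sol\<close>, and
  division by the positive \<open>c\<close> makes \<open>y\<close> a gradient, with potential
  \<open>sol y\<close>.\<close>

lemma critical_point_weak_form:
  assumes c: "c > 0" and crit: "c *\<^sub>R y = G y"
  shows "(sol y, y) \<in> W" "(v, k) \<in> W \<Longrightarrow> c * (y \<bullet> k) = (\<integral>x. indicator \<Omega> x * f (rep_L2 (sol y) x) * rep_L2 v x \<partial>lebesgue)"
proof -
  have "G y \<in> snd ` W" by (rule sol_adjoint_in_snd_W[of _ "nem (sol y)"]) (simp add: inner_G)
  then have "(1 / c) *\<^sub>R G y \<in> snd ` W" using subspace_snd_W subspace_mul by blast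
  moreover have "(1 / c) *\<^sub>R G y = y" unfolding crit[symmetric] using c by simp
  ultimately show "(sol y, y) \<in> W" using sol_W by simp
  assume vk: "(v, k) \<in> W"
  have "c * (y \<bullet> k) = G y \<bullet> k" unfolding crit[symmetric] by simp
  also have "\<dots> = nem (sol y) \<bullet> v" unfolding inner_G sol_in_W[OF vk] ..
  finally show "c * (y \<bullet> k) = (\<integral>x. indicator \<Omega> x * f (rep_L2 (sol y) x) * rep_L2 v x \<partial>lebesgue)" by (simp add: inner_nem)
qed

lemma critical_point_weak_solution:
  assumes c: "c > 0" and crit: "c *\<^sub>R y = G y" and v: "v \<in> H10 \<Omega>"
  shows "integrable (lebesgue_on \<Omega>) (\<lambda>x. f (rep_L2 (sol y) x) * v x)"
    "c * (LINT x|lebesgue_on \<Omega>. wgrad \<Omega> (rep_L2 (sol y)) x \<bullet> wgrad \<Omega> v x) = (LINT x|lebesgue_on \<Omega>. f (rep_L2 (sol y) x) * v x)"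
proof -
  note W = critical_point_weak_form[OF c crit] and D = H10_D[OF v]
  note R = H10_rep[OF W(1)]
  have sv: "sqint (zext v)" using D(1) by (simp add: L2_fun_zext)
  have swv: "sqint (zext (wgrad \<Omega> v))" using W_wgrad(1)[OF D] by (simp add: L2_fun_zext)
  have swu: "sqint (zext (wgrad \<Omega> (rep_L2 (sol y))))" using R(4) by (simp add: L2_fun_zext)
  have z: "zext (\<lambda>x. f (rep_L2 (sol y) x) * v x) = (\<lambda>x. (indicator \<Omega> x * f (rep_L2 (sol y) x)) *\<^sub>R zext v x)"
    by (auto simp: zext_def)
  show "integrable (lebesgue_on \<Omega>) (\<lambda>x. f (rep_L2 (sol y) x) * v x)"
    unfolding integrable_zext z by (rule sqint_mult_integrable[OF sqint_nem sv])
  have z2: "zext (\<lambda>x. wgrad \<Omega> (rep_L2 (sol y)) x \<bullet> wgrad \<Omega> v x) = (\<lambda>x. zext (wgrad \<Omega> (rep_L2 (sol y))) x \<bullet> zext (wgrad \<Omega> v) x)"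
    by (auto simp: zext_def)
  have "(LINT x|lebesgue_on \<Omega>. wgrad \<Omega> (rep_L2 (sol y)) x \<bullet> wgrad \<Omega> v x) = y \<bullet> abs_L2 (zext (wgrad \<Omega> v))"
    unfolding integral_zext z2 inner_abs_L2[OF swu swv, symmetric] R(3) ..
  then have "c * (LINT x|lebesgue_on \<Omega>. wgrad \<Omega> (rep_L2 (sol y)) x \<bullet> wgrad \<Omega> v x)
      = nem (sol y) \<bullet> abs_L2 (zext v)"
    using W(2)[OF D(2)] by (simp add: inner_nem)
  also have "\<dots> = (LINT x|lebesgue_on \<Omega>. f (rep_L2 (sol y) x) * v x)"
    unfolding integral_zext z nem_def inner_abs_L2[OF sqint_nem sv] by simp
  finally show "c * (LINT x|lebesgue_on \<Omega>. wgrad \<Omega> (rep_L2 (sol y)) x \<bullet> wgrad \<Omega> v x)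
      = (LINT x|lebesgue_on \<Omega>. f (rep_L2 (sol y) x) * v x)" .
qed

end

section \<open>Solutions of the truncated problem\<close>

lemma primitive_deriv:
  assumes "continuous_on UNIV f"
  shows "(primitive f has_real_derivative f t) (at t)"
proof -
  \<comment> \<open>An interval containing 0 and having \<open>t\<close> in its interior, so that
    the derivative within it is a full derivative.\<close>
  define a b where "a = - \<bar>t\<bar> - 1" and "b = \<bar>t\<bar> + 1"
  have c: "continuous_on {a..b} f" using assms by (rule continuous_on_subset) simp
  have "((\<lambda>u. LBINT y=ereal 0..ereal u. f y) has_vector_derivative f t) (at t within {a..b})"
    by (rule interval_integral_FTC2[OF _ _ c]) (auto simp: a_def b_def)
  moreover have "at t within {a..b} = at t"
    by (rule at_within_interior) (auto simp: a_def b_def)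
  ultimately show ?thesis
    by (simp add: primitive_def[abs_def] has_real_derivative_iff_has_vector_derivative)
qed

lemma primitive_0: "primitive f 0 = 0"
  by (simp add: primitive_def)

lemma flat_0_deriv: "(flat 0 has_real_derivative flat 2 t) (at t)"
  using flat_deriv[of 0 t] by (simp add: numeral_2_eq_2)

text \<open>The bound comes from \<open>x\<^sup>2 \<le> 2 * exp x\<close> at
  \<open>x = inverse t\<close>. Being the derivative of \<open>flat 0\<close>, the function thereby
  qualifies for the chain rule.\<close>

lemma flat_2_le: "flat 2 t \<le> 2"
proof (cases "t \<le> 0")
  case False
  define x where "x = inverse t"
  have x: "x > 0" using False by (simp add: x_def)
  have "x\<^sup>2 \<le> 2 * exp x" using exp_lower_Taylor_quadratic[of x] x by simp
  then have "x\<^sup>2 * exp (- x) \<le> 2" by (simp add: exp_minus field_simps)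
  then show ?thesis using False by (simp add: flat_def x_def)
qed (simp add: flat_def)

lemma flat_0_strict_mono: "0 < s \<Longrightarrow> r < s \<Longrightarrow> flat 0 r < flat 0 s"
  by (cases "r \<le> 0") (auto simp: flat_def)

lemma flat_0_mono: "r \<le> s \<Longrightarrow> flat 0 r \<le> flat 0 s"
  by (cases "r = s"; cases "s \<le> 0") (auto simp: flat_def)

section \<open>Smooth truncations of Sobolev functions\<close>

context bounded_domain
begin

lemma W_compose:
  assumes W: "(w, g) \<in> W" and h: "smooth h" "\<And>t. (h has_real_derivative h' t) (at t)" "\<And>t. \<bar>h' t\<bar> \<le> L" "h 0 = 0"
  shows "sqint (\<lambda>x. h (rep_L2 w x))" "sqint (\<lambda>x. h' (rep_L2 w x) *\<^sub>R rep_L2 g x)"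
    "(abs_L2 (\<lambda>x. h (rep_L2 w x)), abs_L2 (\<lambda>x. h' (rep_L2 w x) *\<^sub>R rep_L2 g x)) \<in> W"
proof -
  have t: "test_fun \<Omega> (\<lambda>x. 1 * h (\<phi> x))" if "test_fun \<Omega> \<phi>" for \<phi>
    using test_fun_compose[OF that h(1,4)] by simp
  have a: "\<bar>1::real\<bar> \<le> 1" "norm (grad (\<lambda>x::'a. 1) x) \<le> 0" for x :: 'a by (simp_all add: grad_const)
  note R = W_chain_rule[OF W h(1-3) smooth_const[of 1] a t]
  show "sqint (\<lambda>x. h (rep_L2 w x))" "sqint (\<lambda>x. h' (rep_L2 w x) *\<^sub>R rep_L2 g x)"
    "(abs_L2 (\<lambda>x. h (rep_L2 w x)), abs_L2 (\<lambda>x. h' (rep_L2 w x) *\<^sub>R rep_L2 g x)) \<in> W"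
    using R by (simp_all add: grad_const)
qed

text \<open>The composed function lies in the Sobolev space with gradient zero, and the Poincare
  inequality makes it vanish.\<close>

lemma W_compose_eq_0:
  assumes W: "(w, g) \<in> W" and h: "smooth h" "\<And>t. (h has_real_derivative h' t) (at t)" "\<And>t. \<bar>h' t\<bar> \<le> L" "h 0 = 0"
    and 0: "AE x in lebesgue. h' (rep_L2 w x) *\<^sub>R rep_L2 g x = 0"
  shows "AE x in lebesgue. h (rep_L2 w x) = 0"
proof -
  note C = W_compose[OF W h]
  have "abs_L2 (\<lambda>x. h' (rep_L2 w x) *\<^sub>R rep_L2 g x) = abs_L2 (\<lambda>x. 0)"
    using 0 by (subst abs_L2_eq_iff[OF C(2) sqint_zero])
  then have "norm (abs_L2 (\<lambda>x. h (rep_L2 w x))) \<le> 0"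
    using W_poincare[OF C(3)] by (simp add: abs_L2_zero)
  then have "abs_L2 (\<lambda>x. h (rep_L2 w x)) = abs_L2 (\<lambda>x. 0)" by (simp add: abs_L2_zero)
  then show ?thesis by (subst (asm) abs_L2_eq_iff[OF C(1) sqint_zero])
qed

lemma not_AE_False_on_\<Omega>: "\<Omega> \<noteq> {} \<Longrightarrow> \<not> (AE x in lebesgue. x \<notin> \<Omega>)"
proof
  assume "\<Omega> \<noteq> {}" "AE x in lebesgue. x \<notin> \<Omega>"
  then have "AE x in lborel. x \<notin> \<Omega>" by (simp add: AE_completion_iff)
  then have z: "emeasure lborel \<Omega> = 0"
    using open_\<Omega> by (subst (asm) AE_iff_measurable[of "\<Omega>"]) auto
  obtain x where "x \<in> \<Omega>" using \<open>\<Omega> \<noteq> {}\<close> by blast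
  then obtain e where e: "e > 0" "ball x e \<subseteq> \<Omega>" using open_\<Omega> open_contains_ball by blast
  have "emeasure lborel (ball x e) = 0"
    using emeasure_mono[OF e(2), of lborel] open_\<Omega> z by (simp add: borel_open)
  then show False using content_ball_pos[of e x] e by (simp add: measure_def)
qed

end

locale truncated = semilinear \<Omega> f F B for \<Omega> :: "'a::euclidean_space set" and f F B +
  fixes s0 :: real
  assumes s0: "s0 > 0" and f0: "f 0 \<ge> 0"
    and f_neg: "\<And>t. t < 0 \<Longrightarrow> f t = f 0"
    and f_pos: "\<And>t. 0 < t \<Longrightarrow> t < s0 \<Longrightarrow> f t > 0"
    and f_ge: "\<And>t. s0 \<le> t \<Longrightarrow> f t = 0"
    and conn: "connected \<Omega>" and ne: "\<Omega> \<noteq> {}"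
begin

lemma f_nonneg: "f t \<ge> 0"
  using f0 f_neg[of t] f_pos[of t] f_ge[of t] by (cases "t < 0"; cases "t = 0"; cases "t < s0") (auto intro: less_imp_le)

text \<open>Testing the equation with \<open>h (u)\<close> equates \<open>c\<close> times the
  integral of \<open>h' (u)\<close> times the squared gradient with the integral of
  \<open>f (u) * h (u)\<close>. The signs force both to vanish, so \<open>h (u)\<close> has gradient
  zero.\<close>

lemma weak_form_truncate:
  assumes c: "c > 0" and crit: "c *\<^sub>R y = G y"
    and h: "smooth h" "\<And>t. (h has_real_derivative h' t) (at t)" "\<And>t. 0 \<le> h' t \<and> h' t \<le> L" "h 0 = 0"
    and neg: "\<And>t. f t * h t \<le> 0"
  shows "AE x in lebesgue. h (rep_L2 (sol y) x) = 0"
proof -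
  note E = critical_point_weak_form[OF c crit]
  have hb: "\<bar>h' t\<bar> \<le> L" for t using h(3)[of t] by simp
  note C = W_compose[OF E(1) h(1,2) hb h(4)]
  have i: "integrable lebesgue (\<lambda>x. h' (rep_L2 (sol y) x) * (norm (rep_L2 y x))\<^sup>2)"
    using sqint_inner_integrable[OF sqint_rep[of y] C(2)] by (simp add: dot_square_norm)
  have "y \<bullet> abs_L2 (\<lambda>x. h' (rep_L2 (sol y) x) *\<^sub>R rep_L2 y x) = (\<integral>x. h' (rep_L2 (sol y) x) * (norm (rep_L2 y x))\<^sup>2 \<partial>lebesgue)"
    using inner_abs_L2[OF sqint_rep[of y] C(2)] by (simp add: abs_rep_L2 dot_square_norm)
  moreover have "c * (y \<bullet> abs_L2 (\<lambda>x. h' (rep_L2 (sol y) x) *\<^sub>R rep_L2 y x)) \<le> 0"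
  proof -
    have "0 \<le> (\<integral>x. - (indicator \<Omega> x * f (rep_L2 (sol y) x) * rep_L2 (abs_L2 (\<lambda>x. h (rep_L2 (sol y) x))) x) \<partial>lebesgue)"
    proof (rule integral_nonneg_AE)
      show "AE x in lebesgue. 0 \<le> - (indicator \<Omega> x * f (rep_L2 (sol y) x) * rep_L2 (abs_L2 (\<lambda>x. h (rep_L2 (sol y) x))) x)"
        using rep_abs_L2[OF C(1)]
      proof eventually_elim
        case (elim x)
        then show ?case using neg[of "rep_L2 (sol y) x"] by (cases "x \<in> \<Omega>") simp_all
      qed
    qed
    then show ?thesis unfolding E(2)[OF C(3)] by simp
  qed
  ultimately have "(\<integral>x. h' (rep_L2 (sol y) x) * (norm (rep_L2 y x))\<^sup>2 \<partial>lebesgue) \<le> 0"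
    using c by (simp add: mult_le_0_iff)
  moreover have nn: "AE x in lebesgue. 0 \<le> h' (rep_L2 (sol y) x) * (norm (rep_L2 y x))\<^sup>2" using h(3) by simp
  ultimately have "(\<integral>x. h' (rep_L2 (sol y) x) * (norm (rep_L2 y x))\<^sup>2 \<partial>lebesgue) = 0"
    using integral_nonneg_AE[OF nn] by simp
  then have "AE x in lebesgue. h' (rep_L2 (sol y) x) * (norm (rep_L2 y x))\<^sup>2 = 0"
    using integral_nonneg_eq_0_iff_AE[OF i nn] by simp
  then have "AE x in lebesgue. h' (rep_L2 (sol y) x) *\<^sub>R rep_L2 y x = 0" by eventually_elim simp
  then show ?thesis by (rule W_compose_eq_0[OF E(1) h(1,2) hb h(4)])
qed

text \<open>Flat functions of \<open>- t\<close> and \<open>t - s0\<close> act as smooth versions of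
  the negative part and of the excess over \<open>s0\<close>; they vanish exactly on the admissible
  side.\<close>

lemma critical_point_bounds:
  assumes c: "c > 0" and crit: "c *\<^sub>R y = G y"
  shows "AE x in lebesgue. 0 \<le> rep_L2 (sol y) x \<and> rep_L2 (sol y) x \<le> s0"
proof -
  have 1: "AE x in lebesgue. - flat 0 (- rep_L2 (sol y) x) = 0"
  proof (rule weak_form_truncate[OF c crit, of "\<lambda>t. - flat 0 (- t)" "\<lambda>t. flat 2 (- t)" 2])
    show "smooth (\<lambda>t. - flat 0 (- t))"
      by (intro smooth_minus smooth_compose[OF smooth_flat] smooth_ident)
    show "((\<lambda>t. - flat 0 (- t)) has_real_derivative flat 2 (- t)) (at t)" for t
      by (auto intro!: derivative_eq_intros DERIV_chain2[OF flat_0_deriv])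
    show "0 \<le> flat 2 (- t) \<and> flat 2 (- t) \<le> 2" for t by (simp add: flat_nonneg flat_2_le)
    show "f t * - flat 0 (- t) \<le> 0" for t using f_nonneg[of t] flat_nonneg[of 0 "- t"] by simp
  qed (simp add: flat_def)
  have 2: "AE x in lebesgue. flat 0 (rep_L2 (sol y) x - s0) = 0"
  proof (rule weak_form_truncate[OF c crit, of "\<lambda>t. flat 0 (t - s0)" "\<lambda>t. flat 2 (t - s0)" 2])
    show "smooth (\<lambda>t. flat 0 (t - s0))"
      by (intro smooth_compose[OF smooth_flat] smooth_diff smooth_ident smooth_const)
    show "((\<lambda>t. flat 0 (t - s0)) has_real_derivative flat 2 (t - s0)) (at t)" for t
    proof -
      have "((\<lambda>t. t - s0) has_real_derivative 1) (at t)" by (auto intro!: derivative_eq_intros)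
      from DERIV_chain2[OF flat_0_deriv this] show ?thesis by simp
    qed
    show "0 \<le> flat 2 (t - s0) \<and> flat 2 (t - s0) \<le> 2" for t by (simp add: flat_nonneg flat_2_le)
    show "f t * flat 0 (t - s0) \<le> 0" for t using f_ge[of t] by (cases "t < s0") (auto simp: flat_def)
  qed (use s0 in \<open>simp add: flat_def\<close>)
  from 1 2 show ?thesis
  proof eventually_elim
    case (elim x)
    then show ?case
      using flat_0_less[of "- rep_L2 (sol y) x" 0] flat_0_less[of "rep_L2 (sol y) x - s0" 0]
      by (auto simp: not_le[symmetric])
  qed
qed

text \<open>Since \<open>f\<close> is nonnegative the solution is superharmonic, and the strong
  maximum principle applies. If the potential vanished, testing the equation with itself would give
  \<open>y = 0\<close>.\<close>

lemma critical_point_positive: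
  assumes c: "c > 0" and crit: "c *\<^sub>R y = G y" and y0: "y \<noteq> 0"
  shows "AE x in lebesgue. x \<in> \<Omega> \<longrightarrow> rep_L2 (sol y) x > 0"
proof -
  note E = critical_point_weak_form[OF c crit]
  have super: "\<forall>v k. (v, k) \<in> W \<longrightarrow> (AE x in lebesgue. rep_L2 v x \<ge> 0) \<longrightarrow> y \<bullet> k \<ge> 0"
  proof (intro allI impI)
    fix v k assume vk: "(v, k) \<in> W" and nn: "AE x in lebesgue. rep_L2 v x \<ge> 0"
    have "0 \<le> (\<integral>x. indicator \<Omega> x * f (rep_L2 (sol y) x) * rep_L2 v x \<partial>lebesgue)"
    proof (rule integral_nonneg_AE)
      show "AE x in lebesgue. 0 \<le> indicator \<Omega> x * f (rep_L2 (sol y) x) * rep_L2 v x"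
        using nn by eventually_elim (simp add: f_nonneg)
    qed
    then have "0 \<le> c * (y \<bullet> k)" unfolding E(2)[OF vk] .
    then show "y \<bullet> k \<ge> 0" using c by (simp add: zero_le_mult_iff)
  qed
  from strong_maximum_principle[OF conn E(1) super critical_point_bounds[OF c crit] s0]
  show ?thesis
  proof
    assume z: "AE x in lebesgue. x \<in> \<Omega> \<longrightarrow> rep_L2 (sol y) x = 0"
    have "c * (y \<bullet> y) = (\<integral>x. indicator \<Omega> x * f (rep_L2 (sol y) x) * rep_L2 (sol y) x \<partial>lebesgue)" by (rule E(2)[OF E(1)])
    also have "\<dots> = (\<integral>x. 0 \<partial>(lebesgue :: 'a measure))"
    proof (rule integral_cong_AE)
      show "AE x in lebesgue. indicator \<Omega> x * f (rep_L2 (sol y) x) * rep_L2 (sol y) x = 0"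
        using z by eventually_elim (auto simp: indicator_def)
      show "(\<lambda>x. indicator \<Omega> x * f (rep_L2 (sol y) x) * rep_L2 (sol y) x) \<in> borel_measurable lebesgue"
        by (intro borel_measurable_times sqint_measurable[OF sqint_nem] sqint_measurable[OF sqint_rep])
    qed simp
    finally have "y \<bullet> y = 0" using c by simp
    then show ?thesis using y0 by simp
  qed
qed

text \<open>If \<open>f (u)\<close> vanishes, then \<open>u\<close> takes no value strictly between
  0 and \<open>s0\<close>. A Sobolev function cannot jump over this gap, and as it has zero boundary
  values it must stay at or below 0.\<close>

lemma G_eq_0:
  assumes G0: "G y = 0"
  shows "AE x in lebesgue. x \<in> \<Omega> \<longrightarrow> f (rep_L2 (sol y) x) = 0" "AE x in lebesgue. rep_L2 (sol y) x \<le> 0"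
proof -
  obtain g where W: "(sol y, g) \<in> W" using sol_proj[of y] by blast
  show f_0: "AE x in lebesgue. x \<in> \<Omega> \<longrightarrow> f (rep_L2 (sol y) x) = 0"
  proof -
    have "AE x in lebesgue. x \<in> \<Omega> \<longrightarrow> indicator \<Omega> x * f (rep_L2 (sol y) x) = 0"
    proof (rule fundamental_lemma[OF open_\<Omega>])
      show "integrable lebesgue (\<lambda>x. indicator \<Omega> x * f (rep_L2 (sol y) x))"
        by (rule sqint_supported_integrable[OF sqint_nem]) simp
      fix \<phi> assume \<phi>: "test_fun \<Omega> \<phi>"
      have "(\<integral>x. \<phi> x * (indicator \<Omega> x * f (rep_L2 (sol y) x)) \<partial>lebesgue) = nem (sol y) \<bullet> abs_L2 \<phi>"
        unfolding nem_def inner_abs_L2[OF sqint_nem test_fun_integrable(2)[OF \<phi>]] by (simp add: mult.commute)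
      also have "\<dots> = G y \<bullet> abs_L2 (grad \<phi>)" unfolding inner_G sol_in_W[OF test_fun_in_W[OF \<phi>]] ..
      finally show "(\<integral>x. \<phi> x * (indicator \<Omega> x * f (rep_L2 (sol y) x)) \<partial>lebesgue) = 0" using G0 by simp
    qed
    then show ?thesis by eventually_elim simp
  qed
  define a where "a = flat 0 s0"
  \<comment> \<open>Zero for \<open>t \<le> 0\<close>, positive for \<open>t > 0\<close>, and
    constant for \<open>t \<ge> s0\<close>, since the inner function is at most 0 on the left and
    equal to \<open>a\<close> on the right. Its derivative lives in the gap, so \<open>h (u)\<close>
    has gradient zero.\<close>
  define h where "h t = flat 0 (a - flat 0 (s0 - t))" for t
  define h' where "h' t = flat 2 (a - flat 0 (s0 - t)) * flat 2 (s0 - t)" for t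
  have hs: "smooth h" unfolding h_def[abs_def]
    by (intro smooth_compose[OF smooth_flat] smooth_diff smooth_const smooth_ident)
  have hd: "(h has_real_derivative h' t) (at t)" for t
    unfolding h_def[abs_def] h'_def
    by (auto intro!: derivative_eq_intros DERIV_chain2[OF flat_0_deriv])
  have hb: "\<bar>h' t\<bar> \<le> 2 * 2" for t
    unfolding h'_def abs_mult using flat_nonneg flat_2_le by (intro mult_mono) auto
  have h0: "h 0 = 0" by (simp add: h_def a_def flat_def)
  have "AE x in lebesgue. h' (rep_L2 (sol y) x) *\<^sub>R rep_L2 g x = 0"
    using f_0 W_support(2)[OF W]
  proof eventually_elim
    case (elim x)
    define t where "t = rep_L2 (sol y) x"
    show ?case
    proof (cases "x \<in> \<Omega>")
      case True
      then have "f t = 0" using elim by (simp add: t_def)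
      then have "t \<le> 0 \<or> s0 \<le> t" using f_pos[of t] by force
      moreover have "flat 0 s0 \<le> flat 0 (s0 - t)" if "t \<le> 0" using that by (intro flat_0_mono) simp
      ultimately have "h' t = 0" unfolding h'_def a_def by (auto simp: flat_0_eq)
      then show ?thesis by (simp add: t_def)
    qed (use elim in simp)
  qed
  from W_compose_eq_0[OF W hs hd hb h0 this]
  show "AE x in lebesgue. rep_L2 (sol y) x \<le> 0"
  proof eventually_elim
    case (elim x)
    show ?case
    proof (rule ccontr)
      assume "\<not> ?case"
      then have "flat 0 (s0 - rep_L2 (sol y) x) < a" unfolding a_def by (intro flat_0_strict_mono s0) simp
      then have "h (rep_L2 (sol y) x) > 0" unfolding h_def by (intro flat_0_less) simp
      then show False using elim by simp
    qed
  qed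
qed

text \<open>A vanishing \<open>G y\<close> would give \<open>u \<le> 0\<close>, where
  \<open>f\<close> has the positive value \<open>f 0\<close>, together with \<open>f (u) = 0\<close>
  on the nonempty domain.\<close>

lemma G_neq_0: "f 0 > 0 \<Longrightarrow> G y \<noteq> 0"
proof
  assume f0: "f 0 > 0" and G0: "G y = 0"
  have "AE x in lebesgue. x \<notin> \<Omega>"
    using G_eq_0[OF G0]
  proof eventually_elim
    case (elim x)
    have "f (rep_L2 (sol y) x) = f 0" using elim(2) f_neg[of "rep_L2 (sol y) x"] by (cases "rep_L2 (sol y) x = 0") auto
    then show ?case using elim(1) f0 by auto
  qed
  then show False using not_AE_False_on_\<Omega>[OF ne] by blast
qed

section \<open>Signs of the nonlinear potential\<close>

lemma F_mono: assumes "a \<le> b" shows "F a \<le> F b"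
  by (rule DERIV_nonneg_imp_nondecreasing[OF assms]) (use F_deriv f_nonneg in blast)

lemma F_nonpos_eq_0: assumes "f 0 = 0" "t \<le> 0" shows "F t = 0"
proof -
  have "((\<lambda>t. F t) has_field_derivative 0) (at x within {..0})" if "x \<in> {..0}" for x
    using F_deriv[of x] f_neg[of x] assms(1) that
    by (cases "x = 0") (auto intro: has_field_derivative_at_within)
  then obtain k where "\<And>x. x \<in> {..0} \<Longrightarrow> F x = k"
    using has_field_derivative_zero_constant[of "{..0::real}" F] by auto
  from this[of t] this[of 0] show ?thesis using assms(2) F_0 by simp
qed

lemma F_nonneg: assumes "f 0 = 0" shows "F t \<ge> 0"
  using F_nonpos_eq_0[OF assms, of t] F_mono[of 0 t] F_0 by (cases "t \<le> 0") auto

lemma F_pos: assumes "t > 0" shows "F t > 0"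
proof -
  define b where "b = min t s0"
  have b: "b > 0" "b \<le> t" "b \<le> s0" using assms s0 by (auto simp: b_def)
  have "F 0 < F b"
  proof (rule DERIV_pos_imp_increasing_open[OF b(1)])
    show "continuous_on {0..b} F" by (auto intro!: continuous_at_imp_continuous_on DERIV_isCont[OF F_deriv])
    fix x assume "0 < x" "x < b"
    then show "\<exists>y. DERIV F x :> y \<and> y > 0" using F_deriv[of x] f_pos[of x] b(3) by auto
  qed
  then show ?thesis using F_mono[OF b(2)] F_0 by simp
qed

lemma \<Phi>_nonneg: assumes "f 0 = 0" shows "\<Phi> y \<ge> 0"
  unfolding \<Phi>_def energy_def by (intro integral_nonneg_AE AE_I2) (simp add: F_nonneg[OF assms])

lemma inner_G_nonneg: assumes "f 0 = 0" shows "G y \<bullet> y \<ge> 0"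
  unfolding inner_G inner_nem
proof (intro integral_nonneg_AE AE_I2)
  fix x
  have "f t * t \<ge> 0" for t using f_neg[of t] assms f_nonneg[of t] by (cases "t < 0") auto
  then show "0 \<le> indicator \<Omega> x * f (rep_L2 (sol y) x) * rep_L2 (sol y) x" by (simp add: mult.assoc)
qed

lemma G_eq_0_imp_\<Phi>: assumes f0: "f 0 = 0" and G0: "G y = 0" shows "\<Phi> y = 0"
proof -
  have "\<Phi> y = (\<integral>x. 0 \<partial>(lebesgue :: 'a measure))" unfolding \<Phi>_def energy_def
  proof (rule integral_cong_AE)
    show "AE x in lebesgue. indicator \<Omega> x * F (rep_L2 (sol y) x) = 0"
      using G_eq_0(2)[OF G0] by eventually_elim (simp add: F_nonpos_eq_0[OF f0])
  qed (use integrable_energy in auto)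
  then show ?thesis by simp
qed

text \<open>The gradient of a bump over a box serves as direction: every positive multiple of the
  bump is positive on the box, where \<open>F\<close> of it is positive too.\<close>

lemma \<Phi>_positive_ray: "\<exists>v. \<forall>s>0. \<Phi> (s *\<^sub>R v) > 0"
proof -
  obtain x where "x \<in> \<Omega>" using ne by blast
  then obtain c d where x: "x \<in> box c d" "cbox c d \<subseteq> \<Omega>"
    using open_contains_cbox[OF open_\<Omega>] by metis
  define \<phi> where "\<phi> = box_bump c d 1"
  have \<phi>: "test_fun \<Omega> \<phi>" unfolding \<phi>_def by (rule test_fun_box_bump[OF x(2)])
  have \<phi>pos: "\<phi> z > 0" if "z \<in> box c d" for z
    using box_bump_prod(2)[OF that] by (simp add: \<phi>_def box_bump_def)
  have \<phi>nn: "\<phi> z \<ge> 0" for z unfolding \<phi>_def by (rule box_bump_range)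
  have "\<Phi> (s *\<^sub>R abs_L2 (grad \<phi>)) > 0" if s: "s > 0" for s
  proof -
    note s\<phi> = test_fun_integrable(2)[OF test_fun_scale[OF \<phi>, of s]]
    have so: "sol (s *\<^sub>R abs_L2 (grad \<phi>)) = abs_L2 (\<lambda>x. s * \<phi> x)"
      using sol_in_W[OF W_scale[OF test_fun_in_W[OF \<phi>], of s]] abs_L2_scaleR[OF test_fun_integrable(2)[OF \<phi>], of s] by simp
    have i: "integrable lebesgue (\<lambda>x. indicator \<Omega> x * F (rep_L2 (abs_L2 (\<lambda>x. s * \<phi> x)) x))" by (rule integrable_energy)
    have ae: "AE x in lebesgue. indicator \<Omega> x * F (rep_L2 (abs_L2 (\<lambda>x. s * \<phi> x)) x) = indicator \<Omega> x * F (s * \<phi> x)"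
      using rep_abs_L2[OF s\<phi>] by eventually_elim simp
    have nn: "AE x in lebesgue. 0 \<le> indicator \<Omega> x * F (rep_L2 (abs_L2 (\<lambda>x. s * \<phi> x)) x)"
      using ae
    proof eventually_elim
      case (elim x)
      have "F (s * \<phi> x) \<ge> 0" using F_mono[of 0 "s * \<phi> x"] F_0 s \<phi>nn[of x] by simp
      then show ?case unfolding elim by simp
    qed
    have "energy (abs_L2 (\<lambda>x. s * \<phi> x)) \<noteq> 0"
    proof
      assume "energy (abs_L2 (\<lambda>x. s * \<phi> x)) = 0"
      then have "AE x in lebesgue. indicator \<Omega> x * F (rep_L2 (abs_L2 (\<lambda>x. s * \<phi> x)) x) = 0"
        using integral_nonneg_eq_0_iff_AE[OF i nn] by (simp add: energy_def)
      with ae have "AE x in lebesgue. x \<notin> box c d"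
      proof eventually_elim
        case (elim x)
        show ?case
        proof
          assume xb: "x \<in> box c d"
          then have "x \<in> \<Omega>" using x(2) box_subset_cbox by blast
          then have "F (s * \<phi> x) = 0" using elim by simp
          then show False using F_pos[of "s * \<phi> x"] \<phi>pos[OF xb] s by simp
        qed
      qed
      moreover have "bounded_domain (box c d)" by unfold_locales auto
      ultimately show False using bounded_domain.not_AE_False_on_\<Omega>[of "box c d"] x(1) by blast
    qed
    moreover have "energy (abs_L2 (\<lambda>x. s * \<phi> x)) \<ge> 0"
      unfolding energy_def by (rule integral_nonneg_AE[OF nn])
    ultimately show ?thesis unfolding \<Phi>_def so by simp
  qed
  then show ?thesis by blast
qed

text \<open>One interval between consecutive points of degeneracy, for a general left endpoint
  \<open>\<tau>\<close>; it joins the two abstract theorems.\<close>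

theorem critical_point_exists:
  assumes m: "continuous_on {0..} m" and \<tau>: "0 \<le> \<tau>" "\<tau> < T" and m\<tau>: "\<tau> > 0 \<Longrightarrow> m \<tau> = 0" and mT: "m T = 0"
    and m_pos: "\<And>r. \<tau> < r \<Longrightarrow> r < T \<Longrightarrow> m r > 0"
    and \<alpha>: "\<And>y. (norm y)\<^sup>2 \<le> T \<Longrightarrow> \<Phi> y \<le> \<alpha>" "\<alpha> < 1 / 2 * (LBINT r=ereal \<tau>..ereal T. m r)"
  shows "\<exists>y. \<tau> < (norm y)\<^sup>2 \<and> (norm y)\<^sup>2 < T \<and> m ((norm y)\<^sup>2) *\<^sub>R y = G y"
proof -
  \<comment> \<open>One formula for all cases: the constant \<open>m \<tau>\<close> below
    \<open>\<tau>\<close>, which is 0 if \<open>\<tau> > 0\<close>, then \<open>m\<close> up to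
    \<open>T\<close>, and \<open>T - r\<close> beyond. Clamping the argument also keeps it in the
    range where \<open>m\<close> is continuous.\<close>
  define \<mu> where "\<mu> r = m (max \<tau> (min r T)) - max 0 (r - T)" for r
  define M where "M = primitive \<mu>"
  have \<mu>c: "continuous_on UNIV \<mu>"
    unfolding \<mu>_def using \<tau>
    by (intro continuous_intros continuous_on_compose2[OF m]) auto
  have \<mu>_mid: "\<mu> r = m r" if "\<tau> \<le> r" "r \<le> T" for r using that by (simp add: \<mu>_def)
  have \<mu>_low: "\<mu> r = m \<tau>" if "r \<le> \<tau>" for r using that \<tau> by (simp add: \<mu>_def)
  have \<mu>_high: "\<mu> r = T - r" if "T \<le> r" for r using that \<tau> mT by (simp add: \<mu>_def)
  have Md: "(M has_real_derivative \<mu> r) (at r)" for r unfolding M_def by (rule primitive_deriv[OF \<mu>c])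
  have M0: "M 0 = 0" by (simp add: M_def primitive_0)
  interpret nonlocal_energy \<Phi> G \<mu> M by (rule nonlocal_energy_\<Phi>[OF \<mu>c Md M0])
  have M\<tau>: "M r = 0" if "0 \<le> r" "r \<le> \<tau>" for r
  proof (cases "\<tau> > 0")
    case True
    have "(M has_field_derivative 0) (at x within {0..\<tau>})" if "x \<in> {0..\<tau>}" for x
      using Md[of x] \<mu>_low[of x] m\<tau>[OF True] that by (auto intro: has_field_derivative_at_within)
    then obtain k where "\<And>x. x \<in> {0..\<tau>} \<Longrightarrow> M x = k"
      using has_field_derivative_zero_constant[of "{0..\<tau>}" M] by auto
    from this[of r] this[of 0] show ?thesis using M0 that True by simp
  next
    case False
    then have "r = 0" using that \<tau> by linarith
    then show ?thesis using M0 by simp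
  qed
  have MT: "M T = (LBINT r=ereal \<tau>..ereal T. m r)"
  proof -
    have "(LBINT r=ereal \<tau>..ereal T. \<mu> r) = M T - M \<tau>"
    proof (rule interval_integral_FTC_finite)
      show "continuous_on {min \<tau> T..max \<tau> T} \<mu>" using \<mu>c by (rule continuous_on_subset) simp
      show "(M has_vector_derivative \<mu> x) (at x within {min \<tau> T..max \<tau> T})" for x
        using Md[of x] by (simp add: has_real_derivative_iff_has_vector_derivative has_vector_derivative_at_within)
    qed
    moreover have "(LBINT r=ereal \<tau>..ereal T. \<mu> r) = (LBINT r=ereal \<tau>..ereal T. m r)"
      by (rule interval_integral_cong) (use \<tau> \<mu>_mid in \<open>auto simp: min_def max_def einterval_iff\<close>)
    ultimately show ?thesis using M\<tau>[of \<tau>] \<tau> by simp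
  qed
  have \<alpha>M: "\<alpha> < M T / 2" using \<alpha>(2) MT by simp
  obtain v where v: "\<And>s. s > 0 \<Longrightarrow> \<Phi> (s *\<^sub>R v) > 0" using \<Phi>_positive_ray by blast
  have v0: "v \<noteq> 0" using v[of 1] \<Phi>_0 by auto
  have \<mu>_pos: "\<mu> r > 0" if "\<tau> < r" "r < T" for r using m_pos[OF that] \<mu>_mid[of r] that by simp
  have "\<exists>y. \<tau> < (norm y)\<^sup>2 \<and> (norm y)\<^sup>2 < T \<and> \<mu> ((norm y)\<^sup>2) *\<^sub>R y = G y"
  \<comment> \<open>Minimisation works if points with \<open>G y = 0\<close> lie above the minimum.
    For \<open>f 0 > 0\<close> there are no such points; for \<open>\<tau> > 0\<close> they are
    beaten by a point on the inner sphere.\<close>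
  proof (cases "f 0 > 0 \<or> \<tau> > 0")
    case True
    show ?thesis
    proof (rule minimum_critical_point[OF \<tau> _ \<mu>_pos \<alpha>M \<alpha>(1)])
      show "\<mu> r = 0" if "r \<le> \<tau>" "0 < \<tau>" for r using \<mu>_low[OF that(1)] m\<tau>[OF that(2)] by simp
      fix y assume G0: "G y = 0" and yT: "(norm y)\<^sup>2 \<le> T"
      then have f0': "f 0 = 0" using G_neq_0[of y] f0 by force
      with True have \<tau>0: "\<tau> > 0" by simp
      \<comment> \<open>On this sphere \<open>M\<close> vanishes, so only the negative contribution
        of \<open>\<Phi>\<close> is left, whereas \<open>G y = 0\<close> forces
        \<open>\<Phi> y = 0\<close> and \<open>J y \<ge> 0\<close>.\<close>
      define z where "z = (sqrt \<tau> / norm v) *\<^sub>R v"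
      have nz: "(norm z)\<^sup>2 = \<tau>" using v0 \<tau>0 by (simp add: z_def)
      have "J z < 0" unfolding J_def nz using M\<tau>[of \<tau>] \<tau>0 v[of "sqrt \<tau> / norm v"] v0 by (simp add: z_def)
      moreover have "M ((norm y)\<^sup>2) \<ge> 0"
      proof (rule M_nonneg[of T])
        show "\<mu> r \<ge> 0" if "0 < r" "r < T" for r
          using \<mu>_pos[of r] \<mu>_low[of r] m\<tau>[OF \<tau>0] that by (cases "r \<le> \<tau>") auto
      qed (use yT in auto)
      then have "J y \<ge> 0" unfolding J_def using G_eq_0_imp_\<Phi>[OF f0' G0] by simp
      ultimately show "\<exists>z. (norm z)\<^sup>2 \<le> T \<and> J z < J y" using nz \<tau> by (intro exI[of _ z]) auto
    qed auto
  next
    case False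
    then have f0': "f 0 = 0" and \<tau>0: "\<tau> = 0" using f0 \<tau> by auto
    have "\<exists>y. 0 < (norm y)\<^sup>2 \<and> (norm y)\<^sup>2 < T \<and> \<mu> ((norm y)\<^sup>2) *\<^sub>R y = G y"
    proof (rule mountain_pass_critical_point[OF _ _ _ _ _ \<alpha>M \<alpha>(1) \<Phi>_nonneg[OF f0'] inner_G_nonneg[OF f0'] G_eq_0_imp_\<Phi>[OF f0'] v])
      show "T > 0" "\<mu> T = 0" using \<tau> \<tau>0 \<mu>_high[of T] by auto
      show "\<mu> r > 0" if "0 < r" "r < T" for r using \<mu>_pos that \<tau>0 by simp
      show "\<mu> r < 0" if "T < r" for r using \<mu>_high[of r] that by simp
      \<comment> \<open>Beyond \<open>T\<close> the coefficient is \<open>T - r\<close>, so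
        \<open>M\<close> differs there from \<open>- (r - T)\<^sup>2 / 2\<close> by a constant and
        tends to minus infinity.\<close>
      have d: "((\<lambda>r. M r + (r - T)\<^sup>2 / 2) has_field_derivative 0) (at x within {T..})" if "x \<in> {T..}" for x
      proof -
        have "((\<lambda>r. M r + (r - T)\<^sup>2 / 2) has_real_derivative \<mu> x + (x - T)) (at x)"
          by (rule DERIV_add[OF Md]) (auto intro!: derivative_eq_intros)
        moreover have "\<mu> x + (x - T) = 0" using \<mu>_high[of x] that by simp
        ultimately show ?thesis using has_field_derivative_at_within by metis
      qed
      have "\<exists>k. \<forall>x\<in>{T..}. M x + (x - T)\<^sup>2 / 2 = k"
        using has_field_derivative_zero_constant[OF _ d] by fastforce
      then obtain k where k: "\<forall>x\<in>{T..}. M x + (x - T)\<^sup>2 / 2 = k" by (elim exE)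
      have "filterlim (\<lambda>r. k - (r - T)\<^sup>2 / 2) at_bot at_top" by real_asymp
      moreover have "\<forall>\<^sub>F r in at_top. k - (r - T)\<^sup>2 / 2 = M r"
        using eventually_ge_at_top[of T] by eventually_elim (use k in \<open>simp add: algebra_simps\<close>)
      ultimately show "filterlim M at_bot at_top" by (rule filterlim_cong[THEN iffD1, OF refl refl, rotated])
    qed auto
    then show ?thesis using \<tau>0 by simp
  qed
  then obtain y where y: "\<tau> < (norm y)\<^sup>2" "(norm y)\<^sup>2 < T" "\<mu> ((norm y)\<^sup>2) *\<^sub>R y = G y" by blast
  then show ?thesis using \<mu>_mid[of "(norm y)\<^sup>2"] by (intro exI[of _ y]) simp
qed

end

section \<open>Return to the original data\<close>

lemma truncation_eq:
  assumes "s\<^sub>0 > 0" "f s\<^sub>0 = 0"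
  shows "truncation f s\<^sub>0 t = f (max 0 (min t s\<^sub>0))"
  using assms by (auto simp: truncation_def max_def min_def)

lemma clamp_lipschitz: "\<bar>max 0 (min a s) - max 0 (min b s)\<bar> \<le> \<bar>a - b\<bar>" for a b s :: real
  by (auto simp: max_def min_def)

lemma truncated_truncation:
  fixes \<Omega> :: "'a::euclidean_space set" and f :: "real \<Rightarrow> real"
  assumes domain: "smooth_bounded_domain \<Omega>" and f_cont: "continuous_on UNIV f"
    and f_pos: "s\<^sub>0 > 0" "\<forall>r\<in>{0<..<s\<^sub>0}. f r > 0" "f s\<^sub>0 = 0"
  shows "\<exists>B. truncated \<Omega> (truncation f s\<^sub>0) (primitive (truncation f s\<^sub>0)) B s\<^sub>0"
proof -
  define g where "g = truncation f s\<^sub>0"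
  have g: "g t = f (max 0 (min t s\<^sub>0))" for t unfolding g_def by (rule truncation_eq) (fact f_pos)+
  have cl: "max 0 (min t s\<^sub>0) \<in> {0..s\<^sub>0}" for t using f_pos(1) by auto
  have fc: "continuous_on {0..s\<^sub>0} f" using f_cont by (rule continuous_on_subset) simp
  have "compact (f ` {0..s\<^sub>0})" by (rule compact_continuous_image[OF fc]) simp
  then obtain B where "B > 0" and Bf: "\<forall>x\<in>f ` {0..s\<^sub>0}. norm x \<le> B"
    using compact_imp_bounded bounded_pos by blast
  have B: "\<bar>g t\<bar> \<le> B" for t using Bf cl[of t] unfolding g by force
  have gc: "continuous_on UNIV g"
    unfolding g[abs_def] by (rule continuous_on_compose2[OF f_cont]) (auto intro!: continuous_intros)
  have modulus: "\<exists>C\<ge>0. \<forall>a b. \<bar>g a - g b\<bar> \<le> \<epsilon> + C * \<bar>a - b\<bar>" if \<epsilon>: "\<epsilon> > 0" for \<epsilon>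
  proof -
    have "uniformly_continuous_on {0..s\<^sub>0} f" by (rule compact_uniformly_continuous[OF fc]) simp
    then obtain d where d: "d > 0" "\<forall>x\<in>{0..s\<^sub>0}. \<forall>x'\<in>{0..s\<^sub>0}. dist x' x < d \<longrightarrow> dist (f x') (f x) < \<epsilon>"
      unfolding uniformly_continuous_on_def using \<epsilon> by blast
    \<comment> \<open>Arguments closer than \<open>d\<close> are covered by uniform continuity; for
      the others the trivial bound \<open>2 * B\<close> is at most the linear term.\<close>
    have "\<bar>g a - g b\<bar> \<le> \<epsilon> + (2 * B / d) * \<bar>a - b\<bar>" for a b
    proof (cases "\<bar>a - b\<bar> < d")
      case True
      then have "dist (max 0 (min a s\<^sub>0)) (max 0 (min b s\<^sub>0)) < d"
        using clamp_lipschitz[of a s\<^sub>0 b] by (simp add: dist_real_def)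
      then have "\<bar>g a - g b\<bar> < \<epsilon>" using d(2) cl unfolding g dist_real_def by blast
      moreover have "(2 * B / d) * \<bar>a - b\<bar> \<ge> 0" using d(1) \<open>B > 0\<close> by simp
      ultimately show ?thesis by linarith
    next
      case False
      have "2 * B = (2 * B / d) * d" using d(1) by simp
      also have "\<dots> \<le> (2 * B / d) * \<bar>a - b\<bar>" using False d(1) \<open>B > 0\<close> by (intro mult_left_mono) auto
      finally show ?thesis using B[of a] B[of b] \<epsilon> by linarith
    qed
    then show ?thesis using d(1) \<open>B > 0\<close> by (intro exI[of _ "2 * B / d"]) auto
  qed
  \<comment> \<open>\<open>f 0\<close> is the limit from the right of positive values.\<close>
  have f0: "f 0 \<ge> 0"
  proof (rule tendsto_lowerbound)
    have "isCont f 0" using f_cont by (simp add: continuous_on_eq_continuous_at)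
    then have "(f \<longlongrightarrow> f 0) (at 0)" by (simp add: isCont_def)
    then show "(f \<longlongrightarrow> f 0) (at_right 0)" by (rule filterlim_mono) (auto simp: at_le)
    show "\<forall>\<^sub>F x in at_right 0. 0 \<le> f x"
      using eventually_at_right_real[OF f_pos(1)] by eventually_elim (use f_pos(2) in \<open>auto intro: less_imp_le\<close>)
  qed simp
  have "truncated \<Omega> g (primitive g) B s\<^sub>0"
  proof
    show "open \<Omega>" "bounded \<Omega>" "connected \<Omega>" "\<Omega> \<noteq> {}" using domain by (simp_all add: smooth_bounded_domain_def)
    show "(primitive g has_real_derivative g t) (at t)" for t by (rule primitive_deriv[OF gc])
    show "g 0 \<ge> 0" using f0 f_pos(1) by (simp add: g)
    show "g t = g 0" if "t < 0" for t using that f_pos(1) by (simp add: g)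
    show "g t > 0" if "0 < t" "t < s\<^sub>0" for t using that f_pos by (simp add: g)
    show "g t = 0" if "s\<^sub>0 \<le> t" for t using that f_pos by (simp add: g)
  qed (use B gc modulus primitive_0 f_pos(1) in auto)
  then show ?thesis unfolding g_def by blast
qed

text \<open>Each interval is treated on its own. The squared norms fall into disjoint consecutive
  shells, so the ordering of the solutions needs no comparison between them.\<close>

theorem theorem1p1:
  fixes \<Omega> :: "'a::euclidean_space set"
    and m f :: "real \<Rightarrow> real"
    and t :: "nat \<Rightarrow> real"
    and s\<^sub>0 :: real
    and K :: nat
  assumes domain: "smooth_bounded_domain \<Omega>"
    and m_cont: "continuous_on {0..} m"
    and f_cont: "continuous_on UNIV f"
    and K: "K \<ge> 1"
    and m_zeros: "t 0 = 0" "\<forall>k\<in>{1..K}. t (k - 1) < t k" "\<forall>k\<in>{1..K}. m (t k) = 0"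
    and m_pos: "\<forall>k\<in>{1..K}. \<forall>r\<in>{t (k - 1)<..<t k}. m r > 0"
    and f_pos: "s\<^sub>0 > 0" "\<forall>r\<in>{0<..<s\<^sub>0}. f r > 0" "f s\<^sub>0 = 0"
    and area: "\<forall>k\<in>{1..K}.
      alpha \<Omega> f s\<^sub>0 (t k) < 1 / 2 * (LBINT r=ereal (t (k - 1))..ereal (t k). m r) \<and>
      1 / 2 * (LBINT r=ereal (t (k - 1))..ereal (t k). m r)
        < primitive f s\<^sub>0 * measure lebesgue \<Omega>"
  shows "\<exists>u :: nat \<Rightarrow> 'a \<Rightarrow> real. \<forall>k\<in>{1..K}.
    weak_solution \<Omega> m f (u k) \<and> nontrivial_on \<Omega> (u k) \<and> positive_on \<Omega> (u k) \<and>
    t (k - 1) < (H10_norm \<Omega> (u k))\<^sup>2 \<and> (H10_norm \<Omega> (u k))\<^sup>2 < t k"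
proof -
  note f_continuous = f_cont and s0_zero = f_pos(3)
  obtain B where "truncated \<Omega> (truncation f s\<^sub>0) (primitive (truncation f s\<^sub>0)) B s\<^sub>0"
    using truncated_truncation[OF domain f_cont f_pos] by blast
  then interpret truncated \<Omega> "truncation f s\<^sub>0" "primitive (truncation f s\<^sub>0)" B s\<^sub>0 .
  have t_nonneg: "0 \<le> t j" if "j \<le> K" for j
    using that
  proof (induction j)
    case (Suc j)
    then have "Suc j \<in> {1..K}" by simp
    with m_zeros(2) have "t j < t (Suc j)" by force
    then show ?case using Suc by simp
  qed (simp add: m_zeros(1))
  have "\<exists>u. weak_solution \<Omega> m f u \<and> nontrivial_on \<Omega> u \<and> positive_on \<Omega> u \<and>
      t (k - 1) < (H10_norm \<Omega> u)\<^sup>2 \<and> (H10_norm \<Omega> u)\<^sup>2 < t k" if k: "k \<in> {1..K}" for k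
  proof -
    have \<tau>: "0 \<le> t (k - 1)" "t (k - 1) < t k" using t_nonneg[of "k - 1"] m_zeros(2) k by auto
    \<comment> \<open>The zeros of \<open>m\<close> are given from index 1 on. For
      \<open>k = 1\<close> the left endpoint is 0 and the claim is void.\<close>
    have m\<tau>: "m (t (k - 1)) = 0" if pos: "t (k - 1) > 0"
    proof -
      have "k - 1 \<noteq> 0" using pos m_zeros(1) by (metis less_irrefl)
      then have "k - 1 \<in> {1..K}" using k by auto
      then show ?thesis using m_zeros(3) by blast
    qed
    have \<alpha>: "\<Phi> y \<le> alpha \<Omega> f s\<^sub>0 (t k)" if "(norm y)\<^sup>2 \<le> t k" for y
      unfolding alpha_def by (rule alpha_upper_bound) (use \<tau> that in auto)
    obtain y where y: "t (k - 1) < (norm y)\<^sup>2" "(norm y)\<^sup>2 < t k" "m ((norm y)\<^sup>2) *\<^sub>R y = G y"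
      using critical_point_exists[OF m_cont \<tau> m\<tau> _ _ \<alpha>] m_zeros(3) m_pos area k by auto
    define c where "c = m ((norm y)\<^sup>2)"
    have c: "c > 0" unfolding c_def using m_pos k y(1,2) by auto
    have crit: "c *\<^sub>R y = G y" using y(3) by (simp add: c_def)
    have y0: "y \<noteq> 0" using y(1) \<tau>(1) by auto
    define u where "u = rep_L2 (sol y)"
    note R = H10_rep[OF critical_point_weak_form(1)[OF c crit], folded u_def]
    have bounds: "AE x in lebesgue_on \<Omega>. 0 \<le> u x \<and> u x \<le> s\<^sub>0"
      unfolding AE_lebesgue_on u_def using critical_point_bounds[OF c crit] by eventually_elim simp
    have pos: "AE x in lebesgue_on \<Omega>. u x > 0"
      unfolding AE_lebesgue_on u_def by (rule critical_point_positive[OF c crit y0])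
    have um: "u \<in> borel_measurable (lebesgue_on \<Omega>)" using H10_D(1)[OF R(1)] by (simp add: L2_fun_def)
    have "weak_solution \<Omega> m f u"
      unfolding weak_solution_def R(2)
    proof (intro conjI ballI R(1))
      fix v assume v: "v \<in> H10 \<Omega>"
      note S = critical_point_weak_solution[OF c crit v, folded u_def]
      have vm: "v \<in> borel_measurable (lebesgue_on \<Omega>)" using H10_D(1)[OF v] by (simp add: L2_fun_def)
      have fm: "(\<lambda>x. f (u x) * v x) \<in> borel_measurable (lebesgue_on \<Omega>)"
      proof (rule borel_measurable_times[OF _ vm])
        show "(\<lambda>x. f (u x)) \<in> borel_measurable (lebesgue_on \<Omega>)"
          by (rule measurable_compose[OF um]) (rule borel_measurable_continuous_onI[OF f_continuous])
      qed
      \<comment> \<open>Solutions take values in the closed interval from 0 to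
        \<open>s\<^sub>0\<close>. At its upper end the truncation has its default value 0, which
        equals \<open>f s\<^sub>0\<close>.\<close>
      have ae: "AE x in lebesgue_on \<Omega>. truncation f s\<^sub>0 (u x) * v x = f (u x) * v x"
        using bounds by eventually_elim (use s0_zero in \<open>auto simp: truncation_def\<close>)
      show "integrable (lebesgue_on \<Omega>) (\<lambda>x. f (u x) * v x)"
        using integrable_cong_AE[THEN iffD1, OF _ fm ae S(1)] S(1) by blast
      have "(LINT x|lebesgue_on \<Omega>. truncation f s\<^sub>0 (u x) * v x) = (LINT x|lebesgue_on \<Omega>. f (u x) * v x)"
        using S(1) by (intro integral_cong_AE fm ae) auto
      then show "m ((norm y)\<^sup>2) * (LINT x|lebesgue_on \<Omega>. wgrad \<Omega> u x \<bullet> wgrad \<Omega> v x) = (LINT x|lebesgue_on \<Omega>. f (u x) * v x)"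
        using S(2) by (simp add: c_def)
    qed
    moreover have "nontrivial_on \<Omega> u"
      unfolding nontrivial_on_def
    proof
      assume "AE x in lebesgue_on \<Omega>. u x = 0"
      with pos have "AE x in lebesgue_on \<Omega>. False" by eventually_elim simp
      then show False using not_AE_False_on_\<Omega>[OF ne] by (simp add: AE_lebesgue_on)
    qed
    moreover have "positive_on \<Omega> u" unfolding positive_on_def by (rule pos)
    ultimately show ?thesis using y(1,2) R(2) by (intro exI[of _ u]) simp
  qed
  then show ?thesis by (intro bchoice ballI)
qed

end
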